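(* Let $R>0$, $r_0\in(0,R)$, $\Gamma,\theta_0\in\mathbb{R}\setminus\{0\}$, put $c=\frac{\Gamma}{2\pi\theta_0}$, $a(x)=x-r_0$, $b(x)=x-\frac{R^2}{r_0}$, $\rho_0=\frac{r_0}{R}$, $\phi_0=\frac{R^2}{c}=\frac{2\pi R^2\theta_0}{\Gamma}$, and consider on the closed disk $D_R=\{(x,y)\in\mathbb{R}^2: x^2+y^2\le R^2\}$ (which is invariant) the system $$\dot x=-\theta_0y+c\theta_0y\left(\frac{1}{a(x)^2+y^2}-\frac{1}{b(x)^2+y^2}\right),\qquad \dot y=\theta_0x-c\theta_0\left(\frac{a(x)}{a(x)^2+y^2}-\frac{b(x)}{b(x)^2+y^2}\right).$$ Let $\Lambda=\{(\rho_0,\phi_0)\in\mathbb{R}^2:0<\rho_0<1,\ \phi_0\neq0\}$ be the parameter space, and let $\mathcal R_1,\dots,\mathcal R_5$, $C_1,C_2,C_3$ and $\mathcal B=C_1\cup C_2\cup C_3$ be the subsets of $\Lambda$ defined in the context. Let $(\rho_0,\phi_0)\in\Lambda$. The set $\Lambda\setminus\mathcal B$ corresponds to regular parameters of the system. On each connected component of $\Lambda\setminus\mathcal B$ the phase portrait on $D_R$ is the following: (a) If $(\rho_0,\phi_0)\in\mathcal R_1$, then the dynamics on $D_R$ is a global vortex at $(r_0,0)$. (b) If $(\rho_0,\phi_0)\in\mathcal R_2$, then the system has a vortex at $(r_0,0)$, a center at $(x_c^*,0)$ with $x_c^*\in(-R,0)$, and two hyperbolic saddles $(x_s^*,\pm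 y_s^* )$ on $\partial D_R$ with a saddle connection inside $D_R$. (c) If $(\rho_0,\phi_0)\in\mathcal R_3$, then the system has a vortex at $(r_0,0)$, a center at $(x_c^*,0)$ with $x_c^*\in(-R,0)$, and a hyperbolic saddle at $(x_s^*,0)$ with $x_s^*\in(r_0,R)$. (d) If $(\rho_0,\phi_0)\in\mathcal R_4$, then the system has a vortex at $(r_0,0)$, a center $(x_c^*,0)$ and a hyperbolic saddle $(x_s^*,0)$ satisfying $0<x_c^*<x_s^*<r_0$. (e) If $(\rho_0,\phi_0)\in\mathcal R_5$, then the dynamics on $D_R$ is a global vortex at $(r_0,0)$. Moreover, the set $\mathcal B$ corresponds to bifurcation parameters of the system. On each curve the phase portrait on $D_R$ is the following: (f) If $(\rho_0,\phi_0)\in C_1$, then the system has a vortex at $(r_0,0)$ and a degenerate saddle at $(-R,0)$. (g) If $(\rho_0,\phi_0)\in C_2$, then the system has a vortex at $(r_0,0)$, a center at $(x_c^*,0)$ with $x_c^*\in(-R,0)$, and a degenerate saddle at $(R,0)$. (h) If $(\rho_0,\phi_0)\in C_3$, then the system has a vortex at $(r_0,0)$ and a cusp at $(x_p^*,0)$, where $$x_p^*=\frac{R^2+r_0^2-\sqrt{R^4-R^2r_0^2+r_0^4}}{3r_0}.$$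
   Context: The system is Hamiltonian, $\dot x=\partial\Psi/\partial y$, $\dot y=-\partial\Psi/\partial x$, with $$\Psi(x,y)=-\frac{\theta_0}{2}(x^2+y^2)+\frac{\Gamma}{2\pi}\ln\sqrt{\frac{(x-r_0)^2+y^2}{(x-\frac{R^2}{r_0})^2+y^2}}.$$ It is defined on $\mathbb{R}^2\setminus\{(r_0,0),(R^2/r_0,0)\}$; since $R^2/r_0>R$, the only singularity in $D_R$ is $(r_0,0)$. Define $$f(\rho_0,\phi_0)=27\rho_0^2(\rho_0^2-1)+\phi_0\left(2-3\rho_0^2-3\rho_0^4+2\rho_0^6-2(1-\rho_0^2+\rho_0^4)^{3/2}\right).$$ The bifurcation set is $\mathcal B=\left\{(\rho_0,\phi_0)\in\Lambda:\phi_0f(\rho_0,\phi_0)\left(\rho_0-\frac{1-\phi_0}{1+\phi_0}\right)\left(\rho_0-\frac{\phi_0-1}{1+\phi_0}\right)=0\right\}$, that is, $\mathcal B=C_1\cup C_2\cup C_3$, where - $C_1=\{(\rho_0,\phi_0)\in\Lambda:\phi_0>0,\ \rho_0=\frac{1-\phi_0}{1+\phi_0}\}$, - $C_2=\{(\rho_0,\phi_0)\in\Lambda:\phi_0>0,\ \rho_0=\frac{\phi_0-1}{1+\phi_0}\}$, - $C_3=\{(\rho_0,\phi_0)\in\Lambda:\phi_0<0,\ f(\rho_0,\phi_0)=0\}$. The connected components of $\Lambda\setminus\mathcal B$ are - $\mathcal R_1=\{(\rho_0,\phi_0)\in\Lambda:\phi_0>0,\ \rho_0<\frac{1-\phi_0}{1+\phi_0}\}$,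 - $\mathcal R_2=\{(\rho_0,\phi_0)\in\Lambda:\phi_0>0,\ \rho_0>\max\{\frac{1-\phi_0}{1+\phi_0},\frac{\phi_0-1}{1+\phi_0}\}\}$, - $\mathcal R_3=\{(\rho_0,\phi_0)\in\Lambda:\phi_0>0,\ \rho_0<\frac{\phi_0-1}{1+\phi_0}\}$, - $\mathcal R_4=\{(\rho_0,\phi_0)\in\Lambda:\phi_0<0,\ f(\rho_0,\phi_0)>0\}$, - $\mathcal R_5=\{(\rho_0,\phi_0)\in\Lambda:\phi_0<0,\ f(\rho_0,\phi_0)<0\}$. Terminology. A vortex at $(r_0,0)$ means that all orbits in a punctured neighborhood of the singularity $(r_0,0)$ are periodic orbits encircling it. The dynamics on $D_R$ is a global vortex at $(r_0,0)$ if every orbit in $D_R\setminus\{(r_0,0)\}$ is a periodic orbit encircling $(r_0,0)$. In each of the cases (b), (c), (d), (f), (g), (h), the listed points other than $(r_0,0)$ are all the critical points (equilibria) of the system in $D_R$. A center is an equilibrium with a punctured neighborhood filled by periodic orbits encircling it; a hyperbolic saddle is an equilibrium whose Jacobian matrix has real nonzero eigenvalues of opposite signs; a degenerate saddle is an equilibrium that is topologically a saddle but whose Jacobian matrix is singular; a cusp is a degenerate equilibrium whose local phase portrait is a cusp. A saddle connection inside $D_R$ is an orbit in the interior of $D_R$ joining the two saddles. A parameter is regular if all sufficiently close parameters in $\Lambda$ give a phase portrait on the disk topologically equivalent to its own (via a homeomorphism of the disks carrying orbits to orbits, not necessarily preserving the direction of time), and it is a bifurcation parameter otherwise. *)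

theory Defs
  imports "HOL-Analysis.Analysis"
begin

section \<open>Autonomous planar systems\<close>

abbreviation pt :: "real \<Rightarrow> real \<Rightarrow> real^2" where
  "pt x y \<equiv> vector [x, y]"

text \<open>In the following, a system is a vector field \<open>V\<close> together with the set \<open>U\<close> on
  which it is considered; solutions have to stay in \<open>U\<close>.\<close>

definition solution_on :: "real set \<Rightarrow> (real^2) set \<Rightarrow> (real^2 \<Rightarrow> real^2) \<Rightarrow> (real \<Rightarrow> real^2) \<Rightarrow> bool" where
  "solution_on T U V \<gamma> \<longleftrightarrow>
     (\<forall>t\<in>T. \<gamma> t \<in> U \<and> (\<gamma> has_vector_derivative V (\<gamma> t)) (at t))"

text \<open>The orbit of \<open>p\<close> collects all points on solutions through \<open>p\<close>, so for a locally Lipschitz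
  \<open>V\<close> it is the image of the maximal solution.\<close>

definition orbit :: "(real^2) set \<Rightarrow> (real^2 \<Rightarrow> real^2) \<Rightarrow> real^2 \<Rightarrow> (real^2) set" where
  "orbit U V p = {\<gamma> t | \<gamma> t T. open T \<and> is_interval T \<and> 0 \<in> T \<and> t \<in> T \<and>
                      solution_on T U V \<gamma> \<and> \<gamma> 0 = p}"

definition periodic_orbit :: "(real^2) set \<Rightarrow> (real^2 \<Rightarrow> real^2) \<Rightarrow> (real^2) set \<Rightarrow> bool" where
  "periodic_orbit U V O' \<longleftrightarrow>
     (\<exists>\<gamma> \<tau>. solution_on UNIV U V \<gamma> \<and> \<tau> > 0 \<and> (\<forall>t. \<gamma> (t + \<tau>) = \<gamma> t) \<and>
            (\<exists>t. \<gamma> t \<noteq> \<gamma> 0) \<and> O' = range \<gamma>)"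

definition periodic_orbit_encircling ::
    "(real^2) set \<Rightarrow> (real^2 \<Rightarrow> real^2) \<Rightarrow> real^2 \<Rightarrow> (real^2) set \<Rightarrow> bool" where
  "periodic_orbit_encircling U V s O' \<longleftrightarrow> periodic_orbit U V O' \<and> s \<in> inside O'"

definition punctured_nhd_of_periodic_orbits ::
    "(real^2) set \<Rightarrow> (real^2 \<Rightarrow> real^2) \<Rightarrow> real^2 \<Rightarrow> bool" where
  "punctured_nhd_of_periodic_orbits U V s \<longleftrightarrow>
     (\<exists>N. open N \<and> s \<in> N \<and> N - {s} \<subseteq> U \<and>
          (\<forall>p\<in>N - {s}. orbit U V p \<subseteq> N \<and> periodic_orbit_encircling U V s (orbit U V p)))"

definition equilibrium :: "(real^2) set \<Rightarrow> (real^2 \<Rightarrow> real^2) \<Rightarrow> real^2 \<Rightarrow> bool" where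
  "equilibrium U V p \<longleftrightarrow> p \<in> U \<and> V p = 0"

definition vortex :: "(real^2) set \<Rightarrow> (real^2 \<Rightarrow> real^2) \<Rightarrow> real^2 \<Rightarrow> bool" where
  "vortex U V s \<longleftrightarrow> s \<notin> U \<and> punctured_nhd_of_periodic_orbits U V s"

definition center :: "(real^2) set \<Rightarrow> (real^2 \<Rightarrow> real^2) \<Rightarrow> real^2 \<Rightarrow> bool" where
  "center U V p \<longleftrightarrow> equilibrium U V p \<and> punctured_nhd_of_periodic_orbits U V p"

definition eigenvalue :: "real^2^2 \<Rightarrow> real \<Rightarrow> bool" where
  "eigenvalue A l \<longleftrightarrow> (\<exists>v. v \<noteq> 0 \<and> A *v v = l *\<^sub>R v)"

definition hyperbolic_saddle :: "(real^2) set \<Rightarrow> (real^2 \<Rightarrow> real^2) \<Rightarrow> real^2 \<Rightarrow> bool" where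
  "hyperbolic_saddle U V p \<longleftrightarrow> equilibrium U V p \<and> V differentiable (at p) \<and>
     (\<exists>l m. l < 0 \<and> 0 < m \<and> eigenvalue (jacobian V (at p)) l \<and> eigenvalue (jacobian V (at p)) m)"

definition carries_orbits ::
    "(real^2) set \<Rightarrow> (real^2 \<Rightarrow> real^2) \<Rightarrow> (real^2) set \<Rightarrow> (real^2 \<Rightarrow> real^2) \<Rightarrow> (real^2 \<Rightarrow> real^2) \<Rightarrow> bool" where
  "carries_orbits U V U' V' h \<longleftrightarrow> (\<forall>p\<in>U. h p \<in> U' \<and> h ` orbit U V p = orbit U' V' (h p))"

definition locally_orbit_equivalent ::
    "(real^2) set \<Rightarrow> (real^2 \<Rightarrow> real^2) \<Rightarrow> real^2 \<Rightarrow> (real^2) set \<Rightarrow> (real^2 \<Rightarrow> real^2) \<Rightarrow> real^2 \<Rightarrow> bool" where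
  "locally_orbit_equivalent U V p U' V' p' \<longleftrightarrow>
     (\<exists>N N' h k. open N \<and> p \<in> N \<and> N \<subseteq> U \<and> open N' \<and> p' \<in> N' \<and> N' \<subseteq> U' \<and>
        homeomorphism N N' h k \<and> h p = p' \<and> carries_orbits N V N' V' h)"

text \<open>The time direction is not recorded, but the two models used below, \<open>(x, -y)\<close> and \<open>(y, x\<^sup>2)\<close>,
  are time-reversible, so nothing is lost.\<close>

definition topological_saddle :: "(real^2) set \<Rightarrow> (real^2 \<Rightarrow> real^2) \<Rightarrow> real^2 \<Rightarrow> bool" where
  "topological_saddle U V p \<longleftrightarrow> equilibrium U V p \<and>
     locally_orbit_equivalent U V p UNIV (\<lambda>z. pt (z$1) (- (z$2))) 0"

definition degenerate_saddle :: "(real^2) set \<Rightarrow> (real^2 \<Rightarrow> real^2) \<Rightarrow> real^2 \<Rightarrow> bool" where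
  "degenerate_saddle U V p \<longleftrightarrow> topological_saddle U V p \<and>
     V differentiable (at p) \<and> det (jacobian V (at p)) = 0"

text \<open>A homeomorphism alone does not distinguish a cusp from the field \<open>(x\<^sup>2 + y\<^sup>2, 0)\<close>, hence the
  usual additional requirement that the Jacobian be singular but not zero.\<close>

definition cusp :: "(real^2) set \<Rightarrow> (real^2 \<Rightarrow> real^2) \<Rightarrow> real^2 \<Rightarrow> bool" where
  "cusp U V p \<longleftrightarrow> equilibrium U V p \<and>
     V differentiable (at p) \<and> det (jacobian V (at p)) = 0 \<and> jacobian V (at p) \<noteq> 0 \<and>
     locally_orbit_equivalent U V p UNIV (\<lambda>z. pt (z$2) ((z$1)\<^sup>2)) 0"

definition connecting_orbit ::
    "(real^2) set \<Rightarrow> (real^2 \<Rightarrow> real^2) \<Rightarrow> (real^2) set \<Rightarrow> real^2 \<Rightarrow> real^2 \<Rightarrow> bool" where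
  "connecting_orbit U V D p q \<longleftrightarrow>
     (\<exists>\<gamma>. solution_on UNIV U V \<gamma> \<and> range \<gamma> \<subseteq> interior D \<and>
          (\<gamma> \<longlongrightarrow> p) at_bot \<and> (\<gamma> \<longlongrightarrow> q) at_top)"

definition saddle_connection_inside ::
    "(real^2) set \<Rightarrow> (real^2 \<Rightarrow> real^2) \<Rightarrow> (real^2) set \<Rightarrow> real^2 \<Rightarrow> real^2 \<Rightarrow> bool" where
  "saddle_connection_inside U V D p q \<longleftrightarrow>
     p \<noteq> q \<and> (connecting_orbit U V D p q \<or> connecting_orbit U V D q p)"

definition global_vortex :: "(real^2) set \<Rightarrow> (real^2 \<Rightarrow> real^2) \<Rightarrow> (real^2) set \<Rightarrow> real^2 \<Rightarrow> bool" where
  "global_vortex U V D s \<longleftrightarrow> s \<in> D \<and> s \<notin> U \<and> D - {s} \<subseteq> U \<and>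
     (\<forall>p\<in>D - {s}. periodic_orbit_encircling U V s (orbit U V p))"


section \<open>The vortex system on the disk\<close>

definition disk :: "real \<Rightarrow> (real^2) set" where
  "disk R = {z. (z$1)\<^sup>2 + (z$2)\<^sup>2 \<le> R\<^sup>2}"

definition vfield :: "real \<Rightarrow> real \<Rightarrow> real \<Rightarrow> real \<Rightarrow> real^2 \<Rightarrow> real^2" where
  "vfield R r0 c \<theta> z =
     (let x = z$1; y = z$2; a = x - r0; b = x - R\<^sup>2 / r0 in
      pt (- \<theta> * y + c * \<theta> * y * (1 / (a\<^sup>2 + y\<^sup>2) - 1 / (b\<^sup>2 + y\<^sup>2)))
         (\<theta> * x - c * \<theta> * (a / (a\<^sup>2 + y\<^sup>2) - b / (b\<^sup>2 + y\<^sup>2))))"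

definition vdomain :: "real \<Rightarrow> real \<Rightarrow> (real^2) set" where
  "vdomain R r0 = - {pt r0 0, pt (R\<^sup>2 / r0) 0}"

definition param_space :: "(real \<times> real) set" where
  "param_space = {(\<rho>, \<phi>). 0 < \<rho> \<and> \<rho> < 1 \<and> \<phi> \<noteq> 0}"

definition bif_fun :: "real \<Rightarrow> real \<Rightarrow> real" where
  "bif_fun \<rho> \<phi> = 27 * \<rho>^2 * (\<rho>^2 - 1) +
     \<phi> * (2 - 3 * \<rho>^2 - 3 * \<rho>^4 + 2 * \<rho>^6 - 2 * (1 - \<rho>^2 + \<rho>^4) powr (3/2))"

definition curve1 :: "(real \<times> real) set" where
  "curve1 = {(\<rho>, \<phi>). (\<rho>, \<phi>) \<in> param_space \<and> \<phi> > 0 \<and> \<rho> = (1 - \<phi>) / (1 + \<phi>)}"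

definition curve2 :: "(real \<times> real) set" where
  "curve2 = {(\<rho>, \<phi>). (\<rho>, \<phi>) \<in> param_space \<and> \<phi> > 0 \<and> \<rho> = (\<phi> - 1) / (1 + \<phi>)}"

definition curve3 :: "(real \<times> real) set" where
  "curve3 = {(\<rho>, \<phi>). (\<rho>, \<phi>) \<in> param_space \<and> \<phi> < 0 \<and> bif_fun \<rho> \<phi> = 0}"

definition bif_set :: "(real \<times> real) set" where
  "bif_set = curve1 \<union> curve2 \<union> curve3"

definition region1 :: "(real \<times> real) set" where
  "region1 = {(\<rho>, \<phi>). (\<rho>, \<phi>) \<in> param_space \<and> \<phi> > 0 \<and> \<rho> < (1 - \<phi>) / (1 + \<phi>)}"

definition region2 :: "(real \<times> real) set" where
  "region2 = {(\<rho>, \<phi>). (\<rho>, \<phi>) \<in> param_space \<and> \<phi> > 0 \<and>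
                 \<rho> > max ((1 - \<phi>) / (1 + \<phi>)) ((\<phi> - 1) / (1 + \<phi>))}"

definition region3 :: "(real \<times> real) set" where
  "region3 = {(\<rho>, \<phi>). (\<rho>, \<phi>) \<in> param_space \<and> \<phi> > 0 \<and> \<rho> < (\<phi> - 1) / (1 + \<phi>)}"

definition region4 :: "(real \<times> real) set" where
  "region4 = {(\<rho>, \<phi>). (\<rho>, \<phi>) \<in> param_space \<and> \<phi> < 0 \<and> bif_fun \<rho> \<phi> > 0}"

definition region5 :: "(real \<times> real) set" where
  "region5 = {(\<rho>, \<phi>). (\<rho>, \<phi>) \<in> param_space \<and> \<phi> < 0 \<and> bif_fun \<rho> \<phi> < 0}"

text \<open>For fixed \<open>R\<close> and \<open>\<theta>\<close>, the parameter \<open>(\<rho>, \<phi>)\<close> stands for the system with \<open>r0 = \<rho> R\<close> and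
  \<open>c = R\<^sup>2 / \<phi>\<close>. (Rescaling space by \<open>R\<close> and time by \<open>\<theta>\<close> shows that its phase portrait depends on
  \<open>(\<rho>, \<phi>)\<close> only.)\<close>

definition phase_portraits_equivalent :: "real \<Rightarrow> real \<Rightarrow> real \<times> real \<Rightarrow> real \<times> real \<Rightarrow> bool" where
  "phase_portraits_equivalent R \<theta> p q \<longleftrightarrow>
     (let dom = (\<lambda>(\<rho>, \<phi>). disk R \<inter> vdomain R (\<rho> * R));
          fld = (\<lambda>(\<rho>, \<phi>). vfield R (\<rho> * R) (R\<^sup>2 / \<phi>) \<theta>)
      in \<exists>h k. homeomorphism (disk R) (disk R) h k \<and>
               carries_orbits (dom p) (fld p) (dom q) (fld q) h)"

definition regular_parameter :: "real \<Rightarrow> real \<Rightarrow> real \<times> real \<Rightarrow> bool" where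
  "regular_parameter R \<theta> p \<longleftrightarrow> p \<in> param_space \<and>
     (\<exists>e>0. \<forall>q\<in>param_space. dist q p < e \<longrightarrow> phase_portraits_equivalent R \<theta> p q)"

definition bifurcation_parameter :: "real \<Rightarrow> real \<Rightarrow> real \<times> real \<Rightarrow> bool" where
  "bifurcation_parameter R \<theta> p \<longleftrightarrow> p \<in> param_space \<and> \<not> regular_parameter R \<theta> p"

end

theory Submission
  imports Defs
begin

text \<open>In the chart \<open>\<zeta> = (z/R - \<rho>) / (1 - \<rho> z/R)\<close> the disk becomes the unit disk and the vortex the origin.
  With \<open>q = \<bar>\<zeta>\<bar>\<close> and \<open>u = Re \<zeta> / \<bar>\<zeta>\<bar>\<close> the Hamiltonian is the level function
  \<open>(1 - \<rho>^2) (1 - q^2) / (1 + \<rho>^2 q^2 + 2 \<rho> q u) + 2 c ln q\<close>, where \<open>c\<close> stands for \<open>1 / \<phi>\<close>, and an equilibrium is a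
  point on the circle or on the axis at which its \<open>q\<close>-derivative vanishes.

  A compact orbit is a Jordan curve and the Hamiltonian, being constant on it, has an extremum inside; so
  the orbit encircles the vortex or an equilibrium. This gives the vortices and centers.

  Orbits are the components of the level sets without the equilibria. Hence a homeomorphism of the disk
  carries orbits to orbits as soon as it respects levels and equilibria, and it can be constructed on
  the strip \<open>(0, 1] \<times> [-1, 1]\<close> of pairs \<open>(q, u)\<close>. For \<open>c > 0\<close>, and without equilibria also for \<open>c < 0\<close>, every
  ray has a unimodal profile, and the strip is unfolded along the ridge of maxima. In the region with two
  equilibria on the axis and \<open>c < 0\<close> the strip is cut at their radii into three bands. Degenerate saddles
  and cusps are compared with their models by maps that respect levels and are continuous and
  injective, thus open by invariance of domain. On the bifurcation curves the number of equilibria jumps.\<close>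

section \<open>Planar Lipschitz fields\<close>

text \<open>The second singular point is the mirror image of the vortex in the circle, and the chart
  has its pole there. The quotient of the distances to the two points is a multiple of
  \<open>\<bar>\<zeta>\<bar>\<close>, so both logarithms merge into \<open>2 c ln q\<close> and only
  one rational term depends on the direction. On the axis, with \<open>x\<close> the abscissa
  divided by \<open>R\<close>, the equilibria solve the cubic equation
  \<open>x (\<rho> - x) (1 - \<rho> x) = - (1 - \<rho>^2) c\<close>. For \<open>c < 0\<close> the
  maximum of the cubic between the centre of the disk and the vortex decides whether there are any;
  written in terms of \<rho> and \<phi>, this comparison is the sign of \<open>bif_fun\<close>. What
  shapes the regularity proof is that an equivalence has to be a homeomorphism of the whole closed
  disk, through the vortex, the circle and all equilibria, while centers and saddle connections do
  not persist under arbitrary perturbations. Hence no flows are compared, only values of the level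
  function: an increasing map of the level values that fixes 0, the value on the circle, is chosen
  to begin with, and the homeomorphism is built so as to realize it.\<close>

lemma pt_eq_axis: "pt x y = x *\<^sub>R axis 1 1 + y *\<^sub>R axis 2 1"
  by (simp add: vec_eq_iff forall_2 axis_def)

lemma vec2_eq_iff: "(z::real^2) = w \<longleftrightarrow> z$1 = w$1 \<and> z$2 = w$2"
  by (simp add: vec_eq_iff forall_2)

lemma pt_eta [simp]: "pt (z$1) (z$2) = z"
  by (simp add: vec2_eq_iff)

lemma pt_eq_pt_iff [simp]: "pt a b = pt c d \<longleftrightarrow> a = c \<and> b = d"
  by (simp add: vec2_eq_iff)

lemma has_derivative_pt [derivative_intros]:
  assumes "(f has_derivative f') F" "(g has_derivative g') F"
  shows "((\<lambda>x. pt (f x) (g x)) has_derivative (\<lambda>v. pt (f' v) (g' v))) F"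
  unfolding pt_eq_axis by (intro derivative_intros assms)

lemma continuous_on_pt [continuous_intros]:
  assumes "continuous_on S f" "continuous_on S g"
  shows "continuous_on S (\<lambda>x. pt (f x) (g x))"
  unfolding pt_eq_axis by (intro continuous_intros assms)

lemma inner_vec2: "(z::real^2) \<bullet> w = z$1 * w$1 + z$2 * w$2"
  by (simp add: inner_vec_def sum_2)

lemma norm_vec2: "norm (z::real^2) = sqrt ((z$1)^2 + (z$2)^2)"
  by (simp add: norm_eq_sqrt_inner inner_vec2 power2_eq_square)


text \<open>A difference of two solutions vanishes near a common point, because its maximum over a
  short interval is at most half of itself.\<close>

lemma gronwall_zero:
  fixes f :: "real => 'a::real_inner"
  assumes "a <= b" "continuous_on {a..b} f"
    and der: "!!t. a < t ==> t < b ==> (f has_vector_derivative f' t) (at t)"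
    and bound: "!!t. a < t ==> t < b ==> norm (f' t) <= L * norm (f t)"
    and "L \<ge> 0" "L * (b - a) <= 1/2" "f a = 0 \<or> f b = 0" "t \<in> {a..b}"
  shows "f t = 0"
proof -
  have "continuous_on {a..b} (\<lambda>t. norm (f t))"
    by (intro continuous_intros assms)
  then obtain m where m: "m \<in> {a..b}" "!!s. s \<in> {a..b} ==> norm (f s) <= norm (f m)"
    using continuous_attains_sup[of "{a..b}" "\<lambda>t. norm (f t)"] \<open>a <= b\<close> by auto
  have key: "norm (f y - f x) <= norm (f m) / 2" if "x \<in> {a..b}" "y \<in> {a..b}" "x < y" for x y
  proof -
    have "\<exists>s\<in>{x<..<y}. norm (f y - f x) <= norm ((\<lambda>h. h *\<^sub>R f' s) (y - x))"
    proof (rule mvt_general[OF \<open>x < y\<close>])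
      show "continuous_on {x..y} f"
        by (rule continuous_on_subset[OF assms(2)]) (use that in auto)
      show "(f has_derivative (\<lambda>h. h *\<^sub>R f' s)) (at s)" if "x < s" "s < y" for s
        using der[of s] that \<open>x \<in> {a..b}\<close> \<open>y \<in> {a..b}\<close> by (auto simp: has_vector_derivative_def)
    qed
    then obtain s where s: "s \<in> {x<..<y}" "norm (f y - f x) <= (y - x) * norm (f' s)"
      using that by auto
    have "norm (f' s) <= L * norm (f s)" using bound[of s] s that by auto
    also have "\<dots> <= L * norm (f m)" using m(2)[of s] s that \<open>L \<ge> 0\<close> by (intro mult_left_mono) auto
    finally have "(y - x) * norm (f' s) <= (y - x) * (L * norm (f m))"
      using that by (intro mult_left_mono) auto
    also have "\<dots> <= (b - a) * (L * norm (f m))"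
      using that \<open>L \<ge> 0\<close> by (intro mult_right_mono) auto
    also have "\<dots> = (L * (b - a)) * norm (f m)" by simp
    also have "\<dots> <= (1/2) * norm (f m)" by (intro mult_right_mono assms) auto
    finally show ?thesis using s(2) by simp
  qed
  have "norm (f m) <= norm (f m) / 2"
  proof -
    consider "f a = 0" "a = m" | "f a = 0" "a < m" | "f b = 0" "b = m" | "f b = 0" "m < b"
      using m(1) assms(7) by fastforce
    then show ?thesis
    proof cases
      case 2 then show ?thesis using key[of a m] m(1) by auto
    next
      case 4 then show ?thesis using key[of m b] m(1) by (auto simp: norm_minus_commute)
    qed auto
  qed
  then have "norm (f m) = 0" by (smt (verit) norm_ge_zero field_sum_of_halves)
  then show ?thesis using m(2)[OF \<open>t \<in> {a..b}\<close>] by simp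
qed

lemma solution_on_subset: "solution_on T U V \<gamma> ==> S \<subseteq> T ==> solution_on S U V \<gamma>"
  by (auto simp: solution_on_def)

lemma solution_on_mono: "solution_on T U V \<gamma> ==> U \<subseteq> U' ==> solution_on T U' V \<gamma>"
  by (auto simp: solution_on_def)

lemma solution_on_continuous: "solution_on T U V \<gamma> ==> continuous_on T \<gamma>"
  by (meson continuous_at_imp_continuous_on has_vector_derivative_continuous solution_on_def)

lemma solution_on_shift:
  assumes "solution_on T U V \<gamma>"
  shows "solution_on {t. t + a \<in> T} U V (\<lambda>t. \<gamma> (t + a))"
proof -
  have "((\<lambda>t. \<gamma> (t + a)) has_vector_derivative V (\<gamma> (t + a))) (at t)" if "t + a \<in> T" for t
  proof -
    have "((\<lambda>t. t + a) has_vector_derivative 1) (at t)"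
      by (auto intro!: derivative_eq_intros)
    moreover have "(\<gamma> has_vector_derivative V (\<gamma> (t + a))) (at (t + a))"
      using assms that by (auto simp: solution_on_def)
    ultimately show ?thesis
      using vector_diff_chain_at[of "\<lambda>t. t + a" 1 t \<gamma>] by (simp add: o_def)
  qed
  then show ?thesis using assms by (auto simp: solution_on_def)
qed

lemma open_interval_shift:
  assumes "open T" "is_interval (T::real set)"
  shows "open {t. t + a \<in> T}" "is_interval {t. t + a \<in> T}"
proof -
  have eq: "{t. t + a \<in> T} = (\<lambda>t. t - a) ` T"
    by (force simp: image_iff)
  show "open {t. t + a \<in> T}"
    unfolding eq using open_translation[OF assms(1), of "-a"] by (simp add: algebra_simps)
  show "is_interval {t. t + a \<in> T}"
    using assms(2) unfolding is_interval_1 by (smt (verit) mem_Collect_eq)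
qed

lemma solution_on_cong_open:
  assumes "solution_on T U V \<gamma>" "open T" "!!t. t \<in> T ==> \<zeta> t = \<gamma> t"
  shows "solution_on T U V \<zeta>"
proof -
  have "(\<zeta> has_vector_derivative V (\<gamma> t)) (at t)" if "t \<in> T" for t
    using assms that
    by (auto simp: solution_on_def intro: has_vector_derivative_transform_within_open)
  then show ?thesis using assms by (auto simp: solution_on_def)
qed

lemma solution_on_Un:
  "solution_on S U V \<gamma> ==> solution_on T U V \<gamma> ==> solution_on (S \<union> T) U V \<gamma>"
  by (auto simp: solution_on_def)

locale lipschitz_field =
  fixes Om :: "(real^2) set" and V :: "real^2 => real^2"
  assumes open_Om: "open Om" and lip: "local_lipschitz (UNIV::real set) Om (\<lambda>_. V)"
begin

lemma lip_ball:
  assumes "p \<in> Om"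
  obtains u L where "u > 0" "L \<ge> 0" "cball p u \<subseteq> Om" "L-lipschitz_on (cball p u) V"
proof -
  obtain u L where u: "u > 0" "!!t. t \<in> cball (0::real) u \<inter> UNIV ==> L-lipschitz_on (cball p u \<inter> Om) V"
    using local_lipschitzE[OF lip, of 0 p] assms by auto
  obtain v where v: "v > 0" "cball p v \<subseteq> Om"
    using open_Om assms open_contains_cball by blast
  have "L-lipschitz_on (cball p (min u v)) V"
    by (rule lipschitz_on_subset[OF u(2)[of 0]]) (use u v in auto)
  moreover from this have "L \<ge> 0" by (rule lipschitz_on_nonneg)
  ultimately show thesis using that[of "min u v" L] u(1) v by (auto simp: subset_iff)
qed

lemma continuous_V: "continuous_on Om V"
  using local_lipschitz_continuous_on[OF lip, of 0] by auto

text \<open>Derivatives are required only inside the interval, and the common value at either end.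
  \<open>global_solution\<close> needs this form: one end there is a limit time, at which only a
  continuous extension of the solution is known.\<close>

lemma solution_eq_near:
  assumes ab: "a <= b" and "continuous_on {a..b} \<gamma>" "continuous_on {a..b} \<eta>"
    and "\<gamma> ` {a..b} \<subseteq> cball p u" "\<eta> ` {a..b} \<subseteq> cball p u"
    and g: "!!t. a < t ==> t < b ==> (\<gamma> has_vector_derivative V (\<gamma> t)) (at t)"
    and h: "!!t. a < t ==> t < b ==> (\<eta> has_vector_derivative V (\<eta> t)) (at t)"
    and L: "L-lipschitz_on (cball p u) V" "L * (b - a) <= 1/2"
    and "\<gamma> a = \<eta> a \<or> \<gamma> b = \<eta> b" "t \<in> {a..b}"
  shows "\<gamma> t = \<eta> t"
proof -
  have "\<gamma> t - \<eta> t = 0"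
  proof (rule gronwall_zero[where f = "\<lambda>t. \<gamma> t - \<eta> t" and f' = "\<lambda>t. V (\<gamma> t) - V (\<eta> t)" and L = L])
    show "((\<lambda>t. \<gamma> t - \<eta> t) has_vector_derivative V (\<gamma> t) - V (\<eta> t)) (at t)" if "a < t" "t < b" for t
      by (intro derivative_intros g h that)
    show "norm (V (\<gamma> t) - V (\<eta> t)) <= L * norm (\<gamma> t - \<eta> t)" if "a < t" "t < b" for t
    proof -
      have "\<gamma> t \<in> cball p u" "\<eta> t \<in> cball p u" using assms(4,5) that by (auto simp: image_subset_iff)
      then show ?thesis using lipschitz_onD[OF L(1)] by (simp add: dist_norm)
    qed
    show "0 <= L" using L(1) lipschitz_on_nonneg by blast
  qed (use assms in \<open>auto intro!: continuous_intros\<close>)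
  then show ?thesis by simp
qed

text \<open>The times of agreement form a relatively closed set; \<open>solution_eq_near\<close>,
  applied to a short interval on each side, shows that the set is open as well, and \<open>T\<close>
  is connected.\<close>

lemma solution_unique:
  assumes T: "open T" "is_interval T" and s: "solution_on T Om V \<gamma>" "solution_on T Om V \<eta>"
    and "t0 \<in> T" "\<gamma> t0 = \<eta> t0" "t \<in> T"
  shows "\<gamma> t = \<eta> t"
proof -
  let ?S = "{t \<in> T. \<gamma> t = \<eta> t}"
  have cg: "continuous_on T \<gamma>" and ch: "continuous_on T \<eta>"
    using s solution_on_continuous by auto
  have "closedin (top_of_set T) ?S"
  proof -
    have "closedin (top_of_set T) {t \<in> T. \<gamma> t - \<eta> t \<in> {0}}"
      using cg ch by (intro continuous_closedin_preimage[unfolded vimage_def Int_def, simplified] continuous_intros) auto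
    then show ?thesis by simp
  qed
  moreover have "open ?S"
  proof (rule openI)
    fix t1 assume t1: "t1 \<in> ?S"
    then have "\<gamma> t1 \<in> Om" using s(1) by (auto simp: solution_on_def)
    then obtain u L where u: "u > 0" "L \<ge> 0" "cball (\<gamma> t1) u \<subseteq> Om" "L-lipschitz_on (cball (\<gamma> t1) u) V"
      by (rule lip_ball)
    have "\<exists>d>0. \<forall>t\<in>T. dist t t1 < d --> dist (\<gamma> t) (\<gamma> t1) < u"
      using cg t1 u(1) unfolding continuous_on_iff by blast
    then obtain d1 where d1: "d1 > 0" "!!t. t \<in> T ==> dist t t1 < d1 ==> dist (\<gamma> t) (\<gamma> t1) < u" by blast
    have "\<exists>d>0. \<forall>t\<in>T. dist t t1 < d --> dist (\<eta> t) (\<eta> t1) < u"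
      using ch t1 u(1) unfolding continuous_on_iff by blast
    then obtain d2 where d2: "d2 > 0" "!!t. t \<in> T ==> dist t t1 < d2 ==> dist (\<eta> t) (\<eta> t1) < u" by blast
    obtain d3 where d3: "d3 > 0" "ball t1 d3 \<subseteq> T" using T(1) t1 open_contains_ball by blast
    \<comment> \<open>The summand 1 keeps the quotient defined for \<open>L = 0\<close>; a time step
      of this length still gives \<open>L * d <= 1/2\<close>.\<close>
    define e0 where "e0 = 1 / (2 * (L + 1))"
    have "e0 > 0" using u(2) by (simp add: e0_def)
    define d where "d = min (min d1 d2) (min d3 e0) / 2"
    have "d > 0" "d < d1" "d < d2" "d < d3" "d <= e0"
      using d1(1) d2(1) d3(1) \<open>e0 > 0\<close> by (auto simp: d_def min_def)
    then have d: "d > 0" "d < d1" "d < d2" "d < d3" "d <= 1 / (2 * (L + 1))"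
      by (auto simp: e0_def)
    have Ld: "L * d <= 1/2"
    proof -
      have "L * d <= (L + 1) * (1 / (2 * (L + 1)))" using d u(2) by (intro mult_mono) auto
      also have "\<dots> = 1/2" using u(2) by (simp add: field_simps)
      finally show ?thesis .
    qed
    have inT: "{t1 - d..t1 + d} \<subseteq> T" using d d3 by (auto simp: subset_iff dist_real_def)
    have eq: "\<gamma> t = \<eta> t" if "t \<in> {a..b}" "t1 - d <= a" "b <= t1 + d" "a <= b" "b - a <= d" "a = t1 \<or> b = t1" for t a b
    proof (rule solution_eq_near[of a b \<gamma> \<eta> "\<gamma> t1" u L t])
      have sub: "{a..b} \<subseteq> T" using inT that by auto
      then show "continuous_on {a..b} \<gamma>" "continuous_on {a..b} \<eta>"
        using cg ch continuous_on_subset by blast+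
      have near: "dist s t1 < d1" "dist s t1 < d2" if "s \<in> {a..b}" for s
        using that \<open>t1 - d <= a\<close> \<open>b <= t1 + d\<close> d by (auto simp: dist_real_def)
      have "dist (\<gamma> s) (\<gamma> t1) < u" "dist (\<eta> s) (\<eta> t1) < u" if "s \<in> {a..b}" for s
        using d1(2)[OF _ near(1)[OF that]] d2(2)[OF _ near(2)[OF that]] sub that by blast+
      then show "\<gamma> ` {a..b} \<subseteq> cball (\<gamma> t1) u" "\<eta> ` {a..b} \<subseteq> cball (\<gamma> t1) u"
        using t1 by (auto simp: dist_commute less_imp_le)
      show "(\<gamma> has_vector_derivative V (\<gamma> t)) (at t)" "(\<eta> has_vector_derivative V (\<eta> t)) (at t)"
        if "a < t" "t < b" for t
        using s sub that by (auto simp: solution_on_def subset_iff)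
      have "L * (b - a) <= L * d" using that u(2) by (intro mult_left_mono) auto
      then show "L * (b - a) <= 1/2" using Ld by simp
      show "L-lipschitz_on (cball (\<gamma> t1) u) V" by (rule u)
    qed (use that t1 in auto)
    have "ball t1 d \<subseteq> ?S"
    proof
      fix t assume "t \<in> ball t1 d"
      then have "t \<in> {t1-d..t1} \<or> t \<in> {t1..t1+d}" by (auto simp: dist_real_def)
      then have "\<gamma> t = \<eta> t" using eq[of t "t1-d" t1] eq[of t t1 "t1+d"] d(1) by auto
      moreover have "t \<in> T" using \<open>t \<in> ball t1 d\<close> by (intro subsetD[OF inT]) (auto simp: dist_real_def)
      ultimately show "t \<in> ?S" by simp
    qed
    then show "\<exists>e>0. ball t1 e \<subseteq> ?S" using d(1) by blast
  qed
  then have "openin (top_of_set T) ?S" by (simp add: T(1) openin_open_eq)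
  moreover have "connected T" using T(2) is_interval_connected by blast
  ultimately have "?S = {} \<or> ?S = T" unfolding connected_clopen by blast
  then show ?thesis using assms by auto
qed

lemma solution_join:
  assumes "open S" "is_interval S" "solution_on S Om V \<gamma>"
    and "open T" "is_interval T" "solution_on T Om V \<eta>"
    and "t0 \<in> S" "t0 \<in> T" "\<gamma> t0 = \<eta> t0"
  obtains \<zeta> where "solution_on (S \<union> T) Om V \<zeta>" "!!t. t \<in> S ==> \<zeta> t = \<gamma> t" "!!t. t \<in> T ==> \<zeta> t = \<eta> t"
    "open (S \<union> T)" "is_interval (S \<union> T)"
proof -
  have agree: "\<gamma> t = \<eta> t" if "t \<in> S" "t \<in> T" for t
    by (rule solution_unique[of "S \<inter> T" \<gamma> \<eta> t0 t])
       (use assms that in \<open>auto intro: solution_on_subset is_interval_Int\<close>)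
  define \<zeta> where "\<zeta> t = (if t \<in> S then \<gamma> t else \<eta> t)" for t
  have zs: "\<zeta> t = \<gamma> t" if "t \<in> S" for t using that by (simp add: \<zeta>_def)
  have zt: "\<zeta> t = \<eta> t" if "t \<in> T" for t using that agree by (simp add: \<zeta>_def)
  have "solution_on (S \<union> T) Om V \<zeta>"
    by (intro solution_on_Un solution_on_cong_open[OF assms(3) assms(1) zs]
        solution_on_cong_open[OF assms(6) assms(4) zt])
  moreover have "is_interval (S \<union> T)"
    using assms by (simp add: is_interval_connected_1 connected_Un[OF _ _] disjoint_iff) (metis connected_Un disjoint_iff)
  ultimately show thesis using that zs zt assms(1,4) by blast
qed

end

section \<open>Planar Hamiltonian fields\<close>

text \<open>The factor \<open>k\<close> frees the Hamiltonian from its normalisation: orbits see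
  only its level sets, so any nonzero multiple serves, such as the one adapted to the chart.\<close>

locale hamiltonian_field = lipschitz_field +
  fixes H :: "real^2 => real" and k :: real
  assumes k_nz: "k \<noteq> 0"
    and dH: "!!p. p \<in> Om ==> (H has_derivative (\<lambda>v. k * (V p$1 * v$2 - V p$2 * v$1))) (at p)"
begin

lemma continuous_H: "continuous_on Om H"
  by (meson continuous_at_imp_continuous_on dH has_derivative_continuous)

lemma H_const_solution:
  assumes "is_interval T" "solution_on T Om V \<gamma>" "s \<in> T" "t \<in> T"
  shows "H (\<gamma> s) = H (\<gamma> t)"
proof -
  have "((\<lambda>t. H (\<gamma> t)) has_derivative (\<lambda>h. 0)) (at t within T)" if "t \<in> T" for t
  proof -
    have 1: "(\<gamma> has_derivative (\<lambda>h. h *\<^sub>R V (\<gamma> t))) (at t)" "\<gamma> t \<in> Om"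
      using assms(2) that by (auto simp: solution_on_def has_vector_derivative_def)
    have "((\<lambda>t. H (\<gamma> t)) has_derivative (\<lambda>h. k * (V (\<gamma> t)$1 * (h *\<^sub>R V (\<gamma> t))$2 - V (\<gamma> t)$2 * (h *\<^sub>R V (\<gamma> t))$1))) (at t)"
      using has_derivative_compose[OF 1(1) dH[OF 1(2)]] by simp
    then show ?thesis by (auto simp: algebra_simps intro: has_derivative_at_withinI)
  qed
  then have "\<exists>c. \<forall>t\<in>T. H (\<gamma> t) = c"
    by (intro has_derivative_zero_constant) (use assms(1) is_interval_convex_1 in auto)
  then show ?thesis using assms by auto
qed

text \<open>The pair of \<open>H\<close> and the coordinate along \<open>V p\<close> is a local
  diffeomorphism, so the level through \<open>p\<close> is a curve; running along it with the speed
  prescribed by \<open>V\<close> produces a solution. This yields local existence at regular points.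
  The last clause says more: near \<open>p\<close> the entire level is swept by this solution,
  within arbitrarily short time.\<close>

lemma flow_box:
  assumes p: "p \<in> Om" "V p \<noteq> 0"
  obtains \<epsilon> \<eta> where "\<epsilon> > 0" "solution_on {-\<epsilon><..<\<epsilon>} Om V \<eta>" "\<eta> 0 = p"
    "!!\<delta>. \<delta> > 0 ==> \<exists>B. open B \<and> p \<in> B \<and> (\<forall>z\<in>B. H z = H p --> (\<exists>t\<in>{-\<delta><..<\<delta>}. t \<in> {-\<epsilon><..<\<epsilon>} \<and> \<eta> t = z))"
proof -
  define d where "d = V p"
  define n where "n = (d$1)^2 + (d$2)^2"
  have npos: "n > 0" using p(2) unfolding n_def d_def
    by (metis vec2_eq_iff sum_power2_gt_zero_iff zero_index)
  define \<Theta> where "\<Theta> z = pt (H z) (d \<bullet> z)" for z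
  define J where "J z v = pt (k * (V z$1 * v$2 - V z$2 * v$1)) (d \<bullet> v)" for z v
  have blJ: "bounded_linear (J z)" for z
    unfolding linear_conv_bounded_linear[symmetric]
    by (rule linearI) (auto simp: J_def vec2_eq_iff algebra_simps inner_vec2)
  define f' where "f' z = Blinfun (J z)" for z
  have f'[simp]: "blinfun_apply (f' z) = J z" for z
    by (simp add: f'_def bounded_linear_Blinfun_apply blJ)
  \<comment> \<open>The explicit inverse of the derivative \<open>J p\<close>, in the orthogonal
    frame given by \<open>V p\<close> and the vector perpendicular to it.\<close>
  define I where "I w = pt ((w$2 * d$1 - w$1 * d$2 / k) / n) ((w$2 * d$2 + w$1 * d$1 / k) / n)" for w :: "real^2"
  have blI: "bounded_linear I"
    unfolding linear_conv_bounded_linear[symmetric]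
    by (rule linearI) (use npos k_nz in \<open>auto simp: I_def vec2_eq_iff field_simps\<close>)
  obtain U' W g g' where ift: "open U'" "U' \<subseteq> Om" "p \<in> U'" "open W" "\<Theta> p \<in> W" "homeomorphism U' W \<Theta> g"
    "!!y. y \<in> W ==> (g has_derivative (g' y)) (at y)"
    "!!y. y \<in> W ==> g' y = inv (J (g y))"
    "!!y. y \<in> W ==> bij (J (g y))"
  proof (rule inverse_function_theorem[of Om \<Theta> f' p "Blinfun I"])
    show "open Om" by (rule open_Om)
    show "(\<Theta> has_derivative blinfun_apply (f' x)) (at x)" if "x \<in> Om" for x
      unfolding \<Theta>_def f' J_def
      by (intro derivative_intros dH that)
    show "continuous_on Om f'"
    proof (rule continuous_on_blinfun_componentwise)
      fix i :: "real^2"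
      show "continuous_on Om (\<lambda>x. blinfun_apply (f' x) i)"
        unfolding f' J_def by (intro continuous_intros continuous_V)
    qed
    show "p \<in> Om" by (rule p)
    show "Blinfun I o\<^sub>L f' p = id_blinfun"
    proof (rule blinfun_eqI)
      fix v
      have nn: "n = d$1 * d$1 + d$2 * d$2" by (simp add: n_def power2_eq_square)
      have "I (J p v) = v"
        using npos k_nz unfolding I_def J_def d_def[symmetric]
        by (simp add: vec2_eq_iff inner_vec2 divide_simps) (simp add: nn algebra_simps)
      then show "blinfun_apply (Blinfun I o\<^sub>L f' p) v = blinfun_apply id_blinfun v"
        by (simp add: bounded_linear_Blinfun_apply blI)
    qed
  qed auto
  have g\<Theta>: "g (\<Theta> z) = z" if "z \<in> U'" for z
    using ift(6) that by (simp add: homeomorphism_def)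
  have gW: "g w \<in> U'" if "w \<in> W" for w
    using ift(6) that by (auto simp: homeomorphism_def)
  have \<Theta>g: "\<Theta> (g w) = w" if "w \<in> W" for w
    using ift(6) that by (simp add: homeomorphism_def)
  define h where "h = H p"
  define \<sigma>0 where "\<sigma>0 = d \<bullet> p"
  have \<Theta>p: "\<Theta> p = pt h \<sigma>0" by (simp add: \<Theta>_def h_def \<sigma>0_def)
  \<comment> \<open>\<open>c\<close> runs through the level of \<open>p\<close>, parametrised by the
    coordinate \<sigma> along \<open>V p\<close>; \<open>kk\<close> is the rate at which \<sigma>
    changes along solutions.\<close>
  define c where "c \<sigma> = g (pt h \<sigma>)" for \<sigma>
  define kk where "kk \<sigma> = d \<bullet> V (c \<sigma>)" for \<sigma>
  obtain r1 where r1: "r1 > 0" "ball (pt h \<sigma>0) r1 \<subseteq> W"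
    using ift(4,5) \<Theta>p open_contains_ball by metis
  have inW: "pt h \<sigma> \<in> W" if "\<bar>\<sigma> - \<sigma>0\<bar> < r1" for \<sigma>
  proof -
    have "dist (pt h \<sigma>0) (pt h \<sigma>) = \<bar>\<sigma> - \<sigma>0\<bar>"
      by (simp add: dist_norm norm_vec2 abs_minus_commute)
    then show ?thesis using r1(2) that by auto
  qed
  have cOm: "c \<sigma> \<in> U'" "c \<sigma> \<in> Om" if "\<bar>\<sigma> - \<sigma>0\<bar> < r1" for \<sigma>
    using inW[OF that] gW ift(2) by (auto simp: c_def)
  have cp: "c \<sigma>0 = p" using g\<Theta>[OF ift(3)] by (simp add: c_def \<Theta>p)
  have cont_c: "continuous_on {\<sigma>. \<bar>\<sigma> - \<sigma>0\<bar> < r1} c"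
    unfolding c_def
    by (rule continuous_on_compose2[of W g])
       (use ift(6) inW in \<open>auto simp: homeomorphism_def intro!: continuous_intros\<close>)
  have cont_k: "continuous_on {\<sigma>. \<bar>\<sigma> - \<sigma>0\<bar> < r1} kk"
    unfolding kk_def
    by (intro continuous_intros continuous_on_compose2[OF continuous_V cont_c]) (use cOm in auto)
  have "kk \<sigma>0 > 0" using npos by (simp add: kk_def cp d_def[symmetric] inner_vec2 n_def power2_eq_square)
  moreover have "{\<sigma>. \<bar>\<sigma> - \<sigma>0\<bar> < r1} = ball \<sigma>0 r1" by (auto simp: dist_real_def)
  then have "isCont kk \<sigma>0" using cont_k r1(1) continuous_on_eq_continuous_at[of "ball \<sigma>0 r1" kk] by auto
  ultimately have "\<forall>\<^sub>F \<sigma> in at \<sigma>0. kk \<sigma> > 0" using order_tendstoD(1) unfolding isCont_def by blast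
  then obtain r2 where r2: "r2 > 0" "!!\<sigma>. \<sigma> \<noteq> \<sigma>0 ==> \<bar>\<sigma> - \<sigma>0\<bar> < r2 ==> kk \<sigma> > 0"
    unfolding eventually_at dist_real_def by blast
  define r where "r = min r1 r2 / 2"
  have r: "r > 0" "r < r1" "r < r2" using r1 r2 by (auto simp: r_def)
  have kpos: "kk \<sigma> > 0" if "\<bar>\<sigma> - \<sigma>0\<bar> <= r" for \<sigma>
    using r2(2)[of \<sigma>] r that \<open>kk \<sigma>0 > 0\<close> by (cases "\<sigma> = \<sigma>0") auto
  have dc: "(c has_vector_derivative (1 / kk \<sigma>) *\<^sub>R V (c \<sigma>)) (at \<sigma>)" if "\<bar>\<sigma> - \<sigma>0\<bar> <= r" for \<sigma>
  proof -
    have W: "pt h \<sigma> \<in> W" using inW that r by auto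
    have "((\<lambda>\<sigma>. pt h \<sigma>) has_derivative (\<lambda>v. pt 0 v)) (at \<sigma>)"
      by (intro derivative_intros)
    from has_derivative_compose[OF this ift(7)[OF W]]
    have "(c has_derivative (\<lambda>v. g' (pt h \<sigma>) (pt 0 v))) (at \<sigma>)"
      by (simp add: c_def[abs_def])
    \<comment> \<open>\<open>V\<close> annihilates the derivative of \<open>H\<close>, so
      \<open>J\<close> sends \<open>V / kk\<close> to the second unit vector. The curve
      \<open>c\<close> is therefore tangent to \<open>V\<close>.\<close>
    moreover have "g' (pt h \<sigma>) (pt 0 v) = v *\<^sub>R ((1 / kk \<sigma>) *\<^sub>R V (c \<sigma>))" for v
    proof -
      have "J (c \<sigma>) (v *\<^sub>R ((1 / kk \<sigma>) *\<^sub>R V (c \<sigma>))) = pt 0 v"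
        using kpos[OF that] by (simp add: J_def vec2_eq_iff kk_def)
      then show ?thesis
        using ift(8,9)[OF W] by (metis bij_is_inj c_def inv_f_f)
    qed
    ultimately show ?thesis by (simp add: has_vector_derivative_def)
  qed
  define a b where "a = \<sigma>0 - r" and "b = \<sigma>0 + r"
  have ab: "a < \<sigma>0" "\<sigma>0 < b" using r by (auto simp: a_def b_def)
  have inr: "\<bar>\<sigma> - \<sigma>0\<bar> <= r" if "\<sigma> \<in> {a..b}" for \<sigma> using that by (auto simp: a_def b_def)
  have "continuous_on {a..b} (\<lambda>\<sigma>. 1 / kk \<sigma>)"
  proof (intro continuous_intros)
    show "continuous_on {a..b} kk"
      by (rule continuous_on_subset[OF cont_k]) (use inr r in fastforce)
    show "\<forall>\<sigma>\<in>{a..b}. kk \<sigma> \<noteq> 0" using kpos inr by force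
  qed
  then obtain \<tau>0 where \<tau>0: "!!\<sigma>. \<sigma> \<in> {a..b} ==> (\<tau>0 has_vector_derivative 1 / kk \<sigma>) (at \<sigma> within {a..b})"
    using antiderivative_continuous[of a b "\<lambda>\<sigma>. 1 / kk \<sigma>"] by blast
  \<comment> \<open>The time needed to get from \<open>p\<close> to the position \<sigma>; its
    inverse turns the curve into a solution.\<close>
  define \<tau> where "\<tau> \<sigma> = \<tau>0 \<sigma> - \<tau>0 \<sigma>0" for \<sigma>
  have d\<tau>: "(\<tau> has_real_derivative 1 / kk \<sigma>) (at \<sigma>)" if "\<sigma> \<in> {a<..<b}" for \<sigma>
  proof -
    have "(\<tau>0 has_real_derivative 1 / kk \<sigma>) (at \<sigma>)"
      using \<tau>0[of \<sigma>] that at_within_Icc_at[of a \<sigma> b]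
      by (auto simp: has_real_derivative_iff_has_vector_derivative)
    then show ?thesis unfolding \<tau>_def by (auto intro!: derivative_eq_intros)
  qed
  have c\<tau>: "continuous_on {a..b} \<tau>"
    unfolding \<tau>_def by (intro continuous_intros) (meson \<tau>0 continuous_on_vector_derivative)
  have mono: "\<tau> x < \<tau> y" if "a <= x" "x < y" "y <= b" for x y
  proof (rule DERIV_pos_imp_increasing_open[OF \<open>x < y\<close>])
    fix s assume "x < s" "s < y"
    then have "s \<in> {a<..<b}" "\<bar>s - \<sigma>0\<bar> <= r" using that inr by auto
    then show "\<exists>y. DERIV \<tau> s :> y \<and> y > 0"
      using d\<tau>[of s] kpos[of s] by (meson zero_less_divide_1_iff)
  qed (use continuous_on_subset[OF c\<tau>] that in auto)
  have inj: "inj_on \<tau> {a..b}"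
    by (rule inj_onI) (metis atLeastAtMost_iff linorder_neqE_linordered_idom mono order_less_irrefl)
  define sg where "sg = the_inv_into {a..b} \<tau>"
  have sg\<tau>: "sg (\<tau> \<sigma>) = \<sigma>" if "\<sigma> \<in> {a..b}" for \<sigma>
    using the_inv_into_f_f[OF inj that] by (simp add: sg_def)
  have \<tau>00: "\<tau> \<sigma>0 = 0" by (simp add: \<tau>_def)
  define \<epsilon> where "\<epsilon> = min (\<tau> b) (- \<tau> a)"
  have \<epsilon>pos: "\<epsilon> > 0" using mono[of a \<sigma>0] mono[of \<sigma>0 b] ab \<tau>00 by (auto simp: \<epsilon>_def)
  have ex: "\<exists>\<sigma>\<in>{a<..<b}. \<tau> \<sigma> = t" if "t \<in> {-\<epsilon><..<\<epsilon>}" for t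
  proof -
    have t: "\<tau> a < t" "t < \<tau> b" using that by (auto simp: \<epsilon>_def)
    then have "\<exists>\<sigma>\<ge>a. \<sigma> <= b \<and> \<tau> \<sigma> = t"
      by (intro IVT') (use ab c\<tau> in auto)
    then obtain \<sigma> where "\<sigma> \<in> {a..b}" "\<tau> \<sigma> = t" by auto
    moreover have "\<sigma> \<noteq> a" "\<sigma> \<noteq> b" using calculation t by auto
    ultimately show ?thesis by force
  qed
  define \<eta> where "\<eta> t = c (sg t)" for t
  have sol: "solution_on {-\<epsilon><..<\<epsilon>} Om V \<eta>"
    unfolding solution_on_def
  proof (intro ballI conjI)
    fix t assume "t \<in> {-\<epsilon><..<\<epsilon>}"
    then obtain \<sigma> where \<sigma>: "\<sigma> \<in> {a<..<b}" "\<tau> \<sigma> = t" using ex by blast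
    have "\<bar>\<sigma> - \<sigma>0\<bar> <= r" using inr \<sigma>(1) by auto
    have \<eta>t: "\<eta> t = c \<sigma>" using sg\<tau>[of \<sigma>] \<sigma> by (auto simp: \<eta>_def)
    show "\<eta> t \<in> Om" using \<eta>t cOm[of \<sigma>] \<open>\<bar>\<sigma> - \<sigma>0\<bar> <= r\<close> r by auto
    obtain x1 x2 where "a < x1" "x1 < \<sigma>" "\<sigma> < x2" "x2 < b" using \<sigma>(1) dense[of a \<sigma>] dense[of \<sigma> b] by auto
    then have "isCont sg (\<tau> \<sigma>)"
      by (intro isCont_inverse_function2[of x1 \<sigma> x2 sg \<tau>] sg\<tau> DERIV_isCont[OF d\<tau>]) auto
    then have "isCont sg t" using \<sigma> by simp
    have "(sg has_real_derivative inverse (1 / kk \<sigma>)) (at t)"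
    proof (rule DERIV_inverse_function[where a = "-\<epsilon>" and b = \<epsilon> and f = \<tau>])
      show "(\<tau> has_real_derivative 1 / kk \<sigma>) (at (sg t))" using d\<tau>[OF \<sigma>(1)] sg\<tau>[of \<sigma>] \<sigma> by auto
      show "1 / kk \<sigma> \<noteq> 0" using kpos[of \<sigma>] \<open>\<bar>\<sigma> - \<sigma>0\<bar> <= r\<close> by auto
      show "\<tau> (sg y) = y" if "-\<epsilon> < y" "y < \<epsilon>" for y
        using ex[of y] that sg\<tau> by auto
    qed (use \<open>t \<in> _\<close> \<open>isCont sg t\<close> in auto)
    then have "(sg has_vector_derivative kk \<sigma>) (at t)"
      by (simp add: has_real_derivative_iff_has_vector_derivative)
    moreover have "(c has_vector_derivative (1 / kk \<sigma>) *\<^sub>R V (c \<sigma>)) (at (sg t))"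
      using dc[OF \<open>\<bar>\<sigma> - \<sigma>0\<bar> <= r\<close>] sg\<tau>[of \<sigma>] \<sigma> by auto
    ultimately have "(c \<circ> sg has_vector_derivative kk \<sigma> *\<^sub>R ((1 / kk \<sigma>) *\<^sub>R V (c \<sigma>))) (at t)"
      by (rule vector_diff_chain_at)
    then show "(\<eta> has_vector_derivative V (\<eta> t)) (at t)"
      using kpos[of \<sigma>] \<open>\<bar>\<sigma> - \<sigma>0\<bar> <= r\<close> \<eta>t by (simp add: o_def \<eta>_def[abs_def])
  qed
  have \<eta>0: "\<eta> 0 = p" using sg\<tau>[of \<sigma>0] ab \<tau>00 cp by (simp add: \<eta>_def)
  have cover: "\<exists>B. open B \<and> p \<in> B \<and> (\<forall>z\<in>B. H z = H p --> (\<exists>t\<in>{-\<delta><..<\<delta>}. t \<in> {-\<epsilon><..<\<epsilon>} \<and> \<eta> t = z))" if "\<delta> > 0" for \<delta>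
  proof -
    have "isCont \<tau> \<sigma>0" using d\<tau>[of \<sigma>0] ab DERIV_isCont by auto
    then have "\<exists>s>0. \<forall>\<sigma>. \<bar>\<sigma> - \<sigma>0\<bar> < s --> \<bar>\<tau> \<sigma> - \<tau> \<sigma>0\<bar> < min \<delta> \<epsilon>"
      unfolding continuous_at_real_range using that \<epsilon>pos by (simp del: min_less_iff_conj)
    then obtain s where s: "s > 0" "!!\<sigma>. \<bar>\<sigma> - \<sigma>0\<bar> < s ==> \<bar>\<tau> \<sigma>\<bar> < min \<delta> \<epsilon>"
      using \<tau>00 by (metis diff_zero)
    define s' where "s' = min s r"
    define B where "B = U' \<inter> {z. \<bar>d \<bullet> z - \<sigma>0\<bar> < s'}"
    have "open {z. \<bar>d \<bullet> z - \<sigma>0\<bar> < s'}"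
      by (intro open_Collect_less continuous_intros)
    then have "open B" using ift(1) by (auto simp: B_def)
    moreover have "p \<in> B" using ift(3) s r by (auto simp: B_def \<sigma>0_def s'_def)
    moreover have "\<exists>t\<in>{-\<delta><..<\<delta>}. t \<in> {-\<epsilon><..<\<epsilon>} \<and> \<eta> t = z" if "z \<in> B" "H z = H p" for z
    proof -
      have z: "z = c (d \<bullet> z)" using g\<Theta>[of z] that by (auto simp: B_def c_def \<Theta>_def h_def)
      have "d \<bullet> z \<in> {a..b}" using that by (auto simp: B_def s'_def a_def b_def abs_less_iff)
      then have "\<eta> (\<tau> (d \<bullet> z)) = z" using sg\<tau> z by (simp add: \<eta>_def)
      moreover have "\<bar>\<tau> (d \<bullet> z)\<bar> < min \<delta> \<epsilon>" using that by (intro s) (auto simp: B_def s'_def)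
      ultimately show ?thesis by (intro bexI[of _ "\<tau> (d \<bullet> z)"]) auto
    qed
    ultimately show ?thesis by blast
  qed
  show thesis by (rule that[OF \<epsilon>pos sol \<eta>0 cover])
qed

end

section \<open>Orbits and maximal solutions\<close>

lemma orbitI:
  "open T ==> is_interval T ==> 0 \<in> T ==> t \<in> T ==> solution_on T U V \<gamma> ==> \<gamma> 0 = p ==> \<gamma> t = q ==> q \<in> orbit U V p"
  by (auto simp: orbit_def)

lemma orbitE:
  assumes "q \<in> orbit U V p"
  obtains \<gamma> t T where "open T" "is_interval T" "0 \<in> T" "t \<in> T" "solution_on T U V \<gamma>" "\<gamma> 0 = p" "\<gamma> t = q"
  using assms by (auto simp: orbit_def)

context lipschitz_field
begin

lemma orbit_step:
  assumes "q \<in> orbit Om V p"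
  shows "orbit Om V q \<subseteq> orbit Om V p"
proof
  fix r assume "r \<in> orbit Om V q"
  obtain \<gamma> t1 S where \<gamma>: "open S" "is_interval S" "0 \<in> S" "t1 \<in> S" "solution_on S Om V \<gamma>" "\<gamma> 0 = p" "\<gamma> t1 = q"
    using assms by (rule orbitE)
  obtain \<eta> t2 T where \<eta>: "open T" "is_interval T" "0 \<in> T" "t2 \<in> T" "solution_on T Om V \<eta>" "\<eta> 0 = q" "\<eta> t2 = r"
    using \<open>r \<in> orbit Om V q\<close> by (rule orbitE)
  let ?T = "{t. t + - t1 \<in> T}"
  obtain \<zeta> where \<zeta>: "solution_on (S \<union> ?T) Om V \<zeta>" "!!t. t \<in> S ==> \<zeta> t = \<gamma> t" "!!t. t \<in> ?T ==> \<zeta> t = \<eta> (t + - t1)"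
    "open (S \<union> ?T)" "is_interval (S \<union> ?T)"
    by (rule solution_join[OF \<gamma>(1,2,5) open_interval_shift[OF \<eta>(1,2)] solution_on_shift[OF \<eta>(5)], of t1 "- t1"])
       (use \<gamma> \<eta> in auto)
  have "\<zeta> (t1 + t2) = r" "\<zeta> 0 = p" "t1 + t2 \<in> S \<union> ?T" "0 \<in> S \<union> ?T"
    using \<zeta>(3)[of "t1 + t2"] \<zeta>(2)[of 0] \<eta> \<gamma> by auto
  then show "r \<in> orbit Om V p" using orbitI[OF \<zeta>(4,5) _ _ \<zeta>(1)] by blast
qed

lemma orbit_sym:
  assumes "q \<in> orbit Om V p"
  shows "p \<in> orbit Om V q"
proof -
  obtain \<gamma> t1 S where \<gamma>: "open S" "is_interval S" "0 \<in> S" "t1 \<in> S" "solution_on S Om V \<gamma>" "\<gamma> 0 = p" "\<gamma> t1 = q"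
    using assms by (rule orbitE)
  show ?thesis
    by (rule orbitI[OF open_interval_shift[OF \<gamma>(1,2), of t1] _ _ solution_on_shift[OF \<gamma>(5), of t1], of "- t1"])
       (use \<gamma> in auto)
qed

lemma orbit_eq: "q \<in> orbit Om V p ==> orbit Om V q = orbit Om V p"
  using orbit_step orbit_sym by blast

lemma orbit_subset: "orbit Om V p \<subseteq> Om"
  unfolding orbit_def solution_on_def by blast

lemma solution_in_orbit:
  assumes "solution_on T Om V \<gamma>" "open T" "is_interval T" "s \<in> T" "t \<in> T"
  shows "\<gamma> t \<in> orbit Om V (\<gamma> s)"
proof -
  show ?thesis
    by (rule orbitI[OF open_interval_shift[OF assms(2,3), of s] _ _ solution_on_shift[OF assms(1), of s], of "t - s"])
       (use assms in auto)
qed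

lemma orbit_connected: "connected (orbit Om V p)"
proof (cases "orbit Om V p = {}")
  case False
  define F where "F = {\<gamma> ` T | \<gamma> T. open T \<and> is_interval T \<and> 0 \<in> T \<and> solution_on T Om V \<gamma> \<and> \<gamma> 0 = p}"
  have eq: "orbit Om V p = \<Union>F" unfolding orbit_def F_def by blast
  show ?thesis unfolding eq
  proof (rule connected_Union)
    show "connected s" if s: "s \<in> F" for s
    proof -
      obtain \<gamma> T where "s = \<gamma> ` T" "is_interval T" "solution_on T Om V \<gamma>"
        using s unfolding F_def by blast
      then show ?thesis
        using connected_continuous_image solution_on_continuous is_interval_connected by metis
    qed
    have "p \<in> s" if "s \<in> F" for s using that unfolding F_def by (auto simp: image_iff)
    then have "p \<in> \<Inter>F" by blast
    then show "\<Inter>F \<noteq> {}" by blast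
  qed
qed auto

lemma orbit_equilibrium:
  assumes "p \<in> Om" "V p = 0"
  shows "orbit Om V p = {p}"
proof -
  have c: "solution_on T Om V (\<lambda>_. p)" for T
    using assms by (auto simp: solution_on_def)
  have "\<gamma> t = p" if "open T" "is_interval T" "0 \<in> T" "t \<in> T" "solution_on T Om V \<gamma>" "\<gamma> 0 = p" for \<gamma> t T
    using solution_unique[OF that(1,2,5) c, of 0 t] that by auto
  moreover have "p \<in> orbit Om V p"
    using solution_in_orbit[OF c, of UNIV 0 0] by auto
  ultimately show ?thesis unfolding orbit_def by auto
qed

text \<open>All solutions through \<open>p\<close> agree on common times, so their union is a
  solution. The case \<open>T = {}\<close> covers points without any solution, for instance points
  outside \<open>Om\<close>.\<close>

lemma maximal_solution:
  obtains \<Gamma> T where "open T" "is_interval T" "solution_on T Om V \<Gamma>" "0 \<in> T \<or> T = {}" "T \<noteq> {} ==> \<Gamma> 0 = p"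
    "!!\<gamma> S. open S ==> is_interval S ==> 0 \<in> S ==> solution_on S Om V \<gamma> ==> \<gamma> 0 = p ==> S \<subseteq> T \<and> (\<forall>t\<in>S. \<Gamma> t = \<gamma> t)"
    "orbit Om V p = \<Gamma> ` T"
proof -
  define P where "P \<gamma> S \<longleftrightarrow> open S \<and> is_interval S \<and> 0 \<in> S \<and> solution_on S Om V \<gamma> \<and> \<gamma> 0 = p" for \<gamma> S
  have agree: "\<gamma> t = \<eta> t" if "P \<gamma> S" "P \<eta> S'" "t \<in> S" "t \<in> S'" for \<gamma> \<eta> S S' t
    using that unfolding P_def
    by (intro solution_unique[of "S \<inter> S'" \<gamma> \<eta> 0 t]) (auto intro: solution_on_subset is_interval_Int)
  define T where "T = \<Union>{S. \<exists>\<gamma>. P \<gamma> S}"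
  define \<Gamma> where "\<Gamma> t = (SOME x. \<exists>\<gamma> S. P \<gamma> S \<and> t \<in> S \<and> x = \<gamma> t)" for t
  have \<Gamma>: "\<Gamma> t = \<gamma> t" if "P \<gamma> S" "t \<in> S" for \<gamma> S t
  proof -
    have "\<exists>\<gamma> S. P \<gamma> S \<and> t \<in> S \<and> \<Gamma> t = \<gamma> t"
      unfolding \<Gamma>_def by (rule someI[of _ "\<gamma> t"]) (use that in blast)
    then show ?thesis using agree that by metis
  qed
  show thesis
  proof (rule that[of T \<Gamma>])
    show "open T" unfolding T_def P_def by auto
    have "connected T" unfolding T_def
      by (rule connected_Union) (auto simp: P_def is_interval_connected)
    then show "is_interval T" by (simp add: is_interval_connected_1)
    show "solution_on T Om V \<Gamma>"
      unfolding solution_on_def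
    proof
      fix t assume "t \<in> T"
      then obtain \<gamma> S where S: "P \<gamma> S" "t \<in> S" unfolding T_def by blast
      have "solution_on S Om V \<Gamma>"
        by (rule solution_on_cong_open[of S Om V \<gamma>]) (use S \<Gamma> in \<open>auto simp: P_def\<close>)
      then show "\<Gamma> t \<in> Om \<and> (\<Gamma> has_vector_derivative V (\<Gamma> t)) (at t)"
        using S by (auto simp: solution_on_def)
    qed
    show "0 \<in> T \<or> T = {}" unfolding T_def P_def by blast
    show "\<Gamma> 0 = p" if T: "T \<noteq> {}"
    proof -
      obtain \<gamma> S where "P \<gamma> S" using T unfolding T_def by auto
      moreover from this have "0 \<in> S" "\<gamma> 0 = p" by (auto simp: P_def)
      ultimately show ?thesis using \<Gamma>[of \<gamma> S 0] by simp
    qed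
    show "S \<subseteq> T \<and> (\<forall>t\<in>S. \<Gamma> t = \<gamma> t)" if "open S" "is_interval S" "0 \<in> S" "solution_on S Om V \<gamma>" "\<gamma> 0 = p" for \<gamma> S
    proof -
      have "P \<gamma> S" using that by (simp add: P_def)
      then show ?thesis using \<Gamma>[of \<gamma> S] unfolding T_def by blast
    qed
    show "orbit Om V p = \<Gamma> ` T"
    proof
      show "orbit Om V p \<subseteq> \<Gamma> ` T"
      proof
        fix q assume "q \<in> orbit Om V p"
        then obtain \<gamma> t S where "P \<gamma> S" "t \<in> S" "q = \<gamma> t" unfolding P_def by (rule orbitE) blast
        moreover from this have "t \<in> T" unfolding T_def by blast
        ultimately show "q \<in> \<Gamma> ` T" using \<Gamma>[of \<gamma> S t] by (metis imageI)
      qed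
      show "\<Gamma> ` T \<subseteq> orbit Om V p"
      proof clarify
        fix t assume "t \<in> T"
        then obtain \<gamma> S where S: "P \<gamma> S" "t \<in> S" unfolding T_def by blast
        show "\<Gamma> t \<in> orbit Om V p"
          by (rule orbitI[of S t Om V \<gamma>]) (use S \<Gamma>[OF S] in \<open>auto simp: P_def\<close>)
      qed
    qed
  qed
qed

end

section \<open>Orbits in level sets, global existence, periodicity\<close>

context hamiltonian_field
begin

lemma local_solution:
  assumes "p \<in> Om"
  obtains \<epsilon> \<eta> where "\<epsilon> > 0" "solution_on {-\<epsilon><..<\<epsilon>} Om V \<eta>" "\<eta> 0 = p"
proof (cases "V p = 0")
  case True
  then have "solution_on {-1<..<1} Om V (\<lambda>_. p)" using assms by (auto simp: solution_on_def)
  then show ?thesis using that[of 1 "\<lambda>_. p"] by simp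
next
  case False
  from flow_box[OF assms this] show ?thesis using that by metis
qed

lemma orbit_self: "p \<in> Om ==> p \<in> orbit Om V p"
proof -
  assume "p \<in> Om"
  then obtain \<epsilon> \<eta> where "\<epsilon> > 0" "solution_on {-\<epsilon><..<\<epsilon>} Om V \<eta>" "\<eta> 0 = p" by (rule local_solution)
  then show ?thesis using solution_in_orbit[of "{-\<epsilon><..<\<epsilon>}" \<eta> 0 0] by (auto simp: is_interval_1)
qed

lemma orbit_regular:
  assumes "p \<in> Om" "V p \<noteq> 0" "q \<in> orbit Om V p"
  shows "V q \<noteq> 0"
proof
  assume "V q = 0"
  then have "orbit Om V q = {q}" using assms(3) orbit_subset orbit_equilibrium by blast
  then have "p = q" using orbit_sym[OF assms(3)] by simp
  then show False using assms(2) \<open>V q = 0\<close> by simp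
qed

lemma orbit_H: "q \<in> orbit Om V p ==> H q = H p"
  by (erule orbitE) (metis H_const_solution)

text \<open>By the covering clause of \<open>flow_box\<close>, every nearby point on the level of
  \<open>q\<close> is reached by the solution through \<open>q\<close>.\<close>

lemma orbit_nhd:
  assumes "p \<in> Om" "V p \<noteq> 0" "q \<in> orbit Om V p"
  obtains B where "open B" "q \<in> B" "!!z. z \<in> B ==> H z = H p ==> z \<in> orbit Om V p"
proof -
  have q: "q \<in> Om" "V q \<noteq> 0" "H q = H p"
    using assms orbit_subset[of p] orbit_regular[OF assms] orbit_H[OF assms(3)] by auto
  obtain \<epsilon> \<eta> where \<eta>: "\<epsilon> > 0" "solution_on {-\<epsilon><..<\<epsilon>} Om V \<eta>" "\<eta> 0 = q"
    "!!\<delta>. \<delta> > 0 ==> \<exists>B. open B \<and> q \<in> B \<and> (\<forall>z\<in>B. H z = H q --> (\<exists>t\<in>{-\<delta><..<\<delta>}. t \<in> {-\<epsilon><..<\<epsilon>} \<and> \<eta> t = z))"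
    using flow_box[OF q(1,2)] by metis
  obtain B where B: "open B" "q \<in> B" "\<forall>z\<in>B. H z = H q --> (\<exists>t\<in>{-\<epsilon><..<\<epsilon>}. \<eta> t = z)"
    using \<eta>(4)[OF \<eta>(1)] by blast
  have "z \<in> orbit Om V p" if z: "z \<in> B" "H z = H p" for z
  proof -
    obtain t where "t \<in> {-\<epsilon><..<\<epsilon>}" "\<eta> t = z" using B(3) z q(3) by auto
    then have "z \<in> orbit Om V q"
      using solution_in_orbit[OF \<eta>(2), of 0 t] \<eta> by (auto simp: is_interval_1)
    then show ?thesis using orbit_eq[OF assms(3)] by simp
  qed
  then show thesis using that B by blast
qed

text \<open>Orbits are relatively open in a regular level set, hence they are its components.\<close>

lemma openin_orbit:
  assumes "X \<subseteq> {z \<in> Om. H z = h \<and> V z \<noteq> 0}" "p \<in> X"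
  shows "openin (top_of_set X) (X \<inter> orbit Om V p)"
proof (subst openin_subopen, clarify)
  fix q assume q: "q \<in> X" "q \<in> orbit Om V p"
  have p: "p \<in> Om" "V p \<noteq> 0" "H p = h" using assms by auto
  obtain B where B: "open B" "q \<in> B" "!!z. z \<in> B ==> H z = H p ==> z \<in> orbit Om V p"
    using orbit_nhd[OF p(1,2) q(2)] by metis
  have "X \<inter> B \<subseteq> X \<inter> orbit Om V p" using B(3) assms(1) p by auto
  then show "\<exists>T. openin (top_of_set X) T \<and> q \<in> T \<and> T \<subseteq> X \<inter> orbit Om V p"
    using B q by (intro exI[of _ "X \<inter> B"]) (auto simp: openin_open)
qed

lemma connected_subset_orbit:
  assumes X: "X \<subseteq> {z \<in> Om. H z = h \<and> V z \<noteq> 0}" "p \<in> X" "connected X"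
  shows "X \<subseteq> orbit Om V p"
proof -
  \<comment> \<open>The orbits of the remaining points cover the complement by relatively open sets,
    so the orbit of \<open>p\<close> is relatively closed in \<open>X\<close> too.\<close>
  have "X - orbit Om V p = \<Union>{X \<inter> orbit Om V z |z. z \<in> X - orbit Om V p}"
  proof
    show "X - orbit Om V p \<subseteq> \<Union>{X \<inter> orbit Om V z |z. z \<in> X - orbit Om V p}"
      using orbit_self X(1) by (auto 0 3 simp: subset_iff)
    show "\<Union>{X \<inter> orbit Om V z |z. z \<in> X - orbit Om V p} \<subseteq> X - orbit Om V p"
    proof clarify
      fix y z assume "y \<in> X" "y \<in> orbit Om V z" "z \<in> X" "z \<notin> orbit Om V p" "y \<in> orbit Om V p"
      then have "orbit Om V z = orbit Om V p" using orbit_eq by metis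
      then show False using orbit_self[of z] \<open>z \<notin> orbit Om V p\<close> \<open>z \<in> X\<close> X by auto
    qed
  qed
  moreover have "openin (top_of_set X) (\<Union>{X \<inter> orbit Om V z |z. z \<in> X - orbit Om V p})"
    by (rule openin_Union) (use openin_orbit[OF X(1)] in auto)
  ultimately have "openin (top_of_set X) (X - orbit Om V p)" by (simp only:)
  then have "closedin (top_of_set X) (X \<inter> orbit Om V p)"
    by (metis Diff_Diff_Int closedin_diff closedin_topspace topspace_euclidean_subtopology)
  moreover have "p \<in> X \<inter> orbit Om V p" using X(1,2) orbit_self[of p] by auto
  ultimately have "X \<inter> orbit Om V p = X"
    using openin_orbit[OF X(1,2)] X(3) unfolding connected_clopen by blast
  then show ?thesis by blast
qed

lemma orbit_eq_component:
  assumes "!!z. z \<in> D \<inter> Om ==> orbit Om V z \<subseteq> D" "p \<in> D \<inter> Om" "V p \<noteq> 0"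
  shows "orbit Om V p = connected_component_set {z \<in> D \<inter> Om. H z = H p \<and> V z \<noteq> 0} p"
proof
  let ?X = "{z \<in> D \<inter> Om. H z = H p \<and> V z \<noteq> 0}"
  show "orbit Om V p \<subseteq> connected_component_set ?X p"
  proof (rule connected_component_maximal)
    show "p \<in> orbit Om V p" using assms orbit_self by blast
    show "orbit Om V p \<subseteq> ?X"
      using assms(1)[OF assms(2)] orbit_subset[of p] orbit_H[of _ p] orbit_regular[of p] assms(2,3) by blast
  qed (rule orbit_connected)
  show "connected_component_set ?X p \<subseteq> orbit Om V p"
    by (rule connected_subset_orbit[of _ "H p"])
       (use connected_component_subset[of ?X p] assms in auto)
qed

text \<open>The closed disk is not open, so arguments with flow boxes take place in the open set
  \<open>Om\<close>; invariance of \<open>D\<close> shows that nothing changes when solutions are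
  required to stay in \<open>D\<close>.\<close>

lemma orbit_restrict:
  assumes "!!z. z \<in> D \<inter> Om ==> orbit Om V z \<subseteq> D" "p \<in> D \<inter> Om"
  shows "orbit (D \<inter> Om) V p = orbit Om V p"
proof
  show "orbit (D \<inter> Om) V p \<subseteq> orbit Om V p"
  proof
    fix q assume "q \<in> orbit (D \<inter> Om) V p"
    then obtain \<gamma> t T where \<gamma>: "open T" "is_interval T" "0 \<in> T" "t \<in> T" "solution_on T (D \<inter> Om) V \<gamma>" "\<gamma> 0 = p" "\<gamma> t = q"
      by (rule orbitE)
    then show "q \<in> orbit Om V p" using orbitI[OF \<gamma>(1-4) solution_on_mono[OF \<gamma>(5)] \<gamma>(6,7)] by blast
  qed
  show "orbit Om V p \<subseteq> orbit (D \<inter> Om) V p"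
  proof
    fix q assume "q \<in> orbit Om V p"
    then obtain \<gamma> t T where \<gamma>: "open T" "is_interval T" "0 \<in> T" "t \<in> T" "solution_on T Om V \<gamma>" "\<gamma> 0 = p" "\<gamma> t = q"
 by (rule orbitE)
    have "\<gamma> s \<in> D" if "s \<in> T" for s
      using solution_in_orbit[OF \<gamma>(5,1,2,3) that] \<gamma>(6) assms by blast
    then have "solution_on T (D \<inter> Om) V \<gamma>" using \<gamma>(5) by (auto simp: solution_on_def)
    then show "q \<in> orbit (D \<inter> Om) V p" using orbitI[OF \<gamma>(1-4) _ \<gamma>(6,7)] by blast
  qed
qed

text \<open>If the maximal interval had an end point, boundedness of \<open>V\<close> on
  \<open>K\<close> would make the solution Lipschitz and give it a limit in \<open>K\<close>. A
  local solution through that limit continues it past the end, contrary to maximality.\<close>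

lemma global_solution:
  assumes p: "p \<in> Om" and K: "compact K" "K \<subseteq> Om" "orbit Om V p \<subseteq> K"
  obtains \<Gamma> where "solution_on UNIV Om V \<Gamma>" "\<Gamma> 0 = p" "range \<Gamma> = orbit Om V p"
proof -
  obtain \<Gamma> T where T: "open T" "is_interval T" "solution_on T Om V \<Gamma>" "0 \<in> T \<or> T = {}" "T \<noteq> {} ==> \<Gamma> 0 = p"
    "!!\<gamma> S. open S ==> is_interval S ==> 0 \<in> S ==> solution_on S Om V \<gamma> ==> \<gamma> 0 = p ==> S \<subseteq> T \<and> (\<forall>t\<in>S. \<Gamma> t = \<gamma> t)"
    "orbit Om V p = \<Gamma> ` T"
    using maximal_solution[of p] by metis
  have "T \<noteq> {}" using orbit_self[OF p] T(7) by auto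
  then have T0: "0 \<in> T" "\<Gamma> 0 = p" using T(4) T(5) by blast+
  have "T = UNIV"
  proof (rule ccontr)
    assume "T \<noteq> UNIV"
    then have "\<not> closed T" using \<open>open T\<close> \<open>T \<noteq> {}\<close> clopen by blast
    then obtain b where b: "b \<in> closure T" "b \<notin> T" by (metis closure_subset_eq subsetI)
    have "bounded (V ` K)"
      using K continuous_on_subset[OF continuous_V] compact_continuous_image compact_imp_bounded by blast
    then obtain M where M: "M > 0" "!!z. z \<in> K ==> norm (V z) <= M" unfolding bounded_pos by blast
    have \<Gamma>K: "\<Gamma> t \<in> K" if "t \<in> T" for t using that T(7) K(3) by blast
    have "M-lipschitz_on T \<Gamma>"
    proof (rule lipschitz_onI)
      fix x y assume xy: "x \<in> T" "y \<in> T"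
      have "norm (\<Gamma> x - \<Gamma> y) <= M * norm (x - y)"
      proof (rule differentiable_bound[where f' = "\<lambda>t h. h *\<^sub>R V (\<Gamma> t)" and S = T])
        show "convex T" using T(2) is_interval_convex by blast
        show "(\<Gamma> has_derivative (\<lambda>h. h *\<^sub>R V (\<Gamma> t))) (at t within T)" if "t \<in> T" for t
          using T(3) that by (auto simp: solution_on_def has_vector_derivative_def intro: has_derivative_at_withinI)
        show "onorm (\<lambda>h. h *\<^sub>R V (\<Gamma> t)) <= M" if "t \<in> T" for t
          using M(2)[OF \<Gamma>K[OF that]] by (intro onorm_le) (simp add: mult.commute[of M] mult_left_mono)
      qed (use xy in auto)
      then show "dist (\<Gamma> x) (\<Gamma> y) <= M * dist x y" by (simp add: dist_norm)
    qed (use M in auto)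
    then have "uniformly_continuous_on T \<Gamma>" by (rule lipschitz_on_uniformly_continuous)
    then obtain G where G: "uniformly_continuous_on (closure T) G" "!!t. t \<in> T ==> \<Gamma> t = G t"
      by (rule uniformly_continuous_on_extension_on_closure) blast
    have cG: "continuous_on (closure T) G" using G(1) by (rule uniformly_continuous_imp_continuous)
    have "G ` closure T \<subseteq> K"
    proof (rule image_closure_subset[OF cG])
      show "closed K" using K compact_imp_closed by blast
      show "G ` T \<subseteq> K" using \<Gamma>K G(2) by auto
    qed
    define q where "q = G b"
    have "q \<in> Om" using \<open>G ` closure T \<subseteq> K\<close> K b by (auto simp: q_def)
    obtain \<epsilon> \<eta>0 where \<eta>0: "\<epsilon> > 0" "solution_on {-\<epsilon><..<\<epsilon>} Om V \<eta>0" "\<eta>0 0 = q"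
      using local_solution[OF \<open>q \<in> Om\<close>] by metis
    define \<eta> where "\<eta> t = \<eta>0 (t + - b)" for t
    define S where "S = {t. t + - b \<in> {-\<epsilon><..<\<epsilon>}}"
    have S: "open S" "is_interval S" "solution_on S Om V \<eta>" "b \<in> S" "\<eta> b = q"
      unfolding S_def \<eta>_def
      using open_interval_shift[of "{-\<epsilon><..<\<epsilon>}" "-b"] solution_on_shift[OF \<eta>0(2), of "-b"] \<eta>0
      by (auto simp: is_interval_1)
    obtain u L where u: "u > 0" "L \<ge> 0" "cball q u \<subseteq> Om" "L-lipschitz_on (cball q u) V"
      using lip_ball[OF \<open>q \<in> Om\<close>] by metis
    have "\<exists>d>0. \<forall>t\<in>closure T. dist t b < d --> dist (G t) (G b) < u"
      using cG b(1) u(1) unfolding continuous_on_iff by blast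
    then obtain d1 where d1: "d1 > 0" "!!t. t \<in> closure T ==> dist t b < d1 ==> dist (G t) q < u"
      unfolding q_def by blast
    have "\<exists>d>0. \<forall>t\<in>S. dist t b < d --> dist (\<eta> t) (\<eta> b) < u"
      using solution_on_continuous[OF S(3)] S(4) u(1) unfolding continuous_on_iff by blast
    then obtain d2 where d2: "d2 > 0" "!!t. t \<in> S ==> dist t b < d2 ==> dist (\<eta> t) q < u"
      unfolding S(5) by blast
    define d3 where "d3 = 1 / (2 * (L + 1))"
    have d3: "d3 > 0" "L * d3 <= 1/2" using u(2) by (auto simp: d3_def field_simps)
    define d where "d = Min {d1, d2, d3, \<epsilon>}"
    have d: "d > 0" "d <= d1" "d <= d2" "d <= d3" "d <= \<epsilon>" using d1 d2 d3 \<eta>0 by (auto simp: d_def)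
    obtain t1 where t1: "t1 \<in> T" "dist t1 b < d"
      using b(1) d(1) unfolding closure_approachable by blast
    have "t1 \<noteq> b" using t1 b by blast
    \<comment> \<open>The missing time \<open>b\<close> may be the left or the right end of
      \<open>T\<close>; ordering the pair handles both cases at once.\<close>
    define lo hi where "lo = min t1 b" and "hi = max t1 b"
    have lohi: "lo < hi" "hi - lo < d" "t1 \<in> {lo..hi}"
      using \<open>t1 \<noteq> b\<close> t1(2) by (auto simp: lo_def hi_def min_def max_def dist_real_def)
    have inT: "t \<in> T" if "t \<in> {lo..hi}" "t \<noteq> b" for t
    proof -
      obtain t2 where t2: "t2 \<in> T" "dist t2 b < dist t b"
        using b(1) \<open>t \<noteq> b\<close> unfolding closure_approachable by (metis zero_less_dist_iff)
      have "(t1 <= t \<and> t <= t2) \<or> (t2 <= t \<and> t <= t1)"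
        using that t2(2) by (auto simp: lo_def hi_def min_def max_def dist_real_def split: if_splits)
      then show ?thesis using T(2) t1 t2 unfolding is_interval_1 by blast
    qed
    have incl: "t \<in> closure T" if "t \<in> {lo..hi}" for t
      using inT[OF that] b(1) closure_subset by blast
    have nearb: "dist t b < d" if "t \<in> {lo..hi}" for t
      using that t1(2) by (auto simp: lo_def hi_def min_def max_def dist_real_def split: if_splits)
    have inS: "t \<in> S" if "t \<in> {lo..hi}" for t
      using nearb[OF that] d(5) by (auto simp: S_def dist_real_def)
    have "G t1 = \<eta> t1"
    proof (rule solution_eq_near[of lo hi G \<eta> q u L t1])
      show "continuous_on {lo..hi} G" using cG incl by (meson continuous_on_subset subsetI)
      show "continuous_on {lo..hi} \<eta>"
        using solution_on_continuous[OF S(3)] inS by (meson continuous_on_subset subsetI)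
      show "G ` {lo..hi} \<subseteq> cball q u"
      proof clarify
        fix t assume "t \<in> {lo..hi}"
        then have "dist (G t) q < u" using d1(2)[OF incl] nearb d by force
        then show "G t \<in> cball q u" by (simp add: dist_commute)
      qed
      show "\<eta> ` {lo..hi} \<subseteq> cball q u"
      proof clarify
        fix t assume "t \<in> {lo..hi}"
        then have "dist (\<eta> t) q < u" using d2(2)[OF inS] nearb d by force
        then show "\<eta> t \<in> cball q u" by (simp add: dist_commute)
      qed
      show "(G has_vector_derivative V (G t)) (at t)" if "lo < t" "t < hi" for t
      proof -
        have "t \<in> T" using inT[of t] that by (auto simp: lo_def hi_def min_def max_def split: if_splits)
        then show ?thesis
          using T(1,3) G(2) has_vector_derivative_transform_within_open[of \<Gamma> "V (\<Gamma> t)" t T G]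
          by (auto simp: solution_on_def)
      qed
      show "(\<eta> has_vector_derivative V (\<eta> t)) (at t)" if "lo < t" "t < hi" for t
        using S(3) inS[of t] that by (auto simp: solution_on_def)
      have "L * (hi - lo) <= L * d3" using lohi d u(2) by (intro mult_left_mono) auto
      then show "L * (hi - lo) <= 1/2" using d3 by simp
      have "G b = \<eta> b" using S(5) by (simp add: q_def)
      moreover have "lo = b \<or> hi = b" by (auto simp: lo_def hi_def)
      ultimately show "G lo = \<eta> lo \<or> G hi = \<eta> hi" by auto
    qed (use lohi u in auto)
    then have "\<Gamma> t1 = \<eta> t1" using G(2) t1 by simp
    then obtain \<zeta> where \<zeta>: "solution_on (T \<union> S) Om V \<zeta>" "!!t. t \<in> T ==> \<zeta> t = \<Gamma> t" "open (T \<union> S)" "is_interval (T \<union> S)"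
      using solution_join[OF T(1-3) S(1-3) t1(1) inS[OF lohi(3)]] by metis
    have "T \<union> S \<subseteq> T" using T(6)[OF \<zeta>(3,4) _ \<zeta>(1)] \<zeta>(2)[OF T0(1)] T0 by auto
    then show False using S(4) b(2) by blast
  qed
  then show thesis using that T(3,7) T0(2) by metis
qed

text \<open>Near the limit point \<open>q\<close> the level of the solution is covered by one local
  solution. Two late visits therefore lie on the same short arc, and the time between the visits,
  corrected by the time along the arc, is a period.\<close>

lemma recurrent_imp_periodic:
  assumes \<Gamma>: "solution_on UNIV Om V \<Gamma>" and q: "q \<in> Om" "V q \<noteq> 0"
    and X: "filterlim X at_top sequentially" "(\<lambda>n. \<Gamma> (X n)) \<longlonglongrightarrow> q"
  obtains \<tau> where "\<tau> > 0" "!!t. \<Gamma> (t + \<tau>) = \<Gamma> t"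
proof -
  have \<Gamma>Om: "\<Gamma> t \<in> Om" for t using \<Gamma> by (auto simp: solution_on_def)
  have "isCont H q" using dH[OF q(1)] has_derivative_continuous by blast
  then have "(\<lambda>n. H (\<Gamma> (X n))) \<longlonglongrightarrow> H q" using X(2) isCont_tendsto_compose by blast
  moreover have "H (\<Gamma> (X n)) = H (\<Gamma> 0)" for n
    using H_const_solution[OF _ \<Gamma>] by (auto simp: is_interval_univ)
  ultimately have Hq: "H q = H (\<Gamma> t)" for t
    using H_const_solution[OF _ \<Gamma>, of 0 t] by (auto simp: is_interval_univ LIMSEQ_const_iff)
  obtain \<epsilon> \<eta> where \<eta>: "\<epsilon> > 0" "solution_on {-\<epsilon><..<\<epsilon>} Om V \<eta>" "\<eta> 0 = q"
    "!!\<delta>. \<delta> > 0 ==> \<exists>B. open B \<and> q \<in> B \<and> (\<forall>z\<in>B. H z = H q --> (\<exists>t\<in>{-\<delta><..<\<delta>}. t \<in> {-\<epsilon><..<\<epsilon>} \<and> \<eta> t = z))"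
    using flow_box[OF q] by metis
  obtain B where B: "open B" "q \<in> B" "\<forall>z\<in>B. H z = H q --> (\<exists>t\<in>{-(1/2)<..<1/2}. t \<in> {-\<epsilon><..<\<epsilon>} \<and> \<eta> t = z)"
    using \<eta>(4)[of "1/2"] by auto
  have "\<forall>\<^sub>F n in sequentially. \<Gamma> (X n) \<in> B" using X(2) B(1,2) topological_tendstoD by blast
  then obtain N where N: "!!n. n \<ge> N ==> \<Gamma> (X n) \<in> B" unfolding eventually_sequentially by blast
  \<comment> \<open>The two positions on the arc differ by less than 1 in time, so a gap of 2 makes
    the resulting period positive.\<close>
  have "\<forall>\<^sub>F n in sequentially. X n \<ge> X N + 2" using X(1) filterlim_at_top by blast
  then obtain m where m: "m \<ge> N" "X m \<ge> X N + 2"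
    unfolding eventually_sequentially by (metis nle_le)
  have H: "H (\<Gamma> t) = H q" for t using Hq[of t] by simp
  obtain a where a: "a \<in> {-(1/2)<..<1/2}" "a \<in> {-\<epsilon><..<\<epsilon>}" "\<eta> a = \<Gamma> (X N)"
    using B(3)[rule_format, OF N[OF order.refl] H] by blast
  obtain b where b: "b \<in> {-(1/2)<..<1/2}" "b \<in> {-\<epsilon><..<\<epsilon>}" "\<eta> b = \<Gamma> (X m)"
    using B(3)[rule_format, OF N[OF m(1)] H] by blast
  have "solution_on {-\<epsilon><..<\<epsilon>} Om V (\<lambda>t. \<Gamma> (t + (X N - a)))"
    using solution_on_shift[OF \<Gamma>, of "X N - a"] solution_on_subset by fastforce
  then have "\<eta> b = \<Gamma> (b + (X N - a))"
    using solution_unique[OF _ _ \<eta>(2), of "\<lambda>t. \<Gamma> (t + (X N - a))" a b] a b by (auto simp: is_interval_1)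
  then have eq: "\<Gamma> (X m) = \<Gamma> (b + (X N - a))" using b(3) by simp
  define \<tau> where "\<tau> = X m - (b + (X N - a))"
  have "\<tau> > 0" using a(1) b(1) m(2) by (auto simp: \<tau>_def)
  moreover have "\<Gamma> (t + \<tau>) = \<Gamma> t" for t
  proof (rule solution_unique[of UNIV "\<lambda>t. \<Gamma> (t + \<tau>)" \<Gamma> "b + (X N - a)"])
    show "solution_on UNIV Om V (\<lambda>t. \<Gamma> (t + \<tau>))" using solution_on_shift[OF \<Gamma>, of \<tau>] by simp
    show "\<Gamma> (b + (X N - a) + \<tau>) = \<Gamma> (b + (X N - a))" using eq by (simp add: \<tau>_def)
  qed (use \<Gamma> in \<open>auto simp: is_interval_univ\<close>)
  ultimately show thesis using that by blast
qed

text \<open>The positions at integer times accumulate at a point of the orbit itself, which is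
  regular, so the solution is recurrent there.\<close>

lemma compact_orbit_periodic:
  assumes p: "p \<in> Om" "V p \<noteq> 0" and "compact (orbit Om V p)"
  shows "periodic_orbit Om V (orbit Om V p)"
proof -
  obtain \<Gamma> where \<Gamma>: "solution_on UNIV Om V \<Gamma>" "\<Gamma> 0 = p" "range \<Gamma> = orbit Om V p"
    using global_solution[OF p(1) assms(3) orbit_subset order.refl] by metis
  have "\<forall>n. \<Gamma> (real n) \<in> orbit Om V p" using \<Gamma>(3) by blast
  then obtain q r where q: "q \<in> orbit Om V p" "strict_mono (r::nat => nat)" "((\<lambda>n. \<Gamma> (real n)) \<circ> r) \<longlonglongrightarrow> q"
    using assms(3) unfolding compact_def by meson
  have "filterlim (\<lambda>n. real (r n)) at_top sequentially"
    using filterlim_compose[OF filterlim_real_sequentially filterlim_subseq[OF q(2)]] by simp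
  then obtain \<tau> where \<tau>: "\<tau> > 0" "!!t. \<Gamma> (t + \<tau>) = \<Gamma> t"
    using recurrent_imp_periodic[OF \<Gamma>(1), of q "\<lambda>n. real (r n)"] q orbit_subset orbit_regular[OF p q(1)]
    by (auto simp: o_def)
  have "\<exists>t. \<Gamma> t \<noteq> \<Gamma> 0"
  proof (rule ccontr)
    assume "\<not> ?thesis"
    then have "\<Gamma> = (\<lambda>t. \<Gamma> 0)" by auto
    then have "(\<Gamma> has_vector_derivative 0) (at 0)" by (metis has_vector_derivative_const)
    moreover have "(\<Gamma> has_vector_derivative V p) (at 0)" using \<Gamma>(1,2) by (auto simp: solution_on_def)
    ultimately show False using p(2) vector_derivative_unique_at by blast
  qed
  then show ?thesis unfolding periodic_orbit_def using \<Gamma> \<tau> by metis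
qed

end

section \<open>Homeomorphisms that carry orbits to orbits\<close>

lemma hamiltonian_field_subset:
  assumes "hamiltonian_field Om V H k" "open N" "N \<subseteq> Om"
  shows "hamiltonian_field N V H k"
proof -
  interpret hamiltonian_field Om V H k by fact
  show ?thesis
    by unfold_locales (use assms local_lipschitz_subset[OF lip order.refl assms(3)] dH k_nz in auto)
qed

lemma image_connected_component:
  assumes "homeomorphism X Y h k" "p \<in> X"
  shows "h ` connected_component_set X p = connected_component_set Y (h p)"
proof
  have sub: "f ` connected_component_set A a \<subseteq> connected_component_set B (f a)"
    if "continuous_on A f" "f ` A \<subseteq> B" "a \<in> A" for f :: "'c::topological_space => 'd::topological_space" and A B a
  proof (rule connected_component_maximal)
    show "f a \<in> f ` connected_component_set A a" using that(3) by simp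
    show "connected (f ` connected_component_set A a)"
      by (rule connected_continuous_image)
         (use that continuous_on_subset connected_component_subset connected_connected_component in blast)+
    show "f ` connected_component_set A a \<subseteq> B"
      using that(2) connected_component_subset[of A a] by blast
  qed
  show "h ` connected_component_set X p \<subseteq> connected_component_set Y (h p)"
    using assms by (intro sub) (auto simp: homeomorphism_def)
  have "k ` connected_component_set Y (h p) \<subseteq> connected_component_set X (k (h p))"
    using assms by (intro sub) (auto simp: homeomorphism_def)
  moreover have "k (h p) = p" using assms by (simp add: homeomorphism_def)
  ultimately have "h ` (k ` connected_component_set Y (h p)) \<subseteq> h ` connected_component_set X p" by auto
  moreover have "h ` (k ` connected_component_set Y (h p)) = connected_component_set Y (h p)"
  proof -
    have "h (k y) = y" if "y \<in> connected_component_set Y (h p)" for y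
      using that assms(1) connected_component_subset[of Y "h p"] by (auto simp: homeomorphism_def)
    then show ?thesis by (force simp: image_image)
  qed
  ultimately show "connected_component_set Y (h p) \<subseteq> h ` connected_component_set X p" by simp
qed

lemma carries_orbitsI:
  assumes 1: "hamiltonian_field Om V H k" "!!z. z \<in> D \<inter> Om ==> orbit Om V z \<subseteq> D"
    and 2: "hamiltonian_field Om' V' H' k'" "!!z. z \<in> D' \<inter> Om' ==> orbit Om' V' z \<subseteq> D'"
    and h: "homeomorphism (D \<inter> Om) (D' \<inter> Om') h g"
    and levels: "!!z w. z \<in> D \<inter> Om ==> w \<in> D \<inter> Om ==> H z = H w \<longleftrightarrow> H' (h z) = H' (h w)"
    and equil: "!!z. z \<in> D \<inter> Om ==> V z = 0 \<longleftrightarrow> V' (h z) = 0"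
  shows "carries_orbits (D \<inter> Om) V (D' \<inter> Om') V' h"
  unfolding carries_orbits_def
proof (intro ballI conjI)
  interpret P: hamiltonian_field Om V H k by fact
  interpret Q: hamiltonian_field Om' V' H' k' by fact
  fix p assume p: "p \<in> D \<inter> Om"
  show hp: "h p \<in> D' \<inter> Om'" using h p by (auto simp: homeomorphism_def)
  have r1: "orbit (D \<inter> Om) V p = orbit Om V p" by (rule P.orbit_restrict[OF 1(2) p])
  have r2: "orbit (D' \<inter> Om') V' (h p) = orbit Om' V' (h p)" by (rule Q.orbit_restrict[OF 2(2) hp])
  show "h ` orbit (D \<inter> Om) V p = orbit (D' \<inter> Om') V' (h p)"
  proof (cases "V p = 0")
    case True
    then show ?thesis
      unfolding r1 r2 using P.orbit_equilibrium[of p] Q.orbit_equilibrium[of "h p"] equil[OF p] p hp by auto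
  next
    case False
    let ?X = "{z \<in> D \<inter> Om. H z = H p \<and> V z \<noteq> 0}" and ?Y = "{z \<in> D' \<inter> Om'. H' z = H' (h p) \<and> V' z \<noteq> 0}"
    have "homeomorphism ?X ?Y h g"
    proof (rule homeomorphism_of_subsets[OF h])
      show "?X \<subseteq> D \<inter> Om" "?Y \<subseteq> D' \<inter> Om'" by auto
      show "h ` ?X = ?Y"
      proof
        show "h ` ?X \<subseteq> ?Y" using h levels[OF _ p] equil by (auto simp: homeomorphism_def)
        show "?Y \<subseteq> h ` ?X"
        proof
          fix w assume w: "w \<in> ?Y"
          then obtain z where z: "z \<in> D \<inter> Om" "w = h z" using h unfolding homeomorphism_def by blast
          then show "w \<in> h ` ?X" using w levels[OF z(1) p] equil[OF z(1)] by blast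
        qed
      qed
    qed
    moreover have "p \<in> ?X" using p False by simp
    ultimately have "h ` connected_component_set ?X p = connected_component_set ?Y (h p)"
      by (rule image_connected_component)
    then show ?thesis
      unfolding r1 r2 using P.orbit_eq_component[OF 1(2) p False] Q.orbit_eq_component[OF 2(2) hp] False equil[OF p]
      by simp
  qed
qed

section \<open>Compact orbits as Jordan curves\<close>

context hamiltonian_field
begin

text \<open>At first the component of the solution along its initial velocity strictly increases, so
  return times stay away from 0 and there is a least one. Over one such period the solution is a
  simple closed path.\<close>

lemma compact_orbit_circle:
  assumes p: "p \<in> Om" "V p \<noteq> 0" and "compact (orbit Om V p)"
  shows "orbit Om V p homeomorphic sphere (0::real^2) 1"
proof -
  obtain \<Gamma> where \<Gamma>: "solution_on UNIV Om V \<Gamma>" "\<Gamma> 0 = p" "range \<Gamma> = orbit Om V p"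
    using global_solution[OF p(1) assms(3) orbit_subset order.refl] by metis
  obtain \<gamma> \<tau> where \<gamma>: "solution_on UNIV Om V \<gamma>" "\<tau> > 0" "!!t. \<gamma> (t + \<tau>) = \<gamma> t" "orbit Om V p = range \<gamma>"
    using compact_orbit_periodic[OF assms] unfolding periodic_orbit_def by blast
  have cont: "continuous_on UNIV \<gamma>" by (rule solution_on_continuous[OF \<gamma>(1)])
  have V0: "V (\<gamma> 0) \<noteq> 0" using orbit_regular[OF p] \<gamma>(4) by blast
  have per: "\<gamma> (u + (t - s)) = \<gamma> u" if "\<gamma> s = \<gamma> t" for s t u
    using solution_unique[of UNIV "\<lambda>u. \<gamma> (u + (t - s))" \<gamma> s] solution_on_shift[OF \<gamma>(1), of "t - s"] \<gamma>(1) that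
    by (auto simp: is_interval_univ)
  have "((\<lambda>t. \<gamma> t \<bullet> V (\<gamma> 0)) has_real_derivative V (\<gamma> 0) \<bullet> V (\<gamma> 0)) (at 0)"
    using has_derivative_inner_left[of \<gamma> "\<lambda>h. h *\<^sub>R V (\<gamma> 0)" "at 0" "V (\<gamma> 0)"] \<gamma>(1)
    by (auto simp: solution_on_def has_vector_derivative_def has_field_derivative_def mult_commute_abs)
  from DERIV_pos_inc_right[OF this] obtain d where d: "d > 0" "!!t. 0 < t ==> t < d ==> \<gamma> 0 \<bullet> V (\<gamma> 0) < \<gamma> t \<bullet> V (\<gamma> 0)"
    using V0 by auto
  \<comment> \<open>\<open>S\<close> is the set of all positive return times: none is smaller than
    \<open>d\<close>, and starting at \<open>d\<close> makes the set closed, so that its infimum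
    belongs to it.\<close>
  define S where "S = {d..} \<inter> \<gamma> -` {\<gamma> 0}"
  have S: "t \<in> S \<longleftrightarrow> 0 < t \<and> \<gamma> t = \<gamma> 0" for t
    using d(1) d(2)[of t] unfolding S_def by (cases "t < d") auto
  have "closed S" unfolding S_def by (intro closed_Int closed_atLeast closed_vimage closed_singleton cont)
  moreover have "\<tau> \<in> S" using \<gamma>(2) \<gamma>(3)[of 0] by (simp add: S)
  moreover have bdd: "bdd_below S" by (rule bdd_belowI[of _ d]) (simp add: S_def)
  ultimately have T: "Inf S \<in> S" by (intro closed_contains_Inf) auto
  define T where "T = Inf S"
  have T0: "T > 0" "\<gamma> 0 = \<gamma> T" using T by (simp_all add: S T_def)
  have Tmin: "T <= t - s" if "\<gamma> s = \<gamma> t" "s < t" for s t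
    unfolding T_def by (rule cInf_lower[OF _ bdd]) (use per[OF that(1), of 0] that in \<open>simp add: S\<close>)
  interpret periodic_fun_simple \<gamma> T by unfold_locales (use per[OF T0(2)] in simp)
  have "range \<gamma> = \<gamma> ` {0..T}"
  proof
    show "range \<gamma> \<subseteq> \<gamma> ` {0..T}"
    proof clarify
      fix t
      have "t - of_int \<lfloor>t / T\<rfloor> * T \<in> {0..T}"
        using floor_divide_lower[OF T0(1), of t] floor_divide_upper[OF T0(1), of t] by (simp add: algebra_simps)
      then show "\<gamma> t \<in> \<gamma> ` {0..T}" using minus_of_int[of t "\<lfloor>t / T\<rfloor>"] by (metis image_eqI)
    qed
  qed auto
  also have "\<dots> = path_image (\<lambda>x. \<gamma> (T * x))"
  proof -
    have "(\<lambda>x. T * x) ` {0..1} = {0..T}" using T0(1) by (simp add: image_mult_atLeastAtMost)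
    then show ?thesis by (metis image_image path_image_def)
  qed
  finally have "orbit Om V p = path_image (\<lambda>x. \<gamma> (T * x))" by (simp add: \<gamma>(4))
  moreover have "simple_path (\<lambda>x. \<gamma> (T * x))"
    unfolding simple_path_def loop_free_def path_def
  proof (intro conjI ballI impI)
    show "continuous_on {0..1} (\<lambda>x. \<gamma> (T * x))"
      by (intro continuous_on_compose2[OF cont] continuous_intros) auto
    fix x y :: real assume h: "x \<in> {0..1}" "y \<in> {0..1}" "\<gamma> (T * x) = \<gamma> (T * y)"
    have "b - a \<ge> 1" if "\<gamma> (T * a) = \<gamma> (T * b)" "a < b" for a b
    proof -
      have "T * 1 <= T * (b - a)" using Tmin[OF that(1)] that(2) T0(1) by (simp add: algebra_simps)
      then show ?thesis using T0(1) by simp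
    qed
    from this[of x y] this[of y x] show "x = y \<or> x = 0 \<and> y = 1 \<or> x = 1 \<and> y = 0"
      using h by (cases x y rule: linorder_cases) auto
  qed
  moreover have "pathfinish (\<lambda>x. \<gamma> (T * x)) = pathstart (\<lambda>x. \<gamma> (T * x))"
    using T0(2) by (simp add: pathfinish_def pathstart_def)
  ultimately have "orbit Om V p homeomorphic sphere (0::complex) 1"
    using homeomorphic_simple_path_image_circle[of "\<lambda>x. \<gamma> (T * x)" 1 0] by simp
  moreover have "sphere (0::complex) 1 homeomorphic sphere (0::real^2) 1"
    by (rule homeomorphic_spheres_gen) auto
  ultimately show ?thesis by (rule homeomorphic_trans)
qed

lemma extremum_equilibrium:
  assumes "open W" "x \<in> W" "x \<in> Om" "(\<forall>y\<in>W. H y <= H x) \<or> (\<forall>y\<in>W. H x <= H y)"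
  shows "V x = 0"
proof -
  have "(\<lambda>v. k * (V x$1 * v$2 - V x$2 * v$1)) = (\<lambda>v::real^2. 0)"
    by (rule differential_zero_maxmin[OF assms(2,1) dH[OF assms(3)] assms(4)])
  from fun_cong[OF this, of "pt 0 1"] fun_cong[OF this, of "pt 1 0"] show ?thesis
    using k_nz by (simp add: vec2_eq_iff)
qed

lemma compact_orbit_inside:
  assumes p: "p \<in> Om" "V p \<noteq> 0" and O: "compact (orbit Om V p)"
  obtains z where "z \<in> inside (orbit Om V p)" "z \<notin> Om \<or> V z = 0"
proof (rule ccontr)
  let ?O = "orbit Om V p" and ?W = "inside (orbit Om V p)"
  assume "\<not> thesis"
  then have reg: "\<forall>z\<in>?W. z \<in> Om \<and> V z \<noteq> 0" using that by blast
  have "\<not> connected (- ?O)"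
    by (rule Jordan_Brouwer_separation[OF compact_orbit_circle[OF assms]]) simp
  moreover have "connected (outside ?O)"
    using connected_outside[OF compact_imp_bounded[OF O]] by simp
  ultimately have "?W \<noteq> {}" by (metis inside_Un_outside sup_bot_left)
  then obtain w where w: "w \<in> ?W" by blast
  have "open ?W" by (rule open_inside[OF compact_imp_closed[OF O]])
  have K: "closure ?W \<subseteq> ?O \<union> ?W" by (rule closure_inside_subset[OF compact_imp_closed[OF O]])
  have "compact (closure ?W)" using bounded_inside[OF compact_imp_bounded[OF O]] by simp
  moreover have "closure ?W \<subseteq> Om" using K orbit_subset reg by blast
  then have "continuous_on (closure ?W) H" using continuous_H continuous_on_subset by blast
  moreover have "closure ?W \<noteq> {}" using w by auto
  ultimately obtain x y where x: "x \<in> closure ?W" "!!z. z \<in> closure ?W ==> H z <= H x"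
    and y: "y \<in> closure ?W" "!!z. z \<in> closure ?W ==> H y <= H z"
    using continuous_attains_sup[of "closure ?W" H] continuous_attains_inf[of "closure ?W" H] by metis
  have sub: "z \<in> closure ?W" if "z \<in> ?W" for z using that closure_subset by blast
  have "x \<notin> ?W" "y \<notin> ?W"
    using extremum_equilibrium[OF \<open>open ?W\<close>] reg x(2) y(2) sub by blast+
  \<comment> \<open>Both extrema are taken on the orbit. Hence \<open>H\<close> is constant inside,
    and there every point is an extremum.\<close>
  then have "H x = H p" "H y = H p" using x(1) y(1) K orbit_H by blast+
  then have "\<forall>z\<in>?W. H z <= H w" using x(2) y(2) sub w by (metis order.trans)
  then show False using extremum_equilibrium[OF \<open>open ?W\<close> w] reg w by blast
qed

text \<open>\<open>B\<close> is a convex region with \<open>x\<close> as its only exceptional point.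
  The Jordan domain bounded by the orbit lies in \<open>B\<close> and must contain an exceptional
  point, hence \<open>x\<close>.\<close>

lemma encirclesI:
  assumes B: "compact B" "convex B" "B - {x} \<subseteq> Om" "!!z. z \<in> B - {x} ==> V z \<noteq> 0" "x \<notin> Om \<or> V x = 0"
    and p: "p \<in> B - {x}" "orbit Om V p \<subseteq> B" "\<forall>\<^sub>F z in at x. H z \<noteq> H p"
  shows "periodic_orbit_encircling Om V x (orbit Om V p)"
proof -
  let ?O = "orbit Om V p"
  have pO: "p \<in> Om" "V p \<noteq> 0" using p(1) B(3,4) by auto
  obtain d where d: "d > 0" "!!z. z \<noteq> x ==> dist z x < d ==> H z \<noteq> H p"
    using p(3) unfolding eventually_at by auto
  \<comment> \<open>Near \<open>x\<close> the level of \<open>p\<close> is not attained, so the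
    orbit stays in a closed part of its level that avoids \<open>x\<close>. The closure of the orbit
    is a connected subset of the regular level and therefore adds no point.\<close>
  let ?L = "{z \<in> B - ball x d. H z = H p}"
  have "x \<notin> ?O" using orbit_subset[of p] orbit_regular[OF pO] B(5) by blast
  have LOm: "B - ball x d \<subseteq> B - {x}" using d(1) by auto
  have OL: "?O \<subseteq> ?L"
  proof
    fix z assume z: "z \<in> ?O"
    then have "H z = H p" by (rule orbit_H)
    then show "z \<in> ?L" using z p(2) d(2)[of z] \<open>x \<notin> ?O\<close> by (auto simp: dist_commute)
  qed
  have "closed ?L"
    using continuous_closed_preimage_constant[of "B - ball x d" H "H p"] B(1,3) LOm continuous_H
    by (meson closed_Diff compact_imp_closed continuous_on_subset open_ball)
  then have "closure ?O \<subseteq> ?L" by (rule closure_minimal[OF OL])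
  then have "closure ?O \<subseteq> {z \<in> Om. H z = H p \<and> V z \<noteq> 0}" using LOm B(3,4) by blast
  then have "closure ?O \<subseteq> ?O"
    using orbit_self[OF pO(1)] closure_subset
    by (intro connected_subset_orbit connected_imp_connected_closure orbit_connected) blast+
  then have "closed ?O" using closure_subset_eq by blast
  then have cO: "compact ?O"
    using p(2) compact_imp_bounded[OF B(1)] bounded_subset compact_eq_bounded_closed by blast
  obtain z where z: "z \<in> inside ?O" "z \<notin> Om \<or> V z = 0" by (rule compact_orbit_inside[OF pO cO])
  \<comment> \<open>The complement of a bounded convex set is connected and unbounded, so it belongs
    to the outside of the orbit.\<close>
  have "connected (- B)"
    by (rule connected_complement_bounded_convex) (use B compact_imp_bounded in auto)
  moreover have "\<not> bounded (- B)"
    using cobounded_imp_unbounded[of "- B"] compact_imp_bounded[OF B(1)] by simp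
  moreover have "(B - ?O) \<union> - B = - ?O" using p(2) by blast
  ultimately have "inside ?O \<subseteq> B - ?O" by (rule inside_subset)
  then have "z = x" using z B(3,4) by blast
  then show ?thesis
    unfolding periodic_orbit_encircling_def using z(1) compact_orbit_periodic[OF pO cO] by simp
qed

text \<open>The points of the ball at which \<open>s * H\<close> exceeds its maximum on the sphere
  form a neighbourhood of \<open>x\<close>; their orbits cannot cross the sphere. The factor
  \<open>s\<close> lets the same argument serve for peaks and pits, finite or infinite.\<close>

lemma punctured_nhd_of_periodic_orbitsI:
  assumes r: "r > 0" "cball x r - {x} \<subseteq> Om" "!!z. z \<in> cball x r - {x} ==> V z \<noteq> 0" "x \<notin> Om \<or> V x = 0"
    and lim: "!!p. p \<in> cball x r - {x} ==> \<forall>\<^sub>F z in at x. s * H p < s * H z"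
  shows "punctured_nhd_of_periodic_orbits Om V x"
proof -
  have sc: "sphere x r \<subseteq> cball x r - {x}" using r(1) by auto
  have "continuous_on (sphere x r) (\<lambda>z. s * H z)"
    by (intro continuous_intros continuous_on_subset[OF continuous_H] order.trans[OF sc r(2)])
  moreover have "sphere x r \<noteq> {}" using r(1) by simp
  ultimately obtain p0 where p0: "p0 \<in> sphere x r" "!!z. z \<in> sphere x r ==> s * H z <= s * H p0"
    using continuous_attains_sup[OF compact_sphere, of x r "\<lambda>z. s * H z"] by blast
  obtain d where d: "d > 0" "!!z. z \<noteq> x ==> dist z x < d ==> s * H p0 < s * H z"
    using lim[of p0] p0(1) sc unfolding eventually_at by blast
  have d': "z = x \<or> s * H p0 < s * H z" if "z \<in> ball x d" for z
    using d(2)[of z] that by (auto simp: dist_commute)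
  define N where "N = {z \<in> ball x r. z = x \<or> s * H p0 < s * H z}"
  have b: "ball x r - {x} \<subseteq> Om" using r(2) ball_subset_cball by blast
  have "N = (ball x r \<inter> ball x d) \<union> ((ball x r - {x}) \<inter> (\<lambda>z. s * H z) -` {s * H p0<..})"
    using d' d(1) r(1) by (auto simp: N_def simp del: mem_ball)
  moreover have "open ((ball x r - {x}) \<inter> (\<lambda>z. s * H z) -` {s * H p0<..})"
    by (rule continuous_open_preimage)
       (use continuous_on_subset[OF continuous_H b] in \<open>auto intro!: continuous_intros open_Diff\<close>)
  ultimately have "open N" by auto
  moreover have "x \<in> N" "N - {x} \<subseteq> Om" using r(1) b by (auto simp: N_def)
  moreover have "orbit Om V p \<subseteq> N \<and> periodic_orbit_encircling Om V x (orbit Om V p)" if pN: "p \<in> N - {x}" for p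
  proof -
    have p: "p \<in> Om" "p \<in> ball x r" "s * H p0 < s * H p" using pN \<open>N - {x} \<subseteq> Om\<close> by (auto simp: N_def)
    have "orbit Om V p \<inter> sphere x r = {}" using p0(2) orbit_H p(3) by fastforce
    then have "orbit Om V p \<subseteq> ball x r"
      using connected_Int_frontier[OF orbit_connected, of p "ball x r"] orbit_self[OF p(1)] p(2) r(1)
      by (force simp: frontier_ball)
    moreover have "periodic_orbit_encircling Om V x (orbit Om V p)"
    proof (rule encirclesI[of "cball x r"])
      show "\<forall>\<^sub>F z in at x. H z \<noteq> H p" using lim[of p] pN p(2) by (auto elim: eventually_mono)
    qed (use calculation p pN r in auto)
    ultimately show ?thesis using orbit_H p(3) by (auto simp: N_def)
  qed
  ultimately show ?thesis unfolding punctured_nhd_of_periodic_orbits_def by blast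
qed

end

section \<open>The level function\<close>

text \<open>The squared modulus of \<open>1 + \<rho> \<zeta>\<close>, where \<open>q\<close> is the
  modulus of \<zeta> and \<open>u\<close> the cosine of its argument.\<close>

definition dn :: "real => real => real => real" where
  "dn \<rho> q u = 1 + \<rho>^2 * q^2 + 2 * \<rho> * q * u"

definition lev :: "real => real => real => real => real" where
  "lev \<rho> c q u = (1 - \<rho>^2) * (1 - q^2) / dn \<rho> q u + 2 * c * ln q"

text \<open>Up to the factor \<open>- 2 (1 - \<rho>^2)\<close>, this is \<open>q\<close> times the
  \<open>q\<close>-derivative of the rational term of \<open>lev\<close>. So \<open>lev\<close> is
  critical along a ray where \<open>(1 - \<rho>^2) * rad\<close> equals \<open>c\<close>.\<close>

definition rad :: "real => real => real => real" where
  "rad \<rho> q u = q * (q * (1 + \<rho>^2) + \<rho> * u * (1 + q^2)) / (dn \<rho> q u)^2"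

locale disc_params =
  fixes \<rho> c :: real
  assumes \<rho>: "0 < \<rho>" "\<rho> < 1" and c_nz: "c \<noteq> 0"
begin

definition "\<kappa> = 1 - \<rho>^2"

abbreviation "lv \<equiv> lev \<rho> c"
abbreviation "krad q u \<equiv> \<kappa> * rad \<rho> q u"

lemma \<kappa>_pos: "\<kappa> > 0"
  using \<rho> by (simp add: abs_square_less_1 \<kappa>_def)

lemma dn_pos:
  assumes "0 <= q" "\<rho> * q < 1" "-1 <= u"
  shows "dn \<rho> q u > 0"
proof -
  have "dn \<rho> q u = (1 - \<rho> * q)^2 + 2 * (\<rho> * q) * (1 + u)"
    by (simp add: dn_def power2_eq_square algebra_simps)
  moreover have "(1 - \<rho> * q)^2 > 0" using assms by simp
  moreover have "2 * (\<rho> * q) * (1 + u) \<ge> 0" using assms \<rho> by simp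
  ultimately show ?thesis by linarith
qed

lemma \<rho>q: "0 <= q ==> q <= 1 ==> \<rho> * q < 1"
  using \<rho> mult_left_le[of q \<rho>] by linarith

lemma dn_pos': "0 <= q ==> q <= 1 ==> -1 <= u ==> dn \<rho> q u > 0"
  by (simp add: dn_pos \<rho>q)

lemma dn_deriv: "((\<lambda>q. dn \<rho> q u) has_real_derivative 2 * \<rho>^2 * q + 2 * \<rho> * u) (at q)"
  unfolding dn_def by (rule derivative_eq_intros refl | simp)+

lemma lev_deriv:
  assumes "q > 0" "dn \<rho> q u \<noteq> 0"
  shows "((\<lambda>q. lv q u) has_real_derivative (2 * c - 2 * \<kappa> * rad \<rho> q u) / q) (at q)"
proof -
  define d d' N where "d = dn \<rho> q u" and "d' = 2 * \<rho>^2 * q + 2 * \<rho> * u"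
    and "N = q * (1 + \<rho>^2) + \<rho> * u * (1 + q^2)"
  have d: "d \<noteq> 0" using assms by (simp add: d_def)
  have "((\<lambda>q. \<kappa> * (1 - q^2)) has_real_derivative \<kappa> * (- 2 * q)) (at q)"
    by (rule derivative_eq_intros refl | simp)+
  from DERIV_divide[OF this dn_deriv assms(2)]
  have "((\<lambda>q. \<kappa> * (1 - q^2) / dn \<rho> q u) has_real_derivative (\<kappa> * (- 2 * q) * d - \<kappa> * (1 - q^2) * d') / (d * d)) (at q)"
    by (simp add: d_def d'_def)
  moreover have "((\<lambda>q. 2 * c * ln q) has_real_derivative 2 * c * (1 / q)) (at q)"
    using assms by (auto intro!: derivative_eq_intros)
  ultimately have "((\<lambda>q. lv q u) has_real_derivative (\<kappa> * (- 2 * q) * d - \<kappa> * (1 - q^2) * d') / (d * d) + 2 * c * (1 / q)) (at q)"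
    unfolding lev_def \<kappa>_def[symmetric] by (rule DERIV_add)
  moreover have "\<kappa> * (- 2 * q) * d - \<kappa> * (1 - q^2) * d' = - 2 * \<kappa> * N"
    by (simp add: d_def d'_def N_def dn_def algebra_simps power2_eq_square)
  moreover have "(- 2 * \<kappa> * N) / (d * d) + 2 * c * (1 / q) = (2 * c - 2 * \<kappa> * (q * N / d^2)) / q"
    using d assms(1) by (simp add: field_simps power2_eq_square)
  ultimately show ?thesis
    by (simp add: rad_def N_def d_def)
qed

lemma continuous_on_dn:
  "continuous_on S f ==> continuous_on S g ==> continuous_on S (\<lambda>x. dn \<rho> (f x) (g x))"
  unfolding dn_def by (intro continuous_intros)

lemma continuous_on_lev:
  assumes "continuous_on S f" "continuous_on S g" "!!x. x \<in> S ==> f x > 0" "!!x. x \<in> S ==> dn \<rho> (f x) (g x) \<noteq> 0"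
  shows "continuous_on S (\<lambda>x. lv (f x) (g x))"
  unfolding lev_def
  by (intro continuous_intros assms continuous_on_dn ballI) (use assms(3,4) in force)+

lemma continuous_on_rad:
  assumes "continuous_on S f" "continuous_on S g" "!!x. x \<in> S ==> dn \<rho> (f x) (g x) \<noteq> 0"
  shows "continuous_on S (\<lambda>x. rad \<rho> (f x) (g x))"
  unfolding rad_def
  by (intro continuous_intros assms continuous_on_dn ballI) (use assms(3) in force)+

lemma lev_one [simp]: "lv 1 u = 0"
  by (simp add: lev_def)

lemma lev_diff_u:
  assumes "dn \<rho> q u \<noteq> 0" "dn \<rho> q v \<noteq> 0"
  shows "lv q u - lv q v = \<kappa> * (1 - q^2) * (2 * \<rho> * q * (v - u)) / (dn \<rho> q u * dn \<rho> q v)"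
proof -
  have "\<kappa> * w / a + t - (\<kappa> * w / b + t) = \<kappa> * w * (b - a) / (a * b)" if "a \<noteq> 0" "b \<noteq> 0" for a b t w :: real
    using that by (simp add: field_simps)
  moreover have "dn \<rho> q v - dn \<rho> q u = 2 * \<rho> * q * (v - u)" by (simp add: dn_def algebra_simps)
  ultimately show ?thesis using assms unfolding lev_def \<kappa>_def[symmetric] by metis
qed

lemma lev_anti_u:
  assumes "0 < q" "q < 1" "-1 <= u" "u < v"
  shows "lv q v < lv q u"
proof -
  have d: "dn \<rho> q u > 0" "dn \<rho> q v > 0" using assms by (auto intro: dn_pos')
  have "q^2 < 1" using assms by (simp add: abs_square_less_1)
  then have "\<kappa> * (1 - q^2) * (2 * \<rho> * q * (v - u)) / (dn \<rho> q u * dn \<rho> q v) > 0"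
    using d \<kappa>_pos assms \<rho> by (intro divide_pos_pos mult_pos_pos) auto
  then show ?thesis using lev_diff_u[of q u v] d by linarith
qed

text \<open>Beyond the circle \<open>1 - q^2\<close> is negative, so the dependence on
  \<open>u\<close> is reversed. Neighbourhoods of equilibria on the circle reach into this
  range.\<close>

lemma lev_mono_u_outside:
  assumes "1 < q" "\<rho> * q < 1" "-1 <= u" "u < v"
  shows "lv q u < lv q v"
proof -
  have d: "dn \<rho> q u > 0" "dn \<rho> q v > 0" using assms by (auto intro: dn_pos)
  have "q^2 > 1" using assms by (simp add: power2_eq_square less_1_mult)
  then have "\<kappa> * (q^2 - 1) * (2 * \<rho> * q * (v - u)) / (dn \<rho> q u * dn \<rho> q v) > 0"
    using d \<kappa>_pos assms \<rho> by (intro divide_pos_pos mult_pos_pos) auto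
  moreover have "lv q u - lv q v = - (\<kappa> * (q^2 - 1) * (2 * \<rho> * q * (v - u)) / (dn \<rho> q u * dn \<rho> q v))"
    using lev_diff_u[of q u v] d by (simp add: field_simps)
  ultimately show ?thesis by linarith
qed

lemma rad_one: "-1 <= u ==> rad \<rho> 1 u = 1 / dn \<rho> 1 u"
proof -
  assume "-1 <= u"
  have "dn \<rho> 1 u > 0" using \<open>-1 <= u\<close> by (simp add: dn_pos')
  moreover have "1 * (1 * (1 + \<rho>^2) + \<rho> * u * (1 + 1^2)) = dn \<rho> 1 u" by (simp add: dn_def)
  ultimately show ?thesis by (simp add: rad_def power2_eq_square)
qed

definition drad_num :: "real => real => real" where
  "drad_num q u = 2 * (1 + \<rho>^2) * q * (1 - \<rho>^2 * q^2) + \<rho> * u * (1 + 3 * q^2 - 3 * \<rho>^2 * q^2 - \<rho>^2 * q^4)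
     - 2 * \<rho>^2 * u^2 * q * (1 - q^2)"

lemma rad_deriv:
  assumes "dn \<rho> q u \<noteq> 0"
  shows "((\<lambda>q. rad \<rho> q u) has_real_derivative drad_num q u / dn \<rho> q u ^ 3) (at q)"
proof -
  define d d' n n' where "d = dn \<rho> q u" and "d' = 2 * \<rho>^2 * q + 2 * \<rho> * u"
    and "n = q * (q * (1 + \<rho>^2) + \<rho> * u * (1 + q^2))" and "n' = 2 * (1 + \<rho>^2) * q + \<rho> * u * (1 + 3 * q^2)"
  have d: "d \<noteq> 0" using assms by (simp add: d_def)
  have "((\<lambda>q. q * (q * (1 + \<rho>^2) + \<rho> * u * (1 + q^2))) has_real_derivative n') (at q)"
    by (rule derivative_eq_intros refl | simp add: n'_def algebra_simps power2_eq_square)+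
  moreover have "((\<lambda>q. (dn \<rho> q u)^2) has_real_derivative 2 * d * d') (at q)"
    by (rule DERIV_cong[OF DERIV_power[OF dn_deriv]]) (simp add: d_def d'_def algebra_simps)
  ultimately have "((\<lambda>q. rad \<rho> q u) has_real_derivative (n' * d^2 - n * (2 * d * d')) / (d^2 * d^2)) (at q)"
    unfolding rad_def using DERIV_divide[of _ n' q UNIV "\<lambda>q. (dn \<rho> q u)^2" "2 * d * d'"] d
    by (simp add: d_def n_def)
  moreover have "(n' * d^2 - n * (2 * d * d')) / (d^2 * d^2) = (n' * d - 2 * n * d') / d ^ 3"
    using d by (simp add: field_simps power2_eq_square power3_eq_cube)
  moreover have "n' * d - 2 * n * d' = drad_num q u"
    unfolding n_def n'_def d'_def d_def dn_def drad_num_def by algebra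
  ultimately show ?thesis by (simp add: d_def)
qed

text \<open>Unimodality of the levels along rays: once \<open>rad\<close> is positive it increases up to the circle.\<close>

lemma drad_num_pos:
  assumes q: "0 < q" "q <= 1" and u: "-1 <= u" "u <= 1"
    and N: "q * (1 + \<rho>^2) + \<rho> * u * (1 + q^2) > 0"
  shows "drad_num q u > 0"
proof -
  have r1: "0 < \<rho>^2" "\<rho>^2 < 1" using \<rho> by (auto simp: abs_square_less_1)
  have q1: "0 < q^2" "q^2 <= 1" using q by (auto simp: power_le_one)
  have rq: "\<rho>^2 * q^2 < 1" using r1 q1 mult_left_le[of "q^2" "\<rho>^2"] by linarith
  show ?thesis
  proof (cases "u \<ge> 0")
    case True
    have u2: "u^2 <= 1" using u by (simp add: abs_square_le_1)
    have "1 + 3 * q^2 - 3 * \<rho>^2 * q^2 - \<rho>^2 * q^4 = (1 - (\<rho>^2 * q^2) * q^2) + 3 * q^2 * (1 - \<rho>^2)"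
      by (simp add: algebra_simps power2_eq_square power4_eq_xxxx)
    moreover have "(\<rho>^2 * q^2) * q^2 <= 1 * 1" using rq q1 r1 by (intro mult_mono) auto
    moreover have "3 * q^2 * (1 - \<rho>^2) \<ge> 0" using q1 r1 by simp
    ultimately have "\<rho> * u * (1 + 3 * q^2 - 3 * \<rho>^2 * q^2 - \<rho>^2 * q^4) \<ge> 0"
      using \<rho> True by (intro mult_nonneg_nonneg) linarith+
    moreover have "2 * \<rho>^2 * u^2 * q * (1 - q^2) <= 2 * \<rho>^2 * 1 * q * (1 - q^2)"
      using u2 q q1 r1 by (intro mult_right_mono mult_left_mono) auto
    moreover have "2 * (1 + \<rho>^2) * q * (1 - \<rho>^2 * q^2) - 2 * \<rho>^2 * 1 * q * (1 - q^2) = 2 * q * (1 - \<rho>^2 * (\<rho>^2 * q^2))"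
      by (simp add: algebra_simps power2_eq_square)
    moreover have "\<rho>^2 * (\<rho>^2 * q^2) <= \<rho>^2 * 1" using rq r1 by (intro mult_left_mono) auto
    then have "\<rho>^2 * (\<rho>^2 * q^2) < 1" using r1 by linarith
    then have "2 * q * (1 - \<rho>^2 * (\<rho>^2 * q^2)) > 0" using q by simp
    ultimately show ?thesis unfolding drad_num_def by linarith
  next
    case False
    \<comment> \<open>The hypothesis bounds \<open>(1 + \<rho>^2) q\<close> from below by
      \<open>n (1 + q^2)\<close>. After this substitution the rest factors into nonnegative terms,
      the last of which is at least \<open>(1 - \<rho> q)^2\<close> because
      \<open>n <= \<rho>\<close>.\<close>
    define n where "n = - (\<rho> * u)"
    have n: "0 < n" "n <= \<rho>" using False \<rho> u mult_left_le[of "- u" \<rho>] unfolding n_def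
      by (auto simp: mult_pos_neg)
    have N': "(1 + \<rho>^2) * q > n * (1 + q^2)" using N by (simp add: n_def algebra_simps)
    have "2 * (1 + \<rho>^2) * q * (1 - \<rho>^2 * q^2) > 2 * (n * (1 + q^2)) * (1 - \<rho>^2 * q^2)"
    proof (rule mult_strict_right_mono)
      show "2 * (n * (1 + q^2)) < 2 * (1 + \<rho>^2) * q" using N' by linarith
    qed (use rq in simp)
    moreover have "2 * (n * (1 + q^2)) * (1 - \<rho>^2 * q^2) - n * (1 + 3 * q^2 - 3 * \<rho>^2 * q^2 - \<rho>^2 * q^4) - 2 * n^2 * q * (1 - q^2)
       = n * (1 - q^2) * (1 + \<rho>^2 * q^2 - 2 * n * q)"
      by (simp add: algebra_simps power2_eq_square power4_eq_xxxx)
    moreover have "1 + \<rho>^2 * q^2 - 2 * n * q \<ge> 0"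
    proof -
      have "0 <= (1 - \<rho> * q)^2" by simp
      also have "\<dots> = 1 + \<rho>^2 * q^2 - 2 * \<rho> * q" by (simp add: algebra_simps power2_eq_square)
      also have "\<dots> <= 1 + \<rho>^2 * q^2 - 2 * n * q" using n q by simp
      finally show ?thesis .
    qed
    then have "n * (1 - q^2) * (1 + \<rho>^2 * q^2 - 2 * n * q) \<ge> 0" using n q1 by simp
    moreover have "\<rho> * u = - n" "\<rho>^2 * u^2 = n^2" by (auto simp: n_def power_mult_distrib)
    then have "drad_num q u = 2 * (1 + \<rho>^2) * q * (1 - \<rho>^2 * q^2) - n * (1 + 3 * q^2 - 3 * \<rho>^2 * q^2 - \<rho>^2 * q^4) - 2 * n^2 * q * (1 - q^2)"
      unfolding drad_num_def by (simp add: mult.assoc[symmetric])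
    ultimately show ?thesis by linarith
  qed
qed

text \<open>Positivity of the bracket in \<open>rad\<close> is inherited by all larger radii up to
  the circle, so the derivative stays positive on the whole segment.\<close>

lemma rad_increasing:
  assumes "0 < q" "q < q'" "q' <= 1" "-1 <= u" "u <= 1" "rad \<rho> q u > 0"
  shows "rad \<rho> q u < rad \<rho> q' u"
proof -
  have N: "q * (1 + \<rho>^2) + \<rho> * u * (1 + q^2) > 0"
    using assms dn_pos'[of q u] by (simp add: rad_def zero_less_divide_iff zero_less_mult_iff)
  have N': "t * (1 + \<rho>^2) + \<rho> * u * (1 + t^2) > 0" if t: "q <= t" "t <= q'" for t
  proof (cases "u \<ge> 0")
    case True
    have "t * (1 + \<rho>^2) > 0" using assms t by (simp add: add_pos_nonneg)
    moreover have "\<rho> * u * (1 + t^2) \<ge> 0" using True \<rho> by simp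
    ultimately show ?thesis by linarith
  next
    case False
    \<comment> \<open>The identity compares the brackets at \<open>t\<close> and at
      \<open>q\<close>; the extra term has the sign of \<open>(t - q) (1 - q t)\<close>, which is
      nonnegative up to the circle.\<close>
    have "q * (t * (1 + \<rho>^2) + \<rho> * u * (1 + t^2)) = t * (q * (1 + \<rho>^2) + \<rho> * u * (1 + q^2)) + (- (\<rho> * u)) * ((t - q) * (1 - q * t))"
      by (simp add: algebra_simps power2_eq_square)
    moreover have "t * (q * (1 + \<rho>^2) + \<rho> * u * (1 + q^2)) > 0" using N assms t by simp
    moreover have "q * t <= 1" using assms t by (intro mult_le_one) auto
    then have "(- (\<rho> * u)) * ((t - q) * (1 - q * t)) \<ge> 0"
      using False \<rho> t by (intro mult_nonneg_nonneg) (auto simp: mult_le_0_iff)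
    ultimately have "q * (t * (1 + \<rho>^2) + \<rho> * u * (1 + t^2)) > 0" by linarith
    then show ?thesis using assms(1) by (simp add: zero_less_mult_iff)
  qed
  show ?thesis
  proof (rule DERIV_pos_imp_increasing[OF assms(2)])
    fix t assume t: "q <= t" "t <= q'"
    have d: "dn \<rho> t u > 0" using assms t by (intro dn_pos') auto
    have "drad_num t u > 0" using assms t N' by (intro drad_num_pos) auto
    then show "\<exists>y. ((\<lambda>q. rad \<rho> q u) has_real_derivative y) (at t) \<and> 0 < y"
      using rad_deriv[of t u] d by (intro exI[of _ "drad_num t u / dn \<rho> t u ^ 3"]) auto
  qed
qed

lemma rad_axis_aux: "e \<noteq> 0 ==> x * (y * e) / (e^2)^2 = x * y / e ^ 3" for e x y :: real
  by (simp add: field_simps power2_eq_square power3_eq_cube)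

lemma rad_axis:
  shows "\<rho> * q < 1 ==> rad \<rho> q (-1) = q * (q - \<rho>) / (1 - \<rho> * q) ^ 3"
    and "0 <= q ==> rad \<rho> q 1 = q * (q + \<rho>) / (1 + \<rho> * q) ^ 3"
proof -
  assume "\<rho> * q < 1"
  have "dn \<rho> q (-1) = (1 - \<rho> * q)^2" "q * (1 + \<rho>^2) + \<rho> * (-1) * (1 + q^2) = (q - \<rho>) * (1 - \<rho> * q)"
    by (simp_all add: dn_def algebra_simps power2_eq_square)
  then show "rad \<rho> q (-1) = q * (q - \<rho>) / (1 - \<rho> * q) ^ 3"
    using \<open>\<rho> * q < 1\<close> rad_axis_aux[of "1 - \<rho> * q"] by (simp add: rad_def)
next
  assume "0 <= q"
  then have "1 + \<rho> * q > 0" using \<rho> by (simp add: add_pos_nonneg)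
  have "dn \<rho> q 1 = (1 + \<rho> * q)^2" "q * (1 + \<rho>^2) + \<rho> * 1 * (1 + q^2) = (q + \<rho>) * (1 + \<rho> * q)"
    by (simp_all add: dn_def algebra_simps power2_eq_square)
  then show "rad \<rho> q 1 = q * (q + \<rho>) / (1 + \<rho> * q) ^ 3"
    using \<open>1 + \<rho> * q > 0\<close> rad_axis_aux[of "1 + \<rho> * q"] by (simp add: rad_def)
qed

lemma lev_increasing:
  assumes "0 < a" "a < b" "-1 <= u" "\<rho> * b < 1"
    and "!!q. a < q ==> q < b ==> krad q u < c"
  shows "lv a u < lv b u"
proof (rule DERIV_pos_imp_increasing_open[OF assms(2)])
  have d: "dn \<rho> q u \<noteq> 0" if "a <= q" "q <= b" for q
  proof -
    have "\<rho> * q <= \<rho> * b" using \<rho> that by simp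
    then show ?thesis using dn_pos[of q u] assms that by auto
  qed
  show "continuous_on {a..b} (\<lambda>q. lv q u)"
    by (intro continuous_on_lev continuous_intros) (use assms d in auto)
  fix q assume q: "a < q" "q < b"
  show "\<exists>y. ((\<lambda>q. lv q u) has_real_derivative y) (at q) \<and> 0 < y"
    using lev_deriv[of q u] d[of q] q assms(1) assms(5)[OF q]
    by (intro exI[of _ "(2 * c - 2 * \<kappa> * rad \<rho> q u) / q"]) auto
qed

lemma lev_decreasing:
  assumes "0 < a" "a < b" "-1 <= u" "\<rho> * b < 1"
    and "!!q. a < q ==> q < b ==> krad q u > c"
  shows "lv a u > lv b u"
proof (rule DERIV_neg_imp_decreasing_open[OF assms(2)])
  have d: "dn \<rho> q u \<noteq> 0" if "a <= q" "q <= b" for q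
  proof -
    have "\<rho> * q <= \<rho> * b" using \<rho> that by simp
    then show ?thesis using dn_pos[of q u] assms that by auto
  qed
  show "continuous_on {a..b} (\<lambda>q. lv q u)"
    by (intro continuous_on_lev continuous_intros) (use assms d in auto)
  fix q assume q: "a < q" "q < b"
  show "\<exists>y. ((\<lambda>q. lv q u) has_real_derivative y) (at q) \<and> y < 0"
    using lev_deriv[of q u] d[of q] q assms(1) assms(5)[OF q]
    by (intro exI[of _ "(2 * c - 2 * \<kappa> * rad \<rho> q u) / q"]) (auto simp: divide_less_0_iff)
qed

end

section \<open>The vortex system\<close>

lemma local_lipschitz_C1:
  fixes V :: "real^2 => real^2"
  assumes "open Om" and D: "!!p. p \<in> Om ==> (V has_derivative D p) (at p)" "!!v. continuous_on Om (\<lambda>p. D p v)"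
  shows "local_lipschitz (UNIV::real set) Om (\<lambda>_. V)"
proof (rule c1_implies_local_lipschitz[where f' = "\<lambda>(t, p). Blinfun (D p)"])
  have b: "bounded_linear (D p)" if "p \<in> Om" for p using D(1)[OF that] has_derivative_bounded_linear by blast
  show "(V has_derivative blinfun_apply (case (t, x) of (t, p) => Blinfun (D p))) (at x)" if "x \<in> Om" for t :: real and x
    using D(1)[OF that] by (simp add: bounded_linear_Blinfun_apply b that)
  show "continuous_on (UNIV \<times> Om) (\<lambda>(t::real, p). Blinfun (D p))"
    unfolding case_prod_beta
  proof (rule continuous_on_blinfun_componentwise)
    fix i
    have "continuous_on (UNIV \<times> Om) (\<lambda>x::real \<times> (real^2). D (snd x) i)"
      by (rule continuous_on_compose2[OF D(2) continuous_on_snd[OF continuous_on_id]]) auto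
    then show "continuous_on (UNIV \<times> Om) (\<lambda>x::real \<times> (real^2). blinfun_apply (Blinfun (D (snd x))) i)"
      by (rule continuous_on_eq) (auto simp: bounded_linear_Blinfun_apply b)
  qed
qed (use assms(1) in auto)

definition zc :: "real => real^2 => complex" where
  "zc R p = Complex (p$1 / R) (p$2 / R)"

definition mob :: "real => complex => complex" where
  "mob a z = (z - of_real a) / (1 - of_real a * z)"

lemma mob_denom:
  assumes "1 - of_real a * z \<noteq> 0"
  shows "1 + of_real a * mob a z = of_real (1 - a^2) / (1 - of_real a * z)"
proof -
  have "1 + a' * ((z - a') / w) = (1 - a' * a') / w" if "w = 1 - a' * z" "w \<noteq> 0" for w a' :: complex
    using that by (simp add: field_simps)
  from this[OF refl assms] show ?thesis by (simp add: mob_def power2_eq_square)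
qed

lemma has_derivative_vec_nth [derivative_intros]: "((\<lambda>p::real^2. p$i) has_derivative (\<lambda>v. v$i)) F"
  by (rule bounded_linear_imp_has_derivative[OF bounded_linear_vec_nth])

lemma mob_inverse:
  assumes "1 - of_real a * z \<noteq> 0" "a^2 \<noteq> 1"
  shows "mob (-a) (mob a z) = z"
proof -
  have k: "of_real (1 - a^2) \<noteq> (0::complex)" using assms(2) by (metis of_real_eq_0_iff right_minus_eq)
  have "mob a z + of_real a = z * of_real (1 - a^2) / (1 - of_real a * z)"
  proof -
    have "(z - a') / w + a' = z * (1 - a' * a') / w" if "w = 1 - a' * z" "w \<noteq> 0" for w a' :: complex
    proof -
      have "(z - a') / w + a' = (z - a' + a' * w) / w" using that(2) by (simp add: field_simps)
      then show ?thesis unfolding that(1) by (simp add: algebra_simps)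
    qed
    from this[OF refl assms(1)] show ?thesis by (simp add: mob_def power2_eq_square)
  qed
  then have "mob (-a) (mob a z) = (z * of_real (1 - a^2) / (1 - of_real a * z)) / (of_real (1 - a^2) / (1 - of_real a * z))"
    using mob_denom[OF assms(1)] by (simp add: mob_def[of "-a"])
  then show ?thesis using assms(1) k by simp
qed

text \<open>Here \<open>c\<close> is the dimensionless ratio \<open>1 / \<phi>\<close>; the
  coefficient that enters \<open>vfield\<close> is \<open>R^2 * c\<close>, and the vortex sits at
  \<open>\<rho> * R\<close>.\<close>

locale vortex_system = disc_params +
  fixes R \<theta> :: real
  assumes R_pos: "R > 0" and \<theta>_nz: "\<theta> \<noteq> 0"
begin

definition "Om = vdomain R (\<rho> * R)"
definition "V = vfield R (\<rho> * R) (R^2 * c) \<theta>"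
abbreviation "pdisk \<equiv> disk R \<inter> Om"
abbreviation "equilibria \<equiv> {p \<in> disk R. equilibrium Om V p}"
text \<open>\<open>En\<close> is a multiple of the paper's \<open>\<Psi>\<close> plus a constant, chosen so that it vanishes on the circle.\<close>

definition "AA p = (p$1 - \<rho> * R)^2 + (p$2)^2" for p :: "real^2"
definition "BB p = (p$1 - R / \<rho>)^2 + (p$2)^2" for p :: "real^2"
definition "En p = 1 - ((p$1)^2 + (p$2)^2) / R^2 + c * (ln (AA p) - ln (\<rho>^2 * BB p))" for p :: "real^2"

lemma R2: "R^2 / (\<rho> * R) = R / \<rho>"
  using R_pos \<rho> by (simp add: power2_eq_square)

lemma Om_iff: "p \<in> Om \<longleftrightarrow> p \<noteq> pt (\<rho> * R) 0 \<and> p \<noteq> pt (R / \<rho>) 0"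
  by (simp add: Om_def vdomain_def R2)

lemma open_Om': "open Om"
  unfolding Om_def vdomain_def by (intro open_Compl finite_imp_closed) auto

lemma AB_pos: assumes "p \<in> Om" shows "AA p > 0" "BB p > 0"
  using assms unfolding Om_iff AA_def BB_def vec2_eq_iff
  by (auto simp: sum_power2_gt_zero_iff simp del: power2_eq_square)

lemma V_eq: "V p = pt (\<theta> * (- (p$2) + R^2 * c * (p$2) * (1 / AA p - 1 / BB p)))
    (\<theta> * (p$1 - R^2 * c * ((p$1 - \<rho> * R) / AA p - (p$1 - R / \<rho>) / BB p)))"
proof -
  have "- \<theta> * y + C * \<theta> * y * D = \<theta> * (- y + C * y * D)" "\<theta> * x - C * \<theta> * D = \<theta> * (x - C * D)" for x y C D
    by (simp_all add: algebra_simps)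
  then show ?thesis
    unfolding V_def vfield_def Let_def R2 AA_def[symmetric] BB_def[symmetric] by (simp only:)
qed

lemma AB_deriv:
  "(AA has_derivative (\<lambda>v. 2 * (p$1 - \<rho> * R) * v$1 + 2 * p$2 * v$2)) (at p)"
  "(BB has_derivative (\<lambda>v. 2 * (p$1 - R / \<rho>) * v$1 + 2 * p$2 * v$2)) (at p)"
  unfolding AA_def[abs_def] BB_def[abs_def]
  by (rule has_derivative_eq_rhs[OF has_derivative_add[OF
        has_derivative_power[OF has_derivative_diff[OF has_derivative_vec_nth has_derivative_const]]
        has_derivative_power[OF has_derivative_vec_nth]]], simp add: fun_eq_iff)+

lemma dEn:
  assumes "p \<in> Om"
  shows "(En has_derivative (\<lambda>v. (2 / (\<theta> * R^2)) * (V p$1 * v$2 - V p$2 * v$1))) (at p)"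
proof -
  note pos = AB_pos[OF assms]
  have B': "\<rho>^2 * BB p > 0" using pos \<rho> by simp
  define x y a b A B where d: "x = p$1" "y = p$2" "a = p$1 - \<rho> * R" "b = p$1 - R / \<rho>" "A = AA p" "B = BB p"
  have lnA: "((\<lambda>p. ln (AA p)) has_derivative (\<lambda>v. (2 * a * v$1 + 2 * y * v$2) * inverse A)) (at p)"
    using has_derivative_ln[OF pos(1) AB_deriv(1)] by (simp add: d)
  have lnB: "((\<lambda>p. ln (\<rho>^2 * BB p)) has_derivative (\<lambda>v. (\<rho>^2 * (2 * b * v$1 + 2 * y * v$2)) * inverse (\<rho>^2 * B))) (at p)"
    using has_derivative_ln[OF B' has_derivative_mult_right[OF AB_deriv(2)]] by (simp add: d)
  have sq: "((\<lambda>p. 1 - ((p$1)^2 + (p$2)^2) / R^2) has_derivative (\<lambda>v. - ((2 * x * v$1 + 2 * y * v$2) / R^2))) (at p)"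
    by (rule has_derivative_eq_rhs[OF has_derivative_diff[OF has_derivative_const has_derivative_divide[OF
          has_derivative_add[OF has_derivative_power[OF has_derivative_vec_nth] has_derivative_power[OF has_derivative_vec_nth]]
          has_derivative_const]]])
       (use R_pos in \<open>simp_all add: fun_eq_iff d divide_inverse\<close>)
  have "(En has_derivative (\<lambda>v. - ((2 * x * v$1 + 2 * y * v$2) / R^2)
      + c * ((2 * a * v$1 + 2 * y * v$2) * inverse A - (\<rho>^2 * (2 * b * v$1 + 2 * y * v$2)) * inverse (\<rho>^2 * B)))) (at p)"
    unfolding En_def[abs_def]
    by (intro has_derivative_add has_derivative_mult_right has_derivative_diff sq lnA lnB)
  moreover have "- ((2 * x * v1 + 2 * y * v2) / R^2) + c * ((2 * a * v1 + 2 * y * v2) * inverse A - (\<rho>^2 * (2 * b * v1 + 2 * y * v2)) * inverse (\<rho>^2 * B))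
      = (2 / (\<theta> * R^2)) * ((\<theta> * (- y + R^2 * c * y * (1 / A - 1 / B))) * v2 - (\<theta> * (x - R^2 * c * (a / A - b / B))) * v1)" for v1 v2
  proof -
    define w W1 W2 where w: "w = 2 * x * v1 + 2 * y * v2" "W1 = 2 * a * v1 + 2 * y * v2" "W2 = 2 * b * v1 + 2 * y * v2"
    define i j C where i: "i = inverse A" "j = inverse B" "C = R^2 * c"
    have 1: "(\<rho>^2 * W2) * inverse (\<rho>^2 * B) = W2 * j"
      using \<rho> by (simp add: i)
    have 2: "(2 / (\<theta> * R^2)) * (\<theta> * X * v2 - \<theta> * Y * v1) = (2 / R^2) * (X * v2 - Y * v1)" for X Y
    proof -
      have "\<theta> * X * v2 - \<theta> * Y * v1 = \<theta> * (X * v2 - Y * v1)" by (simp add: algebra_simps)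
      then show ?thesis using \<theta>_nz by simp
    qed
    have "- (w / r) + c * ww = (2 / r) * (- w / 2 + r * c * (ww / 2))" if "r \<noteq> 0" for ww r :: real
      using that by (simp add: field_simps)
    from this[of "R^2" "W1 * i - W2 * j"]
    have 3: "- (w / R^2) + c * (W1 * i - W2 * j) = (2 / R^2) * (- w / 2 + C * ((W1 * i - W2 * j) / 2))"
      using R_pos by (simp add: i)
    have 4: "- w / 2 + C * ((W1 * i - W2 * j) / 2) = (- y + C * y * (i - j)) * v2 - (x - C * (a * i - b * j)) * v1"
      by (simp add: w field_simps)
    have 5: "1 / A = i" "1 / B = j" "a / A = a * i" "b / B = b * j" by (simp_all add: i divide_inverse)
    show ?thesis
      unfolding 2 w(1)[symmetric] w(2)[symmetric] w(3)[symmetric] 5 i(1)[symmetric] i(3)[symmetric] 1 3 4 by (rule refl)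
  qed
  ultimately show ?thesis unfolding V_eq by (simp add: d)
qed

text \<open>The entries of the Jacobian matrix. The fourth one is \<open>- j11\<close>, since a
  Hamiltonian field is divergence free.\<close>

definition "j11 p = \<theta> * R^2 * c * p$2 * (2 * (p$1 - R / \<rho>) / (BB p)^2 - 2 * (p$1 - \<rho> * R) / (AA p)^2)" for p :: "real^2"
definition "j12 p = \<theta> * (- 1 + R^2 * c * (1 / AA p - 1 / BB p) + R^2 * c * p$2 * (2 * p$2 / (BB p)^2 - 2 * p$2 / (AA p)^2))" for p :: "real^2"
definition "j21 p = \<theta> * (1 - R^2 * c * (1 / AA p - 2 * (p$1 - \<rho> * R)^2 / (AA p)^2 - 1 / BB p + 2 * (p$1 - R / \<rho>)^2 / (BB p)^2))" for p :: "real^2"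
definition "jac p v = pt (j11 p * v$1 + j12 p * v$2) (j21 p * v$1 - j11 p * v$2)" for p v :: "real^2"

lemma dV:
  assumes "p \<in> Om"
  shows "(V has_derivative jac p) (at p)"
proof -
  note pos = AB_pos[OF assms]
  define x y a b A B where d: "x = p$1" "y = p$2" "a = p$1 - \<rho> * R" "b = p$1 - R / \<rho>" "A = AA p" "B = BB p"
  have AB0: "A \<noteq> 0" "B \<noteq> 0" using pos d by auto
  define dA dB where dd: "dA = (\<lambda>v::real^2. 2 * a * v$1 + 2 * y * v$2)" "dB = (\<lambda>v::real^2. 2 * b * v$1 + 2 * y * v$2)"
  have A': "(AA has_derivative dA) (at p)" and B': "(BB has_derivative dB) (at p)"
    using AB_deriv[of p] by (simp_all add: d dd)
  have iA: "((\<lambda>p. 1 / AA p) has_derivative (\<lambda>v. - dA v / A^2)) (at p)"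
    by (rule has_derivative_eq_rhs[OF has_derivative_divide'[OF has_derivative_const A']])
       (use pos in \<open>simp_all add: fun_eq_iff d power2_eq_square\<close>)
  have iB: "((\<lambda>p. 1 / BB p) has_derivative (\<lambda>v. - dB v / B^2)) (at p)"
    by (rule has_derivative_eq_rhs[OF has_derivative_divide'[OF has_derivative_const B']])
       (use pos in \<open>simp_all add: fun_eq_iff d power2_eq_square\<close>)
  have "((\<lambda>p::real^2. p$1 - \<rho> * R) has_derivative (\<lambda>v. v$1)) (at p)" "((\<lambda>p::real^2. p$1 - R / \<rho>) has_derivative (\<lambda>v. v$1)) (at p)"
    by (rule has_derivative_eq_rhs[OF has_derivative_diff[OF has_derivative_vec_nth has_derivative_const]], simp)+
  note fr = has_derivative_divide'[OF this(1) A'] has_derivative_divide'[OF this(2) B']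
  have aA: "((\<lambda>p. (p$1 - \<rho> * R) / AA p) has_derivative (\<lambda>v. v$1 / A - a * dA v / A^2)) (at p)"
    by (rule has_derivative_eq_rhs[OF fr(1)]) (use pos in \<open>simp_all add: fun_eq_iff d power2_eq_square diff_divide_distrib\<close>)
  have bB: "((\<lambda>p. (p$1 - R / \<rho>) / BB p) has_derivative (\<lambda>v. v$1 / B - b * dB v / B^2)) (at p)"
    by (rule has_derivative_eq_rhs[OF fr(2)]) (use pos in \<open>simp_all add: fun_eq_iff d power2_eq_square diff_divide_distrib\<close>)
  show ?thesis
    unfolding V_eq[abs_def]
  proof (rule has_derivative_eq_rhs[OF has_derivative_pt[OF
        has_derivative_mult_right[OF has_derivative_add[OF has_derivative_minus[OF has_derivative_vec_nth]
          has_derivative_mult[OF has_derivative_mult_right[OF has_derivative_vec_nth] has_derivative_diff[OF iA iB]]]]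
        has_derivative_mult_right[OF has_derivative_diff[OF has_derivative_vec_nth
          has_derivative_mult_right[OF has_derivative_diff[OF aA bB]]]]]], rule ext)
    fix v :: "real^2"
    define v1 v2 where vv: "v1 = v$1" "v2 = v$2"
    define C i j where cij: "C = R^2 * c" "i = inverse A" "j = inverse B"
    show "pt (\<theta> * (- (v $ 2) + (R^2 * c * p $ 2 * (- dA v / A^2 - - dB v / B^2) + R^2 * c * v $ 2 * (1 / AA p - 1 / BB p))))
        (\<theta> * (v $ 1 - R^2 * c * (v $ 1 / A - a * dA v / A^2 - (v $ 1 / B - b * dB v / B^2)))) = jac p v"
      unfolding jac_def j11_def j12_def j21_def pt_eq_pt_iff dd d(3-6)[symmetric]
      unfolding d(1,2)[symmetric] vv[symmetric] mult.assoc[of \<theta>] cij(1)[symmetric]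
      unfolding divide_inverse power_inverse[symmetric] cij(2,3)[symmetric] mult_1
      by (intro conjI; algebra)
  qed
qed

lemma bounded_linear_jac: "bounded_linear (jac p)"
  unfolding linear_conv_bounded_linear[symmetric]
proof (rule linearI)
  show "jac p (v + w) = jac p v + jac p w" for v w
    by (simp add: jac_def vec2_eq_iff distrib_left)
  show "jac p (r *\<^sub>R v) = r *\<^sub>R jac p v" for r v
    by (simp add: jac_def vec2_eq_iff distrib_left right_diff_distrib mult.left_commute)
qed

lemma continuous_AB: "continuous_on S AA" "continuous_on S BB"
  unfolding AA_def BB_def by (intro continuous_intros)+

lemma continuous_jac: "continuous_on Om (\<lambda>p. jac p v)"
proof -
  have nz: "\<forall>p\<in>Om. AA p \<noteq> 0" "\<forall>p\<in>Om. BB p \<noteq> 0" "\<forall>p\<in>Om. (AA p)^2 \<noteq> 0" "\<forall>p\<in>Om. (BB p)^2 \<noteq> 0"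
    by (force dest: AB_pos)+
  have "continuous_on Om j11" "continuous_on Om j12" "continuous_on Om j21"
    unfolding j11_def[abs_def] j12_def[abs_def] j21_def[abs_def]
    by (intro continuous_intros continuous_AB nz)+
  then show ?thesis unfolding jac_def by (intro continuous_intros)
qed

lemma lipschitz_V: "local_lipschitz (UNIV::real set) Om (\<lambda>_. V)"
  by (rule local_lipschitz_C1[OF open_Om' dV continuous_jac])

sublocale hamiltonian_field Om V En "2 / (\<theta> * R^2)"
proof
  show "open Om" by (rule open_Om')
  show "local_lipschitz (UNIV::real set) Om (\<lambda>_. V)" by (rule lipschitz_V)
  show "2 / (\<theta> * R^2) \<noteq> 0" using R_pos \<theta>_nz by simp
  show "(En has_derivative (\<lambda>v. 2 / (\<theta> * R^2) * (V p $ 1 * v $ 2 - V p $ 2 * v $ 1))) (at p)" if "p \<in> Om" for p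
    by (rule dEn[OF that])
qed

end

section \<open>The disc chart and the Hamiltonian in it\<close>

lemma norm_add_real_mult: "(cmod (1 + of_real a * z))^2 = 1 + a^2 * (cmod z)^2 + 2 * a * Re z"
  unfolding cmod_power2 by (simp add: power2_eq_square algebra_simps)

context disc_params
begin

lemma dn_cmod: "\<zeta> \<noteq> 0 ==> dn \<rho> (cmod \<zeta>) (Re \<zeta> / cmod \<zeta>) = (cmod (1 + of_real \<rho> * \<zeta>))^2"
  by (simp add: dn_def norm_add_real_mult)

text \<open>A signed coordinate on the axis treats the rays \<open>u = 1\<close> and
  \<open>u = -1\<close> together.\<close>

lemma rad_real:
  assumes "t \<noteq> 0" "1 + \<rho> * t \<noteq> 0"
  shows "rad \<rho> \<bar>t\<bar> (t / \<bar>t\<bar>) = t * (t + \<rho>) / (1 + \<rho> * t) ^ 3"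
proof -
  define e where "e = 1 + \<rho> * t"
  have "dn \<rho> \<bar>t\<bar> (t / \<bar>t\<bar>) = e^2"
    using assms by (simp add: dn_def e_def power2_eq_square algebra_simps)
  moreover have "\<bar>t\<bar> * (\<bar>t\<bar> * (1 + \<rho>^2) + \<rho> * (t / \<bar>t\<bar>) * (1 + \<bar>t\<bar>^2)) = t * ((t + \<rho>) * e)"
    using assms by (cases "t > 0") (simp_all add: e_def power2_eq_square algebra_simps)
  ultimately show ?thesis using rad_axis_aux[of e t "t + \<rho>"] assms(2) by (simp add: rad_def e_def)
qed

end

context vortex_system
begin

definition "ch p = mob \<rho> (zc R p)"
definition "pz \<zeta> = pt (R * Re (mob (-\<rho>) \<zeta>)) (R * Im (mob (-\<rho>) \<zeta>))"

lemma zc_pt: "zc R (pt (R * x) (R * y)) = Complex x y"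
  using R_pos by (simp add: zc_def)

lemma \<rho>2_ne: "\<rho>^2 \<noteq> 1" using \<kappa>_pos by (simp add: \<kappa>_def)

lemma zc_num: "(cmod (zc R p - of_real \<rho>))^2 = AA p / R^2"
  unfolding cmod_power2 zc_def AA_def using R_pos by (simp add: field_simps power2_eq_square)

lemma zc_den: "(cmod (1 - of_real \<rho> * zc R p))^2 = \<rho>^2 * BB p / R^2"
proof -
  have "1 - \<rho> * (p$1 / R) = - (\<rho> / R) * (p$1 - R / \<rho>)" using R_pos \<rho> by (simp add: field_simps)
  then have "(1 - \<rho> * (p$1 / R))^2 = (\<rho> / R)^2 * (p$1 - R / \<rho>)^2"
    by (simp only: power_mult_distrib power2_minus)
  then show ?thesis
    unfolding cmod_power2 zc_def BB_def
    by (simp add: power_mult_distrib power_divide distrib_left add_divide_distrib)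
qed

lemma den_nz: "p \<noteq> pt (R / \<rho>) 0 ==> 1 - of_real \<rho> * zc R p \<noteq> 0"
proof
  assume "p \<noteq> pt (R / \<rho>) 0" "1 - of_real \<rho> * zc R p = 0"
  then have "BB p = 0" using zc_den[of p] R_pos \<rho> by simp
  then show False using \<open>p \<noteq> _\<close> by (auto simp: BB_def sum_power2_eq_zero_iff vec2_eq_iff)
qed

lemma den_nz_Om: "p \<in> Om ==> 1 - of_real \<rho> * zc R p \<noteq> 0"
  using den_nz by (simp add: Om_iff)

lemma ch_zero_iff: "p \<noteq> pt (R / \<rho>) 0 ==> ch p = 0 \<longleftrightarrow> p = pt (\<rho> * R) 0"
proof -
  assume p: "p \<noteq> pt (R / \<rho>) 0"
  have "ch p = 0 \<longleftrightarrow> zc R p = of_real \<rho>" using den_nz[OF p] by (simp add: ch_def mob_def)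
  also have "\<dots> \<longleftrightarrow> p = pt (\<rho> * R) 0" using R_pos by (auto simp: zc_def complex_eq_iff vec2_eq_iff field_simps)
  finally show ?thesis .
qed

lemma ch_nz: "p \<in> Om ==> ch p \<noteq> 0"
  using ch_zero_iff by (simp add: Om_iff)

lemma ch_den: "p \<noteq> pt (R / \<rho>) 0 ==> 1 + of_real \<rho> * ch p = of_real \<kappa> / (1 - of_real \<rho> * zc R p)"
  using mob_denom[OF den_nz] by (simp add: ch_def \<kappa>_def)

lemma pz_ch: "p \<noteq> pt (R / \<rho>) 0 ==> pz (ch p) = p"
  using mob_inverse[OF den_nz \<rho>2_ne] R_pos by (simp add: pz_def ch_def zc_def)

lemma zc_pz: "zc R (pz \<zeta>) = mob (-\<rho>) \<zeta>"
  by (simp add: pz_def zc_pt)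

lemma ch_pz: "1 + of_real \<rho> * \<zeta> \<noteq> 0 ==> ch (pz \<zeta>) = \<zeta>"
  using mob_inverse[of "-\<rho>" \<zeta>] \<rho>2_ne by (simp add: ch_def zc_pz)

lemma pz_ne: "1 + of_real \<rho> * \<zeta> \<noteq> 0 ==> pz \<zeta> \<noteq> pt (R / \<rho>) 0"
proof
  assume a: "1 + of_real \<rho> * \<zeta> \<noteq> 0" and "pz \<zeta> = pt (R / \<rho>) 0"
  then have "zc R (pz \<zeta>) = of_real (1 / \<rho>)" using R_pos by (simp add: zc_def complex_eq_iff)
  then have "1 - of_real \<rho> * mob (-\<rho>) \<zeta> = 0" using \<rho> by (simp add: zc_pz)
  then have "of_real \<kappa> / (1 + of_real \<rho> * \<zeta>) = 0" using mob_denom[of "-\<rho>" \<zeta>] a by (simp add: \<kappa>_def)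
  then show False using a \<kappa>_pos by simp
qed

lemma pz_Om: "1 + of_real \<rho> * \<zeta> \<noteq> 0 ==> pz \<zeta> \<in> Om \<longleftrightarrow> \<zeta> \<noteq> 0"
  using pz_ne ch_zero_iff[of "pz \<zeta>"] ch_pz by (simp add: Om_iff)

lemma small_den: "cmod \<zeta> * \<rho> < 1 ==> 1 + of_real \<rho> * \<zeta> \<noteq> 0"
proof
  assume "cmod \<zeta> * \<rho> < 1" "1 + of_real \<rho> * \<zeta> = 0"
  then have "of_real \<rho> * \<zeta> = - 1" by (simp add: eq_neg_iff_add_eq_0 add.commute)
  then have "cmod (of_real \<rho> * \<zeta>) = 1" by simp
  then show False using \<open>cmod \<zeta> * \<rho> < 1\<close> \<rho> by (simp add: norm_mult mult.commute)
qed

lemma cmod_ch: "p \<noteq> pt (R / \<rho>) 0 ==> (cmod (ch p))^2 = AA p / (\<rho>^2 * BB p)"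
  using R_pos by (simp add: ch_def mob_def norm_divide power_divide zc_num zc_den)

definition "bdf p = R^2 - ((p$1)^2 + (p$2)^2)" for p :: "real^2"

text \<open>The circle is an Apollonius circle of the vortex and its mirror image: on it the two
  distances have the ratio \<rho>. This is why the chart maps it to the unit circle.\<close>

lemma AB_bdf: "\<rho>^2 * BB p - AA p = \<kappa> * bdf p"
proof -
  have "\<rho>^2 * (p$1 - R / \<rho>)^2 = (\<rho> * p$1 - R)^2"
    using \<rho> by (simp add: power_mult_distrib[symmetric] right_diff_distrib)
  then show ?thesis
    by (simp add: AA_def BB_def bdf_def \<kappa>_def distrib_left) (simp add: power2_eq_square algebra_simps)
qed

lemma one_minus_cmod_ch: "p \<noteq> pt (R / \<rho>) 0 ==> 1 - (cmod (ch p))^2 = \<kappa> * bdf p / (\<rho>^2 * BB p)"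
proof -
  assume p: "p \<noteq> pt (R / \<rho>) 0"
  then have "BB p \<noteq> 0" by (auto simp: BB_def sum_power2_eq_zero_iff vec2_eq_iff)
  then show ?thesis
    unfolding AB_bdf[symmetric] cmod_ch[OF p] using \<rho> by (simp add: field_simps)
qed

lemma BB_pos: "p \<noteq> pt (R / \<rho>) 0 ==> BB p > 0"
  by (auto simp: BB_def sum_power2_gt_zero_iff vec2_eq_iff)

lemma disk_iff: "p \<in> disk R \<longleftrightarrow> bdf p \<ge> 0"
  by (auto simp: disk_def bdf_def)

lemma disk_ne: "p \<in> disk R ==> p \<noteq> pt (R / \<rho>) 0"
proof
  assume "p \<in> disk R" "p = pt (R / \<rho>) 0"
  then have "(R / \<rho>)^2 <= R^2" by (simp add: disk_def)
  moreover have "R / \<rho> > R" using \<rho> R_pos by (simp add: field_simps)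
  ultimately show False using R_pos by (smt (verit) power2_le_imp_le)
qed

lemma
  assumes "p \<noteq> pt (R / \<rho>) 0"
  shows disk_iff_ch: "p \<in> disk R \<longleftrightarrow> cmod (ch p) <= 1"
    and bdf_pos_iff_ch: "bdf p > 0 \<longleftrightarrow> cmod (ch p) < 1"
    and bdf_zero_iff_ch: "bdf p = 0 \<longleftrightarrow> cmod (ch p) = 1"
proof -
  define k where "k = \<rho>^2 * BB p / \<kappa>"
  have pos: "k > 0" using \<rho> BB_pos[OF assms] \<kappa>_pos by (simp add: k_def)
  have eq: "bdf p = k * (1 - (cmod (ch p))^2)"
    unfolding k_def one_minus_cmod_ch[OF assms] using \<rho> BB_pos[OF assms] \<kappa>_pos by simp
  have 1: "bdf p > 0 \<longleftrightarrow> 1 - (cmod (ch p))^2 > 0" "bdf p = 0 \<longleftrightarrow> 1 - (cmod (ch p))^2 = 0"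
    unfolding eq using pos by (simp_all add: zero_less_mult_iff)
  show "bdf p > 0 \<longleftrightarrow> cmod (ch p) < 1"
    unfolding 1 using abs_square_less_1[of "cmod (ch p)"] by simp
  moreover show "bdf p = 0 \<longleftrightarrow> cmod (ch p) = 1"
  proof -
    have "cmod (ch p) \<noteq> -1" using norm_ge_zero[of "ch p"] by linarith
    then show ?thesis unfolding 1 using power2_eq_1_iff[of "cmod (ch p)"] by auto
  qed
  ultimately show "p \<in> disk R \<longleftrightarrow> cmod (ch p) <= 1"
    unfolding disk_iff by auto
qed

lemma disk_eq: "disk R = cball 0 R" and interior_disk: "interior (disk R) = {p. bdf p > 0}"
proof -
  have b: "norm p <= R \<longleftrightarrow> (norm p)^2 <= R^2" "norm p < R \<longleftrightarrow> (norm p)^2 < R^2" for p :: "real^2"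
    using R_pos abs_le_square_iff[of "norm p" R] abs_le_square_iff[of R "norm p"] by (simp_all add: not_le[symmetric])
  then have "z \<in> disk R \<longleftrightarrow> z \<in> cball 0 R" for z by (simp add: disk_def norm_vec2)
  then show d: "disk R = cball 0 R" by blast
  have "z \<in> ball 0 R \<longleftrightarrow> z \<in> {p. bdf p > 0}" for z using b(2)[of z] by (simp add: bdf_def norm_vec2)
  then show "interior (disk R) = {p. bdf p > 0}" unfolding d interior_cball by blast
qed

lemma compact_disk: "compact (disk R)"
  unfolding disk_eq by simp

lemma frontier_disk: "frontier (disk R) = {p. bdf p = 0}"
  unfolding frontier_def interior_disk closure_closed[OF compact_imp_closed[OF compact_disk]]
  by (auto simp: disk_iff)

lemma En_ch:
  assumes "p \<in> Om"
  shows "En p = lv (cmod (ch p)) (Re (ch p) / cmod (ch p))"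
proof -
  have p: "p \<noteq> pt (R / \<rho>) 0" using assms by (simp add: Om_iff)
  note pos = AB_pos[OF assms]
  have B: "\<rho>^2 * BB p > 0" using \<rho> pos by simp
  have "2 * ln (cmod (ch p)) = ln ((cmod (ch p))^2)" using ch_nz[OF assms] by (simp add: ln_realpow)
  also have "\<dots> = ln (AA p) - ln (\<rho>^2 * BB p)" unfolding cmod_ch[OF p] by (subst ln_div) (use pos B \<rho> in auto)
  finally have l: "2 * ln (cmod (ch p)) = ln (AA p) - ln (\<rho>^2 * BB p)" .
  have "dn \<rho> (cmod (ch p)) (Re (ch p) / cmod (ch p)) = \<kappa>^2 / (\<rho>^2 * BB p / R^2)"
    using dn_cmod[OF ch_nz[OF assms]] ch_den[OF p] \<kappa>_pos
    by (simp add: norm_divide power_divide zc_den)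
  then have "\<kappa> * (1 - (cmod (ch p))^2) / dn \<rho> (cmod (ch p)) (Re (ch p) / cmod (ch p)) = bdf p / R^2"
  proof -
    define K where "K = \<rho>^2 * BB p"
    assume "dn \<rho> (cmod (ch p)) (Re (ch p) / cmod (ch p)) = \<kappa>^2 / (\<rho>^2 * BB p / R^2)"
    then show ?thesis
      unfolding one_minus_cmod_ch[OF p] K_def[symmetric] using B[folded K_def] \<kappa>_pos R_pos
      by (simp add: field_simps power2_eq_square)
  qed
  moreover have "bdf p / R^2 = 1 - ((p$1)^2 + (p$2)^2) / R^2"
    using R_pos by (simp add: bdf_def diff_divide_distrib)
  ultimately show ?thesis
    unfolding lev_def En_def \<kappa>_def[symmetric] l[symmetric] by simp
qed

lemma Im_ch: "p \<noteq> pt (R / \<rho>) 0 ==> Im (ch p) = \<kappa> * (p$2) * R / (\<rho>^2 * BB p)"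
proof -
  assume p: "p \<noteq> pt (R / \<rho>) 0"
  have "Im (ch p) = (p$2 / R * (1 - \<rho> * (p$1 / R)) - (p$1 / R - \<rho>) * (- (\<rho> * (p$2 / R)))) / (cmod (1 - of_real \<rho> * zc R p))^2"
    by (simp add: ch_def mob_def Im_divide cmod_power2 zc_def)
  also have "p$2 / R * (1 - \<rho> * (p$1 / R)) - (p$1 / R - \<rho>) * (- (\<rho> * (p$2 / R))) = \<kappa> * (p$2) / R"
    using R_pos by (simp add: \<kappa>_def field_simps power2_eq_square)
  finally show ?thesis unfolding zc_den using BB_pos[OF p] \<rho> R_pos by (simp add: field_simps power2_eq_square)
qed

lemma Im_ch_sgn: "p \<noteq> pt (R / \<rho>) 0 ==> sgn (Im (ch p)) = sgn (p$2)"
proof -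
  assume p: "p \<noteq> pt (R / \<rho>) 0"
  define k where "k = \<kappa> * R / (\<rho>^2 * BB p)"
  have "k > 0" using \<kappa>_pos R_pos \<rho> BB_pos[OF p] by (simp add: k_def)
  moreover have "Im (ch p) = k * (p$2)" using Im_ch[OF p] by (simp add: k_def)
  ultimately show ?thesis by (simp add: sgn_mult)
qed

end

text \<open>By monotonicity in the first argument, \<open>\<phi> x\<close> exceeds a number
  \<open>y\<close> of \<open>I\<close> exactly when \<open>g y x\<close> is below
  \<open>\<gamma> x\<close>, and such a strict inequality between continuous functions persists near
  \<open>x\<close>. Neither differentiability nor compactness of \<open>I\<close> enters, so closed
  and half-open intervals of radii are covered.\<close>

lemma implicit_continuous:
  fixes g :: "real => 'a::topological_space => real"
  assumes I: "is_interval I" and \<phi>: "!!x. x \<in> S ==> \<phi> x \<in> I" "!!x. x \<in> S ==> g (\<phi> x) x = \<gamma> x"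
    and mono: "!!x q q'. x \<in> S ==> q \<in> I ==> q' \<in> I ==> q < q' ==> g q x < g q' x"
    and cont: "!!q. q \<in> I ==> continuous_on S (g q)" "continuous_on S \<gamma>"
  shows "continuous_on S \<phi>"
  unfolding continuous_on
proof
  fix x0 assume x0: "x0 \<in> S"
  have ev: "\<forall>\<^sub>F x in at x0 within S. x \<in> S" by (simp add: eventually_at_filter)
  have lim: "(g q \<longlongrightarrow> g q x0) (at x0 within S)" if "q \<in> I" for q
    using cont(1)[OF that] x0 by (auto simp: continuous_on)
  have lim\<gamma>: "(\<gamma> \<longlongrightarrow> \<gamma> x0) (at x0 within S)" using cont(2) x0 by (auto simp: continuous_on)
  show "(\<phi> \<longlongrightarrow> \<phi> x0) (at x0 within S)"
  proof (rule order_tendstoI)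
    fix y assume y: "y < \<phi> x0"
    show "\<forall>\<^sub>F x in at x0 within S. y < \<phi> x"
    proof (cases "y \<in> I")
      case True
      have "g y x0 < \<gamma> x0" using mono[OF x0 True \<phi>(1)[OF x0] y] \<phi>(2)[OF x0] by simp
      then have "\<forall>\<^sub>F x in at x0 within S. \<gamma> x - g y x > 0"
        using order_tendstoD(1)[OF tendsto_diff[OF lim\<gamma> lim[OF True]], of 0] by simp
      with ev show ?thesis
      proof eventually_elim
        case (elim x)
        show ?case
        proof (rule ccontr)
          assume "\<not> y < \<phi> x"
          then have "g (\<phi> x) x <= g y x"
            using mono[OF elim(1) \<phi>(1)[OF elim(1)] True] by (cases "\<phi> x = y") auto
          then show False using \<phi>(2)[OF elim(1)] elim(2) by simp
        qed
      qed
    next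
      case False
      have "y < \<phi> x" if "x \<in> S" for x
        using I False \<phi>(1)[OF x0] \<phi>(1)[OF that] y unfolding is_interval_1 by (meson less_imp_le not_le)
      then show ?thesis using ev by (auto elim: eventually_mono)
    qed
  next
    fix y assume y: "\<phi> x0 < y"
    show "\<forall>\<^sub>F x in at x0 within S. \<phi> x < y"
    proof (cases "y \<in> I")
      case True
      have "\<gamma> x0 < g y x0" using mono[OF x0 \<phi>(1)[OF x0] True y] \<phi>(2)[OF x0] by simp
      then have "\<forall>\<^sub>F x in at x0 within S. g y x - \<gamma> x > 0"
        using order_tendstoD(1)[OF tendsto_diff[OF lim[OF True] lim\<gamma>], of 0] by simp
      with ev show ?thesis
      proof eventually_elim
        case (elim x)
        show ?case
        proof (rule ccontr)
          assume "\<not> \<phi> x < y"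
          then have "g y x <= g (\<phi> x) x"
            using mono[OF elim(1) True \<phi>(1)[OF elim(1)]] by (cases "\<phi> x = y") auto
          then show False using \<phi>(2)[OF elim(1)] elim(2) by simp
        qed
      qed
    next
      case False
      have "\<phi> x < y" if "x \<in> S" for x
        using I False \<phi>(1)[OF x0] \<phi>(1)[OF that] y unfolding is_interval_1 by (meson less_imp_le not_le)
      then show ?thesis using ev by (auto elim: eventually_mono)
    qed
  qed
qed

text \<open>The sign \<open>\<sigma>\<close> selects the half plane in which the point with \<open>\<bar>\<zeta>\<bar> = q\<close> and \<open>Re \<zeta> = q u\<close> lies.\<close>

definition cpt :: "real => real => real => complex" where
  "cpt \<sigma> q u = Complex (q * u) (\<sigma> * q * sqrt (1 - u^2))"

lemma cpt_simps:
  assumes "q \<ge> 0" "-1 <= u" "u <= 1" "\<sigma> = 1 \<or> \<sigma> = -1"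
  shows "cmod (cpt \<sigma> q u) = q" "Re (cpt \<sigma> q u) = q * u" "Im (cpt \<sigma> q u) = \<sigma> * q * sqrt (1 - u^2)"
proof -
  have "u^2 <= 1" using assms by (simp add: abs_square_le_1)
  then have "(cmod (cpt \<sigma> q u))^2 = q^2"
    unfolding cmod_power2 cpt_def using assms(4) by (auto simp: power_mult_distrib algebra_simps)
  then show "cmod (cpt \<sigma> q u) = q" using assms(1) by (simp add: power2_eq_iff_nonneg)
qed (simp_all add: cpt_def)

lemma cpt_surj:
  assumes "\<zeta> \<noteq> 0"
  obtains \<sigma> where "\<sigma> = 1 \<or> \<sigma> = -1" "\<zeta> = cpt \<sigma> (cmod \<zeta>) (Re \<zeta> / cmod \<zeta>)"
proof
  define \<sigma> :: real where "\<sigma> = (if Im \<zeta> \<ge> 0 then 1 else -1)"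
  show "\<sigma> = 1 \<or> \<sigma> = -1" by (simp add: \<sigma>_def)
  have "cmod \<zeta> * sqrt (1 - (Re \<zeta> / cmod \<zeta>)^2) = sqrt ((cmod \<zeta>)^2 * (1 - (Re \<zeta> / cmod \<zeta>)^2))"
    by (simp add: real_sqrt_mult)
  also have "(cmod \<zeta>)^2 * (1 - (Re \<zeta> / cmod \<zeta>)^2) = (Im \<zeta>)^2"
    using assms by (simp add: right_diff_distrib power_divide cmod_power2)
  finally have "cmod \<zeta> * sqrt (1 - (Re \<zeta> / cmod \<zeta>)^2) = \<bar>Im \<zeta>\<bar>" by simp
  moreover have "Im \<zeta> = \<sigma> * \<bar>Im \<zeta>\<bar>" by (simp add: \<sigma>_def)
  ultimately have "Im \<zeta> = \<sigma> * cmod \<zeta> * sqrt (1 - (Re \<zeta> / cmod \<zeta>)^2)" by (simp only: mult.assoc)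
  moreover have "Re \<zeta> = cmod \<zeta> * (Re \<zeta> / cmod \<zeta>)" using assms by simp
  ultimately show "\<zeta> = cpt \<sigma> (cmod \<zeta>) (Re \<zeta> / cmod \<zeta>)"
    unfolding cpt_def complex_eq_iff complex.sel by blast
qed

lemma cpt_axis: "cpt \<sigma> q 1 = of_real q" "cpt \<sigma> q (-1) = of_real (- q)"
  by (simp_all add: cpt_def complex_eq_iff)

lemma Re_cmod_bounds: "-1 <= Re \<zeta> / cmod \<zeta>" "Re \<zeta> / cmod \<zeta> <= 1"
proof -
  have "\<bar>Re \<zeta> / cmod \<zeta>\<bar> <= 1"
    using abs_Re_le_cmod[of \<zeta>] by (cases "\<zeta> = 0") (auto simp: divide_le_eq)
  then show "-1 <= Re \<zeta> / cmod \<zeta>" "Re \<zeta> / cmod \<zeta> <= 1" unfolding abs_le_iff by linarith+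
qed

section \<open>Equilibria in the chart and invariance of the disk\<close>

context vortex_system
begin

text \<open>On the axis the field is vertical, and its second component vanishes exactly when the
  radial derivative of the level does. Off the axis, vanishing of the first component fixes the
  difference of the two reciprocals; the second component then forces the circle, where
  \<open>krad\<close> takes the value \<open>A / (\<kappa> R^2)\<close>.\<close>

lemma zero_V_iff:
  assumes p: "p \<in> Om"
  shows "V p = 0 \<longleftrightarrow> krad (cmod (ch p)) (Re (ch p) / cmod (ch p)) = c \<and> (cmod (ch p) = 1 \<or> Im (ch p) = 0)"
proof (cases "p$2 = 0")
  case True
  note pne = p[unfolded Om_iff]
  \<comment> \<open>\<open>X\<close> is the abscissa in units of \<open>R\<close>, \<open>t\<close>
    the corresponding real coordinate in the chart.\<close>
  define X t where "X = p$1 / R" and "t = (X - \<rho>) / (1 - \<rho> * X)"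
  have x: "p$1 = R * X" using R_pos by (simp add: X_def)
  have z: "zc R p = of_real X" using True by (simp add: zc_def X_def complex_eq_iff)
  have d: "1 - \<rho> * X \<noteq> 0"
  proof
    assume "1 - \<rho> * X = 0"
    then have "of_real (1 - \<rho> * X) = (0::complex)" by simp
    then show False using den_nz_Om[OF p] z by simp
  qed
  have n: "X - \<rho> \<noteq> 0" using pne True R_pos by (auto simp: vec2_eq_iff x)
  have ch: "ch p = of_real t" by (simp add: ch_def mob_def z t_def)
  have t0: "t \<noteq> 0" using n d by (simp add: t_def)
  have t1: "1 + \<rho> * t = \<kappa> / (1 - \<rho> * X)" "t + \<rho> = X * \<kappa> / (1 - \<rho> * X)"
    using d by (simp_all add: t_def \<kappa>_def field_simps power2_eq_square)
  have aux: "k * ((a / e) * (X * k / e) / (k / e) ^ 3) = X * a * e / k" if "k \<noteq> 0" "e \<noteq> 0" for k a e :: real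
    using that by (simp add: field_simps power3_eq_cube)
  have "krad \<bar>t\<bar> (t / \<bar>t\<bar>) = \<kappa> * (t * (t + \<rho>) / (1 + \<rho> * t) ^ 3)"
    using rad_real[OF t0] t1(1) \<kappa>_pos d by simp
  also have "\<dots> = X * (X - \<rho>) * (1 - \<rho> * X) / \<kappa>"
    unfolding t1 using aux[of \<kappa> "1 - \<rho> * X" "X - \<rho>"] \<kappa>_pos d by (simp add: t_def)
  finally have r: "krad (cmod (ch p)) (Re (ch p) / cmod (ch p)) = X * (X - \<rho>) * (1 - \<rho> * X) / \<kappa>"
    by (simp add: ch)
  define m e where me: "m = X - \<rho>" "e = 1 - \<rho> * X"
  have nz: "m \<noteq> 0" "e \<noteq> 0" "R \<noteq> 0" "\<rho> \<noteq> 0" "\<kappa> \<noteq> 0" using n d R_pos \<rho> \<kappa>_pos by (simp_all add: me)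
  have ab: "p$1 - \<rho> * R = R * m" "p$1 - R / \<rho> = - (R / \<rho>) * e"
    using \<rho> by (simp_all add: x me field_simps)
  have A: "AA p = (R * m)^2" "BB p = (- (R / \<rho>) * e)^2"
    using True by (simp_all add: AA_def BB_def ab)
  have inv: "w / w^2 = 1 / w" for w :: real by (simp add: power2_eq_square)
  have "V p $ 2 = \<theta> * (R * X - R^2 * c * (1 / (R * m) - 1 / (- (R / \<rho>) * e)))"
    unfolding V_eq vector_2 A ab inv unfolding x by (rule refl)
  also have "1 / (R * m) - 1 / (- (R / \<rho>) * e) = (e + \<rho> * m) / (R * (m * e))"
    using nz by (simp add: field_simps)
  also have "e + \<rho> * m = \<kappa>" by (simp add: me \<kappa>_def algebra_simps power2_eq_square)
  also have "\<theta> * (R * X - R^2 * c * (\<kappa> / (R * (m * e)))) = \<theta> * R * (X - c * \<kappa> / (m * e))"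
    using nz by (simp add: field_simps power2_eq_square)
  finally have "V p $ 2 = 0 \<longleftrightarrow> X = c * \<kappa> / (m * e)" using R_pos \<theta>_nz by simp
  also have "\<dots> \<longleftrightarrow> X * m * e / \<kappa> = c"
    using nz by (simp add: field_simps)
  finally have "V p $ 2 = 0 \<longleftrightarrow> X * (X - \<rho>) * (1 - \<rho> * X) / \<kappa> = c" by (simp add: me)
  moreover have "V p $ 1 = 0" by (simp add: V_eq True)
  ultimately have "V p = 0 \<longleftrightarrow> X * (X - \<rho>) * (1 - \<rho> * X) / \<kappa> = c"
    by (simp add: vec2_eq_iff)
  then show ?thesis using r ch by simp
next
  case False
  note pos = AB_pos[OF p]
  have pne: "p \<noteq> pt (R / \<rho>) 0" using p by (simp add: Om_iff)
  have Im: "Im (ch p) \<noteq> 0" using Im_ch_sgn[OF pne] False by (metis sgn_zero_iff)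
  define x y A B where d: "x = p$1" "y = p$2" "A = AA p" "B = BB p"
  have AB0: "A > 0" "B > 0" using pos d by auto
  have V1: "V p $ 1 = 0 \<longleftrightarrow> R^2 * c * (1 / A - 1 / B) = 1"
  proof -
    have "V p $ 1 = \<theta> * y * (R^2 * c * (1 / A - 1 / B) - 1)"
      unfolding V_eq d[symmetric] vector_2 by (simp add: algebra_simps)
    then show ?thesis using \<theta>_nz False by (simp add: d)
  qed
  \<comment> \<open>What remains of the second component once the factor of the first one is split
    off; by \<open>AB_bdf\<close> it vanishes exactly on the circle.\<close>
  define W where "W = (\<rho>^2 * B - A) / (\<rho> * A * B)"
  have V2: "V p $ 2 = \<theta> * (x * (1 - R^2 * c * (1 / A - 1 / B)) + R^2 * c * R * W)"
  proof -
    have 1: "(x - \<rho> * R) / A - (x - R / \<rho>) / B = x * (1 / A - 1 / B) - (\<rho> * R / A - R / \<rho> / B)"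
      by (simp add: algebra_simps diff_divide_distrib)
    have 2: "\<rho> * R / A - R / \<rho> / B = R * W"
      unfolding W_def using AB0 \<rho> by (simp add: field_simps power2_eq_square)
    show ?thesis unfolding V_eq d(1,3,4)[symmetric] vector_2 1 2 by (simp add: algebra_simps)
  qed
  have eq: "V p = 0 \<longleftrightarrow> bdf p = 0 \<and> A = \<kappa> * c * R^2"
  proof
    assume "V p = 0"
    then have "V p $ 1 = 0" "V p $ 2 = 0" by simp_all
    then have 1: "R^2 * c * (1 / A - 1 / B) = 1" and "R^2 * c * R * W = 0"
      using V1 V2 \<theta>_nz by auto
    then have AB: "\<rho>^2 * B = A" using AB0 \<rho> R_pos c_nz by (auto simp: W_def)
    then have "bdf p = 0" using AB_bdf[of p] \<kappa>_pos by (simp add: d)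
    moreover have "1 / B = \<rho>^2 / A" using AB[symmetric] AB0 \<rho> by simp
    with 1 have "R^2 * c * ((1 - \<rho>^2) / A) = 1" by (simp add: diff_divide_distrib)
    then have "A = \<kappa> * c * R^2" using AB0 by (simp add: \<kappa>_def field_simps)
    ultimately show "bdf p = 0 \<and> A = \<kappa> * c * R^2" by simp
  next
    assume a: "bdf p = 0 \<and> A = \<kappa> * c * R^2"
    then have AB: "\<rho>^2 * B = A" using AB_bdf[of p] by (simp add: d)
    then have "1 / B = \<rho>^2 / A" using AB0 \<rho> by (auto simp: field_simps)
    then have "R^2 * c * (1 / A - 1 / B) = (R^2 * c * \<kappa>) / A" by (simp add: \<kappa>_def diff_divide_distrib[symmetric])
    also have "\<dots> = 1" using a \<kappa>_pos R_pos c_nz by simp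
    finally have "R^2 * c * (1 / A - 1 / B) = 1" .
    then have "V p $ 1 = 0" "V p $ 2 = 0" unfolding V1 V2 W_def AB by simp_all
    then show "V p = 0" by (simp add: vec2_eq_iff)
  qed
  have "A = \<kappa> * c * R^2 \<longleftrightarrow> krad 1 (Re (ch p) / cmod (ch p)) = c" if "bdf p = 0"
  proof -
    have AB: "\<rho>^2 * BB p = A" using AB_bdf[of p] that by (simp add: d)
    have c1: "cmod (ch p) = 1" using bdf_zero_iff_ch[OF pne] that by simp
    have "dn \<rho> 1 (Re (ch p) / cmod (ch p)) = \<kappa>^2 / (A / R^2)"
      using dn_cmod[OF ch_nz[OF p]] ch_den[OF pne] \<kappa>_pos unfolding c1
      by (simp add: norm_divide power_divide zc_den AB)
    then have r: "krad 1 (Re (ch p) / cmod (ch p)) = A / (\<kappa> * R^2)"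
      using rad_one[OF Re_cmod_bounds(1)] \<kappa>_pos R_pos AB0 by (simp add: power2_eq_square)
    show ?thesis unfolding r using \<kappa>_pos R_pos by (simp add: field_simps)
  qed
  then show ?thesis unfolding eq using Im bdf_zero_iff_ch[OF pne] by (cases "bdf p = 0") simp_all
qed

text \<open>Along a solution \<open>bdf\<close> satisfies the homogeneous linear equation with
  coefficient \<open>g\<close>, so it is multiplied by a positive exponential and keeps its sign.
  This gives invariance of the disk, of its interior and of the circle.\<close>

lemma bdf_solution:
  assumes "is_interval T" "solution_on T Om V \<gamma>" "s \<in> T" "t \<in> T"
  obtains k where "k > 0" "bdf (\<gamma> t) = k * bdf (\<gamma> s)"
proof -
  define g where "g p = - 2 * \<theta> * c * R^2 * (p$2) * (R / \<rho>) * \<kappa> / (AA p * BB p)" for p :: "real^2"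
  have gV: "- 2 * (p$1 * V p$1 + p$2 * V p$2) = g p * bdf p" if "p \<in> Om" for p
  proof -
    define x y A B where d: "x = p$1" "y = p$2" "A = AA p" "B = BB p"
    have AB0: "A > 0" "B > 0" using AB_pos[OF that] d by auto
    have 1: "(x - \<rho> * R) / A - (x - R / \<rho>) / B = x * (1 / A - 1 / B) - (\<rho> * R / A - R / \<rho> / B)"
      by (simp add: algebra_simps diff_divide_distrib)
    define W where "W = (R / \<rho>) * (\<rho>^2 * B - A) / (A * B)"
    have 2: "\<rho> * R / A - R / \<rho> / B = W"
      unfolding W_def using AB0 \<rho> by (simp add: field_simps power2_eq_square)
    have "x * V p$1 + y * V p$2 = \<theta> * R^2 * c * y * W"
      unfolding V_eq d[symmetric] vector_2 1 2 by (simp add: algebra_simps)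
    also note W_def
    also have "\<rho>^2 * B - A = \<kappa> * bdf p" using AB_bdf by (simp add: d)
    finally show ?thesis unfolding g_def d[symmetric] by (simp add: field_simps)
  qed
  have dw: "((\<lambda>t. bdf (\<gamma> t)) has_real_derivative g (\<gamma> t) * bdf (\<gamma> t)) (at t)" if "t \<in> T" for t
  proof -
    have \<gamma>: "(\<gamma> has_vector_derivative V (\<gamma> t)) (at t)" "\<gamma> t \<in> Om" using assms(2) that by (auto simp: solution_on_def)
    have c: "((\<lambda>t. \<gamma> t $ i) has_real_derivative V (\<gamma> t) $ i) (at t)" for i
      using bounded_linear.has_vector_derivative[OF bounded_linear_vec_nth \<gamma>(1)]
      by (simp add: has_real_derivative_iff_has_vector_derivative)
    have "((\<lambda>t. bdf (\<gamma> t)) has_real_derivative - (2 * (\<gamma> t $ 1) * V (\<gamma> t) $ 1 + 2 * (\<gamma> t $ 2) * V (\<gamma> t) $ 2)) (at t)"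
      unfolding bdf_def by (auto intro!: derivative_eq_intros c)
    then show ?thesis using gV[OF \<gamma>(2)] by (simp add: algebra_simps)
  qed
  have main: "\<exists>k>0. bdf (\<gamma> b) = k * bdf (\<gamma> a)" if ab: "a \<in> T" "b \<in> T" "a <= b" for a b
  proof -
    have sub: "{a..b} \<subseteq> T" using assms(1) ab unfolding is_interval_1 by (meson atLeastAtMost_iff subsetI)
    have "\<forall>p\<in>Om. AA p * BB p \<noteq> 0" using AB_pos by force
    then have cg: "continuous_on Om g" unfolding g_def by (intro continuous_intros continuous_AB)
    have im: "\<gamma> ` {a..b} \<subseteq> Om" using assms(2) sub by (auto simp: solution_on_def)
    have "continuous_on {a..b} (\<lambda>t. g (\<gamma> t))"
      by (rule continuous_on_compose2[OF cg continuous_on_subset[OF solution_on_continuous[OF assms(2)] sub] im])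
    then obtain G where G: "!!t. t \<in> {a..b} ==> (G has_vector_derivative g (\<gamma> t)) (at t within {a..b})"
      using antiderivative_continuous[of a b "\<lambda>t. g (\<gamma> t)"] by metis
    have "((\<lambda>t. bdf (\<gamma> t) * exp (- G t)) has_field_derivative 0) (at t within {a..b})" if "t \<in> {a..b}" for t
    proof -
      have 1: "(G has_real_derivative g (\<gamma> t)) (at t within {a..b})"
        using G[OF that] by (simp add: has_real_derivative_iff_has_vector_derivative)
      have 2: "((\<lambda>t. bdf (\<gamma> t)) has_real_derivative g (\<gamma> t) * bdf (\<gamma> t)) (at t within {a..b})"
        by (rule has_field_derivative_at_within[OF dw]) (use sub that in auto)
      have 3: "((\<lambda>t. exp (- G t)) has_real_derivative exp (- G t) * - g (\<gamma> t)) (at t within {a..b})"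
        by (rule DERIV_chain2[OF DERIV_exp DERIV_minus[OF 1]])
      show ?thesis by (rule DERIV_cong[OF DERIV_mult[OF 2 3]]) simp
    qed
    then obtain k where k: "!!t. t \<in> {a..b} ==> bdf (\<gamma> t) * exp (- G t) = k"
      using has_field_derivative_zero_constant[of "{a..b}" "\<lambda>t. bdf (\<gamma> t) * exp (- G t)"] by (metis convex_real_interval(5))
    have "bdf (\<gamma> b) * exp (- G b) = bdf (\<gamma> a) * exp (- G a)" using k[of a] k[of b] ab by simp
    then have "bdf (\<gamma> b) = exp (G b - G a) * bdf (\<gamma> a)" by (simp add: exp_diff exp_minus field_simps)
    then show ?thesis using exp_gt_zero by blast
  qed
  show thesis
  proof (cases "s <= t")
    case True then show ?thesis using main[OF assms(3,4)] that by blast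
  next
    case False
    then obtain k where k: "k > 0" "bdf (\<gamma> s) = k * bdf (\<gamma> t)" using main[OF assms(4,3)] by auto
    then have "bdf (\<gamma> t) = (1 / k) * bdf (\<gamma> s)" by simp
    then show ?thesis using that[of "1 / k"] k(1) by simp
  qed
qed

lemma bdf_orbit: "q \<in> orbit Om V p ==> sgn (bdf q) = sgn (bdf p)"
proof (erule orbitE)
  fix \<gamma> t T assume "is_interval T" "0 \<in> T" "t \<in> T" "solution_on T Om V \<gamma>" "\<gamma> 0 = p" "\<gamma> t = q"
  then obtain k where "k > 0" "bdf q = k * bdf p" using bdf_solution by metis
  then show "sgn (bdf q) = sgn (bdf p)" by (simp add: sgn_mult)
qed

lemma disk_invariant: "z \<in> pdisk ==> orbit Om V z \<subseteq> disk R"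
proof
  fix w assume "z \<in> pdisk" "w \<in> orbit Om V z"
  then show "w \<in> disk R" using bdf_orbit[of w z] by (auto simp: disk_iff sgn_if split: if_splits)
qed

lemma interior_invariant: "bdf z > 0 ==> w \<in> orbit Om V z ==> bdf w > 0"
  using bdf_orbit[of w z] by (simp add: sgn_if split: if_splits)

end

section \<open>Levels near the vortex and points in polar form\<close>

context disc_params
begin

lemma dn_nz: "0 < q ==> q <= 1 ==> -1 <= u ==> dn \<rho> q u \<noteq> 0"
  using dn_pos'[of q u] by simp

lemma continuous_on_lev_q: "0 < a ==> b <= 1 ==> -1 <= u ==> continuous_on {a..b} (\<lambda>q. lv q u)"
  by (intro continuous_on_lev continuous_on_id continuous_on_const dn_nz) auto

lemma dn_lower:
  assumes "0 <= q" "q <= 1" "-1 <= u"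
  shows "dn \<rho> q u \<ge> (1 - \<rho>)^2"
proof -
  have "dn \<rho> q u = (1 - \<rho> * q)^2 + 2 * (\<rho> * q) * (1 + u)"
    by (simp add: dn_def power2_eq_square algebra_simps)
  moreover have "2 * (\<rho> * q) * (1 + u) \<ge> 0" using assms \<rho> by simp
  moreover have "(1 - \<rho> * q)^2 \<ge> (1 - \<rho>)^2"
    using assms \<rho> mult_left_le[of q \<rho>] by (intro power_mono) auto
  ultimately show ?thesis by linarith
qed

text \<open>The rational term is bounded by \<open>\<kappa> / (1 - \<rho>)^2\<close> uniformly in
  \<open>u\<close>, so the logarithm prevails at the vortex; \<open>s\<close> is the sign of
  \<open>c\<close>.\<close>

lemma lev_to_bot:
  assumes s: "s = 1 \<or> s = -1" "s * c > 0"
  obtains \<delta> where "0 < \<delta>" "\<delta> <= 1"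
    "!!q u. 0 < q ==> q < \<delta> ==> -1 <= u ==> u <= 1 ==> s * lv q u < E"
proof -
  define K where "K = \<kappa> / (1 - \<rho>)^2"
  \<comment> \<open>The exponential is the radius at which \<open>K + 2 s c ln q\<close> equals
    \<open>E\<close>.\<close>
  define \<delta> where "\<delta> = min 1 (exp ((E - K) / (2 * (s * c))))"
  have "s * lv q u < E" if q: "0 < q" "q < \<delta>" "-1 <= u" "u <= 1" for q u
  proof -
    have q1: "q < 1" "q^2 <= 1" using q by (auto simp: \<delta>_def power_le_one)
    have d: "dn \<rho> q u > 0" "dn \<rho> q u \<ge> (1 - \<rho>)^2" using q q1 by (auto intro: dn_pos' dn_lower)
    have f0: "0 <= \<kappa> * (1 - q^2) / dn \<rho> q u" using d \<kappa>_pos q1 by simp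
    have "\<kappa> * (1 - q^2) / dn \<rho> q u <= \<kappa> * 1 / (1 - \<rho>)^2"
      using d \<kappa>_pos q1 \<rho> by (intro frac_le mult_left_mono) auto
    then have "s * (\<kappa> * (1 - q^2) / dn \<rho> q u) <= K" using f0 s(1) by (auto simp: K_def)
    moreover have "q < exp ((E - K) / (2 * (s * c)))" using q by (simp add: \<delta>_def)
    then have "ln q < (E - K) / (2 * (s * c))"
      using ln_less_cancel_iff[of q "exp ((E - K) / (2 * (s * c)))"] q(1) by simp
    then have "2 * (s * c) * ln q < E - K" using s(2) by (simp add: pos_less_divide_eq mult.commute mult.left_commute)
    moreover have "s * lv q u = s * (\<kappa> * (1 - q^2) / dn \<rho> q u) + 2 * (s * c) * ln q"
      by (simp add: lev_def \<kappa>_def algebra_simps)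
    ultimately show ?thesis by linarith
  qed
  then show thesis using that[of \<delta>] by (auto simp: \<delta>_def)
qed

end

context vortex_system
begin

definition "Pt \<sigma> q u = pz (cpt \<sigma> q u)"

abbreviation "sing \<equiv> pt (\<rho> * R) 0"

lemma Pt_facts:
  assumes "0 < q" "\<rho> * q < 1" "-1 <= u" "u <= 1" "\<sigma> = 1 \<or> \<sigma> = -1"
  shows "ch (Pt \<sigma> q u) = cpt \<sigma> q u" "Pt \<sigma> q u \<in> Om" "En (Pt \<sigma> q u) = lv q u"
    "cmod (ch (Pt \<sigma> q u)) = q" "Re (ch (Pt \<sigma> q u)) / cmod (ch (Pt \<sigma> q u)) = u"
    "Im (ch (Pt \<sigma> q u)) = \<sigma> * q * sqrt (1 - u^2)"
proof -
  note s = cpt_simps[OF less_imp_le[OF assms(1)] assms(3-5)]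
  have d: "1 + of_real \<rho> * cpt \<sigma> q u \<noteq> 0" using s assms by (intro small_den) (simp add: mult.commute)
  show ch: "ch (Pt \<sigma> q u) = cpt \<sigma> q u" unfolding Pt_def by (rule ch_pz[OF d])
  have "cpt \<sigma> q u \<noteq> 0" using s(1) assms(1) by force
  then show Om: "Pt \<sigma> q u \<in> Om" unfolding Pt_def using pz_Om[OF d] by simp
  show "cmod (ch (Pt \<sigma> q u)) = q" "Re (ch (Pt \<sigma> q u)) / cmod (ch (Pt \<sigma> q u)) = u"
    "Im (ch (Pt \<sigma> q u)) = \<sigma> * q * sqrt (1 - u^2)"
    unfolding ch using s assms(1) by simp_all
  then show "En (Pt \<sigma> q u) = lv q u" using En_ch[OF Om] by simp
qed

lemmas Pt_facts' = Pt_facts[OF _ \<rho>q[OF less_imp_le]]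

lemma Pt_surj:
  assumes "p \<in> Om"
  obtains \<sigma> where "\<sigma> = 1 \<or> \<sigma> = -1" "p = Pt \<sigma> (cmod (ch p)) (Re (ch p) / cmod (ch p))"
proof -
  obtain \<sigma> where \<sigma>: "\<sigma> = 1 \<or> \<sigma> = -1" "ch p = cpt \<sigma> (cmod (ch p)) (Re (ch p) / cmod (ch p))"
    using cpt_surj[OF ch_nz[OF assms]] by metis
  have "p = pz (ch p)" using pz_ch assms by (simp add: Om_iff)
  then show thesis using that[OF \<sigma>(1)] \<sigma>(2) unfolding Pt_def by metis
qed

lemma Pt_axis: "Pt \<sigma> q 1 = pz (of_real q)" "Pt \<sigma> q (-1) = pz (of_real (- q))"
  by (simp_all add: Pt_def cpt_axis)

lemma continuous_pz:
  assumes "continuous_on S f" "!!x. x \<in> S ==> 1 + of_real \<rho> * f x \<noteq> 0"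
  shows "continuous_on S (\<lambda>x. pz (f x))"
proof -
  have "\<forall>x\<in>S. 1 - of_real (-\<rho>) * f x \<noteq> 0" using assms(2) by simp
  then show ?thesis unfolding pz_def mob_def by (intro continuous_intros assms)
qed

lemma continuous_ch: "continuous_on (- {pt (R / \<rho>) 0}) ch"
proof -
  have "continuous_on S (zc R)" for S
    unfolding zc_def Complex_eq by (intro continuous_intros) (use R_pos in auto)
  then show ?thesis
    unfolding ch_def[abs_def] mob_def by (intro continuous_intros ballI) (use den_nz in auto)
qed

lemma Om_subset: "Om \<subseteq> - {pt (R / \<rho>) 0}" and disk_subset: "disk R \<subseteq> - {pt (R / \<rho>) 0}"
  using Om_iff disk_ne by auto

lemma sing_facts: "ch sing = 0" "sing \<notin> Om" "sing \<in> disk R" "bdf sing > 0" "sing \<noteq> pt (R / \<rho>) 0"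
proof -
  show n: "sing \<noteq> pt (R / \<rho>) 0"
  proof
    assume "sing = pt (R / \<rho>) 0"
    then have "\<rho> * \<rho> = 1" using R_pos \<rho> by (simp add: field_simps)
    then show False using \<rho>2_ne by (simp add: power2_eq_square)
  qed
  show ch: "ch sing = 0" using ch_zero_iff[OF n] by simp
  show "sing \<notin> Om" by (simp add: Om_iff)
  show "bdf sing > 0" using bdf_pos_iff_ch[OF n] ch by simp
  show "sing \<in> disk R" using disk_iff_ch[OF n] ch by simp
qed

lemma in_disk_cases: "z \<in> disk R ==> z = sing \<or> z \<in> Om"
  using disk_ne by (auto simp: Om_iff)

lemma near_sing:
  assumes "\<delta> > 0"
  shows "open {z. z \<noteq> pt (R / \<rho>) 0 \<and> cmod (ch z) < \<delta>}" "sing \<in> {z. z \<noteq> pt (R / \<rho>) 0 \<and> cmod (ch z) < \<delta>}"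
proof -
  have "open ((- {pt (R / \<rho>) 0}) \<inter> ch -` ball 0 \<delta>)"
    by (rule continuous_open_preimage[OF continuous_ch]) auto
  moreover have "(- {pt (R / \<rho>) 0}) \<inter> ch -` ball 0 \<delta> = {z. z \<noteq> pt (R / \<rho>) 0 \<and> cmod (ch z) < \<delta>}" by auto
  ultimately show "open {z. z \<noteq> pt (R / \<rho>) 0 \<and> cmod (ch z) < \<delta>}" by simp
qed (use sing_facts assms in auto)

end

section \<open>Vortices, centers and saddles\<close>

context disc_params
begin

text \<open>For \<open>q <= 1\<close> the bracket in \<open>rad\<close> is at most 4 in modulus and
  \<open>dn\<close> is at least \<open>(1 - \<rho>)^2\<close>, so \<open>krad\<close> is bounded by
  a multiple of \<open>q\<close>, uniformly in \<open>u\<close>. Hence there are no equilibria near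
  the vortex.\<close>

lemma rad_small:
  obtains q1 where "0 < q1" "q1 < 1" "!!q u. 0 < q ==> q <= q1 ==> -1 <= u ==> u <= 1 ==> \<bar>krad q u\<bar> < \<bar>c\<bar>"
proof -
  define K where "K = \<kappa> * 4 / ((1 - \<rho>)^2)^2"
  have K: "K > 0" using \<kappa>_pos \<rho> by (simp add: K_def)
  define q1 where "q1 = min (1/2) (\<bar>c\<bar> / (2 * K))"
  have q1: "0 < q1" "q1 < 1" using K c_nz by (auto simp: q1_def)
  have "\<bar>krad q u\<bar> < \<bar>c\<bar>" if q: "0 < q" "q <= q1" "-1 <= u" "u <= 1" for q u
  proof -
    have q': "q <= 1" "q^2 <= 1" using q q1 by (auto simp: power_le_one)
    have r2: "\<rho>^2 < 1" using \<rho> by (simp add: abs_square_less_1)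
    have "\<bar>q * (1 + \<rho>^2) + \<rho> * u * (1 + q^2)\<bar> <= \<bar>q * (1 + \<rho>^2)\<bar> + \<bar>\<rho> * u * (1 + q^2)\<bar>" by (rule abs_triangle_ineq)
    also have "\<bar>q * (1 + \<rho>^2)\<bar> <= 1 * 2" unfolding abs_mult using q q' r2 by (intro mult_mono) auto
    also have "\<bar>\<rho> * u * (1 + q^2)\<bar> <= (1 * 1) * 2" unfolding abs_mult using q q' \<rho> by (intro mult_mono) auto
    finally have n: "\<bar>q * (1 + \<rho>^2) + \<rho> * u * (1 + q^2)\<bar> <= 4" by simp
    have d: "(dn \<rho> q u)^2 \<ge> ((1 - \<rho>)^2)^2" using dn_lower[of q u] q q' by (intro power_mono) auto
    have d0: "((1 - \<rho>)^2)^2 > 0" using \<rho> by simp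
    have "\<bar>rad \<rho> q u\<bar> = q * \<bar>q * (1 + \<rho>^2) + \<rho> * u * (1 + q^2)\<bar> / (dn \<rho> q u)^2"
      using q by (simp add: rad_def abs_mult)
    also have "\<dots> <= q * 4 / ((1 - \<rho>)^2)^2"
      using n d d0 q by (intro frac_le mult_left_mono) auto
    finally have "\<kappa> * \<bar>rad \<rho> q u\<bar> <= \<kappa> * (q * 4 / ((1 - \<rho>)^2)^2)" using \<kappa>_pos by (intro mult_left_mono) auto
    also have "\<dots> = K * q" by (simp add: K_def)
    also have "\<dots> <= K * (\<bar>c\<bar> / (2 * K))" using q K by (intro mult_left_mono) (auto simp: q1_def)
    also have "\<dots> < \<bar>c\<bar>" using K c_nz by simp
    finally show ?thesis using \<kappa>_pos by (simp add: abs_mult)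
  qed
  then show thesis using that q1 by blast
qed

end

context vortex_system
begin

lemma sing_limit: "\<forall>\<^sub>F z in at sing. sgn c * En z < E"
proof -
  have "sgn c = 1 \<or> sgn c = -1" "sgn c * c > 0" using c_nz by (auto simp: sgn_if)
  then obtain \<delta> where \<delta>: "0 < \<delta>" "!!q u. 0 < q ==> q < \<delta> ==> -1 <= u ==> u <= 1 ==> sgn c * lv q u < E"
    using lev_to_bot by metis
  show ?thesis
    unfolding eventually_at_topological
    using near_sing[OF \<delta>(1)] \<delta>(2)[OF _ _ Re_cmod_bounds] ch_nz En_ch
    by (intro exI[of _ "{z. z \<noteq> pt (R / \<rho>) 0 \<and> cmod (ch z) < \<delta>}"]) (simp add: Om_iff)
qed

text \<open>Near the vortex \<open>- sgn c * En\<close> grows beyond all bounds and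
  \<open>rad_small\<close> excludes equilibria, so the vortex is an infinite peak. This holds for
  all parameters.\<close>

lemma vortex_sing: "vortex Om V sing"
proof -
  obtain q1 where q1: "0 < q1" "!!q u. 0 < q ==> q <= q1 ==> -1 <= u ==> u <= 1 ==> \<bar>krad q u\<bar> < \<bar>c\<bar>"
    using rad_small by metis
  obtain r where r: "r > 0" "cball sing r \<subseteq> {z. z \<noteq> pt (R / \<rho>) 0 \<and> cmod (ch z) < q1}"
    using near_sing[OF q1(1)] unfolding open_contains_cball by blast
  have Om: "z \<in> Om" if "z \<in> cball sing r - {sing}" for z using that r(2) by (auto simp: Om_iff)
  have "punctured_nhd_of_periodic_orbits Om V sing"
  proof (rule punctured_nhd_of_periodic_orbitsI[of r sing "- sgn c"])
    show "V z \<noteq> 0" if "z \<in> cball sing r - {sing}" for z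
      using q1(2)[of "cmod (ch z)", OF _ _ Re_cmod_bounds[of "ch z"]] zero_V_iff[OF Om[OF that]] ch_nz[OF Om[OF that]] that r(2) by force
    show "\<forall>\<^sub>F z in at sing. - sgn c * En p < - sgn c * En z" for p using sing_limit[of "sgn c * En p"] by simp
  qed (use r(1) Om sing_facts(2) in blast)+
  then show ?thesis by (simp add: vortex_def sing_facts)
qed

text \<open>Without equilibria the whole disk can serve as the convex region of
  \<open>encirclesI\<close>; the orbit on the circle is included.\<close>

lemma global_vortexI:
  assumes "equilibria = {}"
  shows "global_vortex Om V (disk R) sing"
  unfolding global_vortex_def
proof (intro conjI ballI)
  show "sing \<in> disk R" "sing \<notin> Om" by (rule sing_facts)+
  show d: "disk R - {sing} \<subseteq> Om" using in_disk_cases by blast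
  fix p assume p: "p \<in> disk R - {sing}"
  show "periodic_orbit_encircling Om V sing (orbit Om V p)"
  proof (rule encirclesI[OF compact_disk _ d _ _ p])
    show "\<forall>\<^sub>F z in at sing. En z \<noteq> En p"
      using sing_limit[of "sgn c * En p"] by (rule eventually_mono) auto
    show "convex (disk R)" unfolding disk_eq by (rule convex_cball)
  qed (use assms d p sing_facts disk_invariant in \<open>auto simp: equilibrium_def\<close>)
qed

end

section \<open>Critical radii on rays and the cubic of the axis\<close>

context disc_params
begin

lemma rad_end: "krad 1 (-1) = (1 + \<rho>) / (1 - \<rho>)" "krad 1 1 = (1 - \<rho>) / (1 + \<rho>)"
proof -
  have k: "\<kappa> = (1 - \<rho>) * (1 + \<rho>)" by (simp add: \<kappa>_def algebra_simps power2_eq_square)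
  have d: "dn \<rho> 1 (-1) = (1 - \<rho>)^2" "dn \<rho> 1 1 = (1 + \<rho>)^2" by (simp_all add: dn_def algebra_simps power2_eq_square)
  show "krad 1 (-1) = (1 + \<rho>) / (1 - \<rho>)" "krad 1 1 = (1 - \<rho>) / (1 + \<rho>)"
    using \<rho> by (simp_all add: rad_one k d power2_eq_square)
qed

lemma rad_one_pos: "-1 <= u ==> rad \<rho> 1 u > 0"
  using dn_pos'[of 1 u] by (simp add: rad_one)

lemma rad_one_anti: "-1 <= u ==> u < v ==> rad \<rho> 1 v < rad \<rho> 1 u"
  using dn_pos'[of 1 u] dn_pos'[of 1 v] \<rho> by (simp add: rad_one frac_less2 dn_def)

lemma rad_one_anti_le: "-1 <= u ==> u <= v ==> rad \<rho> 1 v <= rad \<rho> 1 u"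
  using rad_one_anti[of u v] by (cases "u = v") auto

text \<open>Since \<open>c > 0\<close>, reaching the value \<open>c\<close> makes \<open>rad\<close>
  positive, and from there on it increases. So \<open>krad\<close> takes the value \<open>c\<close>
  at most once on each ray.\<close>

lemma rad_threshold:
  assumes "c > 0" "0 < q" "q < q'" "q' <= 1" "-1 <= u" "u <= 1" "c <= krad q u"
  shows "c < krad q' u"
proof -
  have "krad q u > 0" using assms by linarith
  then have "rad \<rho> q u > 0" using \<kappa>_pos by (simp add: zero_less_mult_iff)
  then have "krad q u < krad q' u"
    using rad_increasing[of q q' u] assms \<kappa>_pos by simp
  then show ?thesis using assms by linarith
qed

lemma continuous_on_rad_q: "0 < a ==> b <= 1 ==> -1 <= u ==> continuous_on {a..b} (\<lambda>q. rad \<rho> q u)"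
  by (intro continuous_on_rad continuous_on_id continuous_on_const dn_nz) auto

lemma crit_exists:
  assumes "c > 0" "c < krad 1 u" "-1 <= u" "u <= 1"
  obtains q where "0 < q" "q < 1" "krad q u = c"
    "!!t. 0 < t ==> t < q ==> krad t u < c" "!!t. q < t ==> t <= 1 ==> c < krad t u"
proof -
  obtain q1 where q1: "0 < q1" "q1 < 1" "!!q u. 0 < q ==> q <= q1 ==> -1 <= u ==> u <= 1 ==> \<bar>krad q u\<bar> < \<bar>c\<bar>"
    using rad_small by metis
  have "krad q1 u <= c" using q1(3)[of q1 u] assms q1(1) by auto
  then have "\<exists>q\<ge>q1. q <= 1 \<and> krad q u = c"
    by (intro IVT') (use assms q1 in \<open>auto intro!: continuous_intros continuous_on_rad_q\<close>)
  then obtain q where q: "q1 <= q" "q <= 1" "krad q u = c" by blast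
  have "q \<noteq> 1" using q assms by auto
  then have q': "0 < q" "q < 1" using q q1 by auto
  show thesis
  proof (rule that[OF q' q(3)])
    show "krad t u < c" if "0 < t" "t < q" for t
      using rad_threshold[OF assms(1) that] q assms(3,4) by force
    show "c < krad t u" if "q < t" "t <= 1" for t
      using rad_threshold[OF assms(1) q'(1) that assms(3,4)] q by simp
  qed
qed

text \<open>With \<open>x\<close> the abscissa in units of \<open>R\<close>, \<open>krad\<close> on
  the ray \<open>u = -1\<close> equals \<open>- cub x / \<kappa>\<close>; this reduces the
  equilibria on that ray to \<open>cub x = - \<kappa> * c\<close>. The discriminant of the
  derivative gives \<open>sq\<close>, and \<open>xp\<close> is its smaller root, the local maximum
  of the cubic.\<close>

definition "cub x = x * (\<rho> - x) * (1 - \<rho> * x)"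
definition "cub' x = 3 * \<rho> * x^2 - 2 * (1 + \<rho>^2) * x + \<rho>"
definition "sq = sqrt (1 - \<rho>^2 + \<rho>^4)"
definition "xp = (1 + \<rho>^2 - sq) / (3 * \<rho>)"

lemma sq2: "sq^2 = 1 - \<rho>^2 + \<rho>^4" "sq > 0"
proof -
  have "1 - \<rho>^2 + \<rho>^4 = \<kappa> + (\<rho>^2)^2" by (simp add: \<kappa>_def)
  then have p: "1 - \<rho>^2 + \<rho>^4 > 0" using \<kappa>_pos by (simp add: add_pos_nonneg)
  then show "sq^2 = 1 - \<rho>^2 + \<rho>^4" "sq > 0" by (simp_all add: sq_def)
qed

lemma cub_deriv: "(cub has_real_derivative cub' x) (at x)"
proof -
  have eq: "cub = (\<lambda>x. \<rho> * x - (1 + \<rho>^2) * x^2 + \<rho> * x^3)"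
    by (simp add: fun_eq_iff cub_def algebra_simps power2_eq_square power3_eq_cube)
  show ?thesis unfolding eq cub'_def by (auto intro!: derivative_eq_intros simp: algebra_simps)
qed

lemma cub'_factor: "cub' x = 3 * \<rho> * (x - xp) * (x - (1 + \<rho>^2 + sq) / (3 * \<rho>))"
proof -
  have "9 * \<rho> * cub' x = 9 * \<rho> * (3 * \<rho> * (x - xp) * (x - (1 + \<rho>^2 + sq) / (3 * \<rho>)))"
  proof -
    have "9 * \<rho> * (3 * \<rho> * (x - xp) * (x - (1 + \<rho>^2 + sq) / (3 * \<rho>))) = 3 * ((3 * \<rho> * x - (1 + \<rho>^2) + sq) * (3 * \<rho> * x - (1 + \<rho>^2) - sq))"
      using \<rho> by (simp add: xp_def field_simps)
    also have "\<dots> = 3 * ((3 * \<rho> * x - (1 + \<rho>^2))^2 - sq^2)" by (simp add: algebra_simps power2_eq_square)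
    also have "\<dots> = 9 * \<rho> * cub' x"
      unfolding sq2(1) cub'_def by (simp add: algebra_simps power2_eq_square power4_eq_xxxx)
    finally show ?thesis by (rule sym)
  qed
  then show ?thesis using \<rho> by simp
qed

text \<open>Each bound isolates \<open>sq\<close> and compares squares; the three differences are
  \<open>3 \<rho>^2\<close>, \<open>3 \<rho>^2 \<kappa>\<close> and
  \<open>6 \<rho> (1 - \<rho>)^2\<close>.\<close>

lemma xp_bounds: "0 < xp" "xp < \<rho>" "1 < (1 + \<rho>^2 + sq) / (3 * \<rho>)"
proof -
  have "sq^2 < (1 + \<rho>^2)^2"
    unfolding sq2(1) using \<rho> by (simp add: algebra_simps power2_eq_square power4_eq_xxxx)
  then have "sq < 1 + \<rho>^2" by (rule power_less_imp_less_base) simp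
  then show "0 < xp" using \<rho> by (simp add: xp_def)
  have "(1 - 2 * \<rho>^2)^2 < sq^2"
  proof -
    have "sq^2 - (1 - 2 * \<rho>^2)^2 = 3 * \<rho>^2 * \<kappa>"
      unfolding sq2(1) \<kappa>_def by (simp add: algebra_simps power2_eq_square power4_eq_xxxx)
    moreover have "3 * \<rho>^2 * \<kappa> > 0" using \<rho> \<kappa>_pos by simp
    ultimately show ?thesis by linarith
  qed
  then have "1 - 2 * \<rho>^2 < sq" using sq2(2) by (meson less_imp_le power_less_imp_less_base)
  then show "xp < \<rho>" using \<rho> by (simp add: xp_def field_simps power2_eq_square)
  have "(3 * \<rho> - 1 - \<rho>^2)^2 < sq^2"
  proof -
    have "sq^2 - (3 * \<rho> - 1 - \<rho>^2)^2 = 6 * \<rho> * (1 - \<rho>)^2"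
      unfolding sq2(1) by (simp add: algebra_simps power2_eq_square power4_eq_xxxx power3_eq_cube)
    moreover have "6 * \<rho> * (1 - \<rho>)^2 > 0" using \<rho> by simp
    ultimately show ?thesis by linarith
  qed
  then have "3 * \<rho> - 1 - \<rho>^2 < sq" using sq2(2) by (meson less_imp_le power_less_imp_less_base)
  then show "1 < (1 + \<rho>^2 + sq) / (3 * \<rho>)" using \<rho> by (simp add: field_simps)
qed

lemma cub'_sign: "x < xp ==> cub' x > 0" "xp < x ==> x <= 1 ==> cub' x < 0"
proof -
  define r where "r = (1 + \<rho>^2 + sq) / (3 * \<rho>)"
  have r: "r > 1" "xp < 1" using xp_bounds \<rho> by (auto simp: r_def[symmetric])
  have f: "cub' x = 3 * \<rho> * ((x - xp) * (x - r))" using cub'_factor by (simp add: r_def)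
  show "cub' x > 0" if "x < xp"
    unfolding f using \<rho> r that by (intro mult_pos_pos mult_neg_neg) auto
  show "cub' x < 0" if "xp < x" "x <= 1"
    unfolding f using \<rho> r that by (intro mult_pos_neg) auto
qed

lemma cub_mono: "a < b ==> b <= xp ==> cub a < cub b"
  by (rule DERIV_pos_imp_increasing_open[of a b cub])
     (use cub_deriv cub'_sign in \<open>auto intro!: exI DERIV_continuous_on intro: has_field_derivative_at_within\<close>)

lemma cub_anti: "xp <= a ==> a < b ==> b <= 1 ==> cub b < cub a"
  by (rule DERIV_neg_imp_decreasing_open[of a b cub])
     (use cub_deriv cub'_sign in \<open>auto intro!: exI DERIV_continuous_on intro: has_field_derivative_at_within\<close>)

lemma cub_max: "0 < x ==> x <= 1 ==> x \<noteq> xp ==> cub x < cub xp"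
  using cub_mono[of x xp] cub_anti[of xp x] by linarith

text \<open>The abscissa of the point with \<open>\<zeta> = -q\<close>; this map is an involution.\<close>

definition "ax q = (\<rho> - q) / (1 - \<rho> * q)"

lemma ax_facts:
  assumes "0 < q" "q < 1"
  shows "1 - \<rho> * q > 0" "-1 < ax q" "ax q < \<rho>" "ax (ax q) = q" "0 < ax q \<longleftrightarrow> q < \<rho>" "krad q (-1) = - cub (ax q) / \<kappa>"
    "1 - \<rho> * ax q > 0"
proof -
  show d: "1 - \<rho> * q > 0" using \<rho>q[of q] assms by simp
  have "(1 - q) * (1 + \<rho>) > 0" using assms \<rho> by simp
  then show "-1 < ax q" using d by (simp add: ax_def field_simps)
  have "\<rho> - ax q = q * \<kappa> / (1 - \<rho> * q)"
    using d by (simp add: ax_def \<kappa>_def field_simps power2_eq_square)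
  moreover have "q * \<kappa> / (1 - \<rho> * q) > 0" using d assms \<kappa>_pos by simp
  ultimately show "ax q < \<rho>" by linarith
  have e: "1 - \<rho> * ax q = \<kappa> / (1 - \<rho> * q)" using d by (simp add: ax_def \<kappa>_def field_simps power2_eq_square)
  then show "1 - \<rho> * ax q > 0" using d \<kappa>_pos by simp
  have f: "\<rho> - ax q = q * \<kappa> / (1 - \<rho> * q)" by fact
  show "ax (ax q) = q" using e f d \<kappa>_pos by (simp add: ax_def[of "ax q"])
  show "0 < ax q \<longleftrightarrow> q < \<rho>" using d by (simp add: ax_def zero_less_divide_iff)
  have aux: "k * (q * (q - \<rho>) / D ^ 3) = - ((\<rho> - q) / D * (q * k / D) * (k / D)) / k" if "k \<noteq> 0" "D \<noteq> 0" for k D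
    using that by (simp add: field_simps power3_eq_cube)
  have "rad \<rho> q (-1) = q * (q - \<rho>) / (1 - \<rho> * q) ^ 3" using d by (intro rad_axis) simp
  then show "krad q (-1) = - cub (ax q) / \<kappa>"
    unfolding cub_def e f using aux[of \<kappa> "1 - \<rho> * q"] \<kappa>_pos d by (simp add: ax_def)
qed

lemma ax_anti: "0 < q ==> q < q' ==> q' <= 1 ==> ax q' < ax q"
proof -
  assume a: "0 < q" "q < q'" "q' <= 1"
  have d: "1 - \<rho> * q > 0" "1 - \<rho> * q' > 0" using \<rho>q[of q] \<rho>q[of q'] a by auto
  have "ax q - ax q' = (q' - q) * \<kappa> / ((1 - \<rho> * q) * (1 - \<rho> * q'))"
    using d by (simp add: ax_def \<kappa>_def field_simps power2_eq_square)
  moreover have "(q' - q) * \<kappa> / ((1 - \<rho> * q) * (1 - \<rho> * q')) > 0" using d a \<kappa>_pos by simp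
  ultimately show ?thesis by linarith
qed

text \<open>Passing to \<open>u = -1\<close> lowers the bracket, which is not positive, and shrinks
  the denominator; both changes lower the quotient. For \<open>c < 0\<close> this reduces lower
  bounds on all rays to the single ray \<open>u = -1\<close>.\<close>

lemma rad_neg:
  assumes "0 < q" "q <= 1" "-1 < u" "rad \<rho> q u <= 0"
  shows "rad \<rho> q (-1) < rad \<rho> q u"
proof -
  define N where "N u = q * (1 + \<rho>^2) + \<rho> * u * (1 + q^2)" for u
  have d: "0 < dn \<rho> q (-1)" "dn \<rho> q (-1) < dn \<rho> q u"
  proof -
    have "dn \<rho> q u - dn \<rho> q (-1) = 2 * (\<rho> * q) * (u + 1)" by (simp add: dn_def algebra_simps)
    moreover have "2 * (\<rho> * q) * (u + 1) > 0" using assms \<rho> by simp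
    ultimately show "dn \<rho> q (-1) < dn \<rho> q u" by linarith
  qed (use dn_pos'[of q "-1"] assms in simp)
  have "\<rho> * (-1) * (1 + q^2) < \<rho> * u * (1 + q^2)"
    using assms \<rho> by (intro mult_strict_right_mono mult_strict_left_mono) (auto simp: add_pos_nonneg)
  then have N: "N (-1) < N u" by (simp add: N_def)
  have Nu: "N u <= 0" using assms(1,4) d by (simp add: rad_def N_def divide_le_0_iff mult_le_0_iff)
  have "N (-1) / (dn \<rho> q (-1))^2 < N u / (dn \<rho> q u)^2"
  proof -
    have "(dn \<rho> q (-1))^2 < (dn \<rho> q u)^2" using d by (intro power_strict_mono) auto
    then have "- N u / (dn \<rho> q u)^2 <= - N u / (dn \<rho> q (-1))^2"
      using Nu d by (intro divide_left_mono) auto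
    also have "\<dots> < - N (-1) / (dn \<rho> q (-1))^2" using N d by (intro divide_strict_right_mono) auto
    finally show ?thesis by simp
  qed
  from mult_strict_left_mono[OF this assms(1)]
  show ?thesis by (simp add: rad_def N_def)
qed

lemma rad_axis_pos: "0 < q ==> rad \<rho> q 1 > 0"
  using \<rho> by (subst rad_axis(2)) (auto intro!: divide_pos_pos mult_pos_pos add_pos_pos)

text \<open>Since \<open>3 \<rho> xp = 1 + \<rho>^2 - sq\<close> and
  \<open>sq^2 = 1 - \<rho>^2 + \<rho>^4\<close>, the number \<open>27 \<rho>^2 cub xp\<close> is
  minus the bracket in \<open>bif_fun\<close>, the power 3/2 being \<open>sq^3\<close>. So
  \<open>bif_fun\<close> measures how far the maximum of the cubic lies above the level
  \<open>- \<kappa> c\<close>.\<close>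

lemma bif_fun_cub:
  assumes "\<phi> < 0" "c = 1 / \<phi>"
  shows "bif_fun \<rho> \<phi> = 27 * \<rho>^2 * (- \<phi>) * (cub xp + \<kappa> * c)"
proof -
  have "(1 - \<rho>^2 + \<rho>^4) powr (3/2) = (sq powr 2) powr (3/2)"
    using sq2 by (simp add: powr_numeral)
  also have "\<dots> = sq powr 3" unfolding powr_powr by simp
  also have "\<dots> = sq ^ 3" by (rule powr_numeral[OF less_imp_le[OF sq2(2)]])
  finally have p: "(1 - \<rho>^2 + \<rho>^4) powr (3/2) = sq ^ 3" .
  have "27 * \<rho>^3 * cub xp = \<rho> * ((3 * \<rho> * xp) * (3 * \<rho>^2 - 3 * \<rho> * xp) * (3 - 3 * \<rho> * xp))"
    by (simp add: cub_def algebra_simps power2_eq_square power3_eq_cube)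
  also have "3 * \<rho> * xp = 1 + \<rho>^2 - sq" using \<rho> by (simp add: xp_def)
  also have "(1 + \<rho>^2 - sq) * (3 * \<rho>^2 - (1 + \<rho>^2 - sq)) * (3 - (1 + \<rho>^2 - sq)) = - (2 - 3 * \<rho>^2 - 3 * \<rho>^4 + 2 * \<rho>^6 - 2 * sq ^ 3)"
  proof -
    have "(1 + \<rho>^2 - sq) * (3 * \<rho>^2 - (1 + \<rho>^2 - sq)) * (3 - (1 + \<rho>^2 - sq))
      = (1 + \<rho>^2) * (2 * \<rho>^2 - 1) * (2 - \<rho>^2) + 3 * ((1 - \<rho>^2 + \<rho>^4) * sq) - sq ^ 3"
      by algebra
    also have "(1 - \<rho>^2 + \<rho>^4) * sq = sq ^ 3"
      unfolding sq2(1)[symmetric] by (simp add: power2_eq_square power3_eq_cube)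
    finally show ?thesis by algebra
  qed
  finally have "\<rho> * (27 * \<rho>^2 * cub xp) = \<rho> * - (2 - 3 * \<rho>^2 - 3 * \<rho>^4 + 2 * \<rho>^6 - 2 * sq ^ 3)"
    by (simp add: power2_eq_square power3_eq_cube mult.assoc mult.left_commute)
  then have J: "27 * \<rho>^2 * cub xp = - (2 - 3 * \<rho>^2 - 3 * \<rho>^4 + 2 * \<rho>^6 - 2 * sq ^ 3)" using \<rho> by simp
  define X where "X = 2 - 3 * \<rho>^2 - 3 * \<rho>^4 + 2 * \<rho>^6 - 2 * sq ^ 3"
  have JX: "27 * \<rho>^2 * cub xp = - X" using J by (simp add: X_def)
  have "27 * \<rho>^2 * (- \<phi>) * (cub xp + \<kappa> * c) = - \<phi> * (27 * \<rho>^2 * cub xp) - 27 * \<rho>^2 * \<kappa> * (\<phi> * c)"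
    by (simp add: algebra_simps)
  also have "\<dots> = 27 * \<rho>^2 * (- \<kappa>) + \<phi> * X"
    unfolding JX using assms by simp
  finally show ?thesis unfolding bif_fun_def p X_def[symmetric] by (simp add: \<kappa>_def)
qed

end

section \<open>Equilibria of the disk and their linear types\<close>

context vortex_system
begin

lemma pz_real: "pz (of_real t) = pt (R * ((t + \<rho>) / (1 + \<rho> * t))) 0"
proof -
  have "mob (-\<rho>) (of_real t) = of_real ((t + \<rho>) / (1 + \<rho> * t))" by (simp add: mob_def)
  then show ?thesis unfolding pz_def by simp
qed

lemma Pt_axis_pt: "Pt \<sigma> q (-1) = pt (R * ax q) 0" "Pt \<sigma> q 1 = pt (R * ((q + \<rho>) / (1 + \<rho> * q))) 0"
  unfolding Pt_axis pz_real ax_def by simp_all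

lemma equilibria_disk:
  "equilibria =
   {Pt \<sigma> q u | \<sigma> q u. (\<sigma> = 1 \<or> \<sigma> = -1) \<and> 0 < q \<and> q <= 1 \<and> -1 <= u \<and> u <= 1 \<and> krad q u = c \<and> (q = 1 \<or> u = -1 \<or> u = 1)}"
  (is "?L = ?R")
proof
  show "?L \<subseteq> ?R"
  proof
    fix p assume "p \<in> ?L"
    then have p: "p \<in> disk R" "p \<in> Om" "V p = 0" by (auto simp: equilibrium_def)
    obtain \<sigma> where \<sigma>: "\<sigma> = 1 \<or> \<sigma> = -1" "p = Pt \<sigma> (cmod (ch p)) (Re (ch p) / cmod (ch p))"
      using Pt_surj[OF p(2)] by metis
    define q u where "q = cmod (ch p)" and "u = Re (ch p) / cmod (ch p)"
    have q: "0 < q" "q <= 1" using ch_nz[OF p(2)] disk_iff_ch[OF disk_ne[OF p(1)]] p(1) by (auto simp: q_def)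
    have u: "-1 <= u" "u <= 1" using Re_cmod_bounds by (auto simp: u_def)
    have z: "krad q u = c" "q = 1 \<or> Im (ch p) = 0" using zero_V_iff[OF p(2)] p(3) by (auto simp: q_def u_def)
    have "q = 1 \<or> u = -1 \<or> u = 1"
    proof (cases "q = 1")
      case False
      then have "Im (ch p) = 0" using z by simp
      then have "q = \<bar>Re (ch p)\<bar>" by (simp add: q_def cmod_def)
      then show ?thesis using q by (auto simp: u_def q_def[symmetric] abs_if split: if_splits)
    qed simp
    moreover have "p = Pt \<sigma> q u" using \<sigma>(2) by (simp add: q_def u_def)
    ultimately show "p \<in> ?R" using \<sigma>(1) q u z(1) by blast
  qed
  show "?R \<subseteq> ?L"
  proof
    fix p assume "p \<in> ?R"
    then obtain \<sigma> q u where h: "p = Pt \<sigma> q u" "\<sigma> = 1 \<or> \<sigma> = -1" "0 < q" "q <= 1" "-1 <= u" "u <= 1"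
      "krad q u = c" "q = 1 \<or> u = -1 \<or> u = 1" by blast
    note P = Pt_facts'[OF h(3) h(3,4,5,6,2), folded h(1)]
    have "Im (ch p) = 0 \<or> q = 1" using P(6) h(8) by auto
    then have "V p = 0" using zero_V_iff[OF P(2)] P(4,5) h(7) by auto
    moreover have "p \<in> disk R" using disk_iff_ch[of p] P(2,4) h(4) by (simp add: Om_iff)
    ultimately show "p \<in> ?L" using P(2) by (simp add: equilibrium_def)
  qed
qed

lemma jacobian_V:
  assumes "p \<in> Om"
  shows "V differentiable (at p)" "jacobian V (at p) *v v = jac p v"
    "det (jacobian V (at p)) = - ((j11 p)^2 + j12 p * j21 p)"
proof -
  show d: "V differentiable (at p)" using dV[OF assms] differentiable_def by blast
  have f: "frechet_derivative V (at p) = jac p" using frechet_derivative_at[OF dV[OF assms]] by simp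
  have lin: "linear (jac p)" using bounded_linear_jac bounded_linear.linear by blast
  show jv: "jacobian V (at p) *v v = jac p v" for v
    unfolding jacobian_def f by (rule matrix_works) (simp add: linear_matrix_vector_mul_eq lin)
  have "jacobian V (at p) $ i $ j = jac p (axis j 1) $ i" for i j
    unfolding jacobian_def f matrix_def by simp
  then have "jacobian V (at p) $ 1 $ 1 = j11 p" "jacobian V (at p) $ 1 $ 2 = j12 p"
    "jacobian V (at p) $ 2 $ 1 = j21 p" "jacobian V (at p) $ 2 $ 2 = - j11 p"
    by (simp_all add: jac_def axis_def)
  then show "det (jacobian V (at p)) = - ((j11 p)^2 + j12 p * j21 p)"
    by (simp add: det_2 power2_eq_square)
qed

text \<open>For trace zero the characteristic equation is \<open>l^2 = - det\<close>. The
  eigenvectors are explicit; in the triangular case \<open>l\<close> is one of the two diagonal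
  entries.\<close>

lemma eigenvalue_jac:
  assumes "p \<in> Om" "l^2 = (j11 p)^2 + j12 p * j21 p" "l \<noteq> 0"
  shows "eigenvalue (jacobian V (at p)) l"
proof -
  define a b d where "a = j11 p" and "b = j12 p" and "d = j21 p"
  have l2: "l * l = a * a + b * d" using assms(2) by (simp add: a_def b_def d_def power2_eq_square)
  have "\<exists>v. v \<noteq> 0 \<and> pt (a * v$1 + b * v$2) (d * v$1 - a * v$2) = l *\<^sub>R v"
  proof (cases "b = 0")
    case False
    have "pt b (l - a) \<noteq> 0" using False by (simp add: vec2_eq_iff)
    moreover have "d * b - a * (l - a) = l * (l - a)" using l2 by (simp add: algebra_simps)
    ultimately show ?thesis by (intro exI[of _ "pt b (l - a)"]) (simp add: vec2_eq_iff algebra_simps)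
  next
    case True
    then have "l * l = a * a" using l2 by simp
    then have "l = a \<or> l = - a" by (simp add: square_eq_iff)
    then show ?thesis
    proof
      assume la: "l = a"
      have "pt (2 * a) d \<noteq> 0" using la assms(3) by (simp add: vec2_eq_iff)
      then show ?thesis using True la
        by (intro exI[of _ "pt (2 * a) d"]) (simp add: vec2_eq_iff algebra_simps)
    next
      assume "l = - a"
      moreover have "pt 0 1 \<noteq> 0" by (simp add: vec2_eq_iff)
      ultimately show ?thesis using True by (intro exI[of _ "pt 0 1"]) (simp add: vec2_eq_iff)
    qed
  qed
  then show ?thesis
    unfolding eigenvalue_def jacobian_V(2)[OF assms(1)] jac_def a_def b_def d_def .
qed

lemma hyperbolic_saddleI:
  assumes "equilibrium Om V p" "(j11 p)^2 + j12 p * j21 p > 0"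
  shows "hyperbolic_saddle Om V p"
proof -
  have p: "p \<in> Om" using assms(1) by (simp add: equilibrium_def)
  define l where "l = sqrt ((j11 p)^2 + j12 p * j21 p)"
  have "l > 0" "l^2 = (j11 p)^2 + j12 p * j21 p" using assms(2) by (simp_all add: l_def)
  then have "- l < 0" "0 < l" "eigenvalue (jacobian V (at p)) (- l)" "eigenvalue (jacobian V (at p)) l"
    using eigenvalue_jac[OF p, of "- l"] eigenvalue_jac[OF p, of l] by auto
  then show ?thesis unfolding hyperbolic_saddle_def using assms(1) jacobian_V(1)[OF p] by blast
qed

text \<open>The equation of the equilibrium eliminates \<open>c\<close> from the Jacobian. What
  remains shows both ways of degenerating: \<open>j21\<close> vanishes at critical points of the
  cubic, \<open>j12\<close> where the axis meets the circle.\<close>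

lemma jac_axis:
  assumes "equilibrium Om V (pt (R * X) 0)"
  shows "j11 (pt (R * X) 0) = 0"
    "j12 (pt (R * X) 0) = \<theta> * (\<rho> * (1 - X^2) / ((X - \<rho>) * (1 - \<rho> * X)))"
    "j21 (pt (R * X) 0) = - \<theta> * cub' X / ((X - \<rho>) * (1 - \<rho> * X))"
    "(X - \<rho>) * (1 - \<rho> * X) \<noteq> 0"
proof -
  define p where "p = pt (R * X) 0"
  have p: "p \<in> Om" "V p = 0" using assms by (auto simp: p_def equilibrium_def)
  define m e where "m = X - \<rho>" and "e = 1 - \<rho> * X"
  have ab: "p$1 - \<rho> * R = R * m" "p$1 - R / \<rho> = - (R / \<rho>) * e"
    using \<rho> by (simp_all add: p_def m_def e_def field_simps)
  have A: "AA p = (R * m)^2" "BB p = ((R / \<rho>) * e)^2"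
    using ab by (simp_all add: AA_def BB_def) (simp_all add: p_def)
  have nz: "m \<noteq> 0" "e \<noteq> 0" "R \<noteq> 0" "\<rho> \<noteq> 0" using AB_pos[OF p(1)] A R_pos \<rho> by auto
  then show "(X - \<rho>) * (1 - \<rho> * X) \<noteq> 0" by (simp add: m_def e_def)
  have "V p $ 2 = 0" using p(2) by simp
  then have "R * X = R^2 * c * ((R * m) / (R * m)^2 - (- (R / \<rho>) * e) / ((R / \<rho>) * e)^2)"
    unfolding V_eq vector_2 A ab using \<theta>_nz by (simp add: p_def)
  also have "\<dots> = R * (c * (1 / m + \<rho> / e))" using nz by (simp add: field_simps power2_eq_square)
  finally have X: "X = c * (1 / m + \<rho> / e)" using R_pos by simp
  show "j11 (pt (R * X) 0) = 0" by (simp add: j11_def)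
  \<comment> \<open>The off-diagonal entries are \<open>\<theta> (t - 1)\<close> and
    \<open>\<theta> (t + 1)\<close>, and the equation of the equilibrium factors \<open>t\<close> as
    \<open>X (1 / m - \<rho> / e)\<close>.\<close>
  define t where "t = R^2 * c * (1 / AA p - 1 / BB p)"
  have "t = c * (1 / m^2 - \<rho>^2 / e^2)"
    unfolding t_def A using nz by (simp add: field_simps power2_eq_square)
  also have "\<dots> = c * (1 / m + \<rho> / e) * (1 / m - \<rho> / e)" by (simp add: algebra_simps power2_eq_square)
  finally have t: "t = X * (1 / m - \<rho> / e)" using X by simp
  have t': "t = X * (e - \<rho> * m) / (m * e)" unfolding t using nz by (simp add: field_simps)
  have "t - 1 = (X * (e - \<rho> * m) - m * e) / (m * e)" unfolding t' using nz by (simp add: field_simps)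
  also have "X * (e - \<rho> * m) - m * e = \<rho> * (1 - X^2)" by (simp add: m_def e_def algebra_simps power2_eq_square)
  finally have t1: "t - 1 = \<rho> * (1 - X^2) / (m * e)" .
  have "t + 1 = (X * (e - \<rho> * m) + m * e) / (m * e)" unfolding t' using nz by (simp add: field_simps)
  also have "X * (e - \<rho> * m) + m * e = - cub' X" by (simp add: m_def e_def cub'_def algebra_simps power2_eq_square)
  finally have t2: "t + 1 = - cub' X / (m * e)" .
  have "j12 p = \<theta> * (t - 1)" by (simp add: j12_def t_def) (simp add: p_def)
  then show "j12 (pt (R * X) 0) = \<theta> * (\<rho> * (1 - X^2) / ((X - \<rho>) * (1 - \<rho> * X)))"
    unfolding t1 by (simp add: p_def m_def e_def)
  have sq: "(p$1 - \<rho> * R)^2 = AA p" "(p$1 - R / \<rho>)^2 = BB p" by (simp_all add: AA_def BB_def) (simp_all add: p_def)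
  have AB: "AA p > 0" "BB p > 0" using AB_pos[OF p(1)] by auto
  have "j21 p = \<theta> * (1 - R^2 * c * (1 / AA p - 2 * (1 / AA p) - 1 / BB p + 2 * (1 / BB p)))"
    unfolding j21_def sq using AB by (simp add: power2_eq_square)
  also have "\<dots> = \<theta> * (t + 1)" by (simp add: t_def algebra_simps)
  finally show "j21 (pt (R * X) 0) = - \<theta> * cub' X / ((X - \<rho>) * (1 - \<rho> * X))"
    unfolding t2 by (simp add: p_def m_def e_def)
qed

lemma axis_saddle:
  assumes "equilibrium Om V (pt (R * X) 0)" "-1 < X" "X < 1" "cub' X < 0"
  shows "hyperbolic_saddle Om V (pt (R * X) 0)"
proof (rule hyperbolic_saddleI[OF assms(1)])
  note j = jac_axis[OF assms(1)]
  define g where "g = (X - \<rho>) * (1 - \<rho> * X)"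
  have "X^2 < 1" using assms by (simp add: abs_square_less_1)
  have "(\<theta> * (\<rho> * (1 - X^2) / g)) * (- \<theta> * cub' X / g) = (\<theta> / g)^2 * (\<rho> * (1 - X^2) * (- cub' X))"
    by (simp add: power2_eq_square)
  also have "\<dots> > 0" using j(4) \<theta>_nz \<rho> \<open>X^2 < 1\<close> assms(4) by (intro mult_pos_pos) (auto simp: g_def)
  finally show "(j11 (pt (R * X) 0))^2 + j12 (pt (R * X) 0) * j21 (pt (R * X) 0) > 0"
    unfolding j(1,2,3) by (simp add: g_def)
qed

text \<open>Once the first equation of the equilibrium is inserted, \<open>- det\<close> is the
  square of \<open>K y i j (a - b)\<close>, which is nonzero because the two singular points are
  distinct.\<close>

lemma boundary_saddle:
  assumes eq: "equilibrium Om V p" and y: "p$2 \<noteq> 0"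
  shows "hyperbolic_saddle Om V p"
proof (rule hyperbolic_saddleI[OF eq])
  have p: "p \<in> Om" "V p = 0" using eq by (auto simp: equilibrium_def)
  define y a b A B where d: "y = p$2" "a = p$1 - \<rho> * R" "b = p$1 - R / \<rho>" "A = AA p" "B = BB p"
  have AB0: "A > 0" "B > 0" using AB_pos[OF p(1)] d by auto
  have "V p $ 1 = 0" using p(2) by simp
  then have "\<theta> * y * (R^2 * c * (1 / A - 1 / B) - 1) = 0"
    unfolding V_eq vector_2 d[symmetric] by (simp add: algebra_simps)
  then have 1: "R^2 * c * (1 / A - 1 / B) = 1" using \<theta>_nz y by (simp add: d)
  define K i j where "K = 2 * \<theta> * (R^2 * c)" and "i = 1 / A" and "j = 1 / B"
  have ij: "1 / A^2 = i^2" "1 / B^2 = j^2" by (simp_all add: i_def j_def power_divide)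
  have f: "w / A^2 = w * i^2" "w / B^2 = w * j^2" for w unfolding ij[symmetric] by simp_all
  have "j11 p = K * y * (b * j^2 - a * i^2)"
    unfolding j11_def d[symmetric] f by (simp add: K_def algebra_simps)
  moreover have "j12 p = K * y^2 * (j^2 - i^2)"
    unfolding j12_def d[symmetric] f 1 by (simp add: K_def algebra_simps power2_eq_square)
  moreover have "j21 p = K * (a^2 * i^2 - b^2 * j^2)"
  proof -
    have "j21 p = \<theta> * (1 - R^2 * c * (1 / A - 1 / B) + 2 * (R^2 * c) * (a^2 * i^2 - b^2 * j^2))"
      unfolding j21_def d[symmetric] f by (simp add: algebra_simps)
    then show ?thesis unfolding 1 by (simp add: K_def)
  qed
  ultimately have "(j11 p)^2 + j12 p * j21 p = (K * y * i * j * (a - b))^2" by algebra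
  moreover have "a - b \<noteq> 0"
  proof
    assume "a - b = 0"
    then have "\<rho> * R = R / \<rho>" by (simp add: d)
    then have "\<rho> * \<rho> = 1" using R_pos \<rho> by (simp add: field_simps)
    then show False using \<rho>2_ne by (simp add: power2_eq_square)
  qed
  then have "K * y * i * j * (a - b) \<noteq> 0"
    using \<theta>_nz R_pos c_nz y AB0 by (simp add: K_def i_def j_def d)
  ultimately show "(j11 p)^2 + j12 p * j21 p > 0" by simp
qed

text \<open>Along the ray \<open>u = -1\<close> the level has a strict maximum at \<open>qc\<close>,
  and for fixed radius it decreases in \<open>u\<close>. So the equilibrium is a strict local
  maximum of \<open>En\<close>, isolated among the equilibria. The sign of \<open>c\<close> does not
  matter.\<close>

lemma center_local:
  assumes q: "0 < a" "a < qc" "qc < b" "b <= 1"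
    and inc: "!!q. a < q ==> q < qc ==> krad q (-1) < c"
    and dec: "!!q. qc < q ==> q < b ==> c < krad q (-1)"
    and crit: "krad qc (-1) = c"
  shows "center Om V (pt (R * ax qc) 0)"
proof -
  define x where "x = Pt 1 qc (-1)"
  have qc: "0 < qc" "qc <= 1" using q by auto
  note X = Pt_facts'[OF qc(1) qc, of "-1" 1, folded x_def, simplified]
  have Vx: "V x = 0" using X zero_V_iff[OF X(2)] crit by simp
  have max: "lv t (-1) < lv qc (-1)" if "a < t" "t < b" "t \<noteq> qc" for t
    using lev_increasing[of t qc "-1"] lev_decreasing[of qc t "-1"] q that inc dec \<rho>q by (cases "t < qc") auto
  have "open ((- {pt (R / \<rho>) 0}) \<inter> ch -` {\<zeta>. cmod \<zeta> \<in> {a<..<b} \<and> Re \<zeta> < 0})"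
    by (rule continuous_open_preimage[OF continuous_ch])
       (auto intro!: open_Collect_conj open_Collect_less continuous_intros)
  moreover have "x \<in> (- {pt (R / \<rho>) 0}) \<inter> ch -` {\<zeta>. cmod \<zeta> \<in> {a<..<b} \<and> Re \<zeta> < 0}"
    using X q Om_iff by (auto simp: divide_eq_minus_1_iff)
  ultimately obtain r where r: "r > 0" "cball x r \<subseteq> (- {pt (R / \<rho>) 0}) \<inter> ch -` {\<zeta>. cmod \<zeta> \<in> {a<..<b} \<and> Re \<zeta> < 0}"
    unfolding open_contains_cball by blast
  have near: "z \<in> Om" "V z \<noteq> 0" "En z < En x" if z: "z \<in> cball x r - {x}" for z
  proof -
    define t u where "t = cmod (ch z)" and "u = Re (ch z) / cmod (ch z)"
    have t: "z \<noteq> pt (R / \<rho>) 0" "a < t" "t < b" "Re (ch z) < 0" using z r(2) by (auto simp: t_def)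
    have "z \<noteq> sing" using t q sing_facts(1) by (auto simp: t_def)
    then show Om: "z \<in> Om" using t(1) by (simp add: Om_iff)
    have u: "-1 <= u" "u <= 1" using Re_cmod_bounds by (auto simp: u_def)
    obtain \<sigma> where "z = Pt \<sigma> t u" using Pt_surj[OF Om] unfolding t_def u_def by metis
    then have ne: "u = -1 ==> t \<noteq> qc" using z by (auto simp: x_def Pt_axis)
    have "lv t u < lv qc (-1)"
      using lev_anti_u[of t "-1" u] max[of t] ne t u q by (cases "u = -1"; cases "t = qc") force+
    then show "En z < En x" using En_ch[OF Om] X by (simp add: t_def u_def)
    show "V z \<noteq> 0"
    proof
      assume "V z = 0"
      then have v: "krad t u = c" "Im (ch z) = 0"
        using zero_V_iff[OF Om] t q by (auto simp: t_def u_def)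
      then have "u = -1" using t(4) by (simp add: u_def cmod_def)
      then show False using inc[of t] dec[of t] ne v(1) t by (cases t qc rule: linorder_cases) auto
    qed
  qed
  have "punctured_nhd_of_periodic_orbits Om V x"
  proof (rule punctured_nhd_of_periodic_orbitsI[of r x 1])
    show "\<forall>\<^sub>F z in at x. 1 * En p < 1 * En z" if "p \<in> cball x r - {x}" for p
      using order_tendstoD(1)[of En "En x" "at x" "En p"] near(3)[OF that] dH[OF X(2)] has_derivative_continuous isCont_def
      by fastforce
  qed (use r(1) near(1,2) Vx in blast)+
  moreover have "x = pt (R * ax qc) 0" by (simp add: x_def Pt_axis_pt)
  ultimately show ?thesis using X(2) Vx by (simp add: center_def equilibrium_def)
qed

end

section \<open>Signs of \<open>krad - c\<close> and the equilibria of each region\<close>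

context disc_params
begin

lemma rad_below:
  assumes "c > 0" "krad 1 u <= c" "0 < q" "q < 1" "-1 <= u" "u <= 1"
  shows "krad q u < c"
proof (rule ccontr)
  assume "\<not> krad q u < c"
  then have "c < krad 1 u" using rad_threshold[of q 1 u] assms by simp
  then show False using assms(2) by simp
qed

lemma \<kappa>_rad_one_anti: "-1 <= u ==> u < v ==> krad 1 v < krad 1 u"
  using rad_one_anti \<kappa>_pos by simp

lemma \<kappa>_rad_one_anti_le: "-1 <= u ==> u <= v ==> krad 1 v <= krad 1 u"
  using rad_one_anti_le \<kappa>_pos by (intro mult_left_mono) auto

text \<open>A positive \<open>rad\<close> exceeds \<open>c < 0\<close> trivially, and for a
  nonpositive one \<open>rad_neg\<close> compares with the ray \<open>u = -1\<close>.\<close>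

lemma rad_above_neg:
  assumes c: "c < 0" and x: "-1 <= u" "u <= 1" "0 < q" "q <= 1"
    and ax: "krad q (-1) \<ge> c" "u = -1 ==> krad q (-1) > c"
  shows "c < krad q u"
proof (cases "rad \<rho> q u <= 0 \<and> u \<noteq> -1")
  case True
  then have "krad q (-1) < krad q u" using rad_neg[of q u] x \<kappa>_pos by simp
  then show ?thesis using ax by linarith
next
  case False
  then show ?thesis
  proof (cases "u = -1")
    case False
    then have "rad \<rho> q u > 0" using \<open>\<not> (rad \<rho> q u <= 0 \<and> u \<noteq> -1)\<close> by auto
    then have "krad q u > 0" using \<kappa>_pos by simp
    then show ?thesis using c by linarith
  qed (use ax in simp)
qed

lemma cub_nonpos: "-1 < x ==> x <= 0 ==> cub x <= 0"
proof -
  assume x: "-1 < x" "x <= 0"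
  have "\<rho> * x <= 0" using x \<rho> by (simp add: mult_le_0_iff)
  then show ?thesis unfolding cub_def using x \<rho> by (intro mult_nonpos_nonneg) auto
qed

lemma rad_axis_gt:
  assumes c: "c < 0" and q: "0 < q" "q <= 1" and x: "cub (ax q) < - \<kappa> * c"
  shows "krad q (-1) > c"
proof (cases "q = 1")
  case True
  have "krad 1 (-1) > 0" using rad_one_pos[of "-1"] \<kappa>_pos by simp
  then show ?thesis using True c by simp
next
  case False
  then have "krad q (-1) = - cub (ax q) / \<kappa>" using ax_facts(6)[of q] q by auto
  moreover have "c < - cub (ax q) / \<kappa>"
    by (subst pos_less_divide_eq[OF \<kappa>_pos]) (use x in \<open>simp add: mult.commute\<close>)
  ultimately show ?thesis by simp
qed

lemma cub_ax_less:
  assumes c: "c < 0" and q: "0 < q" "q < 1" and x: "cub xp <= - \<kappa> * c" "ax q \<noteq> xp \<or> cub xp < - \<kappa> * c"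
  shows "cub (ax q) < - \<kappa> * c"
proof (cases "ax q <= 0")
  case True
  then have "cub (ax q) <= 0" using cub_nonpos ax_facts[of q] q by auto
  also have "0 < - \<kappa> * c" using \<kappa>_pos c by (simp add: mult_pos_neg)
  finally show ?thesis .
next
  case False
  have "ax q < \<rho>" using ax_facts[of q] q by auto
  then show ?thesis using cub_max[of "ax q"] False x \<rho> by (cases "ax q = xp") auto
qed

lemma region5_rad:
  assumes c: "c < 0" "cub xp < - \<kappa> * c" and b: "0 < q" "q <= 1" "-1 <= u" "u <= 1"
  shows "c < krad q u"
proof -
  have "c < krad q (-1)"
  proof (cases "q = 1")
    case True
    have "krad 1 (-1) > 0" using rad_one_pos[of "-1"] \<kappa>_pos by simp
    then show ?thesis using True c by simp
  next
    case False
    then show ?thesis using rad_axis_gt[of q] cub_ax_less[of q] b c by auto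
  qed
  then show ?thesis using rad_above_neg[OF c(1) b(3,4,1,2)] by simp
qed

end

context vortex_system
begin

lemma equilibriumI:
  "\<sigma> = 1 \<or> \<sigma> = -1 ==> 0 < q ==> q <= 1 ==> -1 <= u ==> u <= 1 ==> krad q u = c ==> q = 1 \<or> u = -1 \<or> u = 1 ==>
    Pt \<sigma> q u \<in> equilibria"
  unfolding equilibria_disk mem_Collect_eq
  by (rule exI[of _ \<sigma>], rule exI[of _ q], rule exI[of _ u]) simp

lemma equilibriumE:
  assumes "p \<in> equilibria"
  obtains \<sigma> q u where "p = Pt \<sigma> q u" "\<sigma> = 1 \<or> \<sigma> = -1" "0 < q" "q <= 1" "-1 <= u" "u <= 1" "krad q u = c" "q = 1 \<or> u = -1 \<or> u = 1"
proof -
  from assms have "\<exists>\<sigma> q u. p = Pt \<sigma> q u \<and> (\<sigma> = 1 \<or> \<sigma> = -1) \<and> 0 < q \<and> q <= 1 \<and> -1 <= u \<and> u <= 1 \<and> krad q u = c \<and> (q = 1 \<or> u = -1 \<or> u = 1)"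
    unfolding equilibria_disk by (rule CollectD)
  then show thesis by (elim exE conjE) (rule that)
qed

lemma no_equilibria:
  assumes "!!q u. -1 <= u ==> u <= 1 ==> 0 < q ==> q <= 1 ==> krad q u \<noteq> c"
  shows "equilibria = {}"
proof (rule equals0I)
  fix p assume "p \<in> equilibria"
  then show False by (rule equilibriumE) (use assms in blast)
qed

lemma region1_portrait:
  assumes c: "c > 0" "krad 1 (-1) < c"
  shows "global_vortex Om V (disk R) sing" "equilibria = {}"
proof -
  have b: "krad q u < c" if "-1 <= u" "u <= 1" "0 < q" "q <= 1" for q u
  proof -
    have "krad 1 u <= krad 1 (-1)" using \<kappa>_rad_one_anti_le[of "-1" u] that by simp
    then have "krad 1 u < c" using c by linarith
    then show ?thesis using rad_below[of u q] that c by (cases "q = 1") auto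
  qed
  show "equilibria = {}"
    by (rule no_equilibria) (use b in force)
  then show "global_vortex Om V (disk R) sing" by (rule global_vortexI)
qed

lemma Pt_one_axis: "Pt \<sigma> 1 (-1) = pt (- R) 0" "Pt \<sigma> 1 1 = pt R 0"
proof -
  have "ax 1 = -1" using \<rho> by (simp add: ax_def field_simps)
  then show "Pt \<sigma> 1 (-1) = pt (- R) 0" unfolding Pt_axis_pt by simp
  have "(1 + \<rho>) / (1 + \<rho> * 1) = 1" using \<rho> by simp
  then show "Pt \<sigma> 1 1 = pt R 0" unfolding Pt_axis_pt by simp
qed

lemma curve1_equilibria:
  assumes c: "c > 0" "krad 1 (-1) = c"
  shows "equilibria = {pt (- R) 0}"
proof -
  have b: "q = 1 \<and> u = -1" if "-1 <= u" "u <= 1" "0 < q" "q <= 1" "krad q u = c" for q u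
  proof -
    have u: "krad 1 u <= c" using \<kappa>_rad_one_anti_le[of "-1" u] that c by simp
    then have q: "q = 1" using rad_below[of u q] that c by (cases "q = 1") auto
    moreover have "u = -1" using \<kappa>_rad_one_anti[of "-1" u] that c q by (cases "u = -1") auto
    ultimately show ?thesis by simp
  qed
  show ?thesis
  proof (intro set_eqI iffI)
    fix p assume "p \<in> equilibria"
    then obtain \<sigma> q u where h: "p = Pt \<sigma> q u" "0 < q" "q <= 1" "-1 <= u" "u <= 1" "krad q u = c"
      by (rule equilibriumE)
    then show "p \<in> {pt (- R) 0}" using b[OF h(4,5,2,3,6)] Pt_one_axis by simp
  next
    fix p assume "p \<in> {pt (- R) 0}"
    then have "p = Pt 1 1 (-1)" using Pt_one_axis by simp
    then show "p \<in> equilibria"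
      using equilibriumI[of 1 1 "-1"] c by simp
  qed
qed

lemma axis_center_pos:
  assumes c: "c > 0" "c < krad 1 (-1)"
  obtains q where "0 < q" "q < 1" "krad q (-1) = c" "center Om V (pt (R * ax q) 0)"
    "- R < R * ax q" "R * ax q < 0" "!!t. 0 < t ==> t <= 1 ==> krad t (-1) = c ==> t = q"
proof -
  obtain q where q: "0 < q" "q < 1" "krad q (-1) = c"
    "!!t. 0 < t ==> t < q ==> krad t (-1) < c" "!!t. q < t ==> t <= 1 ==> c < krad t (-1)"
    using crit_exists[OF c] by auto
  have ctr: "center Om V (pt (R * ax q) 0)"
    by (rule center_local[of "q / 2" q 1]) (use q in auto)
  have "- cub (ax q) / \<kappa> = c" using ax_facts(6)[OF q(1,2)] q(3) by simp
  then have "cub (ax q) < 0" using c \<kappa>_pos by (simp add: field_simps) (metis mult_pos_pos neg_0_less_iff_less)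
  then have "ax q < 0"
    unfolding cub_def using ax_facts[OF q(1,2)] by (auto simp: mult_less_0_iff)
  then have "R * ax q < 0" "- R < R * ax q"
    using ax_facts(2)[OF q(1,2)] R_pos mult_strict_left_mono[of "-1" "ax q" R] by (auto simp: mult_pos_neg)
  moreover have "t = q" if "0 < t" "t <= 1" "krad t (-1) = c" for t
    using q(4)[of t] q(5)[of t] that by (cases t q rule: linorder_cases) auto
  ultimately show thesis by (intro that[OF q(1-3) ctr])
qed

lemma Pt_mirror: "Pt (-1) q u $ 1 = Pt 1 q u $ 1" "Pt (-1) q u $ 2 = - (Pt 1 q u $ 2)"
proof -
  have "cpt (-1) q u = cnj (cpt 1 q u)" by (simp add: cpt_def complex_eq_iff)
  then have "mob (-\<rho>) (cpt (-1) q u) = cnj (mob (-\<rho>) (cpt 1 q u))" by (simp add: mob_def)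
  then show "Pt (-1) q u $ 1 = Pt 1 q u $ 1" "Pt (-1) q u $ 2 = - (Pt 1 q u $ 2)"
    by (simp_all add: Pt_def pz_def)
qed

lemma Pt_upper:
  assumes "0 < q" "q <= 1" "-1 < u" "u < 1"
  shows "Pt 1 q u $ 2 > 0"
proof -
  note P = Pt_facts'[OF assms(1) assms(1,2) less_imp_le[OF assms(3)] less_imp_le[OF assms(4)], of 1]
  have "u^2 < 1" using assms by (simp add: abs_square_less_1)
  then have "Im (ch (Pt 1 q u)) > 0" using P(6) assms by simp
  then have "sgn (Pt 1 q u $ 2) = 1" using Im_ch_sgn[of "Pt 1 q u"] P(2) by (simp add: Om_iff)
  then show ?thesis by (simp add: sgn_1_pos)
qed

text \<open>On the circle \<open>krad\<close> decreases in \<open>u\<close> from above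
  \<open>c\<close> to below \<open>c\<close> and meets it once, at \<open>u\<close>; this gives one
  equilibrium in each half plane. On the ray \<open>u = 1\<close> it stays below
  \<open>c\<close>.\<close>

lemma region2_equilibria:
  assumes c: "c > 0" "krad 1 1 < c" "c < krad 1 (-1)"
  obtains q u where "0 < q" "q < 1" "krad q (-1) = c" "-1 < u" "u < 1" "krad 1 u = c"
    "center Om V (pt (R * ax q) 0)" "- R < R * ax q" "R * ax q < 0"
    "equilibria = {pt (R * ax q) 0, Pt 1 1 u, Pt (-1) 1 u}"
proof -
  obtain q where q: "0 < q" "q < 1" "krad q (-1) = c" "center Om V (pt (R * ax q) 0)"
    "- R < R * ax q" "R * ax q < 0" "!!t. 0 < t ==> t <= 1 ==> krad t (-1) = c ==> t = q"
    by (rule axis_center_pos[OF c(1,3)]) blast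
  have "continuous_on {-1..1} (\<lambda>u. krad 1 u)"
    by (intro continuous_intros continuous_on_rad dn_nz) auto
  then have "\<exists>u\<ge>-1. u <= 1 \<and> krad 1 u = c"
    by (intro IVT2') (use c in auto)
  then obtain u where u: "-1 <= u" "u <= 1" "krad 1 u = c" by blast
  have u': "-1 < u" "u < 1" using u c by (auto simp: less_le)
  have "equilibria = {pt (R * ax q) 0, Pt 1 1 u, Pt (-1) 1 u}"
  proof (intro set_eqI iffI)
    fix p assume "p \<in> equilibria"
    then obtain \<sigma> t v where h: "p = Pt \<sigma> t v" "\<sigma> = 1 \<or> \<sigma> = -1" "0 < t" "t <= 1" "-1 <= v" "v <= 1" "krad t v = c" "t = 1 \<or> v = -1 \<or> v = 1"
      by (rule equilibriumE)
    have "v \<noteq> 1"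
    proof
      assume "v = 1"
      then show False using rad_below[of 1 t] c h by (cases "t = 1") auto
    qed
    have "t = 1 ==> v = u"
      using \<kappa>_rad_one_anti[of u v] \<kappa>_rad_one_anti[of v u] u h by (cases u v rule: linorder_cases) auto
    moreover have "v = -1 ==> t = q" using q(7) h by auto
    ultimately show "p \<in> {pt (R * ax q) 0, Pt 1 1 u, Pt (-1) 1 u}"
      using h \<open>v \<noteq> 1\<close> Pt_axis_pt by auto
  next
    fix p assume "p \<in> {pt (R * ax q) 0, Pt 1 1 u, Pt (-1) 1 u}"
    then consider "p = Pt 1 q (-1)" | "p = Pt 1 1 u" | "p = Pt (-1) 1 u" using Pt_axis_pt by auto
    then show "p \<in> equilibria"
    proof cases
      case 1 then show ?thesis using equilibriumI[of 1 q "-1"] q(1-3) by simp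
    next
      case 2 then show ?thesis using equilibriumI[of 1 1 u] u by simp
    next
      case 3 then show ?thesis using equilibriumI[of "-1" 1 u] u by simp
    qed
  qed
  then show thesis by (rule that[OF q(1-3) u' u(3) q(4-6)])
qed

lemma boundary_point:
  assumes "-1 < u" "u < 1" "krad 1 u = c" "\<sigma> = 1 \<or> \<sigma> = -1"
  shows "hyperbolic_saddle Om V (Pt \<sigma> 1 u)" "bdf (Pt \<sigma> 1 u) = 0"
proof -
  have h: "0 < (1::real)" "(1::real) <= 1" "-1 <= u" "u <= 1" using assms by auto
  note P = Pt_facts'[OF h(1) h assms(4)]
  have "V (Pt \<sigma> 1 u) = 0" using zero_V_iff[OF P(2)] P(4,5) assms(3) by simp
  moreover have "Pt \<sigma> 1 u $ 2 \<noteq> 0" using Pt_upper[of 1 u] Pt_mirror[of 1 u] assms by auto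
  ultimately show "hyperbolic_saddle Om V (Pt \<sigma> 1 u)"
    using boundary_saddle P(2) by (simp add: equilibrium_def)
  show "bdf (Pt \<sigma> 1 u) = 0" using bdf_zero_iff_ch P(2,4) by (simp add: Om_iff)
qed

text \<open>The case \<open>c = krad 1 1\<close>, in which the right equilibrium has reached the
  circle, is included so that the second curve is served as well.\<close>

lemma region3_equilibria:
  assumes c: "c > 0" "c <= krad 1 1"
  obtains q q' where "0 < q" "q < 1" "krad q (-1) = c" "0 < q'" "q' <= 1" "krad q' 1 = c"
    "center Om V (pt (R * ax q) 0)" "- R < R * ax q" "R * ax q < 0"
    "equilibria = {pt (R * ax q) 0, Pt 1 q' 1}"
    "q' = 1 \<longleftrightarrow> c = krad 1 1"
proof -
  have c': "c < krad 1 (-1)" using \<kappa>_rad_one_anti[of "-1" 1] c by simp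
  obtain q where q: "0 < q" "q < 1" "krad q (-1) = c" "center Om V (pt (R * ax q) 0)"
    "- R < R * ax q" "R * ax q < 0" "!!t. 0 < t ==> t <= 1 ==> krad t (-1) = c ==> t = q"
    by (rule axis_center_pos[OF c(1) c']) blast
  obtain q' where q': "0 < q'" "q' <= 1" "krad q' 1 = c" "!!t. 0 < t ==> t <= 1 ==> krad t 1 = c ==> t = q'"
    "q' = 1 \<longleftrightarrow> c = krad 1 1"
  proof (cases "c = krad 1 1")
    case True
    have u: "t = 1" if "0 < t" "t <= 1" "krad t 1 = c" for t
      using rad_below[of 1 t] that True c by (cases "t = 1") auto
    show ?thesis
    proof (rule that[of 1])
      show "t = 1" if "0 < t" "t <= 1" "krad t 1 = c" for t by (rule u[OF that])
    qed (use True in simp_all)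
  next
    case False
    then have "c < krad 1 1" using c by simp
    then obtain q' where q': "0 < q'" "q' < 1" "krad q' 1 = c"
      "!!t. 0 < t ==> t < q' ==> krad t 1 < c" "!!t. q' < t ==> t <= 1 ==> c < krad t 1"
      by (rule crit_exists[OF c(1)]) auto
    have u: "t = q'" if "0 < t" "t <= 1" "krad t 1 = c" for t
      using q'(4)[of t] q'(5)[of t] that by (cases t q' rule: linorder_cases) auto
    show ?thesis
    proof (rule that[of q'])
      show "t = q'" if "0 < t" "t <= 1" "krad t 1 = c" for t by (rule u[OF that])
    qed (use q'(1-3) False in simp_all)
  qed
  have "equilibria = {pt (R * ax q) 0, Pt 1 q' 1}"
  proof (intro set_eqI iffI)
    fix p assume "p \<in> equilibria"
    then obtain \<sigma> t v where h: "p = Pt \<sigma> t v" "\<sigma> = 1 \<or> \<sigma> = -1" "0 < t" "t <= 1" "-1 <= v" "v <= 1" "krad t v = c" "t = 1 \<or> v = -1 \<or> v = 1"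
      by (rule equilibriumE)
    have "t = 1 ==> v = 1"
      using \<kappa>_rad_one_anti[of v 1] c h by (cases "v = 1") auto
    then consider "v = 1" | "v = -1" using h by auto
    then show "p \<in> {pt (R * ax q) 0, Pt 1 q' 1}"
    proof cases
      case 1 then show ?thesis using q'(4)[of t] h Pt_axis by simp
    next
      case 2 then show ?thesis using q(7)[of t] h Pt_axis_pt by simp
    qed
  next
    fix p assume "p \<in> {pt (R * ax q) 0, Pt 1 q' 1}"
    then consider "p = Pt 1 q (-1)" | "p = Pt 1 q' 1" using Pt_axis_pt by auto
    then show "p \<in> equilibria"
    proof cases
      case 1 then show ?thesis using equilibriumI[of 1 q "-1"] q(1-3) by simp
    next
      case 2 then show ?thesis using equilibriumI[of 1 q' 1] q'(1-3) by simp
    qed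
  qed
  then show thesis by (rule that[OF q(1-3) q'(1-3) q(4-6) _ q'(5)])
qed

lemma axis_saddle_right:
  assumes "0 < q" "q < 1" "krad q 1 = c"
  shows "hyperbolic_saddle Om V (Pt 1 q 1)" "Pt 1 q 1 = pt (R * ((q + \<rho>) / (1 + \<rho> * q))) 0"
    "\<rho> * R < R * ((q + \<rho>) / (1 + \<rho> * q))" "R * ((q + \<rho>) / (1 + \<rho> * q)) < R"
proof -
  define X where "X = (q + \<rho>) / (1 + \<rho> * q)"
  have d: "1 + \<rho> * q > 0" using \<rho> assms by (simp add: add_pos_pos)
  have "(1 - q) * (1 - \<rho>) > 0" using assms \<rho> by simp
  then have X1: "X < 1" using d by (simp add: X_def field_simps)
  have "\<rho> * \<rho> * q < q" using assms \<rho>2_ne \<kappa>_pos by (simp add: \<kappa>_def power2_eq_square)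
  then have X2: "\<rho> < X" using d by (simp add: X_def field_simps)
  show eq: "Pt 1 q 1 = pt (R * ((q + \<rho>) / (1 + \<rho> * q))) 0" by (rule Pt_axis_pt)
  show "\<rho> * R < R * ((q + \<rho>) / (1 + \<rho> * q))" "R * ((q + \<rho>) / (1 + \<rho> * q)) < R"
    using X1 X2 R_pos unfolding X_def[symmetric] by (auto simp: mult.commute)
  have h: "0 < q" "q <= 1" "-1 <= (1::real)" "(1::real) <= 1" "(1::real) = 1 \<or> (1::real) = -1" using assms by auto
  note P = Pt_facts'[OF h(1) h]
  have "equilibrium Om V (pt (R * X) 0)"
    unfolding X_def eq[symmetric] equilibrium_def using zero_V_iff[OF P(2)] P assms by simp
  moreover have "cub' X < 0" using cub'_sign(2)[of X] xp_bounds X1 X2 by linarith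
  ultimately show "hyperbolic_saddle Om V (Pt 1 q 1)"
    unfolding eq X_def[symmetric] using axis_saddle[of X] X1 X2 \<rho> by simp
qed

lemma neg_crit:
  assumes c: "c < 0" and h: "0 < q" "q <= 1" "-1 <= u" "u <= 1" "krad q u = c" "q = 1 \<or> u = -1 \<or> u = 1"
  shows "u = -1" "q < 1" "cub (ax q) = - \<kappa> * c"
proof -
  have "rad \<rho> q u < 0" using h(5) c \<kappa>_pos by (metis mult_less_0_iff not_less_iff_gr_or_eq)
  then have "q \<noteq> 1" "u \<noteq> 1" using rad_one_pos[of u] rad_axis_pos[of q] h by auto
  then show "u = -1" "q < 1" using h by auto
  then show "cub (ax q) = - \<kappa> * c" using ax_facts(6)[of q] h \<kappa>_pos by (simp add: field_simps)
qed

lemma neg_crit_conv: "0 < q ==> q < 1 ==> cub (ax q) = - \<kappa> * c ==> krad q (-1) = c"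
  using ax_facts(6)[of q] \<kappa>_pos by simp

lemma region5_portrait:
  assumes c: "c < 0" "cub xp < - \<kappa> * c"
  shows "global_vortex Om V (disk R) sing" "equilibria = {}"
proof -
  show "equilibria = {}"
    by (rule no_equilibria) (use region5_rad[OF c] in force)
  then show "global_vortex Om V (disk R) sing" by (rule global_vortexI)
qed

lemma curve3_equilibria:
  assumes c: "c < 0" "cub xp = - \<kappa> * c"
  shows "equilibria = {pt (R * xp) 0}" "0 < ax xp" "ax xp < 1" "ax (ax xp) = xp"
proof -
  have x: "0 < xp" "xp < 1" "xp < \<rho>" using xp_bounds \<rho> by auto
  have d: "1 - \<rho> * xp > 0" using \<rho>q[of xp] x by simp
  then show ax: "0 < ax xp" using x by (simp add: ax_def)
  have "ax xp < \<rho>" by (rule ax_facts(3)[OF x(1,2)])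
  then show ax1: "ax xp < 1" using \<rho> by simp
  show axx: "ax (ax xp) = xp" by (rule ax_facts(4)[OF x(1,2)])
  show "equilibria = {pt (R * xp) 0}"
  proof (intro set_eqI iffI)
    fix p assume "p \<in> equilibria"
    then obtain \<sigma> t v where h: "p = Pt \<sigma> t v" "0 < t" "t <= 1" "-1 <= v" "v <= 1" "krad t v = c" "t = 1 \<or> v = -1 \<or> v = 1"
      by (rule equilibriumE)
    note n = neg_crit[OF c(1) h(2-7)]
    have "ax t = xp" using cub_ax_less[of t] n h c by (metis order.refl less_irrefl)
    then show "p \<in> {pt (R * xp) 0}" using h(1) n Pt_axis_pt by simp
  next
    fix p assume "p \<in> {pt (R * xp) 0}"
    then have "p = Pt 1 (ax xp) (-1)" using Pt_axis_pt axx by simp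
    moreover have "krad (ax xp) (-1) = c" using neg_crit_conv[OF ax ax1] axx c by simp
    ultimately show "p \<in> equilibria"
      using equilibriumI[of 1 "ax xp" "-1"] ax ax1 by simp
  qed
qed

lemma region4_roots:
  assumes c: "c < 0" "cub xp > - \<kappa> * c"
  obtains x1 x2 where "0 < x1" "x1 < xp" "xp < x2" "x2 < \<rho>" "cub x1 = - \<kappa> * c" "cub x2 = - \<kappa> * c"
proof -
  have pos: "- \<kappa> * c > 0" using \<kappa>_pos c by (simp add: mult_pos_neg)
  have cc: "continuous_on S cub" for S
    using cub_deriv by (meson DERIV_continuous_on has_field_derivative_at_within)
  have z: "cub 0 = 0" "cub \<rho> = 0" by (simp_all add: cub_def)
  have "\<exists>x\<ge>0. x <= xp \<and> cub x = - \<kappa> * c" by (rule IVT') (use c pos z xp_bounds cc in auto)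
  then obtain x1 where x1: "0 <= x1" "x1 <= xp" "cub x1 = - \<kappa> * c" by blast
  have "\<exists>x\<ge>xp. x <= \<rho> \<and> cub x = - \<kappa> * c" by (rule IVT2') (use c pos z xp_bounds cc in auto)
  then obtain x2 where x2: "xp <= x2" "x2 <= \<rho>" "cub x2 = - \<kappa> * c" by blast
  have ne: "x1 \<noteq> 0" "x1 \<noteq> xp" "x2 \<noteq> xp" "x2 \<noteq> \<rho>" using x1 x2 c pos z by auto
  show thesis by (rule that[of x1 x2]) (use x1 x2 ne in auto)
qed

lemma cub_compare:
  assumes x: "0 < x1" "x1 < xp" "xp < x2" "x2 < \<rho>" "cub x1 = e" "cub x2 = e" "e > 0"
  shows "-1 < x ==> x < x1 ==> cub x < e" "x1 < x ==> x < x2 ==> e < cub x" "x2 < x ==> x <= 1 ==> cub x < e"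
proof -
  show "cub x < e" if "-1 < x" "x < x1"
    using cub_nonpos[of x] cub_mono[of x x1] that x by (cases "x <= 0") auto
  show "e < cub x" if "x1 < x" "x < x2"
    using cub_mono[of x1 x] cub_anti[of x x2] that x \<rho> by (cases "x <= xp") auto
  show "cub x < e" if "x2 < x" "x <= 1"
    using cub_anti[of x2 x] that x by auto
qed

text \<open>The involution \<open>ax\<close> reverses the order: the larger root of the cubic gives
  the smaller radius \<open>q2\<close>, that of the saddle, and the smaller root gives the radius
  \<open>q1\<close> of the center. The signs of \<open>krad - c\<close> along the ray are plus,
  minus, plus.\<close>

lemma region4_axis:
  assumes c: "c < 0" "cub xp > - \<kappa> * c"
  obtains q2 q1 where "0 < q2" "q2 < q1" "q1 < 1" "0 < ax q1" "ax q1 < ax q2" "ax q2 < \<rho>" "xp < ax q2"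
    "krad q1 (-1) = c" "krad q2 (-1) = c"
    "\<forall>t\<in>{0<..<q2}. c < krad t (-1)" "\<forall>t\<in>{q2<..<q1}. krad t (-1) < c"
    "\<forall>t\<in>{q1<..1}. c < krad t (-1)"
proof -
  obtain x1 x2 where x: "0 < x1" "x1 < xp" "xp < x2" "x2 < \<rho>" "cub x1 = - \<kappa> * c" "cub x2 = - \<kappa> * c"
    by (rule region4_roots[OF c])
  have pos: "- \<kappa> * c > 0" using \<kappa>_pos c by (simp add: mult_pos_neg)
  note cmp = cub_compare[OF x pos]
  define q1 q2 where "q1 = ax x1" and "q2 = ax x2"
  have xx: "0 < x1" "x1 < 1" "0 < x2" "x2 < 1" using x xp_bounds \<rho> by auto
  have q: "0 < q2" "q2 < q1" "q1 < 1" "ax q1 = x1" "ax q2 = x2"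
  proof -
    show "0 < q2" using ax_facts(5)[OF xx(3,4)] x by (simp add: q2_def)
    show "q2 < q1" unfolding q1_def q2_def using ax_anti[of x1 x2] xx x by auto
    show "q1 < 1" using ax_facts(3)[OF xx(1,2)] \<rho> by (simp add: q1_def)
    show "ax q1 = x1" "ax q2 = x2" unfolding q1_def q2_def using ax_facts(4) xx by auto
  qed
  show thesis
  proof (rule that[OF q(1-3)])
    show "krad q1 (-1) = c" "krad q2 (-1) = c" using neg_crit_conv q x by auto
    have "c < krad t (-1)" if "0 < t" "t < q2" for t
    proof (rule rad_axis_gt)
      have "x2 < ax t" "ax t <= 1" using ax_anti[of t q2] ax_facts(3)[of t] \<rho> that q by auto
      then show "cub (ax t) < - \<kappa> * c" using cmp(3) by simp
    qed (use that q c in auto)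
    then show "\<forall>t\<in>{0<..<q2}. c < krad t (-1)" by simp
    have "krad t (-1) < c" if "q2 < t" "t < q1" for t
    proof -
      have "x1 < ax t" "ax t < x2" using ax_anti[of q2 t] ax_anti[of t q1] that q by auto
      then have "- \<kappa> * c < cub (ax t)" using cmp(2) by simp
      then have "- cub (ax t) / \<kappa> < c" by (subst pos_divide_less_eq[OF \<kappa>_pos]) (simp add: mult.commute)
      then show ?thesis using ax_facts(6)[of t] that q by simp
    qed
    then show "\<forall>t\<in>{q2<..<q1}. krad t (-1) < c" by simp
    have "c < krad t (-1)" if "q1 < t" "t <= 1" for t
    proof (cases "t = 1")
      case True
      have "krad 1 (-1) > 0" using rad_one_pos[of "-1"] \<kappa>_pos by simp
      then show ?thesis using True c by simp
    next
      case False
      show ?thesis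
      proof (rule rad_axis_gt)
        have "ax t < x1" "-1 < ax t" using ax_anti[of q1 t] ax_facts(2)[of t] that q False by auto
        then show "cub (ax t) < - \<kappa> * c" using cmp(1) by simp
      qed (use that q c in auto)
    qed
    then show "\<forall>t\<in>{q1<..1}. c < krad t (-1)" by simp
  qed (use q x in auto)
qed

lemma region4_equilibria:
  assumes c: "c < 0" "cub xp > - \<kappa> * c"
  obtains x1 x2 where "0 < x1" "x1 < x2" "x2 < \<rho>" "center Om V (pt (R * x1) 0)" "hyperbolic_saddle Om V (pt (R * x2) 0)"
    "equilibria = {pt (R * x1) 0, pt (R * x2) 0}"
proof -
  obtain q2 q1 where q: "0 < q2" "q2 < q1" "q1 < 1" "0 < ax q1" "ax q1 < ax q2" "ax q2 < \<rho>" "xp < ax q2"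
    and cr: "krad q1 (-1) = c" "krad q2 (-1) = c"
    and sgn: "\<forall>t\<in>{0<..<q2}. c < krad t (-1)" "\<forall>t\<in>{q2<..<q1}. krad t (-1) < c"
      "\<forall>t\<in>{q1<..1}. c < krad t (-1)"
    by (rule region4_axis[OF c])
  have ctr: "center Om V (pt (R * ax q1) 0)"
    by (rule center_local[of q2 q1 1]) (use q cr sgn in auto)
  have eq: "equilibria = {pt (R * ax q1) 0, pt (R * ax q2) 0}"
  proof (intro set_eqI iffI)
    fix p assume "p \<in> equilibria"
    then obtain \<sigma> t v where h: "p = Pt \<sigma> t v" "0 < t" "t <= 1" "-1 <= v" "v <= 1" "krad t v = c" "t = 1 \<or> v = -1 \<or> v = 1"
      by (rule equilibriumE)
    note n = neg_crit[OF c(1) h(2-7)]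
    have "t = q1 \<or> t = q2" using sgn[THEN bspec, of t] h n
      by (cases t q1 rule: linorder_cases; cases t q2 rule: linorder_cases) auto
    then show "p \<in> {pt (R * ax q1) 0, pt (R * ax q2) 0}" using h(1) n Pt_axis_pt by auto
  next
    fix p assume "p \<in> {pt (R * ax q1) 0, pt (R * ax q2) 0}"
    then have "p = Pt 1 q1 (-1) \<or> p = Pt 1 q2 (-1)" using Pt_axis_pt by auto
    then obtain t where "p = Pt 1 t (-1)" "t = q1 \<or> t = q2" by blast
    then show "p \<in> equilibria"
      using equilibriumI[of 1 t "-1"] q cr by auto
  qed
  have "equilibrium Om V (pt (R * ax q2) 0)" using eq by blast
  moreover have "0 < ax q2" "ax q2 < 1" using q \<rho> by auto
  ultimately have "hyperbolic_saddle Om V (pt (R * ax q2) 0)"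
    using axis_saddle[of "ax q2"] cub'_sign(2)[of "ax q2"] q by auto
  then show thesis using that[of "ax q1" "ax q2"] q ctr eq by blast
qed

end

section \<open>Reversibility and the saddle connection\<close>

lemma tendsto_at_top_compact:
  fixes \<gamma> :: "real => 'a::metric_space"
  assumes "compact K" "!!t. t > 0 ==> \<gamma> t \<in> K"
    and cluster: "!!X q. filterlim X at_top sequentially ==> (\<lambda>n. \<gamma> (X n)) \<longlonglongrightarrow> q ==> q = p"
  shows "(\<gamma> \<longlongrightarrow> p) at_top"
proof (rule ccontr)
  assume "\<not> (\<gamma> \<longlongrightarrow> p) at_top"
  then obtain S where S: "open S" "p \<in> S" "\<not> (\<forall>\<^sub>F t in at_top. \<gamma> t \<in> S)"
    unfolding tendsto_def by blast
  then have ex: "\<exists>t\<ge>N. \<gamma> t \<notin> S" for N unfolding eventually_at_top_linorder by blast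
  define f where "f n = (SOME t. t \<ge> real (Suc n) \<and> \<gamma> t \<notin> S)" for n
  have f: "f n \<ge> real (Suc n) \<and> \<gamma> (f n) \<notin> S" for n
    unfolding f_def by (rule someI_ex) (use ex in blast)
  have "\<forall>n. \<gamma> (f n) \<in> K"
  proof
    fix n have "f n > 0" using f[of n] by linarith
    then show "\<gamma> (f n) \<in> K" by (rule assms(2))
  qed
  then obtain q r where q: "q \<in> K" "strict_mono (r::nat => nat)" "((\<lambda>n. \<gamma> (f n)) \<circ> r) \<longlonglongrightarrow> q"
    using assms(1) unfolding compact_def by meson
  have "filterlim (\<lambda>n. real (Suc (r n))) at_top sequentially"
    using filterlim_compose[OF filterlim_real_sequentially filterlim_compose[OF filterlim_Suc filterlim_subseq[OF q(2)]]] .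
  then have "filterlim (\<lambda>n. f (r n)) at_top sequentially"
    by (rule filterlim_at_top_mono) (use f in auto)
  then have "q = p" using cluster[of "\<lambda>n. f (r n)" q] q(3) by (simp add: o_def)
  then have "\<forall>\<^sub>F n in sequentially. \<gamma> (f (r n)) \<in> S"
    using q(3) S(1,2) unfolding o_def tendsto_def by blast
  then show False using f by simp
qed

definition mir :: "real^2 => real^2" where
  "mir z = pt (z$1) (- (z$2))"

lemma bounded_linear_mir: "bounded_linear mir"
  unfolding linear_conv_bounded_linear[symmetric]
  by (rule linearI) (simp_all add: mir_def vec2_eq_iff)

lemma mir_mir [simp]: "mir (mir z) = z"
  by (simp add: mir_def vec2_eq_iff)

context vortex_system
begin

lemma V_mir: "V (mir z) = - mir (V z)"
proof -
  have *: "AA (mir z) = AA z" "BB (mir z) = BB z" by (simp_all add: AA_def BB_def mir_def)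
  show ?thesis unfolding vec2_eq_iff V_eq * by (simp add: mir_def algebra_simps)
qed

lemma mir_Om: "z \<in> Om ==> mir z \<in> Om"
  by (auto simp: Om_iff mir_def vec2_eq_iff)

lemma solution_mir:
  assumes "solution_on UNIV Om V \<Gamma>"
  shows "solution_on UNIV Om V (\<lambda>t. mir (\<Gamma> (- t)))"
  unfolding solution_on_def
proof (intro ballI conjI)
  fix t :: real
  have \<Gamma>: "\<Gamma> (- t) \<in> Om" "(\<Gamma> has_vector_derivative V (\<Gamma> (- t))) (at (- t))"
    using assms by (auto simp: solution_on_def)
  show "mir (\<Gamma> (- t)) \<in> Om" by (rule mir_Om[OF \<Gamma>(1)])
  have "((\<lambda>t. - t) has_vector_derivative - 1) (at t)"
    by (auto intro!: derivative_eq_intros)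
  from vector_diff_chain_at[OF this \<Gamma>(2)]
  have "((\<lambda>t. \<Gamma> (- t)) has_vector_derivative - V (\<Gamma> (- t))) (at t)" by (simp add: o_def)
  from bounded_linear.has_vector_derivative[OF bounded_linear_mir this]
  have "((\<lambda>t. mir (\<Gamma> (- t))) has_vector_derivative mir (- V (\<Gamma> (- t)))) (at t)" .
  then show "((\<lambda>t. mir (\<Gamma> (- t))) has_vector_derivative V (mir (\<Gamma> (- t)))) (at t)"
    by (simp add: V_mir linear_neg[OF bounded_linear.linear[OF bounded_linear_mir]])
qed

text \<open>The system is reversible under reflection in the axis, so a solution starting on the axis
  that returned to its initial point would return at arbitrarily small times.\<close>

lemma no_return:
  assumes \<Gamma>: "solution_on UNIV Om V \<Gamma>" "\<Gamma> 0 = x0" "V x0 \<noteq> 0"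
    and axis: "!!t. \<Gamma> t $ 2 = 0 ==> \<Gamma> t = x0" and x0: "x0 $ 2 = 0"
  shows "t \<noteq> 0 ==> \<Gamma> t $ 2 \<noteq> 0" "\<Gamma> (- t) = mir (\<Gamma> t)"
proof -
  have sym: "mir (\<Gamma> (- t)) = \<Gamma> t" for t
  proof (rule solution_unique[of UNIV "\<lambda>t. mir (\<Gamma> (- t))" \<Gamma> 0 t])
    have "mir x0 = x0" using x0 by (simp add: mir_def vec2_eq_iff)
    then show "mir (\<Gamma> (- 0)) = \<Gamma> 0" using \<Gamma>(2) by simp
  qed (use solution_mir[OF \<Gamma>(1)] \<Gamma>(1) in auto)
  show refl: "\<Gamma> (- t) = mir (\<Gamma> t)" for t using sym[of t] by (metis mir_mir)
  \<comment> \<open>A return at time \<open>a\<close> makes \<open>a\<close> a period. Together with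
    the reflection, the point at time \<open>a / 2\<close> is then its own mirror image, so it lies
    on the axis and is again \<open>x0\<close>.\<close>
  have half: "\<Gamma> (a / 2) = x0" if "\<Gamma> a = x0" for a
  proof -
    have "\<Gamma> (- (a / 2) + a) = \<Gamma> (- (a / 2))"
    proof (rule solution_unique[of UNIV "\<lambda>t. \<Gamma> (t + a)" \<Gamma> 0 "- (a / 2)"])
      show "solution_on UNIV Om V (\<lambda>t. \<Gamma> (t + a))" using solution_on_shift[OF \<Gamma>(1), of a] by simp
      show "\<Gamma> (0 + a) = \<Gamma> 0" using that \<Gamma>(2) by simp
    qed (use \<Gamma>(1) in auto)
    moreover have "- (a / 2) + a = a / 2" by simp
    ultimately have "\<Gamma> (a / 2) = mir (\<Gamma> (a / 2))" using refl[of "a / 2"] by simp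
    then have "\<Gamma> (a / 2) $ 2 = 0" by (simp add: mir_def vec2_eq_iff)
    then show ?thesis by (rule axis)
  qed
  show "\<Gamma> t $ 2 \<noteq> 0" if "t \<noteq> 0" for t
  proof
    assume "\<Gamma> t $ 2 = 0"
    then have t: "\<Gamma> t = x0" by (rule axis)
    have \<Gamma>n: "\<Gamma> (t / 2 ^ n) = x0" for n
    proof (induction n)
      case (Suc n)
      then show ?case using half[of "t / 2 ^ n"] by (simp add: field_simps)
    qed (simp add: t)
    have "(\<Gamma> has_vector_derivative V x0) (at 0)" using \<Gamma>(1,2) by (auto simp: solution_on_def)
    then have "((\<lambda>h. norm (\<Gamma> (0 + h) - \<Gamma> 0 - h *\<^sub>R V x0) / norm h) \<longlongrightarrow> 0) (at 0)"
      unfolding has_vector_derivative_def has_derivative_at by blast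
    then have lim: "((\<lambda>h. norm (\<Gamma> h - \<Gamma> 0 - h *\<^sub>R V x0) / \<bar>h\<bar>) \<longlongrightarrow> 0) (at 0)" by simp
    have "(\<lambda>n. t * (1/2) ^ n) \<longlonglongrightarrow> t * 0"
      by (intro tendsto_intros LIMSEQ_power_zero) auto
    then have "(\<lambda>n. t / 2 ^ n) \<longlonglongrightarrow> 0" by (simp add: power_divide)
    moreover have "\<forall>\<^sub>F n in sequentially. t / 2 ^ n \<noteq> 0" using that by simp
    ultimately have "filterlim (\<lambda>n. t / 2 ^ n) (at 0) sequentially" by (simp add: filterlim_at)
    from filterlim_compose[OF lim this]
    have "(\<lambda>n. norm (\<Gamma> (t / 2 ^ n) - \<Gamma> 0 - (t / 2 ^ n) *\<^sub>R V x0) / \<bar>t / 2 ^ n\<bar>) \<longlonglongrightarrow> 0" .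
    moreover have "norm (\<Gamma> (t / 2 ^ n) - \<Gamma> 0 - (t / 2 ^ n) *\<^sub>R V x0) / \<bar>t / 2 ^ n\<bar> = norm (V x0)" for n
      using \<Gamma>n[of n] \<Gamma>(2) that by simp
    ultimately have "norm (V x0) = 0" by (simp add: LIMSEQ_const_iff)
    then show False using \<Gamma>(3) by simp
  qed
qed

text \<open>Both saddles lie on the circle, at level 0, and inside the disk this level meets the
  axis in a single point \<open>x0\<close>, on the ray \<open>u = -1\<close>. The orbit of
  \<open>x0\<close> stays in one half plane for positive times and, not being periodic, can
  accumulate only at the saddle there; the reflection gives the limit for negative times.\<close>

lemma saddle_connection:
  assumes c: "c > 0" "krad 1 1 < c" "c < krad 1 (-1)"
    and q: "0 < q" "q < 1" "krad q (-1) = c" and u: "-1 < u" "u < 1" "krad 1 u = c"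
    and eqs: "equilibria = {pt (R * ax q) 0, Pt 1 1 u, Pt (-1) 1 u}"
  shows "saddle_connection_inside Om V (disk R) (Pt 1 1 u) (Pt (-1) 1 u)"
proof -
  obtain \<delta> where \<delta>: "0 < \<delta>" "\<delta> <= 1" "!!q u. 0 < q ==> q < \<delta> ==> -1 <= u ==> u <= 1 ==> 1 * lv q u < 0"
    using lev_to_bot[of 1 0] c by auto
  have lo: "krad t (-1) < c" if "0 < t" "t < q" for t
    using rad_threshold[of t q "-1"] that q c(1) by force
  have hi: "c < krad t (-1)" if "q < t" "t <= 1" for t
    using rad_threshold[of q t "-1"] that q c(1) by auto
  have inc: "lv s (-1) < lv t (-1)" if "0 < s" "s < t" "t <= q" for s t
    using lev_increasing[of s t "-1"] that lo \<rho>q q by auto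
  have dec: "lv t (-1) < lv s (-1)" if "q <= s" "s < t" "t <= 1" for s t
    using lev_decreasing[of s t "-1"] that hi \<rho>q q by auto
  have top: "lv q (-1) > 0" using dec[of q 1] q by simp
  have pos: "lv t (-1) > 0" if "q <= t" "t < 1" for t using dec[of t 1] that by simp
  have "\<delta> / 2 < q" using \<delta>(3)[of q "-1"] top \<delta>(1) q by (cases "q < \<delta>") auto
  have "\<exists>t\<ge>\<delta>/2. t <= q \<and> lv t (-1) = 0"
    by (rule IVT') (use \<delta> \<open>\<delta> / 2 < q\<close> top q continuous_on_lev_q in \<open>auto intro!: less_imp_le\<close>)
  then obtain Z where Z: "\<delta> / 2 <= Z" "Z <= q" "lv Z (-1) = 0" by blast
  have Z': "0 < Z" "Z < q" "Z <= 1" using Z \<delta>(1) top q by (auto simp: less_le)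
  have Zu: "t = Z" if "0 < t" "t < 1" "lv t (-1) = 0" for t
  proof -
    have "t < q" using pos[of t] that by force
    then show ?thesis using inc[of t Z] inc[of Z t] that Z Z' by (cases t Z rule: linorder_cases) auto
  qed
  have right: "lv t 1 < 0" if "0 < t" "t < 1" for t
    using lev_increasing[of t 1 1] rad_below[of 1] c that \<rho>q[of 1] by auto
  define x0 where "x0 = Pt 1 Z (-1)"
  note X = Pt_facts'[OF Z'(1) Z'(1,3), of "-1" 1, simplified, folded x0_def]
  have x02: "x0 $ 2 = 0" by (simp add: x0_def Pt_axis_pt)
  have Vx0: "V x0 \<noteq> 0"
    using zero_V_iff[OF X(2)] X lo[of Z] Z' by auto
  have bx0: "bdf x0 > 0" using bdf_pos_iff_ch[of x0] X Z' q by (simp add: Om_iff)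
  \<comment> \<open>Near the vortex the level is negative, so level 0 stays in the compact set left
    after removing a neighbourhood of the vortex.\<close>
  define K where "K = disk R - {z. z \<noteq> pt (R / \<rho>) 0 \<and> cmod (ch z) < \<delta>}"
  have cK: "compact K" unfolding K_def by (rule compact_diff[OF compact_disk near_sing(1)[OF \<delta>(1)]])
  have "sing \<notin> K" unfolding K_def using near_sing(2)[OF \<delta>(1)] by blast
  moreover have "K \<subseteq> disk R" unfolding K_def by blast
  ultimately have KO: "K \<subseteq> Om" using in_disk_cases by blast
  have orb: "bdf z > 0" "En z = 0" "z \<in> Om" if "z \<in> orbit Om V x0" for z
    using that interior_invariant[OF bx0] orbit_H[of z x0] X(3) Z(3) orbit_subset by auto
  have inK: "z \<in> K" if z: "z \<in> disk R" "z \<in> Om" "En z = 0" for z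
  proof -
    have "\<not> cmod (ch z) < \<delta>"
      using \<delta>(3)[of "cmod (ch z)", OF _ _ Re_cmod_bounds[of "ch z"]] ch_nz[OF z(2)] En_ch[OF z(2)] z(3) by auto
    then show ?thesis using z(1) unfolding K_def by blast
  qed
  have orbK: "orbit Om V x0 \<subseteq> K"
  proof
    fix z assume "z \<in> orbit Om V x0"
    from orb[OF this] inK[of z] show "z \<in> K" by (simp add: disk_iff)
  qed
  obtain \<Gamma> where \<Gamma>: "solution_on UNIV Om V \<Gamma>" "\<Gamma> 0 = x0" "range \<Gamma> = orbit Om V x0"
    using global_solution[OF X(2) cK KO orbK] by metis
  have \<Gamma>orb: "bdf (\<Gamma> t) > 0" "En (\<Gamma> t) = 0" "\<Gamma> t \<in> Om" "\<Gamma> t \<in> K" for t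
    using orb[of "\<Gamma> t"] \<Gamma>(3) orbK by (auto simp: subset_iff)
  have axis: "\<Gamma> t = x0" if "\<Gamma> t $ 2 = 0" for t
  proof -
    define z where "z = \<Gamma> t"
    have z: "z \<in> Om" "bdf z > 0" "En z = 0" using \<Gamma>orb by (auto simp: z_def)
    have zn: "z \<noteq> pt (R / \<rho>) 0" using z(1) by (simp add: Om_iff)
    have "sgn (Im (ch z)) = 0" using Im_ch_sgn[OF zn] that by (simp add: z_def)
    then have "Im (ch z) = 0" by (simp add: sgn_zero_iff)
    then have "cmod (ch z) = \<bar>Re (ch z)\<bar>" by (simp add: cmod_def)
    then have e1: "Re (ch z) / cmod (ch z) = 1 \<or> Re (ch z) / cmod (ch z) = -1"
      using ch_nz[OF z(1)] by (auto simp: abs_if)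
    have b: "0 < cmod (ch z)" "cmod (ch z) < 1" using bdf_pos_iff_ch[OF zn] z ch_nz by auto
    have e: "lv (cmod (ch z)) (Re (ch z) / cmod (ch z)) = 0" using En_ch z by simp
    have v: "Re (ch z) / cmod (ch z) = -1" using e1 e right[OF b] by (metis less_irrefl)
    then have "cmod (ch z) = Z" using Zu b e by simp
    moreover obtain \<sigma> where "z = Pt \<sigma> (cmod (ch z)) (Re (ch z) / cmod (ch z))"
      using Pt_surj[OF z(1)] by metis
    ultimately have "z = Pt \<sigma> Z (-1)" using v by simp
    then show ?thesis by (simp add: z_def x0_def Pt_axis)
  qed
  note nr = no_return[OF \<Gamma>(1,2) Vx0 axis x02]
  have cont: "continuous_on UNIV (\<lambda>t. \<Gamma> t $ 2)"
    using solution_on_continuous[OF \<Gamma>(1)] by (intro continuous_intros)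
  define \<sigma> where "\<sigma> = sgn (\<Gamma> 1 $ 2)"
  have \<sigma>: "\<sigma> = 1 \<or> \<sigma> = -1" using nr(1)[of 1] by (auto simp: \<sigma>_def sgn_if)
  \<comment> \<open>A change of half plane would require crossing the axis at a positive
    time.\<close>
  have side: "\<sigma> * (\<Gamma> t $ 2) > 0" if t: "t > 0" for t
  proof (rule ccontr)
    assume "\<not> \<sigma> * (\<Gamma> t $ 2) > 0"
    then have neg: "\<sigma> * (\<Gamma> t $ 2) <= 0" by simp
    have pos1: "\<sigma> * (\<Gamma> 1 $ 2) \<ge> 0" by (simp add: \<sigma>_def sgn_mult_abs mult.commute sgn_if)
    have co: "continuous_on S (\<lambda>t. \<sigma> * (\<Gamma> t $ 2))" for S
      by (intro continuous_intros continuous_on_subset[OF cont]) auto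
    have "\<exists>s\<ge>min t 1. s <= max t 1 \<and> \<sigma> * (\<Gamma> s $ 2) = 0"
    proof (cases "t <= 1")
      case True then show ?thesis using IVT'[of "\<lambda>t. \<sigma> * (\<Gamma> t $ 2)" t 0 1] neg pos1 co by auto
    next
      case False then show ?thesis using IVT2'[of "\<lambda>t. \<sigma> * (\<Gamma> t $ 2)" t 0 1] neg pos1 co by auto
    qed
    then obtain s where s: "s \<ge> min t 1" "\<sigma> * (\<Gamma> s $ 2) = 0" by blast
    then have "s > 0" "\<Gamma> s $ 2 = 0" using t \<sigma> by auto
    then show False using nr(1)[of s] by simp
  qed
  have \<sigma>P: "\<sigma> * (Pt \<sigma> 1 u $ 2) > 0" "Pt (- \<sigma>) 1 u = mir (Pt \<sigma> 1 u)"
    using Pt_upper[of 1 u] Pt_mirror[of 1 u] u \<sigma> by (auto simp: mir_def vec2_eq_iff)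
  have lim: "(\<Gamma> \<longlongrightarrow> Pt \<sigma> 1 u) at_top"
  proof (rule tendsto_at_top_compact[OF cK])
    show "\<Gamma> t \<in> K" for t by (rule \<Gamma>orb)
    fix Y p assume Y: "filterlim Y at_top sequentially" "(\<lambda>n. \<Gamma> (Y n)) \<longlonglongrightarrow> p"
    have "p \<in> K" using closed_sequentially[OF compact_imp_closed[OF cK] _ Y(2)] \<Gamma>orb by blast
    then have pO: "p \<in> Om" using KO by blast
    have "isCont En p" using dH[OF pO] has_derivative_continuous by blast
    then have "(\<lambda>n. En (\<Gamma> (Y n))) \<longlonglongrightarrow> En p" using Y(2) isCont_tendsto_compose by blast
    then have Ep: "En p = 0" using \<Gamma>orb(2) by (simp add: LIMSEQ_const_iff)
    have pd: "p \<in> disk R"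
      using closed_sequentially[OF compact_imp_closed[OF compact_disk] _ Y(2)] \<Gamma>orb(1) disk_iff less_imp_le by blast
    \<comment> \<open>A regular limit point would make the solution periodic and bring it back to
      the axis at the period.\<close>
    have "V p = 0"
    proof (rule ccontr)
      assume "V p \<noteq> 0"
      then obtain \<tau> where \<tau>: "\<tau> > 0" "!!t. \<Gamma> (t + \<tau>) = \<Gamma> t"
        using recurrent_imp_periodic[OF \<Gamma>(1) pO _ Y] by metis
      have "\<Gamma> \<tau> $ 2 = 0" using \<tau>(2)[of 0] \<Gamma>(2) x02 by simp
      then show False using nr(1)[of \<tau>] \<tau>(1) by simp
    qed
    then have "p \<in> {pt (R * ax q) 0, Pt 1 1 u, Pt (-1) 1 u}"
      unfolding eqs[symmetric] using pO pd by (simp add: equilibrium_def)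
    moreover have "p \<noteq> pt (R * ax q) 0"
    proof
      assume "p = pt (R * ax q) 0"
      then have "p = Pt 1 q (-1)" by (simp add: Pt_axis_pt)
      then have "En p = lv q (-1)" using Pt_facts'(3)[OF q(1,1) less_imp_le[OF q(2)], of "-1" 1] by simp
      then show False using Ep top by simp
    qed
    ultimately have "p = Pt \<sigma> 1 u \<or> p = mir (Pt \<sigma> 1 u)" using \<sigma> \<sigma>P(2) by auto
    moreover have "\<sigma> * (p $ 2) \<ge> 0"
    proof -
      have l: "(\<lambda>n. \<sigma> * (\<Gamma> (Y n) $ 2)) \<longlonglongrightarrow> \<sigma> * (p $ 2)" using Y(2) by (intro tendsto_intros)
      have "\<forall>\<^sub>F n in sequentially. Y n > 0" using Y(1) filterlim_at_top_dense by blast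
      then have "\<forall>\<^sub>F n in sequentially. 0 <= \<sigma> * (\<Gamma> (Y n) $ 2)"
        by (rule eventually_mono) (use side less_imp_le in blast)
      then show ?thesis using tendsto_lowerbound[OF l] by simp
    qed
    ultimately show "p = Pt \<sigma> 1 u" using \<sigma>P(1) by (auto simp: mir_def)
  qed
  have lim2: "(\<Gamma> \<longlongrightarrow> Pt (- \<sigma>) 1 u) at_bot"
  proof -
    have "((\<lambda>t. mir (\<Gamma> t)) \<longlongrightarrow> mir (Pt \<sigma> 1 u)) at_top"
      by (rule bounded_linear.tendsto[OF bounded_linear_mir lim])
    then have "((\<lambda>t. \<Gamma> (- t)) \<longlongrightarrow> Pt (- \<sigma>) 1 u) at_top" by (simp only: \<sigma>P(2) nr(2))
    then show ?thesis unfolding at_bot_mirror filterlim_filtermap .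
  qed
  have "connecting_orbit Om V (disk R) (Pt (- \<sigma>) 1 u) (Pt \<sigma> 1 u)"
    unfolding connecting_orbit_def using \<Gamma>(1) lim lim2 \<Gamma>orb(1) by (auto simp: interior_disk)
  moreover have "Pt (- \<sigma>) 1 u \<noteq> Pt \<sigma> 1 u"
  proof
    assume "Pt (- \<sigma>) 1 u = Pt \<sigma> 1 u"
    then have "Pt \<sigma> 1 u $ 2 = - (Pt \<sigma> 1 u $ 2)" using arg_cong[OF \<sigma>P(2), of "\<lambda>z. z $ 2"] by (simp add: mir_def)
    then show False using \<sigma>P(1) by simp
  qed
  ultimately show ?thesis unfolding saddle_connection_inside_def using \<sigma> by fastforce
qed

end

section \<open>Orbit equivalences from maps of the strip\<close>

text \<open>The punctured closed disk folded along the axis: the pairs \<open>(q, u)\<close> of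
  either closed half. The lines \<open>u = 1\<close> and \<open>u = -1\<close> are the two parts of
  the axis.\<close>

definition strip :: "(real \<times> real) set" where
  "strip = {0<..1} \<times> {-1..1}"

context vortex_system
begin

definition co :: "real^2 => real \<times> real" where
  "co z = (cmod (ch z), Re (ch z) / cmod (ch z))"

text \<open>The value on the axis is a convention; by \<open>Pt_side\<close> both signs denote the
  same point there.\<close>

definition sd :: "real^2 => real" where
  "sd z = (if z $ 2 <= 0 then -1 else 1)"

lemma sd: "sd z = 1 \<or> sd z = -1"
  by (simp add: sd_def)

lemma co_strip: "z \<in> pdisk ==> co z \<in> strip"
  using ch_nz disk_iff_ch disk_ne Re_cmod_bounds by (auto simp: strip_def co_def)

lemma Pt_strip:
  assumes "(q, u) \<in> strip" "\<sigma> = 1 \<or> \<sigma> = -1"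
  shows "Pt \<sigma> q u \<in> pdisk" "co (Pt \<sigma> q u) = (q, u)" "En (Pt \<sigma> q u) = lv q u"
proof -
  have h: "0 < q" "q <= 1" "-1 <= u" "u <= 1" using assms by (auto simp: strip_def)
  note P = Pt_facts'[OF h(1) h assms(2)]
  have "Pt \<sigma> q u \<noteq> pt (R / \<rho>) 0" using P(2) Om_subset by blast
  then show "Pt \<sigma> q u \<in> pdisk" using P(2,4) h disk_iff_ch[of "Pt \<sigma> q u"] by simp
  show "co (Pt \<sigma> q u) = (q, u)" using P by (simp add: co_def)
  show "En (Pt \<sigma> q u) = lv q u" by (rule P)
qed

lemma Pt_side: "u = 1 \<or> u = -1 ==> Pt \<sigma> q u = Pt \<sigma>' q u"
  by (auto simp: Pt_axis)

lemma sd_Pt: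
  assumes "(q, u) \<in> strip" "\<sigma> = 1 \<or> \<sigma> = -1" "u \<noteq> 1" "u \<noteq> -1"
  shows "sd (Pt \<sigma> q u) = \<sigma>"
  using Pt_upper[of q u] Pt_mirror[of q u] assms by (auto simp: sd_def strip_def)

lemma Pt_co:
  assumes z: "z \<in> pdisk"
  shows "Pt (sd z) (fst (co z)) (snd (co z)) = z"
proof -
  obtain \<sigma> where \<sigma>: "\<sigma> = 1 \<or> \<sigma> = -1" "z = Pt \<sigma> (fst (co z)) (snd (co z))"
    using Pt_surj[of z] z unfolding co_def by auto
  have c: "(fst (co z), snd (co z)) \<in> strip" using co_strip[OF z] by simp
  show ?thesis
  proof (cases "snd (co z) = 1 \<or> snd (co z) = -1")
    case True then show ?thesis using Pt_side \<sigma>(2) by metis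
  next
    case False then have "sd (Pt \<sigma> (fst (co z)) (snd (co z))) = \<sigma>" using sd_Pt[OF c \<sigma>(1)] by blast
    then show ?thesis using \<sigma>(2) by simp
  qed
qed

lemma axis_co:
  assumes z: "z \<in> pdisk" "z $ 2 = 0"
  shows "snd (co z) = 1 \<or> snd (co z) = -1"
proof (rule ccontr)
  assume "\<not> ?thesis"
  moreover have "fst (co z) > 0" "fst (co z) <= 1" "snd (co z) \<ge> -1" "snd (co z) <= 1"
    using co_strip[OF z(1)] by (auto simp: strip_def)
  ultimately have "Pt 1 (fst (co z)) (snd (co z)) $ 2 > 0" by (intro Pt_upper) auto
  then show False using Pt_co[OF z(1)] z(2) Pt_mirror[of "fst (co z)" "snd (co z)"] sd[of z] by auto
qed

lemma equilibrium_co: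
  assumes z: "z \<in> pdisk"
  shows "V z = 0 \<longleftrightarrow> krad (fst (co z)) (snd (co z)) = c \<and>
           (fst (co z) = 1 \<or> snd (co z) = 1 \<or> snd (co z) = -1)"
proof -
  have "Im (ch z) = 0 \<longleftrightarrow> z $ 2 = 0"
    using Im_ch_sgn[of z] Om_subset z by (metis ComplD Int_iff insertI1 sgn_zero_iff subsetD)
  moreover have "z $ 2 = 0" if "snd (co z) = 1 \<or> snd (co z) = -1"
    using Pt_co[OF z] Pt_side[OF that, of 1 _ "-1"] Pt_mirror[of "fst (co z)" "snd (co z)"] sd[of z] by auto
  ultimately have "Im (ch z) = 0 \<longleftrightarrow> snd (co z) = 1 \<or> snd (co z) = -1" using axis_co[OF z] by blast
  then show ?thesis using zero_V_iff[of z] z by (simp add: co_def)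
qed

lemma continuous_co: "continuous_on (pdisk) co"
proof -
  have "continuous_on (pdisk) ch"
    by (rule continuous_on_subset[OF continuous_ch]) (use Om_subset in auto)
  then show ?thesis unfolding co_def[abs_def]
    by (intro continuous_intros) (use ch_nz in auto)
qed

end

locale two_systems = P: vortex_system \<rho> c R \<theta> + Q: vortex_system \<rho>' c' R \<theta>
  for \<rho> c \<rho>' c' R \<theta> :: real

abbreviation (in two_systems) "equivalent \<equiv> \<exists>h k. homeomorphism (disk R) (disk R) h k \<and> carries_orbits (P.pdisk) P.V (Q.pdisk) Q.V h"
abbreviation (in disc_params) "critical q u \<equiv> krad q u = c \<and> (q = 1 \<or> u = 1 \<or> u = -1)"

text \<open>\<open>F\<close> acts on both half disks alike. The condition \<open>side\<close> sends
  the axis to the axis, so the two copies fit together there.\<close>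

locale strip_map = two_systems +
  fixes F G :: "real \<times> real => real \<times> real"
  assumes FG: "homeomorphism strip strip F G"
    and side: "x \<in> strip ==> snd (F x) = 1 \<or> snd (F x) = -1 \<longleftrightarrow> snd x = 1 \<or> snd x = -1"
begin

definition \<zeta> :: "real^2 => complex" where
  "\<zeta> z = (if z = P.sing then 0 else cpt (P.sd z) (fst (F (P.co z))) (snd (F (P.co z))))"

definition H :: "real^2 => real^2" where
  "H z = Q.pz (\<zeta> z)"

lemma F_strip: "x \<in> strip ==> F x \<in> strip" and GF: "x \<in> strip ==> G (F x) = x"
  using FG by (auto simp: homeomorphism_def)

lemma H_Pt: "z \<in> P.pdisk ==> H z = Q.Pt (P.sd z) (fst (F (P.co z))) (snd (F (P.co z)))"
  using P.sing_facts(2) by (auto simp: H_def \<zeta>_def Q.Pt_def)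

lemma H_sing: "H P.sing = Q.sing"
  using Q.Pt_axis_pt[of 1 0] Q.Pt_axis[of 1 0] by (simp add: H_def \<zeta>_def Q.ax_def)

lemma \<zeta>_cmod: "z \<in> P.pdisk ==> cmod (\<zeta> z) = fst (F (P.co z))"
proof -
  assume z: "z \<in> P.pdisk"
  obtain q u where qu: "F (P.co z) = (q, u)" by force
  have "(q, u) \<in> strip" using F_strip[OF P.co_strip[OF z]] qu by simp
  then show ?thesis using cpt_simps(1)[of q u "P.sd z"] P.sd P.sing_facts(2) z qu
    by (auto simp: \<zeta>_def strip_def)
qed

lemma \<zeta>_le: "z \<in> disk R ==> cmod (\<zeta> z) <= 1"
proof (cases "z = P.sing")
  case False
  assume "z \<in> disk R"
  with False have z: "z \<in> P.pdisk" using P.in_disk_cases by blast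
  show ?thesis using \<zeta>_cmod[OF z] F_strip[OF P.co_strip[OF z]] by (auto simp: strip_def)
qed (simp add: \<zeta>_def)

text \<open>This is continuity at the vortex. \<open>G\<close> maps the compact part of the strip
  with \<open>q \<ge> \<epsilon>\<close> to a compact part, whose radii are bounded below; points of
  smaller radius must be sent to radii below \<epsilon>.\<close>

lemma \<zeta>_small:
  assumes "\<epsilon> > 0"
  obtains \<delta> where "\<delta> > 0" "!!z. z \<in> disk R ==> cmod (P.ch z) < \<delta> ==> cmod (\<zeta> z) < \<epsilon>"
proof -
  define K where "K = {\<epsilon>..1} \<times> {-1..1::real}"
  have K: "K \<subseteq> strip" using assms by (auto simp: K_def strip_def)
  have "continuous_on K G"
    using FG continuous_on_subset[OF _ K] by (auto simp: homeomorphism_def)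
  then have "compact (G ` K)"
    by (rule compact_continuous_image) (simp add: K_def compact_Times)
  then have "compact (fst ` G ` K)" by (rule compact_continuous_image[OF continuous_on_fst[OF continuous_on_id]])
  moreover have pos: "x > 0" if "x \<in> fst ` G ` K" for x
  proof -
    have "G ` strip = strip" using FG by (simp add: homeomorphism_def)
    then have "G ` K \<subseteq> strip" using K by blast
    then show ?thesis using that by (auto simp: strip_def)
  qed
  ultimately obtain \<delta> where \<delta>: "\<delta> > 0" "!!x. x \<in> fst ` G ` K ==> \<delta> <= x"
  proof (cases "fst ` G ` K = {}")
    case True
    then show ?thesis using that[of 1] by auto
  next
    case False
    assume "compact (fst ` G ` K)"
    then obtain m where "m \<in> fst ` G ` K" "\<forall>x\<in>fst ` G ` K. m <= x"
      using compact_attains_inf[OF _ False] by blast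
    then show ?thesis using that[of m] pos by blast
  qed
  have "cmod (\<zeta> z) < \<epsilon>" if z: "z \<in> disk R" "cmod (P.ch z) < \<delta>" for z
  proof (cases "z = P.sing")
    case True then show ?thesis using assms by (simp add: \<zeta>_def)
  next
    case False
    then have zO: "z \<in> P.pdisk" using P.in_disk_cases z by blast
    show ?thesis
    proof (rule ccontr)
      assume "\<not> cmod (\<zeta> z) < \<epsilon>"
      then have "F (P.co z) \<in> K"
        using F_strip[OF P.co_strip[OF zO]] \<zeta>_cmod[OF zO] by (auto simp: K_def strip_def mem_Times_iff)
      then have "P.co z \<in> G ` K" using GF[OF P.co_strip[OF zO]] by (metis imageI)
      then have "\<delta> <= fst (P.co z)" using \<delta>(2) by blast
      then show False using z(2) by (simp add: P.co_def)
    qed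
  qed
  then show ?thesis using that \<delta>(1) by blast
qed

lemma continuous_\<zeta>: "continuous_on (disk R) \<zeta>"
  unfolding continuous_on_eq_continuous_within
proof
  fix z assume z: "z \<in> disk R"
  show "continuous (at z within disk R) \<zeta>"
  proof (cases "z = P.sing")
    case True
    have "continuous_on (disk R) P.ch" by (rule continuous_on_subset[OF P.continuous_ch P.disk_subset])
    then have lim: "(P.ch \<longlongrightarrow> 0) (at z within disk R)"
      using z True P.sing_facts(1) by (auto simp: continuous_on)
    have "(\<zeta> \<longlongrightarrow> 0) (at z within disk R)"
    proof (rule tendstoI)
      fix \<epsilon> :: real assume "\<epsilon> > 0"
      obtain \<delta> where \<delta>: "\<delta> > 0" "!!z. z \<in> disk R ==> cmod (P.ch z) < \<delta> ==> cmod (\<zeta> z) < \<epsilon>"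
        using \<zeta>_small[OF \<open>\<epsilon> > 0\<close>] by blast
      have "\<forall>\<^sub>F x in at z within disk R. x \<in> disk R" by (simp add: eventually_at_filter)
      moreover have "\<forall>\<^sub>F x in at z within disk R. dist (P.ch x) 0 < \<delta>" by (rule tendstoD[OF lim \<delta>(1)])
      ultimately show "\<forall>\<^sub>F x in at z within disk R. dist (\<zeta> x) 0 < \<epsilon>"
        by eventually_elim (use \<delta>(2) in simp)
    qed
    then show ?thesis using True by (simp add: continuous_within \<zeta>_def)
  next
    case False
    then have zO: "z \<in> P.pdisk" using P.in_disk_cases z by blast
    have F: "continuous_on (P.pdisk) (\<lambda>z. F (P.co z))"
      by (rule continuous_on_compose2[OF _ P.continuous_co])
        (use FG P.co_strip in \<open>auto simp: homeomorphism_def\<close>)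
    have c: "continuous_on S (\<lambda>z. cpt \<sigma> (fst (F (P.co z))) (snd (F (P.co z))))" if "S \<subseteq> P.pdisk" for S \<sigma>
      unfolding cpt_def complex_eq_iff Complex_eq
      by (intro continuous_intros continuous_on_subset[OF F that])
    have "continuous_on (P.pdisk) (\<lambda>z. if z $ 2 <= 0
        then cpt (-1) (fst (F (P.co z))) (snd (F (P.co z))) else cpt 1 (fst (F (P.co z))) (snd (F (P.co z))))"
    proof (rule continuous_on_cases_le)
      fix z assume z: "z \<in> P.pdisk" "z $ 2 = 0"
      have "snd (F (P.co z)) = 1 \<or> snd (F (P.co z)) = -1"
        using side[OF P.co_strip[OF z(1)]] P.axis_co[OF z] by simp
      then show "cpt (-1) (fst (F (P.co z))) (snd (F (P.co z))) = cpt 1 (fst (F (P.co z))) (snd (F (P.co z)))"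
        by (auto simp: cpt_axis)
    qed (auto intro!: c continuous_intros)
    then have "continuous_on (P.pdisk) \<zeta>"
      by (rule continuous_on_eq) (use P.sing_facts(2) in \<open>auto simp: \<zeta>_def P.sd_def\<close>)
    then have "continuous (at z within P.pdisk) \<zeta>" using zO by (simp add: continuous_on_eq_continuous_within)
    moreover have "at z within P.pdisk = at z within disk R"
      by (rule at_within_nhd[of _ P.Om]) (use zO P.open_Om in auto)
    ultimately show ?thesis by simp
  qed
qed

lemma continuous_H: "continuous_on (disk R) H"
  unfolding H_def
proof (rule Q.continuous_pz[OF continuous_\<zeta>])
  fix z assume "z \<in> disk R"
  then have "\<rho>' * cmod (\<zeta> z) < 1" using \<zeta>_le[of z] Q.\<rho> mult_left_le[of "cmod (\<zeta> z)" \<rho>'] by linarith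
  then show "1 + of_real \<rho>' * \<zeta> z \<noteq> 0" by (intro Q.small_den) (simp add: mult.commute)
qed

lemma H_props:
  assumes z: "z \<in> P.pdisk"
  shows "H z \<in> Q.pdisk" "Q.co (H z) = F (P.co z)"
    "Q.En (H z) = lev \<rho>' c' (fst (F (P.co z))) (snd (F (P.co z)))"
    "snd (P.co z) \<noteq> 1 ==> snd (P.co z) \<noteq> -1 ==> Q.sd (H z) = P.sd z"
proof -
  have s: "(fst (F (P.co z)), snd (F (P.co z))) \<in> strip" using F_strip[OF P.co_strip[OF z]] by simp
  note * = Q.Pt_strip[OF s P.sd[of z]]
  show "H z \<in> Q.pdisk" "Q.co (H z) = F (P.co z)"
    "Q.En (H z) = lev \<rho>' c' (fst (F (P.co z))) (snd (F (P.co z)))" unfolding H_Pt[OF z] using * by simp_all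
  show "snd (P.co z) \<noteq> 1 ==> snd (P.co z) \<noteq> -1 ==> Q.sd (H z) = P.sd z"
    unfolding H_Pt[OF z] by (rule Q.sd_Pt[OF s P.sd]) (use side[OF P.co_strip[OF z]] in auto)
qed

end

lemma strip_map_sym: "strip_map \<rho> c \<rho>' c' R \<theta> F G ==> strip_map \<rho>' c' \<rho> c R \<theta> G F"
proof -
  assume "strip_map \<rho> c \<rho>' c' R \<theta> F G"
  then interpret strip_map \<rho> c \<rho>' c' R \<theta> F G .
  show ?thesis
  proof unfold_locales
    show "homeomorphism strip strip G F" using FG by (rule homeomorphism_symD)
    fix x :: "real \<times> real" assume "x \<in> strip"
    then have "G x \<in> strip" "F (G x) = x" using FG by (auto simp: homeomorphism_def)
    then show "(snd (G x) = 1 \<or> snd (G x) = -1) = (snd x = 1 \<or> snd x = -1)"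
      using side[of "G x"] by simp
  qed
qed

context strip_map
begin

sublocale S: strip_map \<rho>' c' \<rho> c R \<theta> G F
  by (rule strip_map_sym) unfold_locales

lemma S_H_H:
  assumes "z \<in> disk R"
  shows "S.H (H z) = z"
proof (cases "z = P.sing")
  case True then show ?thesis using H_sing S.H_sing by simp
next
  case False
  then have z: "z \<in> P.pdisk" using P.in_disk_cases assms by blast
  note h = H_props[OF z]
  have G: "G (F (P.co z)) = P.co z" by (rule GF[OF P.co_strip[OF z]])
  have "S.H (H z) = P.Pt (Q.sd (H z)) (fst (P.co z)) (snd (P.co z))" unfolding S.H_Pt[OF h(1)] h(2) G ..
  also have "\<dots> = P.Pt (P.sd z) (fst (P.co z)) (snd (P.co z))"
    using h(4) P.Pt_side[of "snd (P.co z)"] by metis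
  finally show ?thesis using P.Pt_co[OF z] by simp
qed

lemma H_disk: "z \<in> disk R ==> H z \<in> disk R"
  using H_props(1) P.in_disk_cases H_sing Q.sing_facts(3) by fastforce

end

context strip_map
begin

theorem homeomorphism_H: "homeomorphism (disk R) (disk R) H S.H"
  using continuous_H S.continuous_H S_H_H S.S_H_H H_disk S.H_disk
  by (auto intro!: homeomorphismI)

theorem carries_orbits_H:
  assumes levels: "!!x. x \<in> strip ==> lev \<rho>' c' (fst (F x)) (snd (F x)) = e (lev \<rho> c (fst x) (snd x))" "inj e"
    and equil: "!!q u q' u'. (q, u) \<in> strip ==> F (q, u) = (q', u') ==>
        (Q.critical q' u' \<longleftrightarrow> P.critical q u)"
  shows "carries_orbits (P.pdisk) P.V (Q.pdisk) Q.V H"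
proof (rule carries_orbitsI)
  show "hamiltonian_field P.Om P.V P.En (2 / (\<theta> * R^2))" "hamiltonian_field Q.Om Q.V Q.En (2 / (\<theta> * R^2))"
    by unfold_locales
  show "orbit P.Om P.V z \<subseteq> disk R" if "z \<in> P.pdisk" for z by (rule P.disk_invariant[OF that])
  show "orbit Q.Om Q.V z \<subseteq> disk R" if "z \<in> Q.pdisk" for z by (rule Q.disk_invariant[OF that])
  show "homeomorphism (P.pdisk) (Q.pdisk) H S.H"
    using continuous_on_subset[OF continuous_H] continuous_on_subset[OF S.continuous_H]
      S_H_H S.S_H_H H_props(1) S.H_props(1)
    by (intro homeomorphismI) auto
  fix z assume z: "z \<in> P.pdisk"
  have E: "Q.En (H z) = e (P.En z)" if z: "z \<in> P.pdisk" for z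
    using H_props(3)[OF z] levels(1)[OF P.co_strip[OF z]] P.En_ch[of z] z by (simp add: P.co_def)
  show "P.En z = P.En w \<longleftrightarrow> Q.En (H z) = Q.En (H w)" if "w \<in> P.pdisk" for w
    unfolding E[OF z] E[OF that] using levels(2) by (auto simp: inj_def)
  have "Q.V (H z) = 0 \<longleftrightarrow> P.V z = 0"
    unfolding P.equilibrium_co[OF z] Q.equilibrium_co[OF H_props(1)[OF z]] H_props(2)[OF z]
    by (rule equil) (use P.co_strip[OF z] in auto)
  then show "P.V z = 0 \<longleftrightarrow> Q.V (H z) = 0" by simp
qed

end

context two_systems
begin

lemma equivalentI:
  assumes F: "homeomorphism strip strip F G" and e: "strict_mono e"
    and pts: "!!q u q' u'. (q, u) \<in> strip ==> (q', u') \<in> strip ==> F (q, u) = (q', u') ==>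
      lev \<rho>' c' q' u' = e (lev \<rho> c q u) \<and> (u' = 1 \<longleftrightarrow> u = 1) \<and> (u' = -1 \<longleftrightarrow> u = -1) \<and>
      (Q.critical q' u' \<longleftrightarrow> P.critical q u)"
  shows equivalent
proof -
  have F1: "x \<in> strip ==> F x \<in> strip" for x using F by (auto simp: homeomorphism_def)
  interpret strip_map \<rho> c \<rho>' c' R \<theta> F G
  proof
    fix x :: "real \<times> real" assume "x \<in> strip"
    then show "(snd (F x) = 1 \<or> snd (F x) = -1) = (snd x = 1 \<or> snd x = -1)"
      using pts[of "fst x" "snd x" "fst (F x)" "snd (F x)"] F1[of x] by simp
  qed (rule F)
  have "carries_orbits (P.pdisk) P.V (Q.pdisk) Q.V H"
  proof (rule carries_orbits_H)
    show "lev \<rho>' c' (fst (F x)) (snd (F x)) = e (lev \<rho> c (fst x) (snd x))" if "x \<in> strip" for x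
      using pts[of "fst x" "snd x" "fst (F x)" "snd (F x)"] F1[of x] that by simp
    show "inj e" using e by (rule strict_mono_imp_inj_on)
    fix q u q' u' assume x: "(q, u) \<in> strip" "F (q, u) = (q', u')"
    then show "Q.krad q' u' = c' \<and> (q' = 1 \<or> u' = 1 \<or> u' = -1) \<longleftrightarrow> P.krad q u = c \<and> (q = 1 \<or> u = 1 \<or> u = -1)"
      using pts[of q u q' u'] F1[of "(q, u)"] unfolding x(2) by blast
  qed
  then show ?thesis using homeomorphism_H by blast
qed

end

section \<open>Positive circulation ratio\<close>

lemma strict_mono_homeo_inv:
  fixes e :: "real => real"
  assumes "strict_mono e" "surj e"
  shows "strict_mono (inv e)" "surj (inv e)" "e (inv e x) = x" "inv e (e x) = x"
    "continuous_on S e" "continuous_on S (inv e)"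
proof -
  have i: "inj e" using assms(1) by (rule strict_mono_imp_inj_on)
  show f: "e (inv e x) = x" "inv e (e x) = x" for x using assms i by (simp_all add: surj_f_inv_f)
  show m: "strict_mono (inv e)"
    by (rule strict_monoI) (metis assms(1) f(1) strict_mono_less)
  show s: "surj (inv e)" by (metis f(2) surj_def)
  show "continuous_on S e" "continuous_on S (inv e)"
    using continuous_onI_mono[of e UNIV] continuous_onI_mono[of "inv e" UNIV] assms m s
    by (auto simp: strict_mono_less_eq intro: continuous_on_subset)
qed

text \<open>A translation takes \<open>a\<close> to \<open>a'\<close>; then two broken lines correct
  the images of \<open>b\<close> and \<open>c\<close> in turn. Each of them,
  \<open>st p x y\<close>, is the identity up to \<open>p\<close> and linear beyond, so it does not
  disturb what has been arranged.\<close>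

lemma piecewise_linear_homeo:
  fixes a b c a' b' c' :: real
  assumes "a < b" "b < c" "a' < b'" "b' < c'"
  obtains e where "strict_mono e" "surj e" "e a = a'" "e b = b'" "e c = c'"
proof -
  define st where "st p x y t = (if t <= p then t else p + (t - p) * ((y - p) / (x - p)))" for p x y t :: real
  have st: "strict_mono (st p x y)" "surj (st p x y)" "st p x y x = y" "t <= p ==> st p x y t = t"
    if "p < x" "p < y" for p x y t
  proof -
    have k: "(y - p) / (x - p) > 0" using that by simp
    show "strict_mono (st p x y)"
    proof (rule strict_monoI)
      fix s t :: real assume "s < t"
      show "st p x y s < st p x y t"
      proof (cases "t <= p")
        case True then show ?thesis using \<open>s < t\<close> by (simp add: st_def)
      next
        case False
        then have "(t - p) * ((y - p) / (x - p)) > 0" using k by (intro mult_pos_pos) auto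
        moreover have "(s - p) * ((y - p) / (x - p)) < (t - p) * ((y - p) / (x - p))"
          using k \<open>s < t\<close> by (intro mult_strict_right_mono) auto
        ultimately show ?thesis using False by (auto simp: st_def)
      qed
    qed
    have "\<exists>s. st p x y s = t" for t
    proof (cases "t <= p")
      case True then show ?thesis by (intro exI[of _ t]) (simp add: st_def)
    next
      case False
      then have "p + (t - p) / ((y - p) / (x - p)) > p" using k by (simp add: divide_pos_pos del: divide_divide_eq_right)
      then show ?thesis
        by (intro exI[of _ "p + (t - p) / ((y - p) / (x - p))"]) (use k that in \<open>simp add: st_def\<close>)
    qed
    then show "surj (st p x y)" by (metis surj_def)
  qed (use that in \<open>simp_all add: st_def\<close>)
  define f where "f = st a' (b - a + a') b' \<circ> (\<lambda>t. t - a + a')"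
  have bb: "a' < b - a + a'" using assms(1) by simp
  have tr: "strict_mono (\<lambda>t. t - a + a')" "surj (\<lambda>t. t - a + a')"
    by (simp add: strict_mono_def, rule surjI[of _ "\<lambda>t. t + a - a'"], simp)
  note s1 = st[OF bb assms(3)]
  have f: "strict_mono f" "surj f" "f a = a'" "f b = b'"
    unfolding f_def by (rule strict_mono_o[OF s1(1) tr(1)] comp_surj[OF tr(2) s1(2)])+ (simp_all add: s1(3,4))
  have bc: "b' < f c" using strict_monoD[OF f(1) assms(2)] f(4) by simp
  note s2 = st[OF bc assms(4)]
  show ?thesis
    by (rule that[OF strict_mono_o[OF s2(1) f(1)] comp_surj[OF f(2) s2(2)]])
      (use s2(3,4) f assms(3) in auto)
qed

section \<open>Unfolding unimodal strips\<close>

lemma snd_strip: "snd ` strip \<subseteq> {-1..1}"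
  by (auto simp: strip_def)

text \<open>The strip is open at \<open>q = 0\<close>, so compactness alone does not give a
  continuous inverse. The growth condition makes \<open>f\<close> proper, hence closed onto its
  image.\<close>

lemma strip_homeomorphism:
  fixes f :: "real \<times> real => real \<times> real"
  assumes "continuous_on strip f" "inj_on f strip"
    and "!!B. \<exists>\<delta>>0. \<forall>q u. 0 < q --> q < \<delta> --> (q, u) \<in> strip --> norm (f (q, u)) > B"
  obtains g where "homeomorphism strip (f ` strip) f g"
proof (rule homeomorphism_injective_closed_map[OF assms(1) refl assms(2)])
  fix C assume C: "closedin (top_of_set strip) C"
  show "closedin (top_of_set (f ` strip)) (f ` C)"
  proof (rule proper_map[OF C])
    fix K assume K: "K \<subseteq> f ` strip" "compact K"
    obtain B where B: "!!x. x \<in> K ==> norm x <= B" using compact_imp_bounded[OF K(2)] by (auto simp: bounded_iff)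
    obtain \<delta> where \<delta>: "\<delta> > 0" "!!q u. 0 < q ==> q < \<delta> ==> (q, u) \<in> strip ==> norm (f (q, u)) > B"
      using assms(3)[of B] by metis
    define S where "S = {\<delta>..1} \<times> {-1..1::real}"
    have S: "S \<subseteq> strip" "compact S" using \<delta>(1) by (auto simp: S_def strip_def compact_Times)
    have "strip \<inter> f -` K = S \<inter> f -` K"
    proof
      show "strip \<inter> f -` K \<subseteq> S \<inter> f -` K"
      proof
        fix x assume x: "x \<in> strip \<inter> f -` K"
        then have "\<not> fst x < \<delta>" using \<delta>(2)[of "fst x" "snd x"] B[of "f x"] by (auto simp: strip_def)
        then show "x \<in> S \<inter> f -` K" using x by (auto simp: S_def strip_def)
      qed
    qed (use S in auto)
    moreover have "compact (S \<inter> f -` K)"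
      using closed_Int_compact[OF continuous_closed_preimage[OF continuous_on_subset[OF assms(1) S(1)]
          compact_imp_closed[OF S(2)] compact_imp_closed[OF K(2)]] S(2)] by (simp add: Int_absorb2 inf_commute inf_left_commute)
    ultimately show "compact (strip \<inter> f -` K)" by simp
  qed auto
qed

text \<open>A point \<open>(x, y)\<close> stands for the level \<open>max 0 x - y\<close> inside the
  ridge and \<open>max 0 x + y\<close> outside it. The map applies \<open>e\<close> to this level
  and to that of the ridge and keeps the side.\<close>

definition fold_map :: "(real => real) => real \<times> real => real \<times> real" where
  "fold_map e = (\<lambda>(x, y). (e x, if 0 <= y then e (max 0 x) - e (max 0 x - y) else e (max 0 x + y) - e (max 0 x)))"

text \<open>The lower bound for \<open>y\<close> is attained on the circle, where the level is 0;
  there is no upper bound, since the level is unbounded below at the vortex.\<close>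

definition fold_set :: "(real => real) => (real \<times> real) set" where
  "fold_set m = {(x, y). m 1 <= x \<and> x <= m (-1) \<and> - max 0 x <= y}"

lemma fold_map_half:
  assumes e: "strict_mono e" "surj e" "e 0 = 0" "e (m 1) = m' 1" "e (m (-1)) = m' (-1)"
  shows "continuous_on (fold_set m) (fold_map e)" "p \<in> fold_set m ==> fold_map e p \<in> fold_set m'"
    "fold_map (inv e) (fold_map e p) = p"
proof -
  note h = strict_mono_homeo_inv[OF e(1,2)]
  have mx: "max 0 (e x) = e (max 0 x)" for x
    using strict_mono_less_eq[OF e(1), of 0 x] e(3) by (auto simp: max_def)
  have "continuous_on (fold_set m) (\<lambda>p. (e (fst p), if - snd p <= 0 then e (max 0 (fst p)) - e (max 0 (fst p) - snd p)
      else e (max 0 (fst p) + snd p) - e (max 0 (fst p))))"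
    by (intro continuous_on_Pair continuous_on_cases_le continuous_intros
        continuous_on_compose2[OF h(5)[of UNIV]]) auto
  then show "continuous_on (fold_set m) (fold_map e)" by (simp add: fold_map_def case_prod_beta)
  obtain x y where p: "p = (x, y)" by force
  show "fold_map (inv e) (fold_map e p) = p"
  proof (cases "0 <= y")
    case True
    then have "e (max 0 x) - e (max 0 x - y) \<ge> 0" using strict_mono_less_eq[OF e(1)] by simp
    then show ?thesis using True by (simp add: fold_map_def p mx h)
  next
    case False
    then have "\<not> 0 <= e (max 0 x + y) - e (max 0 x)" using strict_mono_less[OF e(1), of "max 0 x + y" "max 0 x"] by simp
    then show ?thesis using False by (simp add: fold_map_def p mx h)
  qed
  assume "p \<in> fold_set m"
  then have b: "m 1 <= x" "x <= m (-1)" "0 <= max 0 x + y" by (auto simp: fold_set_def p)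
  then have "e (m 1) <= e x" "e x <= e (m (-1))" "e 0 <= e (max 0 x + y)" "0 <= y ==> e (max 0 x - y) <= e (max 0 x)"
    "e 0 <= e (max 0 x)"
    unfolding strict_mono_less_eq[OF e(1)] by simp_all
  then show "fold_map e p \<in> fold_set m'" unfolding e(3,4,5)
    by (auto simp: fold_map_def fold_set_def p mx)
qed

lemma fold_map_homeomorphism:
  assumes e: "strict_mono e" "surj e" "e 0 = 0" "e (m 1) = m' 1" "e (m (-1)) = m' (-1)"
  shows "homeomorphism (fold_set m) (fold_set m') (fold_map e) (fold_map (inv e))"
proof -
  note h = strict_mono_homeo_inv[OF e(1,2)]
  have i: "inv e 0 = 0" "inv e (m' 1) = m 1" "inv e (m' (-1)) = m (-1)"
    using h(4)[of 0] h(4)[of "m 1"] h(4)[of "m (-1)"] e by simp_all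
  have ii: "inv (inv e) = e" by (rule inv_inv_eq) (use e strict_mono_imp_inj_on in \<open>auto simp: bij_def\<close>)
  note f = fold_map_half[of e m m', OF e]
  note g = fold_map_half[of "inv e" m' m, OF h(1,2) i, unfolded ii]
  show ?thesis by (rule homeomorphismI) (use f g in auto)
qed

text \<open>Where \<open>m\<close> is positive it is the ridge level. Its negative values only tell
  apart the rays whose maximum is 0 and is attained on the circle; being strictly decreasing,
  \<open>m\<close> determines the ray.\<close>

locale unimodal =
  fixes L :: "real => real => real" and m Qs :: "real => real"
  assumes cont: "continuous_on strip (\<lambda>x. L (fst x) (snd x))"
    and m: "continuous_on {-1..1} m" "!!u v. -1 <= u ==> u < v ==> v <= 1 ==> m v < m u"
    and Qs: "continuous_on {-1..1} Qs" "!!u. -1 <= u ==> u <= 1 ==> 0 < Qs u \<and> Qs u <= 1"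
    and inc: "!!s t u. 0 < s ==> s < t ==> t <= Qs u ==> -1 <= u ==> u <= 1 ==> L s u < L t u"
    and dec: "!!s t u. Qs u <= s ==> s < t ==> t <= 1 ==> -1 <= u ==> u <= 1 ==> L t u < L s u"
    and top: "!!u. -1 <= u ==> u <= 1 ==> L (Qs u) u = max 0 (m u)"
    and edge: "!!u. -1 <= u ==> u <= 1 ==> L 1 u = 0"
    and bot: "!!E. \<exists>\<delta>>0. \<forall>q u. 0 < q --> q < \<delta> --> -1 <= u --> u <= 1 --> L q u < E"
begin

text \<open>\<open>fo\<close> unfolds the strip along the ridge \<open>q = Qs u\<close>: \<open>W\<close> is the drop of the level below the ridge,
  counted negatively on the outer side. There a change \<open>e\<close> of the level values acts as \<open>fold_map e\<close>.\<close>

definition W :: "real => real => real" where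
  "W q u = (if q <= Qs u then max 0 (m u) - L q u else L q u - max 0 (m u))"

definition fo :: "real \<times> real => real \<times> real" where
  "fo = (\<lambda>(q, u). (m u, W q u))"

lemma below: "(q, u) \<in> strip ==> L q u <= max 0 (m u)" "(q, u) \<in> strip ==> L q u = max 0 (m u) ==> q = Qs u"
proof -
  assume "(q, u) \<in> strip"
  then have b: "0 < q" "q <= 1" "-1 <= u" "u <= 1" by (auto simp: strip_def)
  have "q = Qs u \<or> L q u < L (Qs u) u"
    using inc[of q "Qs u" u] dec[of u "Qs u" q] b by (cases q "Qs u" rule: linorder_cases) simp_all
  then show "L q u <= max 0 (m u)" "L q u = max 0 (m u) ==> q = Qs u"
    unfolding top[OF b(3,4)] using top[OF b(3,4)] by (auto intro: less_imp_le)
qed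

lemma W_sign: "(q, u) \<in> strip ==> 0 <= W q u \<longleftrightarrow> q <= Qs u" "(q, u) \<in> strip ==> W q u = 0 \<longleftrightarrow> q = Qs u"
proof -
  assume s: "(q, u) \<in> strip"
  define M where "M = max 0 (m u)"
  have "-1 <= u" "u <= 1" using s by (auto simp: strip_def)
  from top[OF this, folded M_def] below[OF s, folded M_def]
  have b: "L q u < M \<and> q \<noteq> Qs u \<or> L q u = M \<and> q = Qs u" by force
  have W: "W q u = (if q <= Qs u then M - L q u else L q u - M)" by (simp add: W_def M_def)
  show "0 <= W q u \<longleftrightarrow> q <= Qs u" "W q u = 0 \<longleftrightarrow> q = Qs u"
    unfolding W using b by (cases "q <= Qs u"; force)+
qed

lemma W_anti:
  assumes "0 < s" "s < t" "t <= 1" "-1 <= u" "u <= 1"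
  shows "W t u < W s u"
proof -
  consider "t <= Qs u" | "s <= Qs u" "Qs u < t" | "Qs u < s" by linarith
  then show ?thesis
  proof cases
    case 1 then show ?thesis using inc[of s t u] assms by (simp add: W_def)
  next
    case 2
    then have "0 <= W s u" "\<not> 0 <= W t u" using W_sign(1)[of s u] W_sign(1)[of t u] assms by (auto simp: strip_def)
    then show ?thesis by simp
  next
    case 3 then show ?thesis using dec[of u s t] assms by (simp add: W_def)
  qed
qed

lemma W_one: "-1 <= u ==> u <= 1 ==> W 1 u = - max 0 (m u)"
  using edge[of u] top[of u] Qs(2)[of u] by (cases "Qs u = 1") (auto simp: W_def)

lemma W_cont: "continuous_on strip (\<lambda>x. W (fst x) (snd x))"
proof -
  have s: "continuous_on strip (\<lambda>x. m (snd x))" "continuous_on strip (\<lambda>x. Qs (snd x))"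
    using continuous_on_compose2[OF m(1) continuous_on_snd[OF continuous_on_id] snd_strip]
      continuous_on_compose2[OF Qs(1) continuous_on_snd[OF continuous_on_id] snd_strip] by simp_all
  have "continuous_on strip (\<lambda>x. if fst x - Qs (snd x) <= 0 then max 0 (m (snd x)) - L (fst x) (snd x)
      else L (fst x) (snd x) - max 0 (m (snd x)))"
  proof (rule continuous_on_cases_le)
    show "continuous_on {t \<in> strip. fst t - Qs (snd t) <= 0} (\<lambda>x. max 0 (m (snd x)) - L (fst x) (snd x))"
      "continuous_on {t \<in> strip. 0 <= fst t - Qs (snd t)} (\<lambda>x. L (fst x) (snd x) - max 0 (m (snd x)))"
      by (intro continuous_intros continuous_on_subset[OF s(1)] continuous_on_subset[OF cont]; auto)+
  qed (use s(2) top in \<open>auto intro!: continuous_intros simp: strip_def\<close>)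
  then show ?thesis by (simp add: W_def)
qed

text \<open>The first coordinate determines \<open>u\<close>, and \<open>W\<close> decreases along
  each ray from arbitrarily large values to its value on the circle. This gives injectivity, the
  image and properness.\<close>

lemma fo_homeo: obtains g where "homeomorphism strip (fold_set m) fo g"
proof -
  have c: "continuous_on strip fo"
    unfolding fo_def case_prod_beta
    using continuous_on_compose2[OF m(1) continuous_on_snd[OF continuous_on_id] snd_strip]
    by (intro continuous_on_Pair W_cont)
  have i: "inj_on fo strip"
  proof (rule inj_onI)
    fix x y assume x: "x \<in> strip" "y \<in> strip" "fo x = fo y"
    then have "snd x = snd y" using m(2)[of "snd x" "snd y"] m(2)[of "snd y" "snd x"]
      by (cases "snd x" "snd y" rule: linorder_cases) (auto simp: fo_def case_prod_beta strip_def)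
    then obtain q s u where xy: "x = (q, u)" "y = (s, u)" by (metis prod.collapse)
    then have "W q u = W s u" "0 < q" "q <= 1" "0 < s" "s <= 1" "-1 <= u" "u <= 1"
      using x by (auto simp: fo_def strip_def)
    then show "x = y" unfolding xy using W_anti[of q s u] W_anti[of s q u]
      by (cases q s rule: linorder_cases) simp_all
  qed
  have big: "\<exists>\<delta>>0. \<forall>q u. 0 < q --> q < \<delta> --> -1 <= u --> u <= 1 --> W q u > B" for B
  proof -
    \<comment> \<open>A level below \<open>- \<bar>B\<bar>\<close> is negative, which excludes
      points beyond the ridge, where the level is at least 0.\<close>
    obtain \<delta> where \<delta>: "\<delta> > 0" "!!q u. 0 < q ==> q < \<delta> ==> -1 <= u ==> u <= 1 ==> L q u < - \<bar>B\<bar>"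
      using bot[of "- \<bar>B\<bar>"] by metis
    have "W q u > B" if h: "0 < q" "q < min 1 \<delta>" "-1 <= u" "u <= 1" for q u
    proof -
      have "q <= Qs u"
      proof (rule ccontr)
        assume "\<not> q <= Qs u"
        then have "L 1 u < L q u" using dec[of u q 1] h by simp
        then show False using edge[of u] \<delta>(2)[of q u] h by simp
      qed
      then show ?thesis using \<delta>(2)[of q u] h by (simp add: W_def)
    qed
    then show ?thesis using \<delta>(1) by (intro exI[of _ "min 1 \<delta>"]) auto
  qed
  have "fo ` strip = fold_set m"
  proof
    show "fo ` strip \<subseteq> fold_set m"
    proof
      fix p assume "p \<in> fo ` strip"
      then obtain q u where p: "p = fo (q, u)" "0 < q" "q <= 1" "-1 <= u" "u <= 1" by (auto simp: strip_def)
      have "W 1 u <= W q u" using W_anti[of q 1 u] p by (cases "q = 1") auto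
      moreover have "m 1 <= m u" using m(2)[of u 1] p by (cases "u = 1") auto
      moreover have "m u <= m (-1)" using m(2)[of "-1" u] p by (cases "u = -1") auto
      ultimately show "p \<in> fold_set m" using W_one[of u] p by (simp add: fo_def fold_set_def)
    qed
    show "fold_set m \<subseteq> fo ` strip"
    proof
      fix p assume "p \<in> fold_set m"
      then obtain x y where p: "p = (x, y)" "m 1 <= x" "x <= m (-1)" "- max 0 x <= y" by (auto simp: fold_set_def)
      obtain u where u: "-1 <= u" "u <= 1" "m u = x" using IVT2'[of m 1 x "-1"] p m(1) by auto
      obtain \<delta> where \<delta>: "\<delta> > 0" "!!q. 0 < q ==> q < \<delta> ==> W q u > y" using big[of y] u by metis
      define d where "d = min 1 (\<delta> / 2)"
      have d: "0 < d" "d <= 1" "W d u > y" using \<delta> by (auto simp: d_def)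
      have "continuous_on {d..1} (\<lambda>q. W q u)"
        using continuous_on_compose2[OF W_cont, of "{d..1}" "\<lambda>q. (q, u)"] u d
        by (simp add: strip_def image_subset_iff continuous_on_Pair)
      then obtain q where q: "d <= q" "q <= 1" "W q u = y"
        using IVT2'[of "\<lambda>q. W q u" 1 y d] d W_one[of u] u p by auto
      then show "p \<in> fo ` strip" using u d p by (intro image_eqI[of _ _ "(q, u)"]) (auto simp: fo_def strip_def)
    qed
  qed
  moreover have "\<exists>\<delta>>0. \<forall>q u. 0 < q --> q < \<delta> --> (q, u) \<in> strip --> norm (fo (q, u)) > B" for B
  proof -
    obtain \<delta> where \<delta>: "\<delta> > 0" "\<forall>q u. 0 < q --> q < \<delta> --> -1 <= u --> u <= 1 --> W q u > B" using big by blast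
    have "norm (fo (q, u)) \<ge> W q u" for q u using norm_snd_le[of "W q u" "m u"] by (simp add: fo_def)
    then have "q > 0 ==> q < \<delta> ==> (q, u) \<in> strip ==> norm (fo (q, u)) > B" for q u
      using \<delta>(2) by (force simp: strip_def intro: less_le_trans)
    then show ?thesis using \<delta>(1) by blast
  qed
  ultimately show ?thesis using strip_homeomorphism[OF c i] that by metis
qed

end

lemma unimodal_homeo:
  assumes P: "unimodal L m Qs" and Q: "unimodal L' m' Qs'"
    and e: "strict_mono e" "surj e" "e 0 = 0" "e (m 1) = m' 1" "e (m (-1)) = m' (-1)"
  shows "\<exists>F G. homeomorphism strip strip F G \<and>
    (\<forall>q u q' u'. (q, u) \<in> strip --> F (q, u) = (q', u') --> L' q' u' = e (L q u) \<and> m' u' = e (m u) \<and>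
       (q' = Qs' u' \<longleftrightarrow> q = Qs u) \<and> (q' = 1 \<longleftrightarrow> q = 1) \<and> (u' = 1 \<longleftrightarrow> u = 1) \<and> (u' = -1 \<longleftrightarrow> u = -1))"
proof -
  interpret P: unimodal L m Qs by fact
  interpret Q: unimodal L' m' Qs' by fact
  obtain g where g: "homeomorphism strip (fold_set m) P.fo g" using P.fo_homeo .
  obtain g' where g': "homeomorphism strip (fold_set m') Q.fo g'" using Q.fo_homeo .
  note t = fold_map_homeomorphism[of e m m', OF e]
  note hc = homeomorphism_compose[OF homeomorphism_compose[OF g t] homeomorphism_symD[OF g']]
  note lt = strict_mono_less[OF e(1)] and le = strict_mono_less_eq[OF e(1)] and eq = strict_mono_eq[OF e(1)]
  have mx: "max 0 (e x) = e (max 0 x)" for x using le[of 0 x] e(3) by (auto simp: max_def)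
  show ?thesis
  proof (rule exI[of _ "g' \<circ> (fold_map e \<circ> P.fo)"], rule exI, rule conjI[OF hc], intro allI impI)
    fix q u q' u' assume x: "(q, u) \<in> strip" "(g' \<circ> (fold_map e \<circ> P.fo)) (q, u) = (q', u')"
    have T: "fold_map e (P.fo (q, u)) \<in> fold_set m'"
      using homeomorphism_image1[OF g] homeomorphism_image1[OF t] x(1) by blast
    have x': "(q', u') \<in> strip" using homeomorphism_image2[OF g'] T x(2) by force
    have E: "Q.fo (q', u') = fold_map e (P.fo (q, u))"
      using homeomorphism_apply2[OF g' T] x(2) by simp
    have m: "m' u' = e (m u)" using E by (simp add: Q.fo_def P.fo_def fold_map_def)
    have W: "Q.W q' u' = (if 0 <= P.W q u then e (max 0 (m u)) - e (max 0 (m u) - P.W q u)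
        else e (max 0 (m u) + P.W q u) - e (max 0 (m u)))"
      using E by (simp add: Q.fo_def P.fo_def fold_map_def)
    have s: "0 <= Q.W q' u' \<longleftrightarrow> 0 <= P.W q u" "Q.W q' u' = 0 \<longleftrightarrow> P.W q u = 0"
      unfolding W using le lt eq by (auto simp: not_le)
    have L: "L' q' u' = e (L q u)"
    proof (cases "0 <= P.W q u")
      case True
      then have "q <= Qs u" "q' <= Qs' u'" using P.W_sign(1)[OF x(1)] Q.W_sign(1)[OF x'] s by auto
      then show ?thesis using W True by (simp add: P.W_def Q.W_def m mx)
    next
      case False
      have "\<not> q <= Qs u" "\<not> q' <= Qs' u'" using False P.W_sign(1)[OF x(1)] Q.W_sign(1)[OF x'] s by auto
      have "Q.W q' u' = e (max 0 (m u) + P.W q u) - e (max 0 (m u))" using W False by simp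
      then show ?thesis using \<open>\<not> q <= Qs u\<close> \<open>\<not> q' <= Qs' u'\<close> by (simp add: P.W_def Q.W_def m mx)
    qed
    have b: "0 < q" "q <= 1" "-1 <= u" "u <= 1" "0 < q'" "q' <= 1" "-1 <= u'" "u' <= 1"
      using x(1) x' by (auto simp: strip_def)
    have o: "q = 1 \<longleftrightarrow> P.W q u = - max 0 (m u)" "q' = 1 \<longleftrightarrow> Q.W q' u' = - max 0 (m' u')"
      using P.W_one[of u] P.W_anti[of q 1 u] Q.W_one[of u'] Q.W_anti[of q' 1 u'] b by force+
    have one: "q' = 1 \<longleftrightarrow> q = 1"
    proof (cases "P.W q u <= 0")
      case True
      have "Q.W q' u' = e (max 0 (m u) + P.W q u) - e (max 0 (m u))" using W True by (cases "P.W q u = 0") auto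
      then have "q' = 1 \<longleftrightarrow> e (max 0 (m u) + P.W q u) = e 0" unfolding o m mx e(3) by auto
      then show ?thesis unfolding o eq by linarith
    next
      case False
      then have "Q.W q' u' > 0" using s by force
      then show ?thesis unfolding o using False by linarith
    qed
    have u1: "u' = 1 \<longleftrightarrow> u = 1"
      using P.m(2)[of u 1] Q.m(2)[of u' 1] b m e(4) eq by (metis less_irrefl order_le_imp_less_or_eq order.refl)
    have u2: "u' = -1 \<longleftrightarrow> u = -1"
      using P.m(2)[of "-1" u] Q.m(2)[of "-1" u'] b m e(5) eq by (metis less_irrefl order_le_imp_less_or_eq order.refl)
    show "L' q' u' = e (L q u) \<and> m' u' = e (m u) \<and>
       (q' = Qs' u' \<longleftrightarrow> q = Qs u) \<and> (q' = 1 \<longleftrightarrow> q = 1) \<and> (u' = 1 \<longleftrightarrow> u = 1) \<and> (u' = -1 \<longleftrightarrow> u = -1)"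
      using L m one u1 u2 P.W_sign(2)[OF x(1)] Q.W_sign(2)[OF x'] s by auto
  qed
qed

section \<open>The ridge of the vortex levels\<close>

context vortex_system
begin

text \<open>For \<open>c > 0\<close> this is the radius of the maximum on the ray: the unique
  critical radius, or 1 if the level rises all the way to the circle.\<close>

definition ridge :: "real => real" where
  "ridge u = (if c < krad 1 u then SOME q. 0 < q \<and> q < 1 \<and> krad q u = c else 1)"

text \<open>If the maximum on the ray lies on the circle, it is always 0; the second summand makes \<open>rm\<close>
  strictly decreasing in \<open>u\<close> there too, and then \<open>rm\<close> determines \<open>u\<close>.\<close>

definition rm :: "real => real" where
  "rm u = lv (ridge u) u - 2 * max 0 (c - krad 1 u)"

lemma ridge:
  assumes c: "c > 0" and u: "-1 <= u" "u <= 1"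
  shows "0 < ridge u" "ridge u <= 1" "ridge u < 1 \<longleftrightarrow> c < krad 1 u"
    "ridge u < 1 ==> krad (ridge u) u = c"
    "!!q. 0 < q ==> q < ridge u ==> krad q u < c"
    "!!q. ridge u < q ==> q <= 1 ==> c < krad q u"
proof -
  have *: "0 < ridge u \<and> ridge u < 1 \<and> krad (ridge u) u = c" if "c < krad 1 u"
  proof -
    have "\<exists>q. 0 < q \<and> q < 1 \<and> krad q u = c" using crit_exists[OF c that u] by metis
    from someI_ex[OF this] show ?thesis using that by (simp add: ridge_def)
  qed
  have **: "ridge u = 1" if "\<not> c < krad 1 u" using that by (simp add: ridge_def)
  show "0 < ridge u" "ridge u <= 1" "ridge u < 1 \<longleftrightarrow> c < krad 1 u" "ridge u < 1 ==> krad (ridge u) u = c"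
    using * ** by (cases "c < krad 1 u"; force)+
  show "krad q u < c" if "0 < q" "q < ridge u" for q
  proof (cases "c < krad 1 u")
    case True
    then show ?thesis using rad_threshold[of q "ridge u" u] c that u * by force
  next
    case False
    then show ?thesis using rad_below[of u q] c that u ** by force
  qed
  show "c < krad q u" if "ridge u < q" "q <= 1" for q
    using rad_threshold[of "ridge u" q u] c that u * **
    by (cases "c < krad 1 u") simp_all
qed

lemma continuous_rad_u: "0 < q ==> q <= 1 ==> continuous_on {-1..1} (\<lambda>u. krad q u)"
  by (intro continuous_intros continuous_on_rad continuous_on_id continuous_on_const dn_nz) auto

text \<open>The equation \<open>krad q u = c\<close> has no solution on rays whose ridge lies on the
  circle for the other reason, so the equation itself is not followed. A fixed radius is compared
  with the ridge through the sign of \<open>krad - c\<close> there, which persists for nearby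
  \<open>u\<close>.\<close>

lemma continuous_ridge:
  assumes c: "c > 0"
  shows "continuous_on {-1..1} ridge"
  unfolding continuous_on
proof
  fix v :: real assume v: "v \<in> {-1..1}"
  note r = ridge[OF c]
  have ev: "\<forall>\<^sub>F u in at v within {-1..1}. u \<in> {-1..1}" by (simp add: eventually_at_filter)
  have lim: "((\<lambda>u. krad q u) \<longlongrightarrow> krad q v) (at v within {-1..1})" if "0 < q" "q <= 1" for q
    using continuous_rad_u[OF that] v by (auto simp: continuous_on)
  show "(ridge \<longlongrightarrow> ridge v) (at v within {-1..1})"
  proof (rule order_tendstoI)
    fix a assume a: "a < ridge v"
    show "\<forall>\<^sub>F u in at v within {-1..1}. a < ridge u"
    proof (cases "0 < a")
      case True
      have "krad a v < c" using r(5)[of v a] v a True by simp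
      then have "\<forall>\<^sub>F u in at v within {-1..1}. krad a u < c"
        using order_tendstoD(2)[OF lim] True a r(2)[of v] v by auto
      with ev show ?thesis
      proof eventually_elim
        case (elim u)
        then have "\<not> ridge u < a" using r(6)[of u a] a r(2)[of v] v by force
        moreover have "ridge u \<noteq> a" using r(4)[of u] elim a r(2)[of v] v by force
        ultimately show ?case by simp
      qed
    next
      case False
      from ev show ?thesis by eventually_elim (use False r(1) in force)
    qed
  next
    fix b assume b: "ridge v < b"
    show "\<forall>\<^sub>F u in at v within {-1..1}. ridge u < b"
    proof (cases "b <= 1")
      case True
      have "c < krad b v" using r(6)[of v b] v b True by simp
      then have "\<forall>\<^sub>F u in at v within {-1..1}. c < krad b u"
        using order_tendstoD(1)[OF lim] True b r(1)[of v] v by auto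
      with ev show ?thesis
      proof eventually_elim
        case (elim u)
        then have "\<not> b < ridge u" using r(5)[of u b] b r(1)[of v] v by force
        moreover have "ridge u \<noteq> b"
        proof
          assume e: "ridge u = b"
          then have "ridge u < 1" using r(3)[of u] elim True by (cases "b = 1") auto
          then show False using r(4)[of u] elim e by simp
        qed
        ultimately show ?case by simp
      qed
    next
      case False
      from ev show ?thesis by eventually_elim (use False r(2) in force)
    qed
  qed
qed

lemma continuous_lev_strip: "continuous_on strip (\<lambda>x. lv (fst x) (snd x))"
  by (intro continuous_on_lev dn_nz continuous_intros) (auto simp: strip_def)

lemma unimodal_lev:
  assumes c: "c > 0"
  shows "unimodal (lv) rm ridge"
proof
  note r = ridge[OF c]
  show "continuous_on strip (\<lambda>x. lv (fst x) (snd x))" by (rule continuous_lev_strip)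
  show "continuous_on {-1..1} ridge" by (rule continuous_ridge[OF c])
  have "(\<lambda>u. (ridge u, u)) ` {-1..1} \<subseteq> strip" using r(1,2) by (auto simp: strip_def)
  from continuous_on_compose2[OF continuous_lev_strip continuous_on_Pair[OF continuous_ridge[OF c] continuous_on_id] this]
  have "continuous_on {-1..1} (\<lambda>u. lv (ridge u) u)" by simp
  then show "continuous_on {-1..1} rm"
    unfolding rm_def by (intro continuous_on_diff continuous_on_mult continuous_on_max continuous_on_const continuous_rad_u) auto
  show "0 < ridge u \<and> ridge u <= 1" if "-1 <= u" "u <= 1" for u using r that by blast
  show inc: "lv s u < lv t u" if "0 < s" "s < t" "t <= ridge u" "-1 <= u" "u <= 1" for s t u
    by (rule lev_increasing) (use that r(2)[of u] r(5)[of u] \<rho>q[of t] in auto)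
  show dec: "lv t u < lv s u" if "ridge u <= s" "s < t" "t <= 1" "-1 <= u" "u <= 1" for s t u
    by (rule lev_decreasing) (use that r(1)[of u] r(6)[of u] \<rho>q[of t] in auto)
  show "lv 1 u = 0" for u by simp
  show "\<exists>\<delta>>0. \<forall>q u. 0 < q --> q < \<delta> --> -1 <= u --> u <= 1 --> lv q u < E" for E
    using lev_to_bot[of 1 E] c by (metis mult_1)
  have M: "lv (ridge u) u > 0 \<and> rm u = lv (ridge u) u" if "ridge u < 1" "-1 <= u" "u <= 1" for u
    using dec[of u "ridge u" 1] r(3)[of u] that by (simp add: rm_def)
  have N: "rm u = - (2 * (c - krad 1 u)) \<and> c - krad 1 u \<ge> 0" if "ridge u = 1" "-1 <= u" "u <= 1" for u
    using r(3)[of u] that by (simp add: rm_def)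
  show "lv (ridge u) u = max 0 (rm u)" if "-1 <= u" "u <= 1" for u
    using M[of u] N[of u] that r(2)[of u] by (cases "ridge u = 1") auto
  show "rm v < rm u" if h: "-1 <= u" "u < v" "v <= 1" for u v
  proof (cases "ridge v = 1")
    case True
    then have v: "rm v = - (2 * (c - krad 1 v))" "c - krad 1 v \<ge> 0" using N[of v] h by auto
    show ?thesis
    proof (cases "ridge u = 1")
      case True then show ?thesis using N[of u] v \<kappa>_rad_one_anti[of u v] h by simp
    next
      case False then show ?thesis using M[of u] v r(2)[of u] h by simp
    qed
  next
    case False
    then have v: "ridge v < 1" "rm v = lv (ridge v) v" using M[of v] r(2)[of v] h by auto
    have u: "ridge u < 1" using r(3)[of v] r(3)[of u] v \<kappa>_rad_one_anti[of u v] h by simp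
    \<comment> \<open>At the fixed radius \<open>ridge v\<close> the level decreases in
      \<open>u\<close>, and the maximum on the ray \<open>u\<close> is at least the value at that
      radius.\<close>
    have "lv (ridge v) v < lv (ridge v) u" using lev_anti_u[of "ridge v" u v] v r(1)[of v] h by simp
    also have "\<dots> <= lv (ridge u) u"
      using inc[of "ridge v" "ridge u" u] dec[of u "ridge u" "ridge v"] v r(1)[of v] h
      by (cases "ridge v" "ridge u" rule: linorder_cases) auto
    finally show ?thesis using M[of u] u v h by simp
  qed
qed

lemma rm_zero:
  assumes c: "c > 0" and u: "-1 <= u" "u <= 1"
  shows "rm u > 0 \<longleftrightarrow> c < krad 1 u" "rm u = 0 \<longleftrightarrow> krad 1 u = c"
proof -
  interpret u: unimodal "lv" rm ridge by (rule unimodal_lev[OF c])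
  note r = ridge[OF c u]
  have "rm u > 0" if "c < krad 1 u"
    using that u.dec[of u "ridge u" 1] r(3) u by (simp add: rm_def)
  moreover have "rm u = - (2 * (c - krad 1 u))" if "\<not> c < krad 1 u"
    using that r(2,3) by (auto simp: rm_def order_le_less max_def)
  ultimately show "rm u > 0 \<longleftrightarrow> c < krad 1 u" "rm u = 0 \<longleftrightarrow> krad 1 u = c" by force+
qed

text \<open>Criticality is expressed by being on the ridge, by \<open>q < 1\<close> and by the zero
  of \<open>rm\<close>. All of these are preserved by the map of \<open>unimodal_homeo\<close> when
  \<open>e 0 = 0\<close>.\<close>

lemma critical_ridge:
  assumes c: "c > 0" and qu: "(q, u) \<in> strip"
  shows "krad q u = c \<longleftrightarrow> q = ridge u \<and> (q < 1 \<or> rm u = 0)"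
proof -
  have b: "0 < q" "q <= 1" "-1 <= u" "u <= 1" using qu by (auto simp: strip_def)
  note r = ridge[OF c b(3,4)]
  show ?thesis using r(5)[of q] r(6)[of q] r(1-4) rm_zero(2)[OF c b(3,4)] b
    by (cases q "ridge u" rule: linorder_cases) force+
qed

end

context two_systems
begin

lemma equivalent_pos:
  assumes c: "c > 0" "c' > 0"
    and e: "strict_mono e" "surj e" "e 0 = 0" "e (P.rm 1) = Q.rm 1" "e (P.rm (-1)) = Q.rm (-1)"
  shows equivalent
proof -
  obtain F G where F: "homeomorphism strip strip F G"
    "!!q u q' u'. (q, u) \<in> strip ==> F (q, u) = (q', u') ==> lev \<rho>' c' q' u' = e (lev \<rho> c q u) \<and> Q.rm u' = e (P.rm u) \<and>
       (q' = Q.ridge u' \<longleftrightarrow> q = P.ridge u) \<and> (q' = 1 \<longleftrightarrow> q = 1) \<and> (u' = 1 \<longleftrightarrow> u = 1) \<and> (u' = -1 \<longleftrightarrow> u = -1)"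
    using unimodal_homeo[OF P.unimodal_lev[OF c(1)] Q.unimodal_lev[OF c(2)] e] by blast
  show ?thesis
  proof (rule equivalentI[OF F(1) e(1)])
    fix q u q' u' assume x: "(q, u) \<in> strip" "(q', u') \<in> strip" "F (q, u) = (q', u')"
    have b: "q <= 1" "q' <= 1" using x by (auto simp: strip_def)
    have "Q.rm u' = 0 \<longleftrightarrow> P.rm u = 0"
      using F(2)[OF x(1,3)] strict_mono_eq[OF e(1), of "P.rm u" 0] e(3) by simp
    then show "lev \<rho>' c' q' u' = e (lev \<rho> c q u) \<and> (u' = 1 \<longleftrightarrow> u = 1) \<and> (u' = -1 \<longleftrightarrow> u = -1) \<and>
      (Q.critical q' u' \<longleftrightarrow> P.critical q u)"
      unfolding P.critical_ridge[OF c(1) x(1)] Q.critical_ridge[OF c(2) x(2)] using F(2)[OF x(1,3)] b by auto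
  qed
qed

text \<open>The regions differ by the position of 0 relative to the two values
  \<open>rm 1 < rm (-1)\<close>: above both, between them, below both. Within one region a single
  broken line therefore matches all three numbers.\<close>

lemma equivalent_regions123:
  assumes c: "c > 0" "c' > 0"
    and regions: "(1 + \<rho>) / (1 - \<rho>) < c \<and> (1 + \<rho>') / (1 - \<rho>') < c' \<or>
      (1 - \<rho>) / (1 + \<rho>) < c \<and> c < (1 + \<rho>) / (1 - \<rho>) \<and> (1 - \<rho>') / (1 + \<rho>') < c' \<and> c' < (1 + \<rho>') / (1 - \<rho>') \<or>
      c < (1 - \<rho>) / (1 + \<rho>) \<and> c' < (1 - \<rho>') / (1 + \<rho>')"
  shows equivalent
proof -
  interpret p: unimodal "lev \<rho> c" P.rm P.ridge by (rule P.unimodal_lev[OF c(1)])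
  interpret q: unimodal "lev \<rho>' c'" Q.rm Q.ridge by (rule Q.unimodal_lev[OF c(2)])
  have lt: "P.rm 1 < P.rm (-1)" "Q.rm 1 < Q.rm (-1)" using p.m(2)[of "-1" 1] q.m(2)[of "-1" 1] by auto
  note s = P.rm_zero[OF c(1), unfolded less_le] Q.rm_zero[OF c(2)]
  have sp: "P.rm 1 > 0 \<longleftrightarrow> c < (1 - \<rho>) / (1 + \<rho>)" "P.rm (-1) > 0 \<longleftrightarrow> c < (1 + \<rho>) / (1 - \<rho>)"
     "P.rm 1 = 0 \<longleftrightarrow> c = (1 - \<rho>) / (1 + \<rho>)" "P.rm (-1) = 0 \<longleftrightarrow> c = (1 + \<rho>) / (1 - \<rho>)"
    using P.rm_zero[OF c(1), of 1] P.rm_zero[OF c(1), of "-1"] by (auto simp: P.rad_end)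
  have sq: "Q.rm 1 > 0 \<longleftrightarrow> c' < (1 - \<rho>') / (1 + \<rho>')" "Q.rm (-1) > 0 \<longleftrightarrow> c' < (1 + \<rho>') / (1 - \<rho>')"
     "Q.rm 1 = 0 \<longleftrightarrow> c' = (1 - \<rho>') / (1 + \<rho>')" "Q.rm (-1) = 0 \<longleftrightarrow> c' = (1 + \<rho>') / (1 - \<rho>')"
    using Q.rm_zero[OF c(2), of 1] Q.rm_zero[OF c(2), of "-1"] by (auto simp: Q.rad_end)
  have "\<exists>e. strict_mono e \<and> surj e \<and> e 0 = 0 \<and> e (P.rm 1) = Q.rm 1 \<and> e (P.rm (-1)) = Q.rm (-1)"
    using regions
  proof (elim disjE)
    assume "(1 + \<rho>) / (1 - \<rho>) < c \<and> (1 + \<rho>') / (1 - \<rho>') < c'"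
    then have "P.rm (-1) < 0" "Q.rm (-1) < 0" using sp sq by force+
    then show ?thesis using piecewise_linear_homeo[of "P.rm 1" "P.rm (-1)" 0 "Q.rm 1" "Q.rm (-1)" 0] lt by metis
  next
    assume "(1 - \<rho>) / (1 + \<rho>) < c \<and> c < (1 + \<rho>) / (1 - \<rho>) \<and> (1 - \<rho>') / (1 + \<rho>') < c' \<and> c' < (1 + \<rho>') / (1 - \<rho>')"
    then have "P.rm (-1) > 0" "Q.rm (-1) > 0" "P.rm 1 < 0" "Q.rm 1 < 0" using sp sq by force+
    then show ?thesis using piecewise_linear_homeo[of "P.rm 1" 0 "P.rm (-1)" "Q.rm 1" 0 "Q.rm (-1)"] by metis
  next
    assume "c < (1 - \<rho>) / (1 + \<rho>) \<and> c' < (1 - \<rho>') / (1 + \<rho>')"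
    then have "P.rm 1 > 0" "Q.rm 1 > 0" using sp sq by force+
    then show ?thesis using piecewise_linear_homeo[of 0 "P.rm 1" "P.rm (-1)" 0 "Q.rm 1" "Q.rm (-1)"] lt by metis
  qed
  then show ?thesis using equivalent_pos[OF c] by blast
qed

end

section \<open>Negative circulation ratio\<close>

definition glue :: "real => (real => real) => (real => real) => real => real" where
  "glue r e f x = (if x <= r then e x else f x)"

text \<open>Extends an increasing bijection between half lines by one more interval, so that a level
  map can be assembled piece by piece.\<close>

lemma mono_glue:
  assumes e: "strict_mono_on {..r} e" "e ` {..r} = {..f r}" "e r = f r"
    and f: "strict_mono_on {r..s} f" "continuous_on {r..s} f" "r <= s"
  shows "strict_mono_on {..s} (glue r e f)" "glue r e f ` {..s} = {..f s}" "glue r e f s = f s"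
    "x <= r ==> glue r e f x = e x" "r <= x ==> glue r e f x = f x"
proof -
  define g where g_def': "g = glue r e f"
  note g_def = g_def'[unfolded fun_eq_iff glue_def, rule_format]
  have g: "g s = f s" "x <= r ==> g x = e x" "r <= x ==> g x = f x" for x
    using e(3) f(3) by (auto simp: g_def)
  then show "glue r e f s = f s" "x <= r ==> glue r e f x = e x" "r <= x ==> glue r e f x = f x"
    using e(3) by (auto simp: glue_def)
  have er: "e x <= f r" if "x <= r" for x using that e(2) by auto
  have fr: "f r < f x" if "r < x" "x <= s" for x using strict_mono_onD[OF f(1), of r x] that by simp
  show "strict_mono_on {..s} (glue r e f)" unfolding g_def'[symmetric]
  proof (rule strict_mono_onI)
    fix x y assume h: "x \<in> {..s}" "y \<in> {..s}" "x < y"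
    consider "y <= r" | "x <= r" "r < y" | "r < x" by linarith
    then show "g x < g y"
    proof cases
      case 1 then show ?thesis using strict_mono_onD[OF e(1), of x y] h by (simp add: g_def)
    next
      case 2 then show ?thesis using er[of x] fr[of y] h by (simp add: g_def)
    next
      case 3 then show ?thesis using strict_mono_onD[OF f(1), of x y] h by (simp add: g_def)
    qed
  qed
  have fs: "f r <= f s" using fr[of s] f(3) by (cases "r = s") auto
  show "glue r e f ` {..s} = {..f s}" unfolding g_def'[symmetric]
  proof
    show "g ` {..s} \<subseteq> {..f s}"
    proof
      fix y assume "y \<in> g ` {..s}"
      then obtain x where x: "x <= s" "y = g x" by auto
      then show "y \<in> {..f s}"
        using er[of x] fs strict_mono_onD[OF f(1), of x s] by (cases "x = s") (auto simp: g_def)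
    qed
    show "{..f s} \<subseteq> g ` {..s}"
    proof
      fix y assume y: "y \<in> {..f s}"
      show "y \<in> g ` {..s}"
      proof (cases "y <= f r")
        case True
        then have "y \<in> e ` {..r}" using e(2) by simp
        then obtain x where "x <= r" "y = e x" by auto
        then show ?thesis using f(3) g(2) by (intro image_eqI[of _ _ x]) auto
      next
        case False
        then obtain x where "r <= x" "x <= s" "f x = y" using IVT'[of f r y s] y f by auto
        then show ?thesis using g(3) by (intro image_eqI[of _ _ x]) auto
      qed
    qed
  qed
qed

lemma linear_piece:
  fixes r s a b :: real
  assumes "r < s" "a < b"
  defines "f \<equiv> (\<lambda>x. a + (x - r) * ((b - a) / (s - r)))"
  shows "strict_mono_on S f" "continuous_on S f" "f r = a" "f s = b"
proof -
  have "(b - a) / (s - r) > 0" using assms by simp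
  then have "(x - r) * ((b - a) / (s - r)) < (y - r) * ((b - a) / (s - r))" if "x < y" for x y
    using that by (intro mult_strict_right_mono) auto
  then show "strict_mono_on S f" unfolding f_def by (intro strict_mono_onI) simp
  show "continuous_on S f" unfolding f_def by (intro continuous_intros)
  show "f r = a" "f s = b" using assms by (simp_all add: f_def)
qed

lemma proportional_nonneg:
  fixes x y c d :: real
  assumes "x * d = y * c" "c > 0" "d > 0"
  shows "0 <= x \<longleftrightarrow> 0 <= y"
proof -
  have "0 <= x \<longleftrightarrow> 0 <= x * d" "0 <= y \<longleftrightarrow> 0 <= y * c" using assms(2,3) by (auto simp: zero_le_mult_iff)
  then show ?thesis using assms(1) by simp
qed

text \<open>\<open>qs\<close> and \<open>qc\<close> are the radii of the saddle and the center.
  Along \<open>u = -1\<close> the level falls, rises and falls, along \<open>u = 1\<close> it only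
  falls. In the middle band it need not be monotone in \<open>q\<close> on a ray in between;
  monotonicity in \<open>u\<close> takes over there.\<close>

locale cubic =
  fixes L :: "real => real => real" and qs qc :: real
  assumes q: "0 < qs" "qs < qc" "qc < 1"
    and cont: "continuous_on strip (\<lambda>x. L (fst x) (snd x))"
    and anti_u: "!!q u v. 0 < q ==> q < 1 ==> -1 <= u ==> u < v ==> v <= 1 ==> L q v < L q u"
    and decA: "!!s t u. 0 < s ==> s < t ==> t <= qs ==> -1 <= u ==> u <= 1 ==> L t u < L s u"
    and decB: "!!s t u. qc <= s ==> s < t ==> t <= 1 ==> -1 <= u ==> u <= 1 ==> L t u < L s u"
    and hi: "!!s t. qs <= s ==> s < t ==> t <= qc ==> L s (-1) < L t (-1)"
    and lo: "!!s t. qs <= s ==> s < t ==> t <= qc ==> L t 1 < L s 1"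
    and edge: "!!u. L 1 u = 0"
    and top: "!!E. \<exists>\<delta>>0. \<forall>q u. 0 < q --> q < \<delta> --> -1 <= u --> u <= 1 --> E < L q u"
begin

lemma cont_comp:
  assumes "continuous_on S f" "continuous_on S g" "!!x. x \<in> S ==> (f x, g x) \<in> strip"
  shows "continuous_on S (\<lambda>x. L (f x) (g x))"
  using continuous_on_compose2[OF cont continuous_on_Pair[OF assms(1,2)]] assms(3) by auto

lemma cont_q: "0 < a ==> b <= 1 ==> -1 <= u ==> u <= 1 ==> continuous_on {a..b} (\<lambda>q. L q u)"
  by (rule cont_comp) (auto simp: strip_def intro!: continuous_intros)

lemma cont_u: "0 < q ==> q <= 1 ==> continuous_on {-1..1} (L q)"
  by (rule cont_comp[of _ "\<lambda>_. q"]) (auto simp: strip_def intro!: continuous_intros)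

lemma anti_u_le: "0 < q ==> q <= 1 ==> -1 <= u ==> u <= v ==> v <= 1 ==> L q v <= L q u"
  using anti_u[of q u v] edge by (cases "u = v"; cases "q = 1") auto

lemma inj_u: "0 < q ==> q < 1 ==> -1 <= u ==> u <= 1 ==> -1 <= v ==> v <= 1 ==> L q u = L q v ==> u = v"
  using anti_u[of q u v] anti_u[of q v u] by (cases u v rule: linorder_cases) auto

lemma injA: "0 < s ==> s <= qs ==> 0 < t ==> t <= qs ==> -1 <= u ==> u <= 1 ==> L s u = L t u ==> s = t"
  using decA[of s t u] decA[of t s u] by (cases s t rule: linorder_cases) auto

lemma injB: "qc <= s ==> s <= 1 ==> qc <= t ==> t <= 1 ==> -1 <= u ==> u <= 1 ==> L s u = L t u ==> s = t"
  using decB[of s t u] decB[of t s u] by (cases s t rule: linorder_cases) auto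

text \<open>These five levels are the break points of the level map built in
  \<open>cubic_pair_exists\<close>.\<close>

lemma order: "0 < L qc 1" "L qc 1 < L qs 1" "L qs 1 < L qs (-1)" "L qs (-1) < L qc (-1)"
  using decB[of qc 1 1] lo[of qs qc] hi[of qs qc] anti_u[of qs "-1" 1] edge[of 1] q by auto

end

text \<open>In the middle band radii are transferred linearly, which leaves \<open>u'\<close> to be
  found from the level. This is possible only if \<open>e\<close> matches the levels along both
  edges \<open>u = 1\<close> and \<open>u = -1\<close> of the band; \<open>fit\<close> says
  so.\<close>

locale cubic_pair = P: cubic L qs qc + Q: cubic L' qs' qc'
  for L L' :: "real => real => real" and qs qc qs' qc' :: real +
  fixes e :: "real => real"
  assumes e: "strict_mono e" "surj e" "e 0 = 0"
    and fit: "!!q q' \<sigma>. qs <= q ==> q <= qc ==> (q - qs) * (qc' - qs') = (q' - qs') * (qc - qs) ==> \<sigma> = 1 \<or> \<sigma> = -1 ==>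
        L' q' \<sigma> = e (L q \<sigma>)"
begin

text \<open>On the bands \<open>q <= qs\<close>, \<open>qs <= q <= qc\<close> and \<open>qc <= q\<close> the level function is monotone in \<open>q\<close>, \<open>u\<close> and \<open>q\<close>.
  Hence the image of a point is fixed by its new level and by \<open>u'\<close>, \<open>q'\<close> and \<open>u'\<close>, where \<open>u'\<close> is read off
  the adjacent end of the middle band.\<close>

definition Rel :: "real => real => real => real => bool" where
  "Rel q u q' u' \<longleftrightarrow> L' q' u' = e (L q u) \<and>
     (q <= qs \<and> q' <= qs' \<and> L' qs' u' = e (L qs u) \<or>
      qs <= q \<and> q <= qc \<and> (q - qs) * (qc' - qs') = (q' - qs') * (qc - qs) \<or>
      qc <= q \<and> qc' <= q' \<and> L' qc' u' = e (L qc u))"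

text \<open>The data are symmetric in the two systems, so the construction for the exchanged pair
  supplies the inverse map.\<close>

lemma swap: "cubic_pair L' L qs' qc' qs qc (inv e)"
proof unfold_locales
  note i = strict_mono_homeo_inv[OF e(1,2)]
  show "strict_mono (inv e)" "surj (inv e)" "inv e 0 = 0" using i(1,2) i(4)[of 0] e(3) by auto
  fix q' q \<sigma> assume h: "qs' <= q'" "q' <= qc'" "(q' - qs') * (qc - qs) = (q - qs) * (qc' - qs')" "\<sigma> = 1 \<or> \<sigma> = (-1::real)"
  have *: "(qc' - q') * (qc - qs) = (qc - q) * (qc' - qs')" using h(3) by (simp add: algebra_simps)
  have "qs <= q" "q <= qc"
    using proportional_nonneg[OF h(3)] proportional_nonneg[OF *] h(1,2) P.q Q.q by auto
  then show "L q \<sigma> = inv e (L' q' \<sigma>)" using fit[of q q' \<sigma>] h \<open>qs <= q\<close> \<open>q <= qc\<close> i(4) by simp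
qed

lemma fit_range:
  assumes "qs <= q" "q <= qc" "(q - qs) * (qc' - qs') = (q' - qs') * (qc - qs)"
  shows "qs' <= q'" "q' <= qc'" "q = qs \<longleftrightarrow> q' = qs'" "q = qc \<longleftrightarrow> q' = qc'"
proof -
  have *: "(qc - q) * (qc' - qs') = (qc' - q') * (qc - qs)" using assms(3) by (simp add: algebra_simps)
  show "qs' <= q'" "q' <= qc'"
    using proportional_nonneg[OF assms(3)] proportional_nonneg[OF *] assms(1,2) P.q Q.q by auto
  show "q = qs \<longleftrightarrow> q' = qs'" using assms(3) P.q Q.q by auto
  show "q = qc \<longleftrightarrow> q' = qc'" using * P.q Q.q by auto
qed

text \<open>On a border of bands two clauses of \<open>Rel\<close> may apply. Injectivity of the
  level in \<open>q\<close> shows that borders correspond to borders, so they can be assigned to the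
  middle band.\<close>

lemma Rel_cases:
  assumes "Rel q u q' u'" "(q, u) \<in> strip" "(q', u') \<in> strip"
  obtains "q < qs" "q' < qs'" "L' qs' u' = e (L qs u)"
    | "qs <= q" "q <= qc" "(q - qs) * (qc' - qs') = (q' - qs') * (qc - qs)"
    | "qc < q" "qc' < q'" "L' qc' u' = e (L qc u)"
proof -
  have b: "0 < q" "q <= 1" "-1 <= u" "u <= 1" "0 < q'" "q' <= 1" "-1 <= u'" "u' <= 1"
    using assms by (auto simp: strip_def)
  have E: "L' q' u' = e (L q u)" using assms(1) by (simp add: Rel_def)
  have A: "q = qs \<longleftrightarrow> q' = qs'" if "q <= qs" "q' <= qs'" "L' qs' u' = e (L qs u)"
    using P.injA[of q qs u] Q.injA[of q' qs' u'] that b E P.q Q.q strict_mono_eq[OF e(1)] by auto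
  have B: "q = qc \<longleftrightarrow> q' = qc'" if "qc <= q" "qc' <= q'" "L' qc' u' = e (L qc u)"
    using P.injB[of q qc u] Q.injB[of q' qc' u'] that b E P.q Q.q strict_mono_eq[OF e(1)] by auto
  consider "q <= qs" "q' <= qs'" "L' qs' u' = e (L qs u)" | "qs <= q" "q <= qc" "(q - qs) * (qc' - qs') = (q' - qs') * (qc - qs)" |
    "qc <= q" "qc' <= q'" "L' qc' u' = e (L qc u)" using assms(1) unfolding Rel_def by blast
  then show ?thesis
  proof cases
    case 1
    show ?thesis
    proof (cases "q = qs")
      case True then show ?thesis using A[OF 1] P.q by (intro that(2)) auto
    next
      case False then show ?thesis using A[OF 1] 1 by (intro that(1)) auto
    qed
  next
    case 2 then show ?thesis by (rule that(2))
  next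
    case 3
    show ?thesis
    proof (cases "q = qc")
      case True then show ?thesis using B[OF 3] P.q by (intro that(2)) auto
    next
      case False then show ?thesis using B[OF 3] 3 by (intro that(3)) auto
    qed
  qed
qed

lemma Rel_unique:
  assumes r: "Rel q u q1 u1" "Rel q u q2 u2" and s: "(q, u) \<in> strip" "(q1, u1) \<in> strip" "(q2, u2) \<in> strip"
  shows "q1 = q2 \<and> u1 = u2"
proof -
  have b: "0 < q1" "q1 <= 1" "-1 <= u1" "u1 <= 1" "0 < q2" "q2 <= 1" "-1 <= u2" "u2 <= 1"
    using s by (auto simp: strip_def)
  have E: "L' q1 u1 = L' q2 u2" using r by (simp add: Rel_def)
  show ?thesis
  proof (cases rule: Rel_cases[OF r(1) s(1,2)])
    case 1
    then have 2: "q2 < qs'" "L' qs' u2 = e (L qs u)" using Rel_cases[OF r(2) s(1,3)] P.q by auto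
    have "u1 = u2" by (rule Q.inj_u[of qs']) (use 1 2 b Q.q in auto)
    then show ?thesis using Q.injA[of q1 q2 u1] 1 2 b E by simp
  next
    case 2
    then have "(q - qs) * (qc' - qs') = (q2 - qs') * (qc - qs)" using Rel_cases[OF r(2) s(1,3)] by auto
    then have "q1 = q2" using 2 P.q by simp
    moreover have "q1 < 1" using fit_range(2)[OF 2] Q.q by simp
    ultimately show ?thesis using Q.inj_u[of q1 u1 u2] b E by simp
  next
    case 3
    then have 2: "qc' < q2" "L' qc' u2 = e (L qc u)" using Rel_cases[OF r(2) s(1,3)] P.q by auto
    have "u1 = u2" by (rule Q.inj_u[of qc']) (use 3 2 b Q.q in auto)
    then show ?thesis using Q.injB[of q1 q2 u1] 3 2 b E by simp
  qed
qed

lemma fit_end: "\<sigma> = 1 \<or> \<sigma> = -1 ==> L' qs' \<sigma> = e (L qs \<sigma>)" "\<sigma> = 1 \<or> \<sigma> = -1 ==> L' qc' \<sigma> = e (L qc \<sigma>)"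
  using fit[of qs qs' \<sigma>] fit[of qc qc' \<sigma>] P.q by simp_all

lemma Rel_side:
  assumes r: "Rel q \<sigma> q' u'" and s: "(q, \<sigma>) \<in> strip" "(q', u') \<in> strip" and \<sigma>: "\<sigma> = 1 \<or> \<sigma> = -1"
  shows "u' = \<sigma>"
proof -
  have b: "0 < q'" "q' <= 1" "-1 <= u'" "u' <= 1" using s by (auto simp: strip_def)
  have \<sigma>': "-1 <= \<sigma>" "\<sigma> <= 1" using \<sigma> by auto
  have E: "L' q' u' = e (L q \<sigma>)" using r by (simp add: Rel_def)
  show ?thesis
  proof (cases rule: Rel_cases[OF r s])
    case 1 then show ?thesis using Q.inj_u[of qs' u' \<sigma>] fit_end(1)[OF \<sigma>] b \<sigma>' Q.q by simp
  next
    case 2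
    have "q' < 1" using fit_range(2)[OF 2] Q.q by simp
    then show ?thesis using Q.inj_u[of q' u' \<sigma>] fit[OF 2 \<sigma>] E b \<sigma>' by simp
  next
    case 3 then show ?thesis using Q.inj_u[of qc' u' \<sigma>] fit_end(2)[OF \<sigma>] b \<sigma>' Q.q by simp
  qed
qed

definition \<beta> :: "real => real" where
  "\<beta> q = qs' + (q - qs) * ((qc' - qs') / (qc - qs))"

lemma \<beta>: "(q - qs) * (qc' - qs') = (\<beta> q - qs') * (qc - qs)"
  using P.q by (simp add: \<beta>_def)

text \<open>In the middle band \<open>u'\<close> is found by the intermediate value theorem in
  \<open>u\<close>, and in the outer bands, with \<open>u'\<close> known, the radius is found by the
  same theorem in \<open>q\<close>. Continuity of each choice comes from
  \<open>implicit_continuous\<close>, and the pieces agree on the borders.\<close>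

lemma Rel_exists: "\<exists>F. continuous_on strip F \<and> (\<forall>x\<in>strip. F x \<in> strip \<and> Rel (fst x) (snd x) (fst (F x)) (snd (F x)))"
proof -
  note lt = strict_mono_less[OF e(1)] and le = strict_mono_less_eq[OF e(1)]
  have ce: "continuous_on S e" for S by (rule strict_mono_homeo_inv(5)[OF e(1,2)])
  define M where "M = {qs..qc} \<times> {-1..1::real}"
  have Ms: "M \<subseteq> strip" using P.q by (auto simp: M_def strip_def)
  have \<beta>b: "qs' <= \<beta> (fst x)" "\<beta> (fst x) <= qc'" "0 < \<beta> (fst x)" "\<beta> (fst x) < 1" if "x \<in> M" for x
    using fit_range(1,2)[OF _ _ \<beta>[of "fst x"]] that Q.q by (auto simp: M_def)
  have cL: "continuous_on S (\<lambda>x. e (L (fst x) (snd x)))" if "S \<subseteq> strip" for S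
    by (rule continuous_on_compose2[OF ce[of UNIV] continuous_on_subset[OF P.cont that]]) auto
  have "\<exists>v. -1 <= v \<and> v <= 1 \<and> L' (\<beta> (fst x)) v = e (L (fst x) (snd x))" if x: "x \<in> M" for x
  proof -
    have b: "qs <= fst x" "fst x <= qc" "-1 <= snd x" "snd x <= 1" using x by (auto simp: M_def)
    have "L' (\<beta> (fst x)) 1 <= e (L (fst x) (snd x))" "e (L (fst x) (snd x)) <= L' (\<beta> (fst x)) (-1)"
      unfolding fit[OF b(1,2) \<beta> disjI1[OF refl]] fit[OF b(1,2) \<beta> disjI2[OF refl]] le
      using P.anti_u_le[of "fst x" "snd x" 1] P.anti_u_le[of "fst x" "-1" "snd x"] b P.q by auto
    then show ?thesis using IVT2'[of "L' (\<beta> (fst x))" 1 _ "-1"] Q.cont_u[of "\<beta> (fst x)"] \<beta>b[OF x] by auto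
  qed
  then obtain \<psi> where \<psi>: "!!x. x \<in> M ==> -1 <= \<psi> x \<and> \<psi> x <= 1 \<and> L' (\<beta> (fst x)) (\<psi> x) = e (L (fst x) (snd x))"
    by metis
  have c\<beta>: "continuous_on S (\<lambda>x. \<beta> (fst x))" for S :: "(real \<times> real) set"
    unfolding \<beta>_def by (intro continuous_intros)
  have "continuous_on M \<psi>"
  \<comment> \<open>The level decreases in \<open>u\<close>; the minus signs turn it into the
    increasing function required.\<close>
  proof (rule implicit_continuous[where I = "{-1..1}" and g = "\<lambda>v x. - L' (\<beta> (fst x)) v" and \<gamma> = "\<lambda>x. - e (L (fst x) (snd x))"])
    show "continuous_on M (\<lambda>x. - L' (\<beta> (fst x)) v)" if "v \<in> {-1..1}" for v
      by (intro continuous_on_minus Q.cont_comp c\<beta> continuous_on_const) (use \<beta>b that in \<open>auto simp: strip_def less_imp_le\<close>)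
    show "continuous_on M (\<lambda>x. - e (L (fst x) (snd x)))" by (intro continuous_on_minus cL Ms)
    show "- L' (\<beta> (fst x)) v < - L' (\<beta> (fst x)) w" if "x \<in> M" "v \<in> {-1..1}" "w \<in> {-1..1}" "v < w" for x v w
      using Q.anti_u[of "\<beta> (fst x)" v w] \<beta>b[OF that(1)] that by simp
  qed (use \<psi> in \<open>auto simp: is_interval_1\<close>)
  \<comment> \<open>Moving the radius to the nearest end of the middle band extends
    \<open>u'\<close> continuously to the outer bands.\<close>
  define clamp where "clamp x = (max qs (min qc (fst x)), snd x)" for x :: "real \<times> real"
  define U where "U x = \<psi> (clamp x)" for x
  have clM: "clamp x \<in> M" if "x \<in> strip" for x using that P.q by (auto simp: clamp_def M_def strip_def)
  have cU: "continuous_on strip U" unfolding U_def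
    by (rule continuous_on_compose2[OF \<open>continuous_on M \<psi>\<close>])
      (use clM in \<open>auto simp: clamp_def intro!: continuous_intros\<close>)
  have Ub: "-1 <= U x" "U x <= 1" if "x \<in> strip" for x using \<psi>[OF clM[OF that]] by (auto simp: U_def)
  have \<beta>e: "\<beta> qs = qs'" "\<beta> qc = qc'" using P.q by (simp_all add: \<beta>_def)
  have UA: "L' qs' (U x) = e (L qs (snd x))" if "x \<in> strip" "fst x <= qs" for x
    using \<psi>[OF clM[OF that(1)]] that P.q \<beta>e by (simp add: U_def clamp_def)
  have UB: "L' qc' (U x) = e (L qc (snd x))" if "x \<in> strip" "qc <= fst x" for x
    using \<psi>[OF clM[OF that(1)]] that P.q \<beta>e by (simp add: U_def clamp_def)
  have UM: "L' (\<beta> (fst x)) (U x) = e (L (fst x) (snd x))" if "x \<in> M" for x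
    using \<psi>[OF that] that by (auto simp: U_def clamp_def M_def min_def max_def)
  have "\<exists>t. 0 < t \<and> t <= qs' \<and> L' t (U x) = e (L (fst x) (snd x))" if x: "x \<in> strip" "fst x <= qs" for x
  proof -
    have b: "0 < fst x" "-1 <= snd x" "snd x <= 1" using x by (auto simp: strip_def)
    have "L qs (snd x) <= L (fst x) (snd x)" using P.decA[of "fst x" qs "snd x"] b x by (cases "fst x = qs") auto
    then have 1: "L' qs' (U x) <= e (L (fst x) (snd x))" unfolding UA[OF x] le .
    obtain \<delta> where \<delta>: "\<delta> > 0" "\<forall>q u. 0 < q --> q < \<delta> --> -1 <= u --> u <= 1 --> e (L (fst x) (snd x)) < L' q u"
      using Q.top by blast
    define d where "d = min qs' (\<delta> / 2)"
    have d: "0 < d" "d <= qs'" "d < \<delta>" using \<delta>(1) Q.q by (auto simp: d_def)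
    then have 2: "e (L (fst x) (snd x)) <= L' d (U x)" using \<delta>(2) Ub[OF x(1)] less_imp_le by blast
    have "continuous_on {d..qs'} (\<lambda>t. L' t (U x))" using Q.cont_q[of d qs' "U x"] d Ub[OF x(1)] Q.q by simp
    from IVT2'[OF 1 2 d(2) this] show ?thesis using d(1) less_le_trans by blast
  qed
  then obtain A where A: "!!x. x \<in> strip ==> fst x <= qs ==> 0 < A x \<and> A x <= qs' \<and> L' (A x) (U x) = e (L (fst x) (snd x))"
    by metis
  have "\<exists>t. qc' <= t \<and> t <= 1 \<and> L' t (U x) = e (L (fst x) (snd x))" if x: "x \<in> strip" "qc <= fst x" for x
  proof -
    have b: "fst x <= 1" "-1 <= snd x" "snd x <= 1" using x by (auto simp: strip_def)
    have "L (fst x) (snd x) <= L qc (snd x)" using P.decB[of qc "fst x" "snd x"] b x by (cases "fst x = qc") auto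
    then have 2: "e (L (fst x) (snd x)) <= L' qc' (U x)" unfolding UB[OF x] le .
    have "L 1 (snd x) <= L (fst x) (snd x)" using P.decB[of "fst x" 1 "snd x"] b x by (cases "fst x = 1") auto
    then have "e 0 <= e (L (fst x) (snd x))" unfolding le P.edge .
    then have 1: "L' 1 (U x) <= e (L (fst x) (snd x))" by (simp add: e Q.edge)
    have "continuous_on {qc'..1} (\<lambda>t. L' t (U x))" using Q.cont_q[of qc' 1 "U x"] Ub[OF x(1)] Q.q by simp
    from IVT2'[OF 1 2 less_imp_le[OF Q.q(3)] this] show ?thesis by blast
  qed
  then obtain B where B: "!!x. x \<in> strip ==> qc <= fst x ==> qc' <= B x \<and> B x <= 1 \<and> L' (B x) (U x) = e (L (fst x) (snd x))"
    by metis
  have cLU: "continuous_on S (\<lambda>x. - L' t (U x))" if "S \<subseteq> strip" "0 < t" "t <= 1" for S t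
    by (intro continuous_on_minus Q.cont_comp continuous_on_const continuous_on_subset[OF cU that(1)])
      (use Ub that in \<open>auto simp: strip_def\<close>)
  have cA: "continuous_on {x \<in> strip. fst x - qs <= 0} A"
  proof (rule implicit_continuous[where I = "{0<..qs'}" and g = "\<lambda>t x. - L' t (U x)" and \<gamma> = "\<lambda>x. - e (L (fst x) (snd x))"])
    show "continuous_on {x \<in> strip. fst x - qs <= 0} (\<lambda>x. - L' t (U x))" if "t \<in> {0<..qs'}" for t
      by (rule cLU) (use that Q.q in auto)
    show "continuous_on {x \<in> strip. fst x - qs <= 0} (\<lambda>x. - e (L (fst x) (snd x)))"
      by (intro continuous_on_minus cL) auto
    show "- L' s (U x) < - L' t (U x)" if "x \<in> {x \<in> strip. fst x - qs <= 0}" "s \<in> {0<..qs'}" "t \<in> {0<..qs'}" "s < t" for x s t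
      using Q.decA[of s t "U x"] Ub[of x] that by simp
  qed (use A in \<open>auto simp: is_interval_1\<close>)
  have cB: "continuous_on {x \<in> strip. 0 <= fst x - qc} B"
  proof (rule implicit_continuous[where I = "{qc'..1}" and g = "\<lambda>t x. - L' t (U x)" and \<gamma> = "\<lambda>x. - e (L (fst x) (snd x))"])
    show "continuous_on {x \<in> strip. 0 <= fst x - qc} (\<lambda>x. - L' t (U x))" if "t \<in> {qc'..1}" for t
      by (rule cLU) (use that Q.q in auto)
    show "continuous_on {x \<in> strip. 0 <= fst x - qc} (\<lambda>x. - e (L (fst x) (snd x)))"
      by (intro continuous_on_minus cL) auto
    show "- L' s (U x) < - L' t (U x)" if "x \<in> {x \<in> strip. 0 <= fst x - qc}" "s \<in> {qc'..1}" "t \<in> {qc'..1}" "s < t" for x s t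
      using Q.decB[of s t "U x"] Ub[of x] that by simp
  qed (use B in \<open>auto simp: is_interval_1\<close>)
  define T where "T x = (if fst x - qs <= 0 then A x else if fst x - qc <= 0 then \<beta> (fst x) else B x)" for x
  have As: "A x = \<beta> (fst x)" if "x \<in> strip" "fst x = qs" for x
    using A[OF that(1)] UA[OF that(1)] Q.injA[of "A x" qs' "U x"] that \<beta>e Ub[OF that(1)] Q.q by simp
  have Bs: "B x = \<beta> (fst x)" if "x \<in> strip" "fst x = qc" for x
    using B[OF that(1)] UB[OF that(1)] Q.injB[of "B x" qc' "U x"] that \<beta>e Ub[OF that(1)] Q.q by simp
  have "continuous_on {x \<in> strip. 0 <= fst x - qs} (\<lambda>x. if fst x - qc <= 0 then \<beta> (fst x) else B x)"
  proof (rule continuous_on_cases_le)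
    show "continuous_on {t \<in> {x \<in> strip. 0 <= fst x - qs}. 0 <= fst t - qc} B"
      by (rule continuous_on_subset[OF cB]) auto
  qed (use Bs in \<open>auto intro!: continuous_intros c\<beta>\<close>)
  note c2 = this
  have cT: "continuous_on strip T" unfolding T_def
    by (rule continuous_on_cases_le[OF cA c2]) (use As P.q in \<open>auto intro!: continuous_intros\<close>)
  have "T x \<in> {0<..1} \<and> Rel (fst x) (snd x) (T x) (U x)" if x: "x \<in> strip" for x
  proof -
    have b: "0 < fst x" "fst x <= 1" "-1 <= snd x" "snd x <= 1" using x by (auto simp: strip_def)
    consider "fst x <= qs" | "qs < fst x" "fst x <= qc" | "qc < fst x" by linarith
    then show ?thesis
    proof cases
      case 1 then show ?thesis using A[OF x] UA[OF x] Q.q by (auto simp: T_def Rel_def)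
    next
      case 2
      then have xM: "x \<in> M" using b by (auto simp: M_def mem_Times_iff)
      show ?thesis using 2 UM[OF xM] \<beta>b[OF xM] \<beta>[of "fst x"] by (auto simp: T_def Rel_def)
    next
      case 3 then show ?thesis using B[OF x] UB[OF x] Q.q P.q by (auto simp: T_def Rel_def)
    qed
  qed
  then have "\<forall>x\<in>strip. (T x, U x) \<in> strip \<and> Rel (fst x) (snd x) (T x) (U x)" using Ub by (auto simp: strip_def)
  then show ?thesis using cT cU by (intro exI[of _ "\<lambda>x. (T x, U x)"]) (auto intro: continuous_on_Pair)
qed

text \<open>\<open>Rel\<close> for the exchanged pair is the converse relation. As both relations
  determine the image uniquely, the two continuous selections are inverse to each other.\<close>

lemma cubic_homeo:
  "\<exists>F G. homeomorphism strip strip F G \<and>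
     (\<forall>q u q' u'. (q, u) \<in> strip --> F (q, u) = (q', u') --> L' q' u' = e (L q u) \<and>
        (u' = 1 \<longleftrightarrow> u = 1) \<and> (u' = -1 \<longleftrightarrow> u = -1) \<and> (u = -1 --> (q' = qs' \<longleftrightarrow> q = qs) \<and> (q' = qc' \<longleftrightarrow> q = qc)))"
proof -
  interpret S: cubic_pair L' L qs' qc' qs qc "inv e" by (rule swap)
  note i = strict_mono_homeo_inv[OF e(1,2)]
  obtain F where F: "continuous_on strip F" "!!x. x \<in> strip ==> F x \<in> strip" "!!x. x \<in> strip ==> Rel (fst x) (snd x) (fst (F x)) (snd (F x))"
    using Rel_exists by blast
  obtain G where G: "continuous_on strip G" "!!x. x \<in> strip ==> G x \<in> strip" "!!x. x \<in> strip ==> S.Rel (fst x) (snd x) (fst (G x)) (snd (G x))"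
    using S.Rel_exists by blast
  have inv: "x = inv e y \<longleftrightarrow> y = e x" for x y using i(3,4) by metis
  have sw: "S.Rel q' u' q u \<longleftrightarrow> Rel q u q' u'" for q u q' u'
  proof -
    have m: "qs' <= q' \<and> q' <= qc' \<and> (q' - qs') * (qc - qs) = (q - qs) * (qc' - qs') \<longleftrightarrow>
        qs <= q \<and> q <= qc \<and> (q - qs) * (qc' - qs') = (q' - qs') * (qc - qs)"
      using fit_range(1,2)[of q q'] S.fit_range(1,2)[of q' q] by (metis (no_types))
    show ?thesis unfolding Rel_def S.Rel_def inv m by blast
  qed
  note sym = sw[THEN iffD2] and sym' = sw[THEN iffD1]
  have GF: "G (F x) = x" if "x \<in> strip" for x
  proof -
    have "fst (G (F x)) = fst x \<and> snd (G (F x)) = snd x"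
      by (rule S.Rel_unique[OF G(3)[OF F(2)[OF that]] sym[OF F(3)[OF that]]]) (use F(2) G(2) that in auto)
    then show ?thesis by (simp add: prod_eq_iff)
  qed
  have FG: "F (G x) = x" if "x \<in> strip" for x
  proof -
    have "fst (F (G x)) = fst x \<and> snd (F (G x)) = snd x"
      by (rule Rel_unique[OF F(3)[OF G(2)[OF that]] sym'[OF G(3)[OF that]]]) (use F(2) G(2) that in auto)
    then show ?thesis by (simp add: prod_eq_iff)
  qed
  have h: "homeomorphism strip strip F G"
    by (rule homeomorphismI) (use F(1,2) G(1,2) GF FG in auto)
  show ?thesis
  proof (rule exI[of _ F], rule exI[of _ G], rule conjI[OF h], intro allI impI)
    fix q u q' u' assume x: "(q, u) \<in> strip" "F (q, u) = (q', u')"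
    have x': "(q', u') \<in> strip" using F(2)[OF x(1)] x(2) by simp
    have r: "Rel q u q' u'" using F(3)[OF x(1)] x(2) by simp
    have s: "S.Rel q' u' q u" by (rule sym[OF r])
    have u: "u' = 1 \<longleftrightarrow> u = 1" "u' = -1 \<longleftrightarrow> u = -1"
      using Rel_side[of q 1 q' u'] Rel_side[of q "-1" q' u'] S.Rel_side[of q' 1 q u] S.Rel_side[of q' "-1" q u] r s x x' by auto
    have "(q' = qs' \<longleftrightarrow> q = qs) \<and> (q' = qc' \<longleftrightarrow> q = qc)"
      using fit_range(3,4)[of q q'] P.q Q.q by (cases rule: Rel_cases[OF r x(1) x']) auto
    moreover have "L' q' u' = e (L q u)" using r by (simp add: Rel_def)
    ultimately show "L' q' u' = e (L q u) \<and>
        (u' = 1 \<longleftrightarrow> u = 1) \<and> (u' = -1 \<longleftrightarrow> u = -1) \<and> (u = -1 --> (q' = qs' \<longleftrightarrow> q = qs) \<and> (q' = qc' \<longleftrightarrow> q = qc))"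
      using u by blast
  qed
qed

end

text \<open>The map is \<open>h'\<close> after the inverse of \<open>h\<close>, which is continuous
  because the interval is compact.\<close>

lemma profile_transfer:
  fixes h h' :: "real => real"
  assumes ab: "a < b" and h: "strict_mono_on {a..b} h" "continuous_on {a..b} h"
    and h': "strict_mono_on {a..b} h'" "continuous_on {a..b} h'"
  obtains f where "strict_mono_on {h a..h b} f" "continuous_on {h a..h b} f" "\<forall>q\<in>{a..b}. f (h q) = h' q"
proof -
  have inj: "inj_on h {a..b}" by (rule strict_mono_on_imp_inj_on[OF h(1)])
  have hle: "h x <= h y" if "a <= x" "x <= y" "y <= b" for x y
    using strict_mono_onD[OF h(1), of x y] that by (cases "x = y") auto
  have img: "h ` {a..b} = {h a..h b}"
  proof
    show "h ` {a..b} \<subseteq> {h a..h b}" using hle by auto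
    show "{h a..h b} \<subseteq> h ` {a..b}"
    proof
      fix y assume "y \<in> {h a..h b}"
      then obtain x where "a <= x" "x <= b" "h x = y" using IVT'[of h a y b] h(2) ab by auto
      then show "y \<in> h ` {a..b}" by auto
    qed
  qed
  define g where "g = inv_into {a..b} h"
  have gh: "g (h q) = q" if "q \<in> {a..b}" for q using inv_into_f_f[OF inj that] by (simp add: g_def)
  have cg: "continuous_on {h a..h b} g"
    unfolding g_def img[symmetric] by (rule continuous_on_inv[OF h(2) compact_Icc]) (simp add: inv_into_f_f[OF inj])
  have gm: "g ` {h a..h b} \<subseteq> {a..b}" unfolding img[symmetric] using gh by auto
  show thesis
  proof (rule that[of "h' \<circ> g"])
    show "continuous_on {h a..h b} (h' \<circ> g)" unfolding o_def by (rule continuous_on_compose2[OF h'(2) cg gm])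
    show "\<forall>q\<in>{a..b}. (h' \<circ> g) (h q) = h' q" using gh by simp
    show "strict_mono_on {h a..h b} (h' \<circ> g)"
    proof (rule strict_mono_onI)
      fix x y assume xy: "x \<in> {h a..h b}" "y \<in> {h a..h b}" "x < y"
      then obtain s t where st: "s \<in> {a..b}" "t \<in> {a..b}" "x = h s" "y = h t" unfolding img[symmetric] by blast
      have "s < t"
      proof (rule ccontr)
        assume "\<not> s < t"
        then show False using hle[of t s] st xy(3) by auto
      qed
      then show "(h' \<circ> g) x < (h' \<circ> g) y" using gh st strict_mono_onD[OF h'(1), of s t] by simp
    qed
  qed
qed

text \<open>\<open>fit\<close> prescribes the level map on two intervals, one for each edge of the
  middle band; by \<open>order\<close> they are disjoint and lie above 0. The gaps are filled
  linearly, with the identity below 0 and a translation above the level of the center.\<close>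

lemma cubic_pair_exists:
  assumes P: "cubic L qs qc" and Q: "cubic L' qs' qc'"
  shows "\<exists>e. cubic_pair L L' qs qc qs' qc' e"
proof -
  interpret P: cubic L qs qc by fact
  interpret Q: cubic L' qs' qc' by fact
  define \<beta> where "\<beta> q = qs' + (q - qs) * ((qc' - qs') / (qc - qs))" for q
  have \<beta>: "strict_mono_on S \<beta>" "continuous_on S \<beta>" "\<beta> qs = qs'" "\<beta> qc = qc'" for S
    unfolding \<beta>_def by (rule linear_piece[OF P.q(2) Q.q(2)])+
  have \<beta>b: "qs' <= \<beta> q" "\<beta> q <= qc'" if "qs <= q" "q <= qc" for q
    using strict_mono_onD[OF \<beta>(1)[of UNIV], of qs q] strict_mono_onD[OF \<beta>(1)[of UNIV], of q qc] that \<beta>(3,4)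
    by (cases "q = qs"; cases "q = qc"; auto)+
  have \<beta>_less: "\<beta> s < \<beta> t" if "s < t" for s t using strict_mono_onD[OF \<beta>(1)[of UNIV]] that by simp
  have cP: "continuous_on {qs..qc} (\<lambda>q. L q \<sigma>)" if "-1 <= \<sigma>" "\<sigma> <= 1" for \<sigma>
    using P.cont_q[of qs qc \<sigma>] P.q that by simp
  have cQ: "continuous_on {qs..qc} (\<lambda>q. L' (\<beta> q) \<sigma>)" if "-1 <= \<sigma>" "\<sigma> <= 1" for \<sigma>
    by (rule continuous_on_compose2[OF _ \<beta>(2)]) (use Q.cont_q[of qs' qc' \<sigma>] Q.q that \<beta>b in auto)
  obtain fh where fh: "strict_mono_on {L qs (-1)..L qc (-1)} fh" "continuous_on {L qs (-1)..L qc (-1)} fh"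
    "\<forall>q\<in>{qs..qc}. fh (L q (-1)) = L' (\<beta> q) (-1)"
  proof (rule profile_transfer[OF P.q(2), of "\<lambda>q. L q (-1)" "\<lambda>q. L' (\<beta> q) (-1)"])
    show "strict_mono_on {qs..qc} (\<lambda>q. L q (-1))" by (rule strict_mono_onI) (auto intro: P.hi)
    show "strict_mono_on {qs..qc} (\<lambda>q. L' (\<beta> q) (-1))" by (rule strict_mono_onI) (auto intro!: Q.hi \<beta>_less \<beta>b)
  qed (use cP[of "-1"] cQ[of "-1"] in auto)
  \<comment> \<open>On the edge \<open>u = 1\<close> the level falls with the radius; reversing the
    radius makes \<open>profile_transfer\<close> applicable.\<close>
  have ab: "- qc < - qs" using P.q by simp
  obtain fl where fl: "strict_mono_on {L qc 1..L qs 1} fl" "continuous_on {L qc 1..L qs 1} fl"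
    "\<forall>q\<in>{-qc..-qs}. fl (L (- q) 1) = L' (\<beta> (- q)) 1"
  proof (rule profile_transfer[OF ab, of "\<lambda>q. L (- q) 1" "\<lambda>q. L' (\<beta> (- q)) 1", simplified])
    have m: "continuous_on {-qc..-qs} (\<lambda>q. - q)" "(\<lambda>q. - q) ` {-qc..-qs} \<subseteq> {qs..qc}"
      by (auto intro!: continuous_intros)
    show "strict_mono_on {-qc..-qs} (\<lambda>q. L (- q) 1)" by (rule strict_mono_onI) (auto intro: P.lo)
    show "strict_mono_on {-qc..-qs} (\<lambda>q. L' (\<beta> (- q)) 1)" by (rule strict_mono_onI) (auto intro!: Q.lo \<beta>_less \<beta>b)
    show "continuous_on {-qc..-qs} (\<lambda>q. L (- q) 1)" "continuous_on {-qc..-qs} (\<lambda>q. L' (\<beta> (- q)) 1)"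
      using continuous_on_compose2[OF cP m] continuous_on_compose2[OF cQ m] by simp_all
  qed auto
  have fh': "fh (L q (-1)) = L' (\<beta> q) (-1)" and fl': "fl (L q 1) = L' (\<beta> q) 1" if "qs <= q" "q <= qc" for q
    using fh(3) fl(3)[THEN bspec, of "- q"] that by auto
  have ends: "fl (L qc 1) = L' qc' 1" "fl (L qs 1) = L' qs' 1" "fh (L qs (-1)) = L' qs' (-1)" "fh (L qc (-1)) = L' qc' (-1)"
    using fh' fl' \<beta> P.q by auto
  note o = P.order and o' = Q.order
  define f1 where "f1 x = 0 + (x - 0) * ((L' qc' 1 - 0) / (L qc 1 - 0))" for x
  define f3 where "f3 x = L' qs' 1 + (x - L qs 1) * ((L' qs' (-1) - L' qs' 1) / (L qs (-1) - L qs 1))" for x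
  define f5 where "f5 x = x - L qc (-1) + L' qc' (-1)" for x
  note l1 = linear_piece[OF o(1) o'(1), folded f1_def] and l3 = linear_piece[OF o(3) o'(3), folded f3_def]
  define e1 where "e1 = glue 0 (\<lambda>x. x) f1"
  have id: "strict_mono_on {..0::real} (\<lambda>x. x)" "(\<lambda>x. x) ` {..0::real} = {..0}" "(0::real) = 0"
    by (simp_all add: strict_mono_on_def)
  note m1 = mono_glue[of 0 "\<lambda>x. x" f1, unfolded l1(3), OF id l1(1,2) less_imp_le[OF o(1)], folded e1_def, unfolded l1(4)]
  define e2 where "e2 = glue (L qc 1) e1 fl"
  note m2 = mono_glue[of "L qc 1" e1 fl, unfolded ends, OF m1(1-3) fl(1,2) less_imp_le[OF o(2)], folded e2_def, unfolded ends]
  define e3 where "e3 = glue (L qs 1) e2 f3"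
  note m3 = mono_glue[of "L qs 1" e2 f3, unfolded l3, OF m2(1-3) l3(1,2) less_imp_le[OF o(3)], folded e3_def, unfolded l3]
  define e4 where "e4 = glue (L qs (-1)) e3 fh"
  note m4 = mono_glue[of "L qs (-1)" e3 fh, unfolded ends, OF m3(1-3) fh(1,2) less_imp_le[OF o(4)], folded e4_def, unfolded ends]
  define e where "e = glue (L qc (-1)) e4 f5"
  have f5: "f5 (L qc (-1)) = L' qc' (-1)" "strict_mono_on S f5" "continuous_on S f5" for S
    unfolding f5_def[abs_def] by (simp, rule strict_mono_onI, simp, intro continuous_intros)
  note m5 = mono_glue[of "L qc (-1)" e4 f5, unfolded f5(1), OF m4(1-3) f5(2,3), folded e_def]
  have em: "strict_mono e"
  proof (rule strict_monoI)
    fix x y :: real assume "x < y"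
    then show "e x < e y" using strict_mono_onD[OF m5(1)[of "max y (L qc (-1))"], of x y] by simp
  qed
  have es: "surj e"
  proof -
    have "\<exists>x. e x = y" for y
    proof -
      define s where "s = max (L qc (-1)) (y + L qc (-1) - L' qc' (-1))"
      have "y \<in> e ` {..s}" using m5(2)[of s] by (simp add: s_def f5_def)
      then show ?thesis by auto
    qed
    then show ?thesis by (metis surj_def)
  qed
  have elo: "e (L q 1) = L' (\<beta> q) 1" if "qs <= q" "q <= qc" for q
  proof -
    have "L qc 1 <= L q 1" "L q 1 <= L qs 1" using P.lo[of q qc] P.lo[of qs q] that by (cases "q = qs"; cases "q = qc"; auto)+
    then show ?thesis using m5(4)[OF order.refl] m4(4) m3(4) m2(5) fl' that o by simp
  qed
  have ehi: "e (L q (-1)) = L' (\<beta> q) (-1)" if "qs <= q" "q <= qc" for q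
  proof -
    have "L qs (-1) <= L q (-1)" "L q (-1) <= L qc (-1)" using P.hi[of q qc] P.hi[of qs q] that by (cases "q = qs"; cases "q = qc"; auto)+
    then show ?thesis using m5(4)[OF order.refl] m4(5) fh' that by simp
  qed
  have "e 0 = 0" using m5(4)[OF order.refl] m4(4) m3(4) m2(4) m1(4)[OF order.refl] o by simp
  moreover have "L' q' \<sigma> = e (L q \<sigma>)"
    if h: "qs <= q" "q <= qc" "(q - qs) * (qc' - qs') = (q' - qs') * (qc - qs)" "\<sigma> = 1 \<or> \<sigma> = -1" for q q' \<sigma>
  proof -
    have "(\<beta> q - qs') * (qc - qs) = (q' - qs') * (qc - qs)" using h(3) P.q by (simp add: \<beta>_def)
    then have "q' = \<beta> q" using P.q by simp
    then show ?thesis using elo[OF h(1,2)] ehi[OF h(1,2)] h(4) by auto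
  qed
  ultimately have "cubic_pair L L' qs qc qs' qc' e" by unfold_locales (use em es in auto)
  then show ?thesis by blast
qed

section \<open>The vortex levels for negative ratio\<close>

context vortex_system
begin

lemma cubic_lev:
  assumes c: "c < 0" "cub xp > - \<kappa> * c"
  obtains qs qc where "cubic (lv) qs qc"
    "\<forall>q u. (q, u) \<in> strip --> (krad q u = c \<and> (q = 1 \<or> u = 1 \<or> u = -1) \<longleftrightarrow> u = -1 \<and> (q = qs \<or> q = qc))"
proof -
  obtain qs qc where q: "0 < qs" "qs < qc" "qc < 1"
    and cr: "krad qc (-1) = c" "krad qs (-1) = c"
    and sgn: "\<forall>t\<in>{0<..<qs}. c < krad t (-1)" "\<forall>t\<in>{qs<..<qc}. krad t (-1) < c"
      "\<forall>t\<in>{qc<..1}. c < krad t (-1)"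
    using region4_axis[OF c] by metis
  have "cubic (lv) qs qc"
  proof
    show "continuous_on strip (\<lambda>x. lv (fst x) (snd x))" by (rule continuous_lev_strip)
    show "lv q v < lv q u" if "0 < q" "q < 1" "-1 <= u" "u < v" "v <= 1" for q u v
      by (rule lev_anti_u) (use that in auto)
    show "lv t u < lv s u" if h: "0 < s" "s < t" "t <= qs" "-1 <= u" "u <= 1" for s t u
    proof (rule lev_decreasing)
      show "c < krad x u" if x: "s < x" "x < t" for x
        using rad_above_neg[OF c(1) h(4,5), of x] sgn(1) x h q by (simp add: less_imp_le)
    qed (use h q \<rho>q[of t] in auto)
    show "lv t u < lv s u" if h: "qc <= s" "s < t" "t <= 1" "-1 <= u" "u <= 1" for s t u
    proof (rule lev_decreasing)
      show "c < krad x u" if x: "s < x" "x < t" for x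
        using rad_above_neg[OF c(1) h(4,5), of x] sgn(3) x h q by (simp add: less_imp_le)
    qed (use h q \<rho>q[of t] in auto)
    show "lv s (-1) < lv t (-1)" if h: "qs <= s" "s < t" "t <= qc" for s t
      by (rule lev_increasing) (use h q sgn(2) \<rho>q[of t] in auto)
    show "lv t 1 < lv s 1" if h: "qs <= s" "s < t" "t <= qc" for s t
    proof (rule lev_decreasing)
      show "c < krad x 1" if "s < x" "x < t" for x
        using rad_axis_pos[of x] that h q c(1) \<kappa>_pos by (smt (verit) mult_pos_pos)
    qed (use h q \<rho>q[of t] in auto)
    show "\<exists>\<delta>>0. \<forall>q u. 0 < q --> q < \<delta> --> -1 <= u --> u <= 1 --> E < lv q u" for E
    proof -
      obtain \<delta> where "0 < \<delta>" "\<delta> <= 1" "!!q u. 0 < q ==> q < \<delta> ==> -1 <= u ==> u <= 1 ==> -1 * lv q u < - E"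
        using lev_to_bot[of "-1" "- E"] c(1) by auto
      then show ?thesis by (intro exI[of _ \<delta>]) force
    qed
  qed (use q in auto)
  moreover have "krad q u = c \<and> (q = 1 \<or> u = 1 \<or> u = -1) \<longleftrightarrow> u = -1 \<and> (q = qs \<or> q = qc)"
    if "(q, u) \<in> strip" for q u
  proof -
    have b: "0 < q" "q <= 1" "-1 <= u" "u <= 1" using that by (auto simp: strip_def)
    show ?thesis
    proof
      assume h: "krad q u = c \<and> (q = 1 \<or> u = 1 \<or> u = -1)"
      then have n: "u = -1" "q < 1" using neg_crit(1,2)[OF c(1) b] by auto
      then show "u = -1 \<and> (q = qs \<or> q = qc)" using sgn[THEN bspec, of q] h b
        by (cases q qs rule: linorder_cases; cases q qc rule: linorder_cases) auto
    qed (use cr in auto)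
  qed
  ultimately show thesis using that by blast
qed

text \<open>With reversed sign the level rises on every ray up to the circle, so the ridge is the
  circle. The function \<open>- u - 2\<close> is merely a decreasing function that stays negative;
  as it is the same for all parameters, the identity can serve as the level map.\<close>

lemma unimodal_region5:
  assumes c: "c < 0" "cub xp < - \<kappa> * c"
  shows "unimodal (\<lambda>q u. - lv q u) (\<lambda>u. - u - 2) (\<lambda>_. 1)"
proof
  show "continuous_on strip (\<lambda>x. - lv (fst x) (snd x))"
    by (intro continuous_on_minus continuous_lev_strip)
  show "- lv s u < - lv t u" if "0 < s" "s < t" "t <= 1" "-1 <= u" "u <= 1" for s t u
    using lev_decreasing[of s t u] region5_rad[OF c] that \<rho>q[of t] by auto
  show "\<exists>\<delta>>0. \<forall>q u. 0 < q --> q < \<delta> --> -1 <= u --> u <= 1 --> - lv q u < E" for E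
  proof -
    have "(-1::real) = 1 \<or> (-1::real) = -1" "-1 * c > 0" using c(1) by auto
    from lev_to_bot[OF this, of E] obtain \<delta> where "0 < \<delta>" "!!q u. 0 < q ==> q < \<delta> ==> -1 <= u ==> u <= 1 ==> -1 * lv q u < E"
      by metis
    then show ?thesis unfolding mult_minus1 by blast
  qed
  show "- lv 1 u = max 0 (- u - 2)" if "-1 <= u" for u using that by simp
qed (auto intro!: continuous_on_diff continuous_on_minus)

end

context two_systems
begin

lemma equivalent_region4:
  assumes "c < 0" "c' < 0" "P.cub P.xp > - P.\<kappa> * c" "Q.cub Q.xp > - Q.\<kappa> * c'"
  shows equivalent
proof -
  obtain qs qc where P: "cubic (lev \<rho> c) qs qc"
    "\<forall>q u. (q, u) \<in> strip --> (P.krad q u = c \<and> (q = 1 \<or> u = 1 \<or> u = -1) \<longleftrightarrow> u = -1 \<and> (q = qs \<or> q = qc))"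
    by (rule P.cubic_lev[OF assms(1,3)])
  obtain qs' qc' where Q: "cubic (lev \<rho>' c') qs' qc'"
    "\<forall>q u. (q, u) \<in> strip --> (Q.krad q u = c' \<and> (q = 1 \<or> u = 1 \<or> u = -1) \<longleftrightarrow> u = -1 \<and> (q = qs' \<or> q = qc'))"
    by (rule Q.cubic_lev[OF assms(2,4)])
  obtain e where "cubic_pair (lev \<rho> c) (lev \<rho>' c') qs qc qs' qc' e" using cubic_pair_exists[OF P(1) Q(1)] by blast
  then interpret C: cubic_pair "lev \<rho> c" "lev \<rho>' c'" qs qc qs' qc' e .
  obtain F G where F: "homeomorphism strip strip F G"
    "!!q u q' u'. (q, u) \<in> strip ==> F (q, u) = (q', u') ==> lev \<rho>' c' q' u' = e (lev \<rho> c q u) \<and>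
        (u' = 1 \<longleftrightarrow> u = 1) \<and> (u' = -1 \<longleftrightarrow> u = -1) \<and> (u = -1 --> (q' = qs' \<longleftrightarrow> q = qs) \<and> (q' = qc' \<longleftrightarrow> q = qc))"
    using C.cubic_homeo by blast
  show ?thesis
  proof (rule equivalentI[OF F(1) C.e(1)])
    fix q u q' u' assume x: "(q, u) \<in> strip" "(q', u') \<in> strip" "F (q, u) = (q', u')"
    then show "lev \<rho>' c' q' u' = e (lev \<rho> c q u) \<and> (u' = 1 \<longleftrightarrow> u = 1) \<and> (u' = -1 \<longleftrightarrow> u = -1) \<and>
      (Q.critical q' u' \<longleftrightarrow> P.critical q u)"
      unfolding P(2)[rule_format, OF x(1)] Q(2)[rule_format, OF x(2)] using F(2)[OF x(1,3)] by auto
  qed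
qed

lemma equivalent_region5:
  assumes "c < 0" "c' < 0" "P.cub P.xp < - P.\<kappa> * c" "Q.cub Q.xp < - Q.\<kappa> * c'"
  shows equivalent
proof -
  note rP = P.region5_rad[OF assms(1,3)] and rQ = Q.region5_rad[OF assms(2,4)]
  obtain F G where F: "homeomorphism strip strip F G"
    "!!q u q' u'. (q, u) \<in> strip ==> F (q, u) = (q', u') ==> - lev \<rho>' c' q' u' = - lev \<rho> c q u \<and> - u' - 2 = - u - 2 \<and>
       (q' = 1 \<longleftrightarrow> q = 1) \<and> (q' = 1 \<longleftrightarrow> q = 1) \<and> (u' = 1 \<longleftrightarrow> u = 1) \<and> (u' = -1 \<longleftrightarrow> u = -1)"
    using unimodal_homeo[OF P.unimodal_region5[OF assms(1,3)] Q.unimodal_region5[OF assms(2,4)] strict_mono_id surj_id,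
        unfolded id_apply, OF refl refl refl] by blast
  show ?thesis
  proof (rule equivalentI[OF F(1) strict_mono_id])
    fix q u q' u' assume x: "(q, u) \<in> strip" "(q', u') \<in> strip" "F (q, u) = (q', u')"
    show "lev \<rho>' c' q' u' = id (lev \<rho> c q u) \<and> (u' = 1 \<longleftrightarrow> u = 1) \<and> (u' = -1 \<longleftrightarrow> u = -1) \<and>
      (Q.critical q' u' \<longleftrightarrow> P.critical q u)"
      using F(2)[OF x(1,3)] rP[of q u] rQ[of q' u'] x(1,2) by (auto simp: strip_def)
  qed
qed

end

section \<open>Degenerate equilibria\<close>

lemma local_model:
  assumes P: "hamiltonian_field Om V H k" and Q: "hamiltonian_field UNIV V' H' k'"
    and N: "open N" "N \<subseteq> Om" "p \<in> N" and f: "continuous_on N f" "inj_on f N" "f p = 0"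
    and level: "!!z w. z \<in> N ==> w \<in> N ==> H z = H w \<longleftrightarrow> H' (f z) = H' (f w)"
    and equil: "!!z. z \<in> N ==> V z = 0 \<longleftrightarrow> V' (f z) = 0"
  shows "locally_orbit_equivalent Om V p UNIV V' 0"
proof -
  obtain g where g: "homeomorphism N (f ` N) f g" using invariance_of_domain_homeomorphism[OF N(1) f(1) _ f(2)] by auto
  have o: "open (f ` N)" by (rule invariance_of_domain[OF f(1) N(1) f(2)])
  have "carries_orbits (UNIV \<inter> N) V (UNIV \<inter> f ` N) V' f"
    by (rule carries_orbitsI[OF hamiltonian_field_subset[OF P N(1,2)] _ hamiltonian_field_subset[OF Q o]])
      (use g level equil in auto)
  moreover have "0 \<in> f ` N" using N(3) f(3) by (metis imageI)
  ultimately show ?thesis unfolding locally_orbit_equivalent_def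
    using N o g f(3) by (intro exI[of _ N] exI[of _ "f ` N"] exI[of _ f] exI[of _ g]) simp
qed

section \<open>The model fields\<close>

lemma hamiltonian_field_UNIV:
  assumes H: "!!p. (H has_derivative (\<lambda>v. V p $ 1 * v $ 2 - V p $ 2 * v $ 1)) (at p)"
    and D: "!!p. (V has_derivative D p) (at p)" "!!v. continuous_on UNIV (\<lambda>p. D p v)"
  shows "hamiltonian_field UNIV V H 1"
proof unfold_locales
  show "local_lipschitz (UNIV::real set) UNIV (\<lambda>_. V)" by (rule local_lipschitz_C1[OF open_UNIV D])
qed (use H in simp_all)

lemma saddle_model: "hamiltonian_field UNIV (\<lambda>z. pt (z$1) (- (z$2))) (\<lambda>z. z$1 * z$2) 1"
proof (rule hamiltonian_field_UNIV)
  show "((\<lambda>z. pt (z$1) (- (z$2))) has_derivative (\<lambda>v. pt (v$1) (- (v$2)))) (at p)" for p :: "real^2"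
    by (auto intro!: derivative_eq_intros)
  show "((\<lambda>z. z$1 * z$2) has_derivative (\<lambda>v. pt (p$1) (- (p$2)) $ 1 * v$2 - pt (p$1) (- (p$2)) $ 2 * v$1)) (at p)" for p :: "real^2"
    by (auto intro!: derivative_eq_intros)
qed simp

lemma cusp_model: "hamiltonian_field UNIV (\<lambda>z. pt (z$2) ((z$1)^2)) (\<lambda>z. (z$2)^2 / 2 - (z$1)^3 / 3) 1"
proof (rule hamiltonian_field_UNIV)
  show "((\<lambda>z. pt (z$2) ((z$1)^2)) has_derivative (\<lambda>v. pt (v$2) (2 * p$1 * v$1))) (at p)" for p :: "real^2"
    by (auto intro!: derivative_eq_intros)
  show "((\<lambda>z. (z$2)^2 / 2 - (z$1)^3 / 3) has_derivative
      (\<lambda>v. pt (p$2) ((p$1)^2) $ 1 * v$2 - pt (p$2) ((p$1)^2) $ 2 * v$1)) (at p)" for p :: "real^2"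
    by (auto intro!: derivative_eq_intros)
  show "continuous_on UNIV (\<lambda>p. pt (v$2) (2 * p$1 * v$1))" for v :: "real^2"
    by (intro continuous_intros)
qed

lemma continuous_sgn_mult:
  fixes f g :: "'a::topological_space => real"
  assumes "continuous_on S f" "continuous_on S g" "!!x. x \<in> S ==> f x = 0 ==> g x = 0"
  shows "continuous_on S (\<lambda>x. sgn (f x) * g x)"
proof -
  have "continuous_on S (\<lambda>x. if f x <= 0 then - g x else g x)"
    by (rule continuous_on_cases_le)
      (use assms in \<open>auto intro: continuous_on_subset continuous_on_minus\<close>)
  then show ?thesis by (rule continuous_on_eq) (use assms(3) in \<open>auto simp: sgn_if\<close>)
qed

section \<open>The vortex system near its degenerate equilibria\<close>

context vortex_system
begin

definition qq :: "real^2 => real" where "qq z = cmod (ch z)"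
definition uu :: "real^2 => real" where "uu z = Re (ch z) / cmod (ch z)"

lemma qu:
  assumes "z \<in> Om"
  shows "0 < qq z" "-1 <= uu z" "uu z <= 1" "Re (ch z) = qq z * uu z" "En z = lv (qq z) (uu z)"
    "V z = 0 \<longleftrightarrow> krad (qq z) (uu z) = c \<and> (qq z = 1 \<or> Im (ch z) = 0)"
  using ch_nz[OF assms] Re_cmod_bounds[of "ch z"] En_ch[OF assms] zero_V_iff[OF assms] by (auto simp: qq_def uu_def)

lemma qu_Pt:
  assumes "0 < q" "q <= 1" "-1 <= u" "u <= 1"
  shows "qq (Pt 1 q u) = q" "uu (Pt 1 q u) = u" "Pt 1 q u \<in> Om"
  using Pt_facts'[OF assms(1) assms, of 1] by (simp_all add: qq_def uu_def)

lemma continuous_qu: "continuous_on Om qq" "continuous_on Om uu" "continuous_on Om (\<lambda>z. Im (ch z))"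
proof -
  have c: "continuous_on Om ch" by (rule continuous_on_subset[OF continuous_ch Om_subset])
  show "continuous_on Om qq" "continuous_on Om uu" "continuous_on Om (\<lambda>z. Im (ch z))"
    unfolding qq_def[abs_def] uu_def[abs_def] by (intro continuous_intros c; use ch_nz in auto)+
qed

lemma Im_square: "z \<in> Om ==> (Im (ch z))^2 = (qq z)^2 * (1 - (uu z)^2)"
proof -
  assume "z \<in> Om"
  then have "(qq z)^2 * (uu z)^2 = (Re (ch z))^2" using qu(4) by (simp add: power_mult_distrib)
  then show ?thesis using cmod_power2[of "ch z"] by (simp add: right_diff_distrib qq_def)
qed

lemma Im_zero_iff: "z \<in> Om ==> Im (ch z) = 0 \<longleftrightarrow> uu z = 1 \<or> uu z = -1"
proof -
  assume z: "z \<in> Om"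
  have "Im (ch z) = 0 \<longleftrightarrow> (Im (ch z))^2 = 0" by simp
  also have "\<dots> \<longleftrightarrow> (uu z)^2 = 1" unfolding Im_square[OF z] using qu(1)[OF z] by auto
  finally show ?thesis by (simp add: power2_eq_1_iff)
qed

lemma Om_eqI:
  assumes z: "z \<in> Om" "w \<in> Om" "qq z = qq w" "uu z = uu w"
    and s: "uu z \<noteq> 1 ==> uu z \<noteq> -1 ==> sgn (Im (ch z)) = sgn (Im (ch w))"
  shows "z = w"
proof -
  have "Re (ch z) = Re (ch w)" using qu(4)[OF z(1)] qu(4)[OF z(2)] z(3,4) by simp
  moreover have "(Im (ch z))^2 = (Im (ch w))^2" unfolding Im_square[OF z(1)] Im_square[OF z(2)] z(3,4) ..
  then have "\<bar>Im (ch z)\<bar> = \<bar>Im (ch w)\<bar>" by (simp add: power2_eq_iff abs_eq_iff)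
  moreover have "sgn (Im (ch z)) = sgn (Im (ch w))"
    using s Im_zero_iff[OF z(1)] Im_zero_iff[OF z(2)] z(4) by (cases "uu z = 1 \<or> uu z = -1") auto
  ultimately have "ch z = ch w" by (metis complex_eq_iff mult_sgn_abs)
  then show ?thesis using pz_ch[of z] pz_ch[of w] z Om_subset by (metis ComplD insertI1 subsetD)
qed

text \<open>Write \<open>En\<close> as its value \<open>P\<close> on the ray \<open>u = -1\<close>
  at the same radius, minus a nonnegative defect. \<open>P\<close> decreases strictly through its
  critical point, so a cube root of it can serve as the first coordinate, and a signed square root
  of the defect is the second. Then \<open>y^2 / 2 - x^3 / 3\<close> is a constant minus
  \<open>En\<close>.\<close>

lemma cusp_curve3:
  assumes c: "c < 0" "cub xp = - \<kappa> * c"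
  shows "cusp Om V (pt (R * xp) 0)"
proof -
  define p qp where "p = pt (R * xp) 0" and "qp = ax xp"
  note c3 = curve3_equilibria[OF c]
  have eqp: "equilibrium Om V p" using c3(1) by (auto simp: p_def)
  then have pO: "p \<in> Om" by (simp add: equilibrium_def)
  have qp: "0 < qp" "qp < 1" "ax qp = xp" using c3 by (auto simp: qp_def)
  have x: "0 < xp" "xp < 1" using xp_bounds \<rho> by auto
  note J = jac_axis[OF eqp[unfolded p_def], folded p_def]
  have "cub' xp = 0" by (simp add: cub'_factor)
  then have j: "j11 p = 0" "j21 p = 0" using J by auto
  have "1 - xp^2 > 0" using x by (simp add: abs_square_less_1)
  then have j12: "j12 p \<noteq> 0" using J(2,4) \<theta>_nz \<rho> by simp
  have nz: "jacobian V (at p) \<noteq> 0"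
  proof
    assume "jacobian V (at p) = 0"
    then have "jac p (pt 0 1) = 0" using jacobian_V(2)[OF pO, of "pt 0 1"] by simp
    then show False using j12 by (simp add: jac_def vec2_eq_iff)
  qed
  have below: "c < krad q (-1)" if "0 < q" "q < 1" "q \<noteq> qp" for q
  proof (rule rad_axis_gt)
    have "ax q \<noteq> xp"
      using ax_facts(4)[of q] that by (auto simp: qp_def)
    then show "cub (ax q) < - \<kappa> * c" using cub_ax_less[OF c(1), of q] that c by simp
  qed (use that c in auto)
  define P where "P q = lv q (-1)" for q
  \<comment> \<open>The derivative of \<open>P\<close> vanishes at \<open>qp\<close> only; splitting
    the interval there keeps the monotonicity strict.\<close>
  have Pdec: "P t < P s" if "0 < s" "s < t" "t < 1" for s t
  proof -
    have d: "P t < P s" if "0 < s" "s < t" "t < 1" "qp \<notin> {s<..<t}" for s t unfolding P_def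
      by (rule lev_decreasing) (use that below \<rho>q[of t] in auto)
    show ?thesis
    proof (cases "qp \<in> {s<..<t}")
      case True
      then have "P t < P qp" "P qp < P s" using d[of qp t] d[of s qp] that qp by auto
      then show ?thesis by linarith
    qed (use d that in auto)
  qed
  define N where "N = {z \<in> Om. qq z < 1 \<and> uu z < 0}"
  have "open (Om \<inter> (\<lambda>z. (qq z, uu z)) -` ({..<1} \<times> {..<0}))"
    by (rule continuous_open_preimage) (intro continuous_on_Pair continuous_qu open_Om open_Times; simp)+
  also have "Om \<inter> (\<lambda>z. (qq z, uu z)) -` ({..<1} \<times> {..<0}) = N" by (auto simp: N_def)
  finally have oN: "open N" .
  have NO: "N \<subseteq> Om" by (auto simp: N_def)
  have Nb: "0 < qq z" "qq z < 1" "-1 <= uu z" "uu z < 0" if "z \<in> N" for z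
    using that qu(1,2)[of z] by (auto simp: N_def)
  \<comment> \<open>\<open>K\<close> is twice the defect divided by the square of
    \<open>Im (ch z)\<close>. The factor \<open>1 + u\<close> that both share has been cancelled, so
    \<open>K\<close> is continuous and positive across the axis.\<close>
  define K where "K z = 4 * \<kappa> * \<rho> * (1 - (qq z)^2) / (qq z * (1 - uu z) * (dn \<rho> (qq z) (-1) * dn \<rho> (qq z) (uu z)))" for z
  have dpos: "dn \<rho> (qq z) (-1) > 0" "dn \<rho> (qq z) (uu z) > 0" if "z \<in> N" for z
    using Nb[OF that] by (auto intro!: dn_pos')
  have dnz: "dn \<rho> (qq z) (-1) \<noteq> 0" "dn \<rho> (qq z) (uu z) \<noteq> 0" if "z \<in> N" for z
    using dpos[OF that] by auto
  have Kpos: "K z > 0" if "z \<in> N" for z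
  proof -
    have "1 - uu z > 0" using Nb[OF that] by linarith
    moreover have "1 - (qq z)^2 > 0" "0 < qq z" using Nb[OF that] by (auto simp: abs_square_less_1)
    ultimately show ?thesis unfolding K_def using dpos[OF that] \<kappa>_pos \<rho> by (intro divide_pos_pos mult_pos_pos) auto
  qed
  have KI: "(Im (ch z))^2 * K z = 2 * (P (qq z) - lv (qq z) (uu z))" if "z \<in> N" for z
  proof -
    note b = Nb[OF that]
    define q u where "q = qq z" and "u = uu z"
    note b' = b[folded q_def u_def] and d = dpos[OF that, folded q_def u_def]
    have "P q - lv q u = \<kappa> * (1 - q^2) * (2 * \<rho> * q * (u + 1)) / (dn \<rho> q (-1) * dn \<rho> q u)"
      unfolding P_def using lev_diff_u[of q "-1" u] d by simp
    moreover have "(Im (ch z))^2 = q^2 * ((1 - u) * (1 + u))"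
      using Im_square[of z] that NO by (auto simp: q_def u_def algebra_simps power2_eq_square)
    moreover have "q^2 * ((1 - u) * (1 + u)) * (4 * \<kappa> * \<rho> * (1 - q^2) / (q * (1 - u) * (dn \<rho> q (-1) * dn \<rho> q u)))
        = 2 * (\<kappa> * (1 - q^2) * (2 * \<rho> * q * (u + 1)) / (dn \<rho> q (-1) * dn \<rho> q u))"
    proof -
      have "q^2 * ((1 - u) * (1 + u)) * (4 * \<kappa> * \<rho> * A / (q * (1 - u) * D)) = 2 * (\<kappa> * A * (2 * \<rho> * q * (u + 1)) / D)"
        if "D \<noteq> 0" for A D
        using that b' by (simp add: field_simps power2_eq_square)
      then show ?thesis using d by simp
    qed
    ultimately show ?thesis unfolding K_def u_def[symmetric] q_def[symmetric] by (simp only:)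
  qed
  define f where "f z = pt (root 3 (3 * (P (qq z) - P qp))) (Im (ch z) * sqrt (K z))" for z
  have f1: "(f z $ 1)^3 = 3 * (P (qq z) - P qp)" for z
    by (simp add: f_def odd_real_root_pow)
  have f2: "(f z $ 2)^2 = 2 * (P (qq z) - lv (qq z) (uu z))" if "z \<in> N" for z
    using KI[OF that] Kpos[OF that] by (simp add: f_def power_mult_distrib)
  have pP: "p = Pt 1 qp (-1)" using Pt_axis_pt qp by (simp add: p_def)
  have pN: "qq p = qp" "uu p = -1" "p \<in> N"
    using qu_Pt[of qp "-1"] qp unfolding pP N_def by auto
  have Pinj: "s = t" if "0 < s" "s < 1" "0 < t" "t < 1" "P s = P t" for s t
    using Pdec[of s t] Pdec[of t s] that by (cases s t rule: linorder_cases) auto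
  have fq: "f z $ 1 = f w $ 1 ==> qq z = qq w" if "z \<in> N" "w \<in> N" for z w
    using f1[of z] f1[of w] Pinj[of "qq z" "qq w"] Nb[OF that(1)] Nb[OF that(2)] by simp
  have "locally_orbit_equivalent Om V p UNIV (\<lambda>z. pt (z$2) ((z$1)^2)) 0"
  proof (rule local_model[OF hamiltonian_field_axioms cusp_model oN NO pN(3)])
    have cN: "continuous_on N qq" "continuous_on N uu" "continuous_on N (\<lambda>z. Im (ch z))"
      using continuous_on_subset[OF _ NO] continuous_qu by blast+
    have cP: "continuous_on N (\<lambda>z. P (qq z))" unfolding P_def
      by (intro continuous_on_lev cN continuous_on_const Nb(1) dnz(1))
    have cK: "continuous_on N K" unfolding K_def
    proof (intro continuous_intros continuous_on_dn cN ballI)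
      fix z assume z: "z \<in> N"
      have "1 - uu z \<noteq> 0" "qq z \<noteq> 0" using Nb[OF z] by linarith+
      then show "qq z * (1 - uu z) * (dn \<rho> (qq z) (-1) * dn \<rho> (qq z) (uu z)) \<noteq> 0" using dnz[OF z] by simp
    qed
    show "continuous_on N f" unfolding f_def
      by (intro continuous_on_pt continuous_on_real_root continuous_on_mult continuous_on_diff continuous_on_const cP cN(3)
          continuous_on_real_sqrt cK)
    show "inj_on f N"
    proof (rule inj_onI)
      fix z w assume h: "z \<in> N" "w \<in> N" "f z = f w"
      have q: "qq z = qq w" using fq[OF h(1,2)] h(3) by simp
      have "lv (qq z) (uu z) = lv (qq z) (uu w)" using f2[OF h(1)] f2[OF h(2)] h(3) q by simp
      then have u: "uu z = uu w"
        using lev_anti_u[of "qq z" "uu z" "uu w"] lev_anti_u[of "qq z" "uu w" "uu z"] Nb[OF h(1)] Nb[OF h(2)]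
        by (cases "uu z" "uu w" rule: linorder_cases) auto
      have "sgn (Im (ch z)) = sgn (f z $ 2)" "sgn (Im (ch w)) = sgn (f w $ 2)"
        using Kpos[OF h(1)] Kpos[OF h(2)] by (auto simp: f_def sgn_mult)
      then show "z = w" using Om_eqI[of z w] h q u NO by auto
    qed
    show "f p = 0"
      using Im_zero_iff[OF pO] pN by (simp add: f_def vec2_eq_iff)
    have Hf: "(f z $ 2)^2 / 2 - (f z $ 1)^3 / 3 = P qp - En z" if "z \<in> N" for z
      unfolding f1 f2[OF that] qu(5)[OF subsetD[OF NO that]] by (simp add: field_simps)
    show "En z = En w \<longleftrightarrow> (f z $ 2)^2 / 2 - (f z $ 1)^3 / 3 = (f w $ 2)^2 / 2 - (f w $ 1)^3 / 3"
      if "z \<in> N" "w \<in> N" for z w unfolding Hf[OF that(1)] Hf[OF that(2)] by auto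
    show "V z = 0 \<longleftrightarrow> pt (f z $ 2) ((f z $ 1)^2) = 0" if z: "z \<in> N" for z
    proof -
      note b = Nb[OF z]
      have zO: "z \<in> Om" using z NO by auto
      have I: "Im (ch z) = 0 \<longleftrightarrow> uu z = -1" using Im_zero_iff[OF zO] b by auto
      have "krad qp (-1) = c" using neg_crit_conv[of qp] qp c by simp
      then have "V z = 0 \<longleftrightarrow> qq z = qp \<and> uu z = -1"
        unfolding qu(6)[OF zO] I using below[of "qq z"] b by (cases "qq z = qp") auto
      also have "\<dots> \<longleftrightarrow> f z $ 1 = 0 \<and> f z $ 2 = 0"
        using Kpos[OF z] I Pinj[of "qq z" qp] b qp by (auto simp: f_def)
      finally show ?thesis by (auto simp: vec2_eq_iff)
    qed
  qed
  then show ?thesis unfolding cusp_def p_def[symmetric]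
    using eqp jacobian_V[OF pO] nz j by simp
qed

text \<open>At the equilibrium on the circle \<open>rad\<close> has positive
  \<open>q\<close>-derivative, so for nearby \<open>u\<close> the critical radius is unique and
  depends continuously on \<open>u\<close>. It may lie beyond the circle, hence a box that extends
  to both sides.\<close>

lemma ridge_box:
  assumes u0: "u0 = 1 \<or> u0 = -1" and c: "krad 1 u0 = c"
  obtains \<delta> \<epsilon> qs where "0 < \<delta>" "\<delta> < 1" "\<rho> * (1 + \<delta>) < 1" "0 < \<epsilon>" "\<epsilon> < 1"
    "continuous_on {u. -1 <= u \<and> u <= 1 \<and> \<bar>u - u0\<bar> < \<epsilon>} qs"
    "\<forall>u. -1 <= u \<and> u <= 1 \<and> \<bar>u - u0\<bar> < \<epsilon> --> \<bar>qs u - 1\<bar> < \<delta> \<and> krad (qs u) u = c \<and>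
       (\<forall>s t. 1 - \<delta> <= s --> s < t --> t <= 1 + \<delta> --> rad \<rho> s u < rad \<rho> t u)"
proof -
  have "continuous_on UNIV (\<lambda>x. drad_num (fst x) (snd x))"
    unfolding drad_num_def by (intro continuous_intros)
  moreover have pos: "drad_num 1 u0 > 0"
  proof (rule drad_num_pos)
    have "1 * (1 + \<rho>^2) + \<rho> * u0 * (1 + 1^2) = (1 + u0 * \<rho>)^2" "1 + u0 * \<rho> \<noteq> 0"
      using u0 \<rho> by (auto simp: algebra_simps power2_eq_square)
    then show "1 * (1 + \<rho>^2) + \<rho> * u0 * (1 + 1^2) > 0" by simp
  qed (use u0 in auto)
  then have "((\<lambda>x. drad_num (fst x) (snd x)) \<longlongrightarrow> drad_num (fst (1, u0)) (snd (1, u0))) (at (1, u0))"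
    if "continuous_on UNIV (\<lambda>x. drad_num (fst x) (snd x))"
    using that by (simp add: continuous_on_eq_continuous_at isCont_def)
  ultimately have "\<forall>\<^sub>F x in at (1, u0). drad_num (fst x) (snd x) > 0"
    using order_tendstoD(1)[of "\<lambda>x. drad_num (fst x) (snd x)" "drad_num 1 u0" "at (1, u0)" 0] pos by simp
  then obtain d where d: "d > 0" "!!x. x \<noteq> (1, u0) ==> dist x (1, u0) < d ==> drad_num (fst x) (snd x) > 0"
    unfolding eventually_at by (metis UNIV_I)
  \<comment> \<open>The first bound keeps the box within distance \<open>d\<close> of
    \<open>(1, u0)\<close>, the second keeps \<open>\<rho> q < 1\<close> beyond the circle.\<close>
  define \<delta> where "\<delta> = min (d / 3) ((1 - \<rho>) / 2)"
  have \<delta>: "0 < \<delta>" "\<delta> < 1" "\<delta> < d / 2" using d(1) \<rho> by (auto simp: \<delta>_def min_def)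
  have "\<rho> * \<delta> <= \<delta>" "\<delta> <= (1 - \<rho>) / 2" using mult_right_mono[of \<rho> 1 \<delta>] \<rho> \<delta>(1) by (simp, simp add: \<delta>_def min_def)
  then have \<rho>\<delta>: "\<rho> * (1 + \<delta>) < 1" using \<rho> by (simp add: algebra_simps)
  have dn: "dn \<rho> q u > 0" if "1 - \<delta> <= q" "q <= 1 + \<delta>" "-1 <= u" for q u
  proof (rule dn_pos)
    have "\<rho> * q <= \<rho> * (1 + \<delta>)" using that \<rho> by simp
    then show "\<rho> * q < 1" using \<rho>\<delta> by linarith
  qed (use that \<delta> in auto)
  have dn': "dn \<rho> q u \<noteq> 0" if "1 - \<delta> <= q" "q <= 1 + \<delta>" "-1 <= u" for q u using dn[OF that] by simp
  have inc: "rad \<rho> s u < rad \<rho> t u" if h: "-1 <= u" "u <= 1" "\<bar>u - u0\<bar> < \<delta>" "1 - \<delta> <= s" "s < t" "t <= 1 + \<delta>" for s t u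
  proof (rule DERIV_pos_imp_increasing_open[OF h(5)])
    fix q assume q: "s < q" "q < t"
    have "dist (q, u) (1, u0) < d"
    proof -
      have "dist (q, u) (1, u0) <= \<bar>q - 1\<bar> + \<bar>u - u0\<bar>"
        unfolding dist_prod_def dist_real_def by (rule order.trans[OF sqrt_sum_squares_le_sum_abs]) simp
      then show ?thesis using h q \<delta> by auto
    qed
    then have "drad_num q u > 0" using d(2)[of "(q, u)"] pos by (cases "(q, u) = (1, u0)") auto
    moreover have "dn \<rho> q u > 0" using dn h q by simp
    ultimately show "\<exists>y. ((\<lambda>q. rad \<rho> q u) has_real_derivative y) (at q) \<and> 0 < y"
      using rad_deriv[of q u] by (intro exI[of _ "drad_num q u / dn \<rho> q u ^ 3"]) auto
  next
    show "continuous_on {s..t} (\<lambda>q. rad \<rho> q u)"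
      by (intro continuous_on_rad continuous_on_id continuous_on_const dn') (use h in auto)
  qed
  define I where "I = {-1..1} \<inter> {u0 - \<delta><..<u0 + \<delta>}"
  have crad: "continuous_on I (\<lambda>u. krad q u)" if "1 - \<delta> <= q" "q <= 1 + \<delta>" for q
    by (intro continuous_on_mult continuous_on_rad continuous_on_id continuous_on_const dn') (use that in \<open>auto simp: I_def\<close>)
  have uI: "u0 \<in> I" using u0 \<delta> by (auto simp: I_def)
  have "krad (1 - \<delta>) u0 < c" "c < krad (1 + \<delta>) u0"
    unfolding c[symmetric] using inc[of u0 "1 - \<delta>" 1] inc[of u0 1 "1 + \<delta>"] u0 \<delta> \<kappa>_pos by auto
  moreover have "((\<lambda>u. krad (1 - \<delta>) u) \<longlongrightarrow> krad (1 - \<delta>) u0) (at u0 within I)"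
    "((\<lambda>u. krad (1 + \<delta>) u) \<longlongrightarrow> krad (1 + \<delta>) u0) (at u0 within I)"
    using crad[of "1 - \<delta>"] crad[of "1 + \<delta>"] uI \<delta> by (auto simp: continuous_on)
  ultimately have "\<forall>\<^sub>F u in at u0 within I. krad (1 - \<delta>) u < c \<and> c < krad (1 + \<delta>) u"
    by (intro eventually_conj order_tendstoD)
  then obtain e where e: "e > 0" "!!u. u \<in> I ==> u \<noteq> u0 ==> dist u u0 < e ==> krad (1 - \<delta>) u < c \<and> c < krad (1 + \<delta>) u"
    unfolding eventually_at by (metis UNIV_I)
  define \<epsilon> where "\<epsilon> = min e \<delta>"
  define U where "U = {u. -1 <= u \<and> u <= 1 \<and> \<bar>u - u0\<bar> < \<epsilon>}"
  have UI: "U \<subseteq> I" by (auto simp: U_def I_def \<epsilon>_def)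
  have "\<exists>q. \<bar>q - 1\<bar> < \<delta> \<and> krad q u = c" if u: "u \<in> U" for u
  proof -
    have lt: "krad (1 - \<delta>) u < c" "c < krad (1 + \<delta>) u"
      using e(2)[of u] u UI \<open>krad (1 - \<delta>) u0 < c\<close> \<open>c < krad (1 + \<delta>) u0\<close>
      by (cases "u = u0"; auto simp: U_def \<epsilon>_def dist_real_def)+
    have "continuous_on {1 - \<delta>..1 + \<delta>} (\<lambda>q. krad q u)"
      by (intro continuous_on_mult continuous_on_rad continuous_on_id continuous_on_const dn') (use u in \<open>auto simp: U_def\<close>)
    then obtain q where "1 - \<delta> <= q" "q <= 1 + \<delta>" "krad q u = c"
      using IVT'[of "\<lambda>q. krad q u" "1 - \<delta>" c "1 + \<delta>"] lt \<delta> by auto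
    moreover from this have "q \<noteq> 1 - \<delta>" "q \<noteq> 1 + \<delta>" using lt by auto
    ultimately show ?thesis by (intro exI[of _ q]) auto
  qed
  then obtain qs where qs: "!!u. u \<in> U ==> \<bar>qs u - 1\<bar> < \<delta> \<and> krad (qs u) u = c" by metis
  have inc': "rad \<rho> s u < rad \<rho> t u" if "u \<in> U" "1 - \<delta> <= s" "s < t" "t <= 1 + \<delta>" for s t u
    using inc[of u s t] that by (auto simp: U_def \<epsilon>_def)
  have "continuous_on U qs"
  proof (rule implicit_continuous[where I = "{1 - \<delta>..1 + \<delta>}" and g = "\<lambda>q u. krad q u" and \<gamma> = "\<lambda>_. c"])
    show "qs u \<in> {1 - \<delta>..1 + \<delta>}" "krad (qs u) u = c" if "u \<in> U" for u using qs[OF that] by auto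
    show "continuous_on U (\<lambda>u. krad q u)" if "q \<in> {1 - \<delta>..1 + \<delta>}" for q
      using continuous_on_subset[OF crad UI] that by auto
  qed (use inc' \<kappa>_pos in \<open>auto simp: is_interval_1\<close>)
  then show thesis
    using that[of \<delta> \<epsilon> qs] \<delta> \<rho>\<delta> e(1) qs inc' unfolding U_def \<epsilon>_def by auto
qed

text \<open>With \<open>m\<close> the maximum along the ray, \<open>En\<close> is
  \<open>m - (m - En)\<close>, a difference of two nonnegative functions. Their square roots
  \<open>X\<close> and \<open>Y\<close>, signed by the half plane and by the side of the ridge, are
  coordinates, and \<open>(X - Y) (X + Y)\<close> is the Hamiltonian of the linear saddle.\<close>

lemma boundary_degenerate_saddle:
  assumes u0: "u0 = 1 \<or> u0 = -1" and c: "krad 1 u0 = c"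
  shows "degenerate_saddle Om V (Pt 1 1 u0)"
proof -
  obtain \<delta> \<epsilon> qs where \<delta>: "0 < \<delta>" "\<delta> < 1" "\<rho> * (1 + \<delta>) < 1" and \<epsilon>: "0 < \<epsilon>" "\<epsilon> < 1"
    and cqs: "continuous_on {u. -1 <= u \<and> u <= 1 \<and> \<bar>u - u0\<bar> < \<epsilon>} qs"
    and box: "\<forall>u. -1 <= u \<and> u <= 1 \<and> \<bar>u - u0\<bar> < \<epsilon> --> \<bar>qs u - 1\<bar> < \<delta> \<and> krad (qs u) u = c \<and>
       (\<forall>s t. 1 - \<delta> <= s --> s < t --> t <= 1 + \<delta> --> rad \<rho> s u < rad \<rho> t u)"
    by (rule ridge_box[OF assms])
  define U where "U = {u. -1 <= u \<and> u <= 1 \<and> \<bar>u - u0\<bar> < \<epsilon>}"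
  have u0U: "u0 \<in> U" using u0 \<epsilon> by (auto simp: U_def)
  have Ub: "-1 <= u" "u <= 1" if "u \<in> U" for u using that by (auto simp: U_def)
  have qs: "1 - \<delta> < qs u" "qs u < 1 + \<delta>" "krad (qs u) u = c" if "u \<in> U" for u
    using box that by (auto simp: U_def abs_less_iff)
  have rinc: "krad s u < krad t u" if "u \<in> U" "1 - \<delta> <= s" "s < t" "t <= 1 + \<delta>" for s t u
    using box that \<kappa>_pos by (auto simp: U_def)
  have \<rho>\<delta>: "\<rho> * q < 1" if "q <= 1 + \<delta>" for q
    using mult_left_mono[OF that, of \<rho>] \<rho> \<delta>(3) by linarith
  have inc: "lv s u < lv t u" if h: "u \<in> U" "1 - \<delta> <= s" "s < t" "t <= qs u" for s t u
  proof (rule lev_increasing)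
    show "krad q u < c" if "s < q" "q < t" for q using rinc[OF h(1), of q "qs u"] qs[OF h(1)] h that by simp
    show "\<rho> * t < 1" using \<rho>\<delta>[of t] qs[OF h(1)] h by simp
  qed (use h \<delta> Ub in auto)
  have dec: "lv t u < lv s u" if h: "u \<in> U" "qs u <= s" "s < t" "t <= 1 + \<delta>" for s t u
  proof (rule lev_decreasing)
    show "c < krad q u" if "s < q" "q < t" for q using rinc[OF h(1), of "qs u" q] qs[OF h(1)] h that by simp
    show "\<rho> * t < 1" using \<rho>\<delta>[of t] h by simp
    show "0 < s" using qs[OF h(1)] h \<delta> by linarith
  qed (use h Ub in auto)
  define m where "m u = lv (qs u) u" for u
  have below: "lv q u <= m u" "lv q u = m u ==> q = qs u" if "u \<in> U" "1 - \<delta> <= q" "q <= 1 + \<delta>" for q u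
    using inc[of u q "qs u"] dec[of u "qs u" q] that qs[of u] by (cases q "qs u" rule: linorder_cases; simp add: m_def)+
  have one: "qs u = 1 \<longleftrightarrow> krad 1 u = c" if "u \<in> U" for u
    using rinc[OF that, of 1 "qs u"] rinc[OF that, of "qs u" 1] qs[OF that] \<delta> by (cases "qs u" "1::real" rule: linorder_cases) auto
  have uniq: "v = u0" if v: "v \<in> U" "krad 1 v = c" for v
  proof (rule ccontr)
    assume "v \<noteq> u0"
    then have "u0 = 1 \<and> v < 1 \<or> u0 = -1 \<and> -1 < v" using u0 Ub[OF v(1)] by fastforce
    then have "krad 1 v \<noteq> krad 1 u0"
      using \<kappa>_rad_one_anti[of v 1] \<kappa>_rad_one_anti[of "-1" v] Ub[OF v(1)] by auto
    then show False using v c by simp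
  qed
  have m0: "qs u0 = 1" "m u0 = 0" using one[OF u0U] c by (auto simp: m_def)
  \<comment> \<open>The ridge level grows with the distance from \<open>u0\<close>. For
    \<open>u0 = 1\<close> the nearby ridge lies inside the circle, where the level falls with
    \<open>u\<close>; for \<open>u0 = -1\<close> it lies outside, where the level rises with
    \<open>u\<close>.\<close>
  have mono: "m u < m v" if uv: "u \<in> U" "v \<in> U" "\<bar>u - u0\<bar> < \<bar>v - u0\<bar>" for u v
  proof -
    have ne: "qs v \<noteq> 1" using one[OF uv(2)] uniq[OF uv(2)] uv(3) by auto
    show ?thesis
    proof (cases "qs u = 1")
      case True
      have "lv 1 v <= m v" "lv 1 v \<noteq> m v" using below[OF uv(2), of 1] ne \<delta> by auto
      then show ?thesis using True by (simp add: m_def)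
    next
      case False
      have q: "0 < qs u" "\<rho> * qs u < 1" using qs[OF uv(1)] \<delta> \<rho>\<delta> by auto
      have "lv (qs u) u < lv (qs u) v"
        using u0
      proof
        assume u1: "u0 = 1"
        then have vu: "v < u" using uv(3) Ub[OF uv(1)] Ub[OF uv(2)] by simp
        have "krad 1 u \<ge> c" using \<kappa>_rad_one_anti_le[of u 1] c u1 Ub[OF uv(1)] by simp
        then have "qs u < 1" using rinc[OF uv(1), of 1 "qs u"] qs[OF uv(1)] \<delta> False by (cases "qs u" "1::real" rule: linorder_cases) auto
        then show ?thesis using lev_anti_u[of "qs u" v u] q vu Ub uv by simp
      next
        assume u1: "u0 = -1"
        then have vu: "u < v" using uv(3) Ub[OF uv(1)] Ub[OF uv(2)] by simp
        have "krad 1 u <= c" using \<kappa>_rad_one_anti_le[of "-1" u] c u1 Ub[OF uv(1)] by simp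
        then have "qs u > 1" using rinc[OF uv(1), of "qs u" 1] qs[OF uv(1)] \<delta> False by (cases "qs u" "1::real" rule: linorder_cases) auto
        then show ?thesis using lev_mono_u_outside[of "qs u" u v] q vu Ub uv by simp
      qed
      also have "\<dots> <= m v" using below(1)[OF uv(2)] qs[OF uv(1)] by simp
      finally show ?thesis by (simp add: m_def)
    qed
  qed
  have m_inj: "u = v" if "u \<in> U" "v \<in> U" "m u = m v" for u v
    using mono[of u v] mono[of v u] that u0 Ub[of u] Ub[of v]
    by (cases "\<bar>u - u0\<bar>" "\<bar>v - u0\<bar>" rule: linorder_cases) auto
  have m_nonneg: "m u \<ge> 0" if "u \<in> U" for u using below(1)[OF that, of 1] \<delta> by simp
  define N where "N = {z \<in> Om. \<bar>qq z - 1\<bar> < \<delta> \<and> \<bar>uu z - u0\<bar> < \<epsilon>}"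
  have NO: "N \<subseteq> Om" by (auto simp: N_def)
  have "open (Om \<inter> (\<lambda>z. (qq z, uu z)) -` ({1 - \<delta><..<1 + \<delta>} \<times> {u0 - \<epsilon><..<u0 + \<epsilon>}))"
    by (rule continuous_open_preimage) (intro continuous_on_Pair continuous_qu open_Om open_Times; simp)+
  also have "Om \<inter> (\<lambda>z. (qq z, uu z)) -` ({1 - \<delta><..<1 + \<delta>} \<times> {u0 - \<epsilon><..<u0 + \<epsilon>}) = N" by (auto simp: N_def abs_less_iff)
  finally have oN: "open N" .
  have Nu: "uu z \<in> U" "1 - \<delta> < qq z" "qq z < 1 + \<delta>" "z \<in> Om" if "z \<in> N" for z
    using that qu(2,3)[of z] by (auto simp: N_def U_def abs_less_iff)
  have side: "uu z = 1 \<or> uu z = -1 \<longleftrightarrow> uu z = u0" if "z \<in> N" for z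
    using that u0 \<epsilon>(2) by (auto simp: N_def)
  \<comment> \<open>Each sign jumps only where the root it multiplies vanishes: on the axis, where
    \<open>m\<close> is 0, and on the ridge.\<close>
  define X Y where "X z = sgn (Im (ch z)) * sqrt (m (uu z))"
    and "Y z = sgn (qs (uu z) - qq z) * sqrt (m (uu z) - lv (qq z) (uu z))" for z
  have mu0: "m u = 0 \<longleftrightarrow> u = u0" if "u \<in> U" for u using m_inj[OF that u0U] m0 by auto
  have IX: "Im (ch z) = 0 \<longleftrightarrow> uu z = u0" if "z \<in> N" for z using Im_zero_iff[of z] side[OF that] Nu[OF that] by simp
  have X2: "(X z)^2 = m (uu z)" if "z \<in> N" for z
    using m_nonneg[OF Nu(1)[OF that]] IX[OF that] mu0[OF Nu(1)[OF that]]
    by (auto simp: X_def power_mult_distrib sgn_if)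
  have Yq: "m (uu z) - lv (qq z) (uu z) \<ge> 0" "m (uu z) - lv (qq z) (uu z) = 0 \<longleftrightarrow> qs (uu z) = qq z" if "z \<in> N" for z
  proof -
    note b = below[OF Nu(1)[OF that] less_imp_le[OF Nu(2)[OF that]] less_imp_le[OF Nu(3)[OF that]]]
    show "m (uu z) - lv (qq z) (uu z) \<ge> 0" using b(1) by simp
    have "qs (uu z) = qq z ==> lv (qq z) (uu z) = m (uu z)" by (simp add: m_def)
    then show "m (uu z) - lv (qq z) (uu z) = 0 \<longleftrightarrow> qs (uu z) = qq z" using b(2) by auto
  qed
  have Y2: "(Y z)^2 = m (uu z) - lv (qq z) (uu z)" if "z \<in> N" for z
    using Yq[OF that] by (cases "qs (uu z) = qq z") (simp_all add: Y_def power_mult_distrib sgn_if)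
  have Ys: "sgn (Y z) = sgn (qs (uu z) - qq z)" if "z \<in> N" for z
  proof (cases "qs (uu z) = qq z")
    case False
    then have "sqrt (m (uu z) - lv (qq z) (uu z)) > 0" using Yq[OF that] by simp
    then show ?thesis by (simp add: Y_def sgn_mult)
  qed (simp add: Y_def)
  define f where "f z = pt (X z - Y z) (X z + Y z)" for z
  have fXY: "X z = X w \<and> Y z = Y w" if "f z = f w" for z w using that by (auto simp: f_def)
  have Hf: "f z $ 1 * f z $ 2 = En z" if "z \<in> N" for z
    using X2[OF that] Y2[OF that] qu(5)[OF Nu(4)[OF that]] by (simp add: f_def algebra_simps power2_eq_square)
  define p where "p = Pt 1 1 u0"
  have pN: "p \<in> N" "uu p = u0" "qq p = 1"
    using qu_Pt[of 1 u0] u0 \<delta> \<epsilon> by (auto simp: N_def p_def)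
  have V0: "V z = 0 \<longleftrightarrow> uu z = u0 \<and> qq z = 1" if z: "z \<in> N" for z
  proof -
    have crit: "krad (qq z) (uu z) = c \<longleftrightarrow> qq z = qs (uu z)"
      using rinc[OF Nu(1)[OF z], of "qq z" "qs (uu z)"] rinc[OF Nu(1)[OF z], of "qs (uu z)" "qq z"]
        qs[OF Nu(1)[OF z]] Nu[OF z] by (cases "qq z" "qs (uu z)" rule: linorder_cases) auto
    have "qs (uu z) = 1 ==> uu z = u0" using one[OF Nu(1)[OF z]] uniq[OF Nu(1)[OF z]] by simp
    then show ?thesis unfolding qu(6)[OF Nu(4)[OF z]] crit IX[OF z] using m0(1) by auto
  qed
  have "locally_orbit_equivalent Om V p UNIV (\<lambda>z. pt (z$1) (- (z$2))) 0"
  proof (rule local_model[OF hamiltonian_field_axioms saddle_model oN NO pN(1)])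
    have cN: "continuous_on N qq" "continuous_on N uu" "continuous_on N (\<lambda>z. Im (ch z))"
      using continuous_on_subset[OF _ NO] continuous_qu by blast+
    have cq: "continuous_on N (\<lambda>z. qs (uu z))"
      by (rule continuous_on_compose2[OF cqs[folded U_def] cN(2)]) (use Nu in auto)
    have dn: "dn \<rho> q (uu z) \<noteq> 0" if "z \<in> N" "1 - \<delta> < q" "q < 1 + \<delta>" for q z
      using dn_pos[of q "uu z"] \<rho>\<delta>[of q] that Ub[OF Nu(1)[OF that(1)]] \<delta> by simp
    have cm: "continuous_on N (\<lambda>z. m (uu z))" unfolding m_def
      by (rule continuous_on_lev[OF cq cN(2)]) (use qs[OF Nu(1)] dn \<delta> in force)+
    have cl: "continuous_on N (\<lambda>z. lv (qq z) (uu z))"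
      by (rule continuous_on_lev[OF cN(1,2)]) (use Nu dn \<delta> in force)+
    have "continuous_on N X" unfolding X_def
      by (rule continuous_sgn_mult) (use cN cm IX mu0 Nu in \<open>auto intro!: continuous_intros\<close>)
    moreover have "continuous_on N Y" unfolding Y_def
      by (rule continuous_sgn_mult) (use cN cm cl cq Yq in \<open>auto intro!: continuous_intros\<close>)
    ultimately show "continuous_on N f" unfolding f_def by (intro continuous_intros)
    show "inj_on f N"
    proof (rule inj_onI)
      fix z w assume h: "z \<in> N" "w \<in> N" "f z = f w"
      note XY = fXY[OF h(3)]
      have u: "uu z = uu w" using m_inj[OF Nu(1)[OF h(1)] Nu(1)[OF h(2)]] X2[OF h(1)] X2[OF h(2)] XY by simp
      have l: "lv (qq z) (uu z) = lv (qq w) (uu z)" using Y2[OF h(1)] Y2[OF h(2)] XY u by simp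
      have s: "sgn (qs (uu z) - qq z) = sgn (qs (uu z) - qq w)" using Ys[OF h(1)] Ys[OF h(2)] XY u by simp
      have q: "qq z = qq w"
      proof (cases "qq z" "qq w" rule: linorder_cases)
        case less
        then consider "qq w <= qs (uu z)" | "qs (uu z) <= qq z" using s by (auto simp: sgn_if split: if_splits)
        then show ?thesis using inc[OF Nu(1)[OF h(1)], of "qq z" "qq w"] dec[OF Nu(1)[OF h(1)], of "qq z" "qq w"] l less Nu[OF h(1)] Nu[OF h(2)]
          by cases auto
      next
        case greater
        then consider "qq z <= qs (uu z)" | "qs (uu z) <= qq w" using s by (auto simp: sgn_if split: if_splits)
        then show ?thesis using inc[OF Nu(1)[OF h(1)], of "qq w" "qq z"] dec[OF Nu(1)[OF h(1)], of "qq w" "qq z"] l greater Nu[OF h(1)] Nu[OF h(2)]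
          by cases auto
      qed
      have "sgn (X z) = sgn (Im (ch z))" "sgn (X w) = sgn (Im (ch w))" if "uu z \<noteq> u0"
        using that u mu0[OF Nu(1)[OF h(1)]] m_nonneg[OF Nu(1)[OF h(1)]] by (auto simp: X_def sgn_mult)
      then show "z = w" using Om_eqI[OF Nu(4)[OF h(1)] Nu(4)[OF h(2)] q u] side[OF h(1)] XY by metis
    qed
    show "f p = 0"
      using IX[OF pN(1)] pN m0 by (simp add: f_def X_def Y_def vec2_eq_iff)
    show "En z = En w \<longleftrightarrow> f z $ 1 * f z $ 2 = f w $ 1 * f w $ 2" if "z \<in> N" "w \<in> N" for z w
      using Hf that by simp
    show "V z = 0 \<longleftrightarrow> pt (f z $ 1) (- (f z $ 2)) = 0" if z: "z \<in> N" for z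
    proof -
      have "f z $ 1 = 0 \<and> f z $ 2 = 0 \<longleftrightarrow> X z = 0 \<and> Y z = 0" by (auto simp: f_def)
      also have "\<dots> \<longleftrightarrow> uu z = u0 \<and> qs (uu z) = qq z"
        using X2[OF z] Y2[OF z] mu0[OF Nu(1)[OF z]] Yq(2)[OF z] by (metis zero_eq_power2)
      also have "\<dots> \<longleftrightarrow> V z = 0" unfolding V0[OF z] using m0(1) by auto
      finally show ?thesis by (auto simp: vec2_eq_iff)
    qed
  qed
  moreover have pO: "p \<in> Om" using pN NO by auto
  then have eq: "equilibrium Om V p" using V0[OF pN(1)] pN by (simp add: equilibrium_def)
  have pR: "p = pt (R * u0) 0" using Pt_one_axis u0 by (auto simp: p_def)
  note J = jac_axis[OF eq[unfolded pR], folded pR]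
  have "u0^2 = 1" using u0 by auto
  then have "j11 p = 0" "j12 p = 0" using J by auto
  ultimately show ?thesis unfolding degenerate_saddle_def topological_saddle_def
    using eq jacobian_V[OF pO] by (simp add: p_def)
qed

end

section \<open>Regular and bifurcation parameters\<close>

context hamiltonian_field
begin

text \<open>Equilibria can be recognised from the partition into orbits alone, and this is what an
  orbit equivalence preserves.\<close>

lemma singleton_orbit_iff:
  assumes D: "!!z. z \<in> D \<inter> Om ==> orbit Om V z \<subseteq> D" and z: "z \<in> D \<inter> Om"
  shows "(\<exists>w. orbit (D \<inter> Om) V z = {w}) \<longleftrightarrow> V z = 0"
proof -
  have zO: "z \<in> Om" using z by blast
  have r: "orbit (D \<inter> Om) V z = orbit Om V z" by (rule orbit_restrict[OF D z])
  show ?thesis unfolding r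
  proof
    assume "\<exists>w. orbit Om V z = {w}"
    then obtain w where w: "orbit Om V z = {w}" ..
    obtain \<epsilon> \<eta> where \<eta>: "\<epsilon> > 0" "solution_on {-\<epsilon><..<\<epsilon>} Om V \<eta>" "\<eta> 0 = z" using local_solution[OF zO] .
    have const: "\<eta> t = w" if "t \<in> {-\<epsilon><..<\<epsilon>}" for t
      using solution_in_orbit[OF \<eta>(2), of 0 t] that \<eta>(1,3) w by (auto simp: is_interval_1)
    have "(\<eta> has_vector_derivative 0) (at 0)"
      by (rule has_vector_derivative_transform_within_open[where f = "\<lambda>_. w" and S = "{-\<epsilon><..<\<epsilon>}"])
        (use \<eta>(1) const in auto)
    moreover have "(\<eta> has_vector_derivative V z) (at 0)" using \<eta> by (auto simp: solution_on_def)
    ultimately show "V z = 0" using vector_derivative_unique_at by blast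
  next
    assume "V z = 0"
    then show "\<exists>w. orbit Om V z = {w}" using orbit_equilibrium[OF zO] by simp
  qed
qed

end

context two_systems
begin

text \<open>One-point orbits correspond to one-point orbits. The vortex belongs to no orbit, so
  surjectivity on the disk is needed to see that it is sent to the vortex and that all equilibria
  are reached.\<close>

lemma equilibria_correspond:
  assumes h: "homeomorphism (disk R) (disk R) h k" and c: "carries_orbits (P.pdisk) P.V (Q.pdisk) Q.V h"
  shows "bij_betw h {p \<in> disk R. equilibrium P.Om P.V p} {p \<in> disk R. equilibrium Q.Om Q.V p}"
proof -
  have inj: "inj_on h (disk R)" using h unfolding homeomorphism_def by (metis inj_onI)
  have dom: "h z \<in> Q.pdisk" "h ` orbit (P.pdisk) P.V z = orbit (Q.pdisk) Q.V (h z)" if "z \<in> P.pdisk" for z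
    using c that by (auto simp: carries_orbits_def)
  have eq: "P.V z = 0 \<longleftrightarrow> Q.V (h z) = 0" if z: "z \<in> P.pdisk" for z
  proof -
    have sub: "orbit (P.pdisk) P.V z \<subseteq> disk R"
      using P.orbit_restrict[OF P.disk_invariant z] P.disk_invariant[OF z] by simp
    have "(\<exists>w. orbit (P.pdisk) P.V z = {w}) \<longleftrightarrow> (\<exists>w. h ` orbit (P.pdisk) P.V z = {w})"
    proof
      assume "\<exists>w. h ` orbit (P.pdisk) P.V z = {w}"
      then have "card (h ` orbit (P.pdisk) P.V z) = 1" by auto
      then have "card (orbit (P.pdisk) P.V z) = 1" using card_image[OF inj_on_subset[OF inj sub]] by simp
      then show "\<exists>w. orbit (P.pdisk) P.V z = {w}" by (auto simp: card_1_singleton_iff)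
    qed auto
    then show ?thesis unfolding dom(2)[OF z]
      using P.singleton_orbit_iff[OF P.disk_invariant z] Q.singleton_orbit_iff[OF Q.disk_invariant dom(1)[OF z]] by simp
  qed
  have surj: "h ` disk R = disk R" using h by (simp add: homeomorphism_def)
  have "h ` {p \<in> disk R. equilibrium P.Om P.V p} = {p \<in> disk R. equilibrium Q.Om Q.V p}"
  proof
    show "h ` {p \<in> disk R. equilibrium P.Om P.V p} \<subseteq> {p \<in> disk R. equilibrium Q.Om Q.V p}"
      using dom(1) eq by (auto simp: equilibrium_def)
    show "{p \<in> disk R. equilibrium Q.Om Q.V p} \<subseteq> h ` {p \<in> disk R. equilibrium P.Om P.V p}"
    proof
      fix w assume w: "w \<in> {p \<in> disk R. equilibrium Q.Om Q.V p}"
      \<comment> \<open>The preimage of the vortex is not in the punctured disk, which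
        \<open>h\<close> sends to the punctured disk.\<close>
      obtain s where s: "s \<in> disk R" "h s = Q.sing" using surj Q.sing_facts(3) by (metis imageE)
      have s': "s = P.sing" using P.in_disk_cases[OF s(1)] dom(1)[of s] s Q.sing_facts(2) by auto
      obtain z where z: "z \<in> disk R" "h z = w" using surj w by (metis (mono_tags, lifting) imageE mem_Collect_eq)
      have "z \<noteq> P.sing" using w z s s' Q.sing_facts(2) by (auto simp: equilibrium_def)
      then have "z \<in> P.pdisk" using P.in_disk_cases[OF z(1)] z(1) by blast
      then show "w \<in> h ` {p \<in> disk R. equilibrium P.Om P.V p}"
        using eq[of z] w z by (auto simp: equilibrium_def)
    qed
  qed
  moreover have "inj_on h {p \<in> disk R. equilibrium P.Om P.V p}" by (rule inj_on_subset[OF inj]) auto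
  ultimately show ?thesis by (simp add: bij_betw_def)
qed

end

section \<open>The components of the complement of the bifurcation set\<close>

lemma components_open_partition:
  fixes \<C> :: "'a::topological_space set set"
  assumes "!!C. C \<in> \<C> ==> open C \<and> connected C \<and> C \<noteq> {}" "!!C D. C \<in> \<C> ==> D \<in> \<C> ==> C \<noteq> D ==> C \<inter> D = {}"
  shows "components (\<Union>\<C>) = \<C>"
proof -
  have eq: "connected_component_set (\<Union>\<C>) x = C" if C: "C \<in> \<C>" "x \<in> C" for C x
  proof
    show "C \<subseteq> connected_component_set (\<Union>\<C>) x" by (rule connected_component_maximal) (use C assms(1) in auto)
    define K where "K = connected_component_set (\<Union>\<C>) x"
    have K: "connected K" "K \<subseteq> \<Union>\<C>" "x \<in> K" using C by (auto simp: K_def connected_component_subset intro: connected_component_refl)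
    have "C \<inter> K = {} \<or> \<Union>(\<C> - {C}) \<inter> K = {}"
      by (rule connectedD[OF K(1)]) (use C assms K(2) in \<open>auto intro!: open_Union\<close>)
    then have "\<Union>(\<C> - {C}) \<inter> K = {}" using C K(3) by blast
    then show "connected_component_set (\<Union>\<C>) x \<subseteq> C" using K(2) unfolding K_def by blast
  qed
  show ?thesis
  proof (intro set_eqI iffI)
    fix K assume "K \<in> components (\<Union>\<C>)"
    then obtain x where "x \<in> \<Union>\<C>" "K = connected_component_set (\<Union>\<C>) x" by (auto simp: components_def)
    then show "K \<in> \<C>" using eq by auto
  next
    fix C assume C: "C \<in> \<C>"
    then obtain x where "x \<in> C" using assms(1) by blast
    then show "C \<in> components (\<Union>\<C>)" using eq[OF C] C by (auto simp: components_def)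
  qed
qed

lemma band_connected:
  fixes p r :: "real => real"
  assumes "continuous_on {0<..<1} p" "continuous_on {0<..<1} r" "connected T"
  shows "connected ((\<lambda>(\<rho>, t). (\<rho>, p \<rho> + t * r \<rho>)) ` ({0<..<1} \<times> T))"
proof (rule connected_continuous_image)
  show "continuous_on ({0<..<1} \<times> T) (\<lambda>(\<rho>, t). (\<rho>, p \<rho> + t * r \<rho>))"
    unfolding case_prod_beta
    by (intro continuous_intros continuous_on_compose2[OF assms(1)] continuous_on_compose2[OF assms(2)]) auto
  show "connected ({0<..<1::real} \<times> T)" using assms(3) by (simp add: connected_Times)
qed

text \<open>The slope of \<open>bif_fun\<close> as an affine function of \<phi>.\<close>

definition bif_coeff :: "real => real" where
  "bif_coeff \<rho> = 2 - 3 * \<rho>^2 - 3 * \<rho>^4 + 2 * \<rho>^6 - 2 * (1 - \<rho>^2 + \<rho>^4) powr (3/2)"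

lemma bif_fun_coeff: "bif_fun \<rho> \<phi> = 27 * \<rho>^2 * (\<rho>^2 - 1) + \<phi> * bif_coeff \<rho>"
  by (simp add: bif_fun_def bif_coeff_def)

lemma continuous_bif_coeff: "continuous_on S bif_coeff"
proof -
  have "1 - x^2 + x^4 \<noteq> 0" for x :: real
  proof -
    have "1 - x^2 + x^4 = (1 - x^2 / 2)^2 + 3 / 4 * (x^2)^2" by (simp add: power2_eq_square power4_eq_xxxx algebra_simps)
    moreover have "(1 - x^2 / 2)^2 + 3 / 4 * (x^2)^2 > 0" by (cases "x = 0") (auto intro: add_nonneg_pos)
    ultimately show ?thesis by linarith
  qed
  then show ?thesis unfolding bif_coeff_def by (intro continuous_intros) auto
qed

text \<open>Evaluating \<open>bif_fun_cub\<close> at \<open>\<phi> = -1\<close> identifies the slope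
  as \<open>- 27 \<rho>^2 cub xp\<close>, and the cubic is positive at \<open>xp\<close>.\<close>

lemma bif_coeff_neg:
  assumes "0 < \<rho>" "\<rho> < 1"
  shows "bif_coeff \<rho> < 0"
proof -
  interpret disc_params \<rho> "-1" using assms by unfold_locales auto
  have "bif_fun \<rho> (-1) = 27 * \<rho>^2 * (- (- 1)) * (cub xp + \<kappa> * (- 1))" by (rule bif_fun_cub) auto
  then have "bif_coeff \<rho> = - (27 * \<rho>^2 * cub xp)" by (simp add: bif_fun_coeff \<kappa>_def algebra_simps)
  moreover have "cub xp > 0" unfolding cub_def using xp_bounds \<rho> \<rho>q[of xp] by (intro mult_pos_pos) auto
  ultimately show ?thesis using \<rho> by simp
qed

text \<open>The first two curves solved for \<phi>, so that regions become bands over the interval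
  of \<rho>.\<close>

definition lo_curve :: "real => real" where "lo_curve \<rho> = (1 - \<rho>) / (1 + \<rho>)"
definition hi_curve :: "real => real" where "hi_curve \<rho> = (1 + \<rho>) / (1 - \<rho>)"

lemma curve_order: "0 < \<rho> ==> \<rho> < 1 ==> 0 < lo_curve \<rho>" "0 < \<rho> ==> \<rho> < 1 ==> lo_curve \<rho> < hi_curve \<rho>"
  by (auto simp: lo_curve_def hi_curve_def frac_less2)

text \<open>The last four equivalences translate to \<open>1 / \<phi>\<close>, which is compared
  with the values of \<open>krad\<close> at the two ends of the diameter, see
  \<open>rad_end\<close>.\<close>

lemma vortex_thresholds:
  assumes "0 < \<rho>" "\<rho> < 1" "0 < \<phi>"
  shows "\<rho> < (1 - \<phi>) / (1 + \<phi>) \<longleftrightarrow> \<phi> < lo_curve \<rho>" "\<rho> = (1 - \<phi>) / (1 + \<phi>) \<longleftrightarrow> \<phi> = lo_curve \<rho>"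
    "\<rho> < (\<phi> - 1) / (1 + \<phi>) \<longleftrightarrow> hi_curve \<rho> < \<phi>" "\<rho> = (\<phi> - 1) / (1 + \<phi>) \<longleftrightarrow> \<phi> = hi_curve \<rho>"
    "\<phi> < lo_curve \<rho> \<longleftrightarrow> (1 + \<rho>) / (1 - \<rho>) < 1 / \<phi>" "\<phi> = lo_curve \<rho> \<longleftrightarrow> 1 / \<phi> = (1 + \<rho>) / (1 - \<rho>)"
    "\<phi> < hi_curve \<rho> \<longleftrightarrow> (1 - \<rho>) / (1 + \<rho>) < 1 / \<phi>" "\<phi> = hi_curve \<rho> \<longleftrightarrow> 1 / \<phi> = (1 - \<rho>) / (1 + \<rho>)"
proof -
  have d: "0 < 1 + \<phi>" "0 < 1 + \<rho>" "0 < 1 - \<rho>" using assms by auto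
  note l = pos_less_divide_eq[OF d(1)] pos_less_divide_eq[OF d(2)] pos_less_divide_eq[OF d(3)]
    pos_divide_less_eq[OF d(2)] pos_divide_less_eq[OF d(3)] pos_less_divide_eq[OF assms(3)]
  have e: "x = y / z \<longleftrightarrow> x * z = y" if "0 < z" for x y z :: real using that by (auto simp: field_simps)
  show "\<rho> < (1 - \<phi>) / (1 + \<phi>) \<longleftrightarrow> \<phi> < lo_curve \<rho>" "\<rho> = (1 - \<phi>) / (1 + \<phi>) \<longleftrightarrow> \<phi> = lo_curve \<rho>"
    "\<rho> < (\<phi> - 1) / (1 + \<phi>) \<longleftrightarrow> hi_curve \<rho> < \<phi>" "\<rho> = (\<phi> - 1) / (1 + \<phi>) \<longleftrightarrow> \<phi> = hi_curve \<rho>"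
    unfolding lo_curve_def hi_curve_def l e[OF d(1)] e[OF d(2)] e[OF d(3)] by (auto simp: algebra_simps)
  show "\<phi> < lo_curve \<rho> \<longleftrightarrow> (1 + \<rho>) / (1 - \<rho>) < 1 / \<phi>" "\<phi> < hi_curve \<rho> \<longleftrightarrow> (1 - \<rho>) / (1 + \<rho>) < 1 / \<phi>"
    unfolding lo_curve_def hi_curve_def l times_divide_eq_left using l by (auto simp: mult.commute)
  show "\<phi> = lo_curve \<rho> \<longleftrightarrow> 1 / \<phi> = (1 + \<rho>) / (1 - \<rho>)" "\<phi> = hi_curve \<rho> \<longleftrightarrow> 1 / \<phi> = (1 - \<rho>) / (1 + \<rho>)"
    using assms by (auto simp: lo_curve_def hi_curve_def field_simps)
qed

lemma region_pos_iff:
  "(\<rho>, \<phi>) \<in> region1 \<longleftrightarrow> 0 < \<rho> \<and> \<rho> < 1 \<and> 0 < \<phi> \<and> \<phi> < lo_curve \<rho>"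
  "(\<rho>, \<phi>) \<in> region2 \<longleftrightarrow> 0 < \<rho> \<and> \<rho> < 1 \<and> lo_curve \<rho> < \<phi> \<and> \<phi> < hi_curve \<rho>"
  "(\<rho>, \<phi>) \<in> region3 \<longleftrightarrow> 0 < \<rho> \<and> \<rho> < 1 \<and> hi_curve \<rho> < \<phi>"
  "(\<rho>, \<phi>) \<in> curve1 \<longleftrightarrow> 0 < \<rho> \<and> \<rho> < 1 \<and> \<phi> = lo_curve \<rho>"
  "(\<rho>, \<phi>) \<in> curve2 \<longleftrightarrow> 0 < \<rho> \<and> \<rho> < 1 \<and> \<phi> = hi_curve \<rho>"
proof -
  have *: "((\<rho>, \<phi>) \<in> region1 \<longleftrightarrow> \<phi> < lo_curve \<rho>) \<and> ((\<rho>, \<phi>) \<in> region2 \<longleftrightarrow> lo_curve \<rho> < \<phi> \<and> \<phi> < hi_curve \<rho>) \<and>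
      ((\<rho>, \<phi>) \<in> region3 \<longleftrightarrow> hi_curve \<rho> < \<phi>) \<and> ((\<rho>, \<phi>) \<in> curve1 \<longleftrightarrow> \<phi> = lo_curve \<rho>) \<and> ((\<rho>, \<phi>) \<in> curve2 \<longleftrightarrow> \<phi> = hi_curve \<rho>)"
    if "0 < \<rho>" "\<rho> < 1" "0 < \<phi>"
  proof -
    note t = vortex_thresholds[OF that]
    have "(\<rho>, \<phi>) \<in> region2 \<longleftrightarrow> \<not> \<rho> < (1 - \<phi>) / (1 + \<phi>) \<and> \<rho> \<noteq> (1 - \<phi>) / (1 + \<phi>) \<and> \<not> \<rho> < (\<phi> - 1) / (1 + \<phi>) \<and> \<rho> \<noteq> (\<phi> - 1) / (1 + \<phi>)"
      using that by (auto simp: region2_def param_space_def)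
    then have "(\<rho>, \<phi>) \<in> region2 \<longleftrightarrow> lo_curve \<rho> < \<phi> \<and> \<phi> < hi_curve \<rho>" unfolding t(1-4) by auto
    moreover have "(\<rho>, \<phi>) \<in> region1 \<longleftrightarrow> \<phi> < lo_curve \<rho>" "(\<rho>, \<phi>) \<in> region3 \<longleftrightarrow> hi_curve \<rho> < \<phi>"
      "(\<rho>, \<phi>) \<in> curve1 \<longleftrightarrow> \<phi> = lo_curve \<rho>" "(\<rho>, \<phi>) \<in> curve2 \<longleftrightarrow> \<phi> = hi_curve \<rho>"
      unfolding t(1-4)[symmetric] using that
      by (simp_all add: region1_def region3_def curve1_def curve2_def param_space_def)
    ultimately show ?thesis by blast
  qed
  have n: "0 < \<rho> \<and> \<rho> < 1 \<and> 0 < \<phi>" if "(\<rho>, \<phi>) \<in> region1 \<union> region2 \<union> region3 \<union> curve1 \<union> curve2"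
    using that by (auto simp: region1_def region2_def region3_def curve1_def curve2_def param_space_def)
  have p: "0 < lo_curve \<rho>" "0 < hi_curve \<rho>" if "0 < \<rho>" "\<rho> < 1" using curve_order[OF that] by auto
  show "(\<rho>, \<phi>) \<in> region1 \<longleftrightarrow> 0 < \<rho> \<and> \<rho> < 1 \<and> 0 < \<phi> \<and> \<phi> < lo_curve \<rho>" using * n by blast
  show "(\<rho>, \<phi>) \<in> region2 \<longleftrightarrow> 0 < \<rho> \<and> \<rho> < 1 \<and> lo_curve \<rho> < \<phi> \<and> \<phi> < hi_curve \<rho>" using * n p less_trans by blast
  show "(\<rho>, \<phi>) \<in> region3 \<longleftrightarrow> 0 < \<rho> \<and> \<rho> < 1 \<and> hi_curve \<rho> < \<phi>" using * n p less_trans by blast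
  show "(\<rho>, \<phi>) \<in> curve1 \<longleftrightarrow> 0 < \<rho> \<and> \<rho> < 1 \<and> \<phi> = lo_curve \<rho>" using * n p by blast
  show "(\<rho>, \<phi>) \<in> curve2 \<longleftrightarrow> 0 < \<rho> \<and> \<rho> < 1 \<and> \<phi> = hi_curve \<rho>" using * n p by blast
qed

text \<open>The zero of the affine function \<open>bif_fun \<rho>\<close>: the third curve as a
  graph over \<rho>.\<close>

definition cusp_curve :: "real => real" where
  "cusp_curve \<rho> = 27 * \<rho>^2 * (1 - \<rho>^2) / bif_coeff \<rho>"

lemma cusp_curve_neg: "0 < \<rho> ==> \<rho> < 1 ==> cusp_curve \<rho> < 0"
proof -
  assume "0 < \<rho>" "\<rho> < 1"
  moreover from this have "0 < 1 - \<rho>^2" by (simp add: abs_square_less_1)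
  ultimately show ?thesis unfolding cusp_curve_def using bif_coeff_neg[of \<rho>] by (intro divide_pos_neg) auto
qed

lemma region_neg_iff:
  "(\<rho>, \<phi>) \<in> region4 \<longleftrightarrow> 0 < \<rho> \<and> \<rho> < 1 \<and> \<phi> < cusp_curve \<rho>"
  "(\<rho>, \<phi>) \<in> region5 \<longleftrightarrow> 0 < \<rho> \<and> \<rho> < 1 \<and> cusp_curve \<rho> < \<phi> \<and> \<phi> < 0"
  "(\<rho>, \<phi>) \<in> curve3 \<longleftrightarrow> 0 < \<rho> \<and> \<rho> < 1 \<and> \<phi> = cusp_curve \<rho>"
proof -
  have *: "bif_fun \<rho> \<phi> > 0 \<longleftrightarrow> \<phi> < cusp_curve \<rho>" "bif_fun \<rho> \<phi> < 0 \<longleftrightarrow> cusp_curve \<rho> < \<phi>" "bif_fun \<rho> \<phi> = 0 \<longleftrightarrow> \<phi> = cusp_curve \<rho>"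
    if "0 < \<rho>" "\<rho> < 1"
    unfolding bif_fun_coeff cusp_curve_def using bif_coeff_neg[OF that] by (auto simp: field_simps)
  show "(\<rho>, \<phi>) \<in> region4 \<longleftrightarrow> 0 < \<rho> \<and> \<rho> < 1 \<and> \<phi> < cusp_curve \<rho>"
    using *(1) cusp_curve_neg[of \<rho>] by (auto simp: region4_def param_space_def dest: less_trans)
  show "(\<rho>, \<phi>) \<in> region5 \<longleftrightarrow> 0 < \<rho> \<and> \<rho> < 1 \<and> cusp_curve \<rho> < \<phi> \<and> \<phi> < 0"
    using *(2) by (auto simp: region5_def param_space_def)
  show "(\<rho>, \<phi>) \<in> curve3 \<longleftrightarrow> 0 < \<rho> \<and> \<rho> < 1 \<and> \<phi> = cusp_curve \<rho>"
    using *(3) cusp_curve_neg[of \<rho>] by (auto simp: curve3_def param_space_def)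
qed

lemma region_facts:
  "open region1" "open region2" "open region3" "open region4" "open region5"
  "connected region1" "connected region2" "connected region3" "connected region4" "connected region5"
proof -
  define S where "S = {0<..<1::real} \<times> (UNIV::real set)"
  have S: "open S" by (simp add: S_def open_Times)
  have c: "continuous_on {0<..<1} lo_curve" "continuous_on {0<..<1} hi_curve"
    unfolding lo_curve_def hi_curve_def by (intro continuous_intros; auto)+
  have c3: "continuous_on {0<..<1} cusp_curve"
    unfolding cusp_curve_def using bif_coeff_neg by (intro continuous_intros continuous_bif_coeff) force
  have o: "open {x \<in> S. f x < g x}" if "continuous_on S f" "continuous_on S g" for f g :: "real \<times> real => real"
  proof -
    have "open (S \<inter> (\<lambda>x. g x - f x) -` {0<..})"
      by (rule continuous_open_preimage) (use that S in \<open>auto intro!: continuous_intros\<close>)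
    also have "S \<inter> (\<lambda>x. g x - f x) -` {0<..} = {x \<in> S. f x < g x}" by auto
    finally show ?thesis .
  qed
  have cS: "continuous_on S (\<lambda>x. p (fst x))" if "continuous_on {0<..<1} p" for p :: "real => real"
    by (rule continuous_on_compose2[OF that continuous_on_fst[OF continuous_on_id]]) (auto simp: S_def)
  note o' = o[OF continuous_on_const continuous_on_snd[OF continuous_on_id]]
    o[OF continuous_on_snd[OF continuous_on_id] continuous_on_const]
    o[OF cS continuous_on_snd[OF continuous_on_id]] o[OF continuous_on_snd[OF continuous_on_id] cS]
  have e: "region1 = {x \<in> S. 0 < snd x} \<inter> {x \<in> S. snd x < lo_curve (fst x)}"
    "region2 = {x \<in> S. lo_curve (fst x) < snd x} \<inter> {x \<in> S. snd x < hi_curve (fst x)}"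
    "region3 = {x \<in> S. hi_curve (fst x) < snd x}"
    "region4 = {x \<in> S. snd x < cusp_curve (fst x)}"
    "region5 = {x \<in> S. cusp_curve (fst x) < snd x} \<inter> {x \<in> S. snd x < 0}"
    by (auto simp: S_def region_pos_iff region_neg_iff)
  show "open region1" "open region2" "open region3" "open region4" "open region5"
    unfolding e by (intro open_Int o' c c3)+
  have pos: "0 < lo_curve \<rho>" "0 < hi_curve \<rho>" "lo_curve \<rho> < hi_curve \<rho>" if "0 < \<rho>" "\<rho> < 1" for \<rho>
    using curve_order[OF that] by auto
  \<comment> \<open>Each region is straightened by the fibre coordinate
    \<open>(\<phi> - p \<rho>) / r \<rho>\<close>, which runs over a bounded interval or a half
    line. The width \<open>r\<close> may be negative, as it is for the cusp curve.\<close>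
  have img: "X = (\<lambda>(\<rho>, t). (\<rho>, p \<rho> + t * r \<rho>)) ` ({0<..<1} \<times> T)"
    if "!!\<rho> \<phi>. (\<rho>, \<phi>) \<in> X \<longleftrightarrow> 0 < \<rho> \<and> \<rho> < 1 \<and> (\<phi> - p \<rho>) / r \<rho> \<in> T" "!!\<rho>. 0 < \<rho> ==> \<rho> < 1 ==> r \<rho> \<noteq> 0" for X T and p r :: "real => real"
  proof (intro set_eqI iffI)
    fix x assume "x \<in> X"
    moreover obtain \<rho> \<phi> where "x = (\<rho>, \<phi>)" by force
    ultimately show "x \<in> (\<lambda>(\<rho>, t). (\<rho>, p \<rho> + t * r \<rho>)) ` ({0<..<1} \<times> T)"
      using that by (intro image_eqI[of _ _ "(\<rho>, (\<phi> - p \<rho>) / r \<rho>)"]) auto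
  qed (use that in auto)
  have "region1 = (\<lambda>(\<rho>, t). (\<rho>, 0 + t * lo_curve \<rho>)) ` ({0<..<1} \<times> {0<..<1})"
    by (rule img) (use pos in \<open>force simp: region_pos_iff pos_divide_less_eq pos_less_divide_eq\<close>)+
  then show "connected region1" using band_connected[OF continuous_on_const c(1), of "{0<..<1}" 0] by simp
  have "region2 = (\<lambda>(\<rho>, t). (\<rho>, lo_curve \<rho> + t * (hi_curve \<rho> - lo_curve \<rho>))) ` ({0<..<1} \<times> {0<..<1})"
  proof (rule img)
    fix \<rho> \<phi> :: real
    have "(\<phi> - a) / (b - a) \<in> {0<..<1} \<longleftrightarrow> a < \<phi> \<and> \<phi> < b" if "a < b" for a b :: real
      using that by (auto simp: field_simps)
    then show "(\<rho>, \<phi>) \<in> region2 \<longleftrightarrow> 0 < \<rho> \<and> \<rho> < 1 \<and> (\<phi> - lo_curve \<rho>) / (hi_curve \<rho> - lo_curve \<rho>) \<in> {0<..<1}"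
      using pos(3)[of \<rho>] unfolding region_pos_iff by blast
  qed (use pos in force)
  then show "connected region2"
    using band_connected[OF c(1) continuous_on_diff[OF c(2,1)], of "{0<..<1}"] by simp
  have "region3 = (\<lambda>(\<rho>, t). (\<rho>, 0 + t * hi_curve \<rho>)) ` ({0<..<1} \<times> {1<..})"
    by (rule img) (use pos in \<open>force simp: region_pos_iff pos_less_divide_eq\<close>)+
  then show "connected region3" using band_connected[OF continuous_on_const c(2), of "{1<..}" 0] by simp
  have "region4 = (\<lambda>(\<rho>, t). (\<rho>, 0 + t * cusp_curve \<rho>)) ` ({0<..<1} \<times> {1<..})"
    by (rule img) (use cusp_curve_neg in \<open>force simp: region_neg_iff neg_less_divide_eq\<close>)+
  then show "connected region4" using band_connected[OF continuous_on_const c3, of "{1<..}" 0] by simp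
  have "region5 = (\<lambda>(\<rho>, t). (\<rho>, 0 + t * cusp_curve \<rho>)) ` ({0<..<1} \<times> {0<..<1})"
    by (rule img) (use cusp_curve_neg in \<open>force simp: region_neg_iff neg_less_divide_eq neg_divide_less_eq\<close>)+
  then show "connected region5" using band_connected[OF continuous_on_const c3, of "{0<..<1}" 0] by simp
qed

lemma complement_bif_set: "param_space - bif_set = \<Union>{region1, region2, region3, region4, region5}"
proof (intro set_eqI iffI)
  fix x assume x: "x \<in> param_space - bif_set"
  obtain \<rho> \<phi> where xx: "x = (\<rho>, \<phi>)" by force
  have b: "0 < \<rho>" "\<rho> < 1" "\<phi> \<noteq> 0" "(\<rho>, \<phi>) \<notin> curve1" "(\<rho>, \<phi>) \<notin> curve2" "(\<rho>, \<phi>) \<notin> curve3"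
    using x by (auto simp: xx param_space_def bif_set_def)
  then show "x \<in> \<Union>{region1, region2, region3, region4, region5}"
    unfolding xx using cusp_curve_neg[of \<rho>] by (auto simp: region_pos_iff region_neg_iff)
next
  fix x assume x: "x \<in> \<Union>{region1, region2, region3, region4, region5}"
  obtain \<rho> \<phi> where xx: "x = (\<rho>, \<phi>)" by force
  have b: "0 < \<rho> \<and> \<rho> < 1" using x by (auto simp: xx region_pos_iff region_neg_iff)
  then have "0 < lo_curve \<rho>" "lo_curve \<rho> < hi_curve \<rho>" using curve_order by auto
  then show "x \<in> param_space - bif_set"
    using x b cusp_curve_neg[of \<rho>] unfolding xx bif_set_def param_space_def
    by (auto simp: region_pos_iff region_neg_iff)
qed

lemma regions_disjoint:
  assumes "(\<rho>, \<phi>) \<in> C" "(\<rho>, \<phi>) \<in> D" "C \<in> {region1, region2, region3, region4, region5}" "D \<in> {region1, region2, region3, region4, region5}"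
  shows "C = D"
proof -
  have b: "0 < \<rho> \<and> \<rho> < 1" using assms by (auto simp: region_pos_iff region_neg_iff)
  then have "0 < lo_curve \<rho>" "lo_curve \<rho> < hi_curve \<rho>" "cusp_curve \<rho> < 0"
    using cusp_curve_neg curve_order by auto
  then show ?thesis using assms by (auto simp: region_pos_iff region_neg_iff)
qed

lemma components_complement: "components (param_space - bif_set) = {region1, region2, region3, region4, region5}"
  unfolding complement_bif_set
proof (rule components_open_partition)
  \<comment> \<open>At \<open>\<rho> = 1/2\<close> the first two curves pass through the values 1/3
    and 3.\<close>
  have "(1/2, 1/4) \<in> region1" "(1/2, 1) \<in> region2" "(1/2, 4) \<in> region3"
    "(1/2, cusp_curve (1/2) - 1) \<in> region4" "(1/2, cusp_curve (1/2) / 2) \<in> region5"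
    using cusp_curve_neg[of "1/2"] by (auto simp: region_pos_iff region_neg_iff lo_curve_def hi_curve_def)
  then have "region1 \<noteq> {}" "region2 \<noteq> {}" "region3 \<noteq> {}" "region4 \<noteq> {}" "region5 \<noteq> {}" by blast+
  then show "open C \<and> connected C \<and> C \<noteq> {}" if "C \<in> {region1, region2, region3, region4, region5}" for C
    using that region_facts by blast
  show "C \<inter> D = {}" if "C \<in> {region1, region2, region3, region4, region5}" "D \<in> {region1, region2, region3, region4, region5}" "C \<noteq> D" for C D
  proof (rule ccontr)
    assume "C \<inter> D \<noteq> {}"
    then obtain \<rho> \<phi> where "(\<rho>, \<phi>) \<in> C" "(\<rho>, \<phi>) \<in> D" by fastforce
    then show False using regions_disjoint[of \<rho> \<phi> C D] that by blast
  qed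
qed

section \<open>Equivalence within regions and change of the number of equilibria on curves\<close>

context disc_params
begin

lemma region_thresholds:
  assumes \<phi>: "\<phi> \<noteq> 0" "c = 1 / \<phi>"
  shows "(\<rho>, \<phi>) \<in> region1 \<longleftrightarrow> 0 < c \<and> (1 + \<rho>) / (1 - \<rho>) < c"
    "(\<rho>, \<phi>) \<in> region2 \<longleftrightarrow> 0 < c \<and> (1 - \<rho>) / (1 + \<rho>) < c \<and> c < (1 + \<rho>) / (1 - \<rho>)"
    "(\<rho>, \<phi>) \<in> region3 \<longleftrightarrow> 0 < c \<and> c < (1 - \<rho>) / (1 + \<rho>)"
    "(\<rho>, \<phi>) \<in> region4 \<longleftrightarrow> c < 0 \<and> cub xp > - \<kappa> * c"
    "(\<rho>, \<phi>) \<in> region5 \<longleftrightarrow> c < 0 \<and> cub xp < - \<kappa> * c"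
    "(\<rho>, \<phi>) \<in> curve1 \<longleftrightarrow> 0 < c \<and> (1 + \<rho>) / (1 - \<rho>) = c"
    "(\<rho>, \<phi>) \<in> curve2 \<longleftrightarrow> 0 < c \<and> (1 - \<rho>) / (1 + \<rho>) = c"
    "(\<rho>, \<phi>) \<in> curve3 \<longleftrightarrow> c < 0 \<and> cub xp = - \<kappa> * c"
proof -
  have pos: "0 < c \<longleftrightarrow> 0 < \<phi>" "c < 0 \<longleftrightarrow> \<phi> < 0" using \<phi> by auto
  note o = curve_order[OF \<rho>]
  show "(\<rho>, \<phi>) \<in> region1 \<longleftrightarrow> 0 < c \<and> (1 + \<rho>) / (1 - \<rho>) < c"
    unfolding region_pos_iff pos using vortex_thresholds(5)[OF \<rho>, of \<phi>] \<phi>(2) \<rho> by auto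
  show "(\<rho>, \<phi>) \<in> region2 \<longleftrightarrow> 0 < c \<and> (1 - \<rho>) / (1 + \<rho>) < c \<and> c < (1 + \<rho>) / (1 - \<rho>)"
    unfolding region_pos_iff pos using vortex_thresholds(5,6,7)[OF \<rho>, of \<phi>] \<phi>(2) \<rho> o by (cases "0 < \<phi>") auto
  show "(\<rho>, \<phi>) \<in> region3 \<longleftrightarrow> 0 < c \<and> c < (1 - \<rho>) / (1 + \<rho>)"
    unfolding region_pos_iff pos using vortex_thresholds(7,8)[OF \<rho>, of \<phi>] \<phi>(2) \<rho> o by (cases "0 < \<phi>") auto
  show "(\<rho>, \<phi>) \<in> curve1 \<longleftrightarrow> 0 < c \<and> (1 + \<rho>) / (1 - \<rho>) = c"
    unfolding region_pos_iff pos using vortex_thresholds(6)[OF \<rho>, of \<phi>] \<phi>(2) \<rho> o by (cases "0 < \<phi>") auto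
  show "(\<rho>, \<phi>) \<in> curve2 \<longleftrightarrow> 0 < c \<and> (1 - \<rho>) / (1 + \<rho>) = c"
    unfolding region_pos_iff pos using vortex_thresholds(8)[OF \<rho>, of \<phi>] \<phi>(2) \<rho> o by (cases "0 < \<phi>") auto
  have b: "bif_fun \<rho> \<phi> > 0 \<longleftrightarrow> cub xp > - \<kappa> * c" "bif_fun \<rho> \<phi> < 0 \<longleftrightarrow> cub xp < - \<kappa> * c" "bif_fun \<rho> \<phi> = 0 \<longleftrightarrow> cub xp = - \<kappa> * c"
    if "\<phi> < 0"
  proof -
    define d K where "d = cub xp - (- \<kappa> * c)" and "K = 27 * \<rho>^2 * (- \<phi>)"
    have "bif_fun \<rho> \<phi> = K * d" using bif_fun_cub[OF that \<phi>(2)] by (simp add: d_def K_def)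
    moreover have "K > 0" unfolding K_def using that \<rho> by (intro mult_pos_pos) auto
    ultimately have "bif_fun \<rho> \<phi> > 0 \<longleftrightarrow> d > 0" "bif_fun \<rho> \<phi> < 0 \<longleftrightarrow> d < 0" "bif_fun \<rho> \<phi> = 0 \<longleftrightarrow> d = 0"
      by (simp_all add: zero_less_mult_iff mult_less_0_iff)
    then show "bif_fun \<rho> \<phi> > 0 \<longleftrightarrow> cub xp > - \<kappa> * c" "bif_fun \<rho> \<phi> < 0 \<longleftrightarrow> cub xp < - \<kappa> * c" "bif_fun \<rho> \<phi> = 0 \<longleftrightarrow> cub xp = - \<kappa> * c"
      unfolding d_def diff_gt_0_iff_gt diff_less_0_iff_less right_minus_eq by simp_all
  qed
  show "(\<rho>, \<phi>) \<in> region4 \<longleftrightarrow> c < 0 \<and> cub xp > - \<kappa> * c" "(\<rho>, \<phi>) \<in> region5 \<longleftrightarrow> c < 0 \<and> cub xp < - \<kappa> * c"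
    "(\<rho>, \<phi>) \<in> curve3 \<longleftrightarrow> c < 0 \<and> cub xp = - \<kappa> * c"
    unfolding pos using b \<rho> by (auto simp: region4_def region5_def curve3_def param_space_def)
qed

end

lemma vortex_systemI: "(\<rho>, \<phi>) \<in> param_space ==> R > 0 ==> \<theta> \<noteq> 0 ==> vortex_system \<rho> (1 / \<phi>) R \<theta>"
  by unfold_locales (auto simp: param_space_def)

lemma two_systemsI:
  "(\<rho>, \<phi>) \<in> param_space ==> (\<rho>', \<phi>') \<in> param_space ==> R > 0 ==> \<theta> \<noteq> 0 ==> two_systems \<rho> (1 / \<phi>) \<rho>' (1 / \<phi>') R \<theta>"
  by (simp add: two_systems_def vortex_systemI)

lemma (in two_systems) phase_portraits_equivalent_iff:
  assumes "c = 1 / \<phi>" "c' = 1 / \<phi>'"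
  shows "phase_portraits_equivalent R \<theta> (\<rho>, \<phi>) (\<rho>', \<phi>') \<longleftrightarrow>
    (\<exists>h k. homeomorphism (disk R) (disk R) h k \<and> carries_orbits (P.pdisk) P.V (Q.pdisk) Q.V h)"
  unfolding phase_portraits_equivalent_def P.Om_def P.V_def Q.Om_def Q.V_def using assms by simp

lemma same_region_equivalent:
  assumes R: "R > 0" "\<theta> \<noteq> 0" and C: "C \<in> {region1, region2, region3, region4, region5}" and pq: "(\<rho>, \<phi>) \<in> C" "(\<rho>', \<phi>') \<in> C"
  shows "phase_portraits_equivalent R \<theta> (\<rho>, \<phi>) (\<rho>', \<phi>')"
proof -
  have ps: "(\<rho>, \<phi>) \<in> param_space" "(\<rho>', \<phi>') \<in> param_space"
    using C pq by (auto simp: region1_def region2_def region3_def region4_def region5_def)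
  interpret two_systems \<rho> "1 / \<phi>" \<rho>' "1 / \<phi>'" R \<theta> by (rule two_systemsI[OF ps R])
  have nz: "\<phi> \<noteq> 0" "\<phi>' \<noteq> 0" using ps by (auto simp: param_space_def)
  note t = P.region_thresholds[OF nz(1) refl] Q.region_thresholds[OF nz(2) refl]
  show ?thesis unfolding phase_portraits_equivalent_iff[OF refl refl]
  proof (cases "C = region4 \<or> C = region5")
    case True
    then show equivalent
    proof
      assume "C = region4"
      then show ?thesis using pq t(4,12) by (intro equivalent_region4) simp_all
    next
      assume "C = region5"
      then show ?thesis using pq t(5,13) by (intro equivalent_region5) simp_all
    qed
  next
    case False
    then have "C = region1 \<or> C = region2 \<or> C = region3" using C by auto
    then show equivalent
      using pq t(1-3) t(9-11) by (intro equivalent_regions123) blast+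
  qed
qed

lemma regular_complement:
  assumes R: "R > 0" "\<theta> \<noteq> 0" and p: "p \<in> param_space - bif_set"
  shows "regular_parameter R \<theta> p"
proof -
  obtain C where C: "C \<in> {region1, region2, region3, region4, region5}" "p \<in> C"
    using p unfolding complement_bif_set by blast
  have "open C" using C(1) region_facts(1-5) by blast
  then obtain e where e: "e > 0" "ball p e \<subseteq> C" using C(2) open_contains_ball by blast
  have "phase_portraits_equivalent R \<theta> p q" if "dist q p < e" for q
  proof -
    have "q \<in> C" using e(2) that by (auto simp: dist_commute)
    then show ?thesis using same_region_equivalent[OF R C(1), of "fst p" "snd p" "fst q" "snd q"] C(2) by simp
  qed
  then show ?thesis unfolding regular_parameter_def using p e(1) by blast
qed

text \<open>An equivalence preserves the number of equilibria, and it is enough to vary \<phi> with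
  \<rho> fixed.\<close>

lemma bifurcation_by_count:
  assumes R: "R > 0" "\<theta> \<noteq> 0" and p: "(\<rho>, \<phi>) \<in> param_space"
    and near: "!!e. e > 0 ==> \<exists>\<phi>'. \<bar>\<phi>' - \<phi>\<bar> < e \<and> (\<rho>, \<phi>') \<in> param_space \<and>
      card {z \<in> disk R. equilibrium (vortex_system.Om \<rho> R) (vortex_system.V \<rho> (1 / \<phi>') R \<theta>) z} \<noteq>
      card {z \<in> disk R. equilibrium (vortex_system.Om \<rho> R) (vortex_system.V \<rho> (1 / \<phi>) R \<theta>) z}"
  shows "bifurcation_parameter R \<theta> (\<rho>, \<phi>)"
proof -
  have "\<not> regular_parameter R \<theta> (\<rho>, \<phi>)"
  proof
    assume "regular_parameter R \<theta> (\<rho>, \<phi>)"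
    then obtain e where e: "e > 0" "!!q. q \<in> param_space ==> dist q (\<rho>, \<phi>) < e ==> phase_portraits_equivalent R \<theta> (\<rho>, \<phi>) q"
      unfolding regular_parameter_def by blast
    obtain \<phi>' where \<phi>': "\<bar>\<phi>' - \<phi>\<bar> < e" "(\<rho>, \<phi>') \<in> param_space"
      "card {z \<in> disk R. equilibrium (vortex_system.Om \<rho> R) (vortex_system.V \<rho> (1 / \<phi>') R \<theta>) z} \<noteq>
       card {z \<in> disk R. equilibrium (vortex_system.Om \<rho> R) (vortex_system.V \<rho> (1 / \<phi>) R \<theta>) z}"
      using near[OF e(1)] by blast
    interpret two_systems \<rho> "1 / \<phi>" \<rho> "1 / \<phi>'" R \<theta> by (rule two_systemsI[OF p \<phi>'(2) R])
    have "dist (\<rho>, \<phi>') (\<rho>, \<phi>) < e" using \<phi>'(1) by (simp add: dist_prod_def dist_real_def)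
    then have "phase_portraits_equivalent R \<theta> (\<rho>, \<phi>) (\<rho>, \<phi>')" by (rule e(2)[OF \<phi>'(2)])
    then obtain h k where "homeomorphism (disk R) (disk R) h k" "carries_orbits (P.pdisk) P.V (Q.pdisk) Q.V h"
      unfolding phase_portraits_equivalent_iff[OF refl refl] by blast
    then show False using bij_betw_same_card[OF equilibria_correspond] \<phi>'(3) by metis
  qed
  then show ?thesis using p by (simp add: bifurcation_parameter_def)
qed

lemma nearby:
  fixes a \<phi> :: real
  assumes "e > 0"
  shows "a < \<phi> ==> \<exists>x. \<bar>x - \<phi>\<bar> < e \<and> a < x \<and> x < \<phi>" "\<phi> < a ==> \<exists>x. \<bar>x - \<phi>\<bar> < e \<and> \<phi> < x \<and> x < a"
proof -
  show "\<exists>x. \<bar>x - \<phi>\<bar> < e \<and> a < x \<and> x < \<phi>" if "a < \<phi>"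
  proof -
    have "max a (\<phi> - e) < \<phi>" using assms that by simp
    then obtain z where "max a (\<phi> - e) < z" "z < \<phi>" using dense by blast
    then show ?thesis by (intro exI[of _ z]) auto
  qed
  show "\<exists>x. \<bar>x - \<phi>\<bar> < e \<and> \<phi> < x \<and> x < a" if "\<phi> < a"
  proof -
    have "\<phi> < min a (\<phi> + e)" using assms that by simp
    then obtain z where "\<phi> < z" "z < min a (\<phi> + e)" using dense by blast
    then show ?thesis by (intro exI[of _ z]) auto
  qed
qed

context vortex_system
begin

lemma curve2_portrait:
  assumes c: "c > 0" "(1 - \<rho>) / (1 + \<rho>) = c"
  obtains x where "- R < x" "x < 0" "center Om V (pt x 0)" "{p \<in> disk R. equilibrium Om V p} = {pt x 0, pt R 0}"
proof -
  have c': "c <= krad 1 1" "c = krad 1 1" using c by (simp_all add: rad_end)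
  obtain q q' where "center Om V (pt (R * ax q) 0)" "- R < R * ax q" "R * ax q < 0"
    "{p \<in> disk R. equilibrium Om V p} = {pt (R * ax q) 0, Pt 1 q' 1}" "q' = 1 \<longleftrightarrow> c = krad 1 1"
    by (rule region3_equilibria[OF c(1) c'(1)])
  then show thesis using that[of "R * ax q"] c'(2) Pt_one_axis(2) by simp
qed

lemma region2_portrait:
  assumes c: "c > 0" "(1 - \<rho>) / (1 + \<rho>) < c" "c < (1 + \<rho>) / (1 - \<rho>)"
  obtains x u v where "- R < x" "x < 0" "0 < v" "center Om V (pt x 0)"
    "{p \<in> disk R. equilibrium Om V p} = {pt x 0, pt u v, pt u (- v)}"
    "hyperbolic_saddle Om V (pt u v)" "pt u v \<in> frontier (disk R)"
    "hyperbolic_saddle Om V (pt u (- v))" "pt u (- v) \<in> frontier (disk R)"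
    "saddle_connection_inside Om V (disk R) (pt u v) (pt u (- v))"
proof -
  have c': "krad 1 1 < c" "c < krad 1 (-1)" using c by (simp_all add: rad_end)
  obtain q u where q: "0 < q" "q < 1" "krad q (-1) = c" and u: "-1 < u" "u < 1" "krad 1 u = c"
    and ctr: "center Om V (pt (R * ax q) 0)" "- R < R * ax q" "R * ax q < 0"
    and eqs: "{p \<in> disk R. equilibrium Om V p} = {pt (R * ax q) 0, Pt 1 1 u, Pt (-1) 1 u}"
    by (rule region2_equilibria[OF c(1) c'])
  define x y where "x = Pt 1 1 u $ 1" and "y = Pt 1 1 u $ 2"
  have y: "y > 0" using Pt_upper[of 1 u] u by (simp add: y_def)
  have P: "Pt 1 1 u = pt x y" "Pt (-1) 1 u = pt x (- y)"
    using Pt_mirror[of 1 u] by (simp_all add: vec2_eq_iff x_def y_def)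
  note b = boundary_point[OF u]
  have f: "pt x y \<in> frontier (disk R)" "pt x (- y) \<in> frontier (disk R)"
    unfolding P[symmetric] frontier_disk using b(2)[of 1] b(2)[of "-1"] by simp_all
  show thesis
    by (rule that[OF ctr(2,3) y ctr(1) eqs[unfolded P]])
      (use b(1)[of 1] b(1)[of "-1"] f saddle_connection[OF c(1) c' q u eqs] P in simp_all)
qed

lemma region2_count:
  assumes "c > 0" "(1 - \<rho>) / (1 + \<rho>) < c" "c < (1 + \<rho>) / (1 - \<rho>)"
  shows "card {p \<in> disk R. equilibrium Om V p} = 3"
proof -
  obtain x u v where "0 < v" "{p \<in> disk R. equilibrium Om V p} = {pt x 0, pt u v, pt u (- v)}"
    by (rule region2_portrait[OF assms])
  then show ?thesis by (simp add: vec2_eq_iff)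
qed

end

text \<open>Each curve borders a region with a different number of equilibria: one against none in
  \<open>region1\<close> for the first, two against three in \<open>region2\<close> for the second,
  and one against none in \<open>region5\<close> for the third.\<close>

lemma bif_set_bifurcation:
  assumes R: "R > 0" "\<theta> \<noteq> 0" and p: "p \<in> bif_set"
  shows "bifurcation_parameter R \<theta> p"
proof -
  obtain \<rho> \<phi> where pp: "p = (\<rho>, \<phi>)" by force
  have ps: "(\<rho>, \<phi>) \<in> param_space" using p by (auto simp: pp bif_set_def curve1_def curve2_def curve3_def)
  have r: "0 < \<rho>" "\<rho> < 1" "\<phi> \<noteq> 0" using ps by (auto simp: param_space_def)
  interpret P: vortex_system \<rho> "1 / \<phi>" R \<theta> by (rule vortex_systemI[OF ps R])
  have ps': "(\<rho>, \<phi>') \<in> param_space" if "\<phi>' \<noteq> 0" for \<phi>' using that r by (simp add: param_space_def)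
  note I = vortex_systemI[OF ps' R]
  note D = vortex_system.axioms(1)[OF I]
  note t = P.region_thresholds[OF r(3) refl]
  show ?thesis unfolding pp
  proof (rule bifurcation_by_count[OF R ps])
    fix e :: real assume e: "e > 0"
    consider "(\<rho>, \<phi>) \<in> curve1" | "(\<rho>, \<phi>) \<in> curve2" | "(\<rho>, \<phi>) \<in> curve3" using p by (auto simp: pp bif_set_def)
    then show "\<exists>\<phi>'. \<bar>\<phi>' - \<phi>\<bar> < e \<and> (\<rho>, \<phi>') \<in> param_space \<and>
      card {z \<in> disk R. equilibrium (vortex_system.Om \<rho> R) (vortex_system.V \<rho> (1 / \<phi>') R \<theta>) z} \<noteq>
      card {z \<in> disk R. equilibrium P.Om P.V z}"
    proof cases
      case 1
      then have "\<phi> = lo_curve \<rho>" by (simp add: region_pos_iff)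
      then obtain x where x: "\<bar>x - \<phi>\<bar> < e" "0 < x" "x < lo_curve \<rho>"
        using nearby(1)[OF e, of 0 \<phi>] curve_order[OF r(1,2)] by blast
      then have x0: "x \<noteq> 0" and xr: "(\<rho>, x) \<in> region1" using r by (auto simp: region_pos_iff)
      interpret Q: vortex_system \<rho> "1 / x" R \<theta> by (rule I[OF x0])
      have a: "0 < 1 / x" "Q.krad 1 (-1) < 1 / x"
        using xr Q.region_thresholds(1)[OF x0 refl] by (simp_all add: Q.rad_end)
      have b: "0 < 1 / \<phi>" "P.krad 1 (-1) = 1 / \<phi>" using 1 t(6) by (simp_all add: P.rad_end)
      have "card {z \<in> disk R. equilibrium Q.Om Q.V z} \<noteq> card {z \<in> disk R. equilibrium P.Om P.V z}"
        unfolding Q.region1_portrait(2)[OF a] P.curve1_equilibria[OF b] by simp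
      then show ?thesis using x(1) ps'[OF x0] by blast
    next
      case 2
      then have "\<phi> = hi_curve \<rho>" by (simp add: region_pos_iff)
      then obtain x where x: "\<bar>x - \<phi>\<bar> < e" "lo_curve \<rho> < x" "x < hi_curve \<rho>"
        using nearby(1)[OF e, of "lo_curve \<rho>" \<phi>] curve_order[OF r(1,2)] by blast
      then have x0: "x \<noteq> 0" and xr: "(\<rho>, x) \<in> region2" using r curve_order[OF r(1,2)] by (auto simp: region_pos_iff)
      interpret Q: vortex_system \<rho> "1 / x" R \<theta> by (rule I[OF x0])
      have 3: "card {z \<in> disk R. equilibrium Q.Om Q.V z} = 3"
        using Q.region2_count xr Q.region_thresholds(2)[OF x0 refl] by simp
      have b: "0 < 1 / \<phi>" "(1 - \<rho>) / (1 + \<rho>) = 1 / \<phi>" using 2 t(7) by simp_all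
      obtain y where y: "{z \<in> disk R. equilibrium P.Om P.V z} = {pt y 0, pt R 0}"
        by (rule P.curve2_portrait[OF b])
      have "card {z \<in> disk R. equilibrium Q.Om Q.V z} \<noteq> card {z \<in> disk R. equilibrium P.Om P.V z}"
        unfolding 3 y using card_2_iff'[of "{pt y 0, pt R 0}"] by (simp add: card_insert_if)
      then show ?thesis using x(1) ps'[OF x0] by blast
    next
      case 3
      then have "\<phi> = cusp_curve \<rho>" by (simp add: region_neg_iff)
      then obtain x where x: "\<bar>x - \<phi>\<bar> < e" "cusp_curve \<rho> < x" "x < 0"
        using nearby(2)[OF e, of \<phi> 0] cusp_curve_neg[OF r(1,2)] by blast
      then have x0: "x \<noteq> 0" and xr: "(\<rho>, x) \<in> region5" using r by (auto simp: region_neg_iff)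
      interpret Q: vortex_system \<rho> "1 / x" R \<theta> by (rule I[OF x0])
      have a: "1 / x < 0" "Q.cub Q.xp < - Q.\<kappa> * (1 / x)" using xr Q.region_thresholds(5)[OF x0 refl] by simp_all
      have b: "1 / \<phi> < 0" "P.cub P.xp = - P.\<kappa> * (1 / \<phi>)" using 3 t(8) by simp_all
      have "card {z \<in> disk R. equilibrium Q.Om Q.V z} \<noteq> card {z \<in> disk R. equilibrium P.Om P.V z}"
        unfolding Q.region5_portrait(2)[OF a] P.curve3_equilibria(1)[OF b] by simp
      then show ?thesis using x(1) ps'[OF x0] by blast
    qed
  qed
qed

theorem theorem2p1:
  fixes R r0 \<Gamma> \<theta>0 c \<rho>0 \<phi>0 :: real
    and U D :: "(real^2) set" and V :: "real^2 \<Rightarrow> real^2"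
  assumes "R > 0" and "0 < r0" and "r0 < R" and "\<Gamma> \<noteq> 0" and "\<theta>0 \<noteq> 0"
    and "c = \<Gamma> / (2 * pi * \<theta>0)" and "\<rho>0 = r0 / R" and "\<phi>0 = R\<^sup>2 / c"
    and "U = vdomain R r0" and "V = vfield R r0 c \<theta>0" and "D = disk R"
  shows
    "(\<forall>p\<in>D \<inter> U. orbit U V p \<subseteq> D) \<and>
     (\<rho>0, \<phi>0) \<in> param_space \<and>
     components (param_space - bif_set) = {region1, region2, region3, region4, region5} \<and>
     (\<forall>p\<in>param_space - bif_set. regular_parameter R \<theta>0 p) \<and>
     ((\<rho>0, \<phi>0) \<in> region1 \<longrightarrow> global_vortex U V D (pt r0 0)) \<and>
     ((\<rho>0, \<phi>0) \<in> region2 \<longrightarrow>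
        vortex U V (pt r0 0) \<and>
        (\<exists>xc xs ys. -R < xc \<and> xc < 0 \<and> 0 < ys \<and>
           {p \<in> D. equilibrium U V p} = {pt xc 0, pt xs ys, pt xs (- ys)} \<and>
           center U V (pt xc 0) \<and>
           hyperbolic_saddle U V (pt xs ys) \<and> pt xs ys \<in> frontier D \<and>
           hyperbolic_saddle U V (pt xs (- ys)) \<and> pt xs (- ys) \<in> frontier D \<and>
           saddle_connection_inside U V D (pt xs ys) (pt xs (- ys)))) \<and>
     ((\<rho>0, \<phi>0) \<in> region3 \<longrightarrow>
        vortex U V (pt r0 0) \<and>
        (\<exists>xc xs. -R < xc \<and> xc < 0 \<and> r0 < xs \<and> xs < R \<and>
           {p \<in> D. equilibrium U V p} = {pt xc 0, pt xs 0} \<and>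
           center U V (pt xc 0) \<and> hyperbolic_saddle U V (pt xs 0))) \<and>
     ((\<rho>0, \<phi>0) \<in> region4 \<longrightarrow>
        vortex U V (pt r0 0) \<and>
        (\<exists>xc xs. 0 < xc \<and> xc < xs \<and> xs < r0 \<and>
           {p \<in> D. equilibrium U V p} = {pt xc 0, pt xs 0} \<and>
           center U V (pt xc 0) \<and> hyperbolic_saddle U V (pt xs 0))) \<and>
     ((\<rho>0, \<phi>0) \<in> region5 \<longrightarrow> global_vortex U V D (pt r0 0)) \<and>
     (\<forall>p\<in>bif_set. bifurcation_parameter R \<theta>0 p) \<and>
     ((\<rho>0, \<phi>0) \<in> curve1 \<longrightarrow>
        vortex U V (pt r0 0) \<and>
        {p \<in> D. equilibrium U V p} = {pt (- R) 0} \<and>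
        degenerate_saddle U V (pt (- R) 0)) \<and>
     ((\<rho>0, \<phi>0) \<in> curve2 \<longrightarrow>
        vortex U V (pt r0 0) \<and>
        (\<exists>xc. -R < xc \<and> xc < 0 \<and>
           {p \<in> D. equilibrium U V p} = {pt xc 0, pt R 0} \<and>
           center U V (pt xc 0) \<and> degenerate_saddle U V (pt R 0))) \<and>
     ((\<rho>0, \<phi>0) \<in> curve3 \<longrightarrow>
        vortex U V (pt r0 0) \<and>
        (let xp = (R\<^sup>2 + r0\<^sup>2 - sqrt (R^4 - R\<^sup>2 * r0\<^sup>2 + r0^4)) / (3 * r0) in
           {p \<in> D. equilibrium U V p} = {pt xp 0} \<and> cusp U V (pt xp 0)))"
proof -
  have c: "c \<noteq> 0" using assms by simp
  have nz: "\<phi>0 \<noteq> 0" using c assms by simp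
  have ps: "(\<rho>0, \<phi>0) \<in> param_space" using assms nz by (simp add: param_space_def)
  interpret M: vortex_system \<rho>0 "1 / \<phi>0" R \<theta>0 by (rule vortex_systemI[OF ps assms(1,5)])
  have r0: "\<rho>0 * R = r0" using assms by simp
  have "R\<^sup>2 * (1 / \<phi>0) = c" using assms c by simp
  then have U: "U = M.Om" and V: "V = M.V"
    using assms(9,10) by (simp_all add: M.Om_def M.V_def r0)
  note D = assms(11)
  have s: "pt r0 0 = M.sing" by (simp add: r0)
  note t = M.region_thresholds[OF nz refl]
  have vtx: "vortex M.Om M.V M.sing" by (rule M.vortex_sing)
  \<comment> \<open>By homogeneity a factor \<open>R^2\<close> leaves the root, so the formula is
    \<open>R\<close> times its dimensionless form.\<close>
  have cp: "(R\<^sup>2 + r0\<^sup>2 - sqrt (R^4 - R\<^sup>2 * r0\<^sup>2 + r0^4)) / (3 * r0) = R * M.xp"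
  proof -
    have "sqrt (R^4 - R\<^sup>2 * r0\<^sup>2 + r0^4) = R\<^sup>2 * M.sq"
    proof (rule real_sqrt_unique)
      show "(R\<^sup>2 * M.sq)\<^sup>2 = R^4 - R\<^sup>2 * r0\<^sup>2 + r0^4"
        unfolding power_mult_distrib M.sq2(1) r0[symmetric] by (simp add: power2_eq_square power4_eq_xxxx algebra_simps)
    qed (use M.sq2(2) in simp)
    then show ?thesis unfolding M.xp_def r0[symmetric] using M.R_pos M.\<rho> by (simp add: field_simps power2_eq_square)
  qed
  have 1: "global_vortex M.Om M.V (disk R) M.sing" if "(\<rho>0, \<phi>0) \<in> region1"
    using M.region1_portrait(1) t(1) that by (simp add: M.rad_end)
  have 2: "\<exists>xc xs ys. -R < xc \<and> xc < 0 \<and> 0 < ys \<and>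
     {p \<in> disk R. equilibrium M.Om M.V p} = {pt xc 0, pt xs ys, pt xs (- ys)} \<and> center M.Om M.V (pt xc 0) \<and>
     hyperbolic_saddle M.Om M.V (pt xs ys) \<and> pt xs ys \<in> frontier (disk R) \<and>
     hyperbolic_saddle M.Om M.V (pt xs (- ys)) \<and> pt xs (- ys) \<in> frontier (disk R) \<and>
     saddle_connection_inside M.Om M.V (disk R) (pt xs ys) (pt xs (- ys))" if "(\<rho>0, \<phi>0) \<in> region2"
  proof -
    have c: "0 < 1 / \<phi>0" "(1 - \<rho>0) / (1 + \<rho>0) < 1 / \<phi>0" "1 / \<phi>0 < (1 + \<rho>0) / (1 - \<rho>0)" using that t(2) by simp_all
    show ?thesis by (rule M.region2_portrait[OF c]) (intro exI conjI)
  qed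
  have 3: "\<exists>xc xs. -R < xc \<and> xc < 0 \<and> r0 < xs \<and> xs < R \<and>
     {p \<in> disk R. equilibrium M.Om M.V p} = {pt xc 0, pt xs 0} \<and> center M.Om M.V (pt xc 0) \<and> hyperbolic_saddle M.Om M.V (pt xs 0)"
    if "(\<rho>0, \<phi>0) \<in> region3"
  proof -
    have c: "0 < 1 / \<phi>0" "1 / \<phi>0 < M.krad 1 1" using that t(3) by (simp_all add: M.rad_end)
    obtain q q' where q: "0 < q'" "q' \<le> 1" "M.krad q' 1 = 1 / \<phi>0"
      "center M.Om M.V (pt (R * M.ax q) 0)" "- R < R * M.ax q" "R * M.ax q < 0"
      "{p \<in> disk R. equilibrium M.Om M.V p} = {pt (R * M.ax q) 0, M.Pt 1 q' 1}"
      "q' = 1 \<longleftrightarrow> 1 / \<phi>0 = M.krad 1 1"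
      by (rule M.region3_equilibria[OF c(1) less_imp_le[OF c(2)]])
    then have "q' < 1" using c(2) by (auto simp: order_le_less)
    note a = M.axis_saddle_right[OF q(1) this q(3)]
    show ?thesis
      by (intro exI[of _ "R * M.ax q"] exI[of _ "R * ((q' + \<rho>0) / (1 + \<rho>0 * q'))"] conjI)
        (use q(4-7) a r0 in simp_all)
  qed
  have 4: "\<exists>xc xs. 0 < xc \<and> xc < xs \<and> xs < r0 \<and>
     {p \<in> disk R. equilibrium M.Om M.V p} = {pt xc 0, pt xs 0} \<and> center M.Om M.V (pt xc 0) \<and> hyperbolic_saddle M.Om M.V (pt xs 0)"
    if "(\<rho>0, \<phi>0) \<in> region4"
  proof -
    have c: "1 / \<phi>0 < 0" "M.cub M.xp > - M.\<kappa> * (1 / \<phi>0)" using that t(4) by simp_all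
    obtain x1 x2 where x: "0 < x1" "x1 < x2" "x2 < \<rho>0" "center M.Om M.V (pt (R * x1) 0)"
      "hyperbolic_saddle M.Om M.V (pt (R * x2) 0)"
      "{p \<in> disk R. equilibrium M.Om M.V p} = {pt (R * x1) 0, pt (R * x2) 0}"
      by (rule M.region4_equilibria[OF c])
    have "0 < R * x1" "R * x1 < R * x2" "R * x2 < r0" using x(1-3) assms(1) by (simp_all add: r0[symmetric])
    then show ?thesis using x(4-6) by blast
  qed
  have 5: "global_vortex M.Om M.V (disk R) M.sing" if "(\<rho>0, \<phi>0) \<in> region5"
    using M.region5_portrait(1) t(5) that by simp
  have c1: "{p \<in> disk R. equilibrium M.Om M.V p} = {pt (- R) 0} \<and> degenerate_saddle M.Om M.V (pt (- R) 0)"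
    if "(\<rho>0, \<phi>0) \<in> curve1"
  proof -
    have c: "0 < 1 / \<phi>0" "M.krad 1 (-1) = 1 / \<phi>0" using that t(6) by (simp_all add: M.rad_end)
    show ?thesis using M.curve1_equilibria[OF c] M.boundary_degenerate_saddle[OF disjI2[OF refl] c(2)]
      by (simp add: M.Pt_one_axis)
  qed
  have c2: "\<exists>xc. -R < xc \<and> xc < 0 \<and> {p \<in> disk R. equilibrium M.Om M.V p} = {pt xc 0, pt R 0} \<and>
     center M.Om M.V (pt xc 0) \<and> degenerate_saddle M.Om M.V (pt R 0)" if "(\<rho>0, \<phi>0) \<in> curve2"
  proof -
    have c: "0 < 1 / \<phi>0" "(1 - \<rho>0) / (1 + \<rho>0) = 1 / \<phi>0" "M.krad 1 1 = 1 / \<phi>0" using that t(7) by (simp_all add: M.rad_end)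
    obtain x where x: "- R < x" "x < 0" "center M.Om M.V (pt x 0)" "{p \<in> disk R. equilibrium M.Om M.V p} = {pt x 0, pt R 0}"
      by (rule M.curve2_portrait[OF c(1,2)])
    have "degenerate_saddle M.Om M.V (pt R 0)"
      using M.boundary_degenerate_saddle[OF disjI1[OF refl] c(3)] by (simp add: M.Pt_one_axis)
    then show ?thesis using x by blast
  qed
  have c3: "{p \<in> disk R. equilibrium M.Om M.V p} = {pt (R * M.xp) 0} \<and> cusp M.Om M.V (pt (R * M.xp) 0)"
    if "(\<rho>0, \<phi>0) \<in> curve3"
  proof -
    have c: "1 / \<phi>0 < 0" "M.cub M.xp = - M.\<kappa> * (1 / \<phi>0)" using that t(8) by simp_all
    show ?thesis using M.curve3_equilibria(1)[OF c] M.cusp_curve3[OF c] by blast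
  qed
  have inv: "\<forall>p\<in>disk R \<inter> M.Om. orbit M.Om M.V p \<subseteq> disk R" using M.disk_invariant by blast
  show ?thesis unfolding U V D s Let_def cp
    by (intro conjI impI ballI 1 2 3 4 5 c1[THEN conjunct1] c1[THEN conjunct2] c2 c3[THEN conjunct1] c3[THEN conjunct2]
        vtx components_complement ps regular_complement[OF assms(1,5)] bif_set_bifurcation[OF assms(1,5)] inv[rule_format])
qed

end
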